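(* Let $S$ be a small set (of sorts) and let $(I,\mathsf{ar})$ be a multi-sorted binding signature over $S$. Let $\mathcal C$ be a category with a terminal object $\top$, binary products, set-indexed coproducts and limits of $\omega$-cochains, such that in $\mathcal C$ $\omega$-limits distribute over $J$-indexed coproducts for every subsingleton $J$, for $J=I$, and for a two-element set $J$. Let $\mathcal V=[\mathcal C^S,\mathcal C^S]$ with the monoidal structure given by composition, $X\otimes Y:=X\cdot Y$ (first $X$, then $Y$), with unit $\mathsf{Id}$. Let $H:\mathcal V\to\mathcal V$ be the signature functor associated with $(I,\mathsf{ar})$ and let $\theta$ be the family of morphisms $\theta_{(Y,e),X}:Y\cdot HX\to H(Y\cdot X)$ described in the context. Then: (1) $\theta$ is a pointed tensorial strength for $H$. (2) The functor $\mathsf{Id}+H{-}$ on $\mathcal V$ has a final coalgebra $(T,\mathsf{out})$, and, writing $\mathsf{out}^{-1}=[\eta,\tau]$ with $\eta:\mathsf{Id}\to T$ and $\tau:HT\to T$, the triple $(T,\eta,\tau)$ is a monoidal heterogeneous substitution system (MHSS) for $(\mathcal V,H,\theta)$. (3) With $\mu:T\cdot T\to T$ the unique morphism that the MHSS property associates with $(z,e,f)=(T,\eta,1_T)$, the quadruple $(T,\eta,\mu,\tau)$ is an $(H,\theta)$-monoid; in particular $(T,\eta,\mu)$ is a monad on $\mathcal C^S$.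
   Context: Composition (of morphisms and of functors) is written in diagrammatic order: $F\cdot G$ means first $F$, then $G$. $\mathcal C^S$ is the functor category $[S,\mathcal C]$ with $S$ viewed as a discrete category; for an object $\xi$ of $\mathcal C^S$ and $s\in S$ its value is written $\xi\,s$. $A^*$ is the set of finite lists over $A$. $\mathsf{Id}$ is the identity functor on $\mathcal C^S$. A multi-sorted binding signature over $S$ is a small set $I$ with a function $\mathsf{ar}:I\to(S^*\times S)^*\times S$. $\omega$-limits are limits of diagrams of shape $0\leftarrow1\leftarrow2\leftarrow\cdots$. $\omega$-limits distribute over $J$-coproducts if for every $J$-indexed family of such diagrams $(x_{j,n})_n$ the canonical morphism $\coprod_{j}\lim_n x_{j,n}\to\lim_n\coprod_j x_{j,n}$ is an isomorphism. A subsingleton is a set with at most one element. Signature functor $H$ (functorial actions on morphisms are the evident ones). - For $s\in S$, $\mathsf{option}_s:\mathcal C^S\to\mathcal C^S$, $\mathsf{option}_s\,\xi\,t:=(\coprod_{(s=t)}\top)+\xi\,t$, where the coproduct is indexed by the subsingleton of proofs of $s=t$. - For a list $\ell=[s_1,\dots,s_n]$, $\mathsf{option}^*\,\ell:=\mathsf{option}_{s_1}\cdot(\mathsf{option}_{s_2}\cdot\ldots)$, and $\mathsf{option}^*\,[]:=\mathsf{Id}$. - For $s\in S$, $\mathsf{pr}_s:\mathcal C^S\to\mathcal C$, $\mathsf{pr}_s\,\xi:=\xi\,s$; and $\hat s:\mathcal C\to\mathcal C^S$, $\hat s\,c\,t:=\coprod_{(s=t)}c$. - For $a=(\ell,s)\in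 S^*\times S$ and $t\in S$, $G^{(a,t)}X:=\mathsf{option}^*\,\ell\cdot X\cdot\mathsf{pr}_s\cdot\hat t$. - For a non-empty list $\vec a=[a_1,\dots,a_n]$ and $t\in S$, $G^{(\vec a,t)}X:=G^{(a_1,t)}X\times(G^{(a_2,t)}X\times\cdots)$ (pointwise binary products, ending with $G^{(a_n,t)}X$); $G^{([],t)}X$ is the functor constantly $\hat t\,\top$, independently of $X$. - $HX:=\coprod_{i\in I}G^{\mathsf{ar}(i)}X$ (pointwise coproduct). The family $\theta$. Let $Y,X$ be endofunctors on $\mathcal C^S$ and $e:\mathsf{Id}\to Y$ a natural transformation. - For $s\in S$, $\gamma^s_{(Y,e)}:Y\cdot\mathsf{option}_s\to\mathsf{option}_s\cdot Y$ has components $\gamma^s_{(Y,e),\xi}:\mathsf{option}_s(Y\xi)\to Y(\mathsf{option}_s\,\xi)$ given, at $t\in S$, by case analysis on the coproduct $(\coprod_{(s=t)}\top)+(Y\xi)\,t$: on the left summand it is the left injection into $\mathsf{option}_s\,\xi\,t$ followed by $e_{\mathsf{option}_s\xi}$ (at $t$); on the right summand it is $Y(\mathsf{inr})$ (at $t$), with $\mathsf{inr}:\xi\to\mathsf{option}_s\,\xi$ the right injection. - For a list $\ell$, $\gamma^\ell_{(Y,e),\xi}:\mathsf{option}^*\,\ell\,(Y\xi)\to Y(\mathsf{option}^*\,\ell\,\xi)$ is defined by recursion: the identity for $\ell=[]$; for $\ell=s_1::\ell'$ (so that $\mathsf{option}^*\,\ell\,\xi=\mathsf{option}^*\,\ell'(\mathsf{option}_{s_1}\xi)$)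 it is $\mathsf{option}^*\,\ell'(\gamma^{s_1}_{(Y,e),\xi})$ followed by $\gamma^{\ell'}_{(Y,e),\mathsf{option}_{s_1}\xi}$. - For $a=(\ell,s)$: $\theta^{(a,t)}_{(Y,e),X}:Y\cdot G^{(a,t)}X\to G^{(a,t)}(Y\cdot X)$ has component at $\xi$ the morphism $\hat t\big(\mathsf{pr}_s(X(\gamma^\ell_{(Y,e),\xi}))\big)$. - For lists: $\theta^{([],t)}$ is pointwise the identity; for non-empty $\vec a$, $\theta^{(\vec a,t)}$ is the pointwise product of the $\theta^{(a_i,t)}$ (using that precomposition with $Y$ commutes with pointwise products). - $\theta_{(Y,e),X}$ is the canonical isomorphism $Y\cdot\coprod_iG^{\mathsf{ar}(i)}X\cong\coprod_i(Y\cdot G^{\mathsf{ar}(i)}X)$ followed by $\coprod_i\theta^{\mathsf{ar}(i)}_{(Y,e),X}$. General notions, for a monoidal category $(\mathcal V,\otimes,I,\lambda,\rho,\alpha)$ (here $I$ is the monoidal unit; in the claim it is $\mathsf{Id}$), with $\lambda_x:I\otimes x\to x$, $\rho_x:x\otimes I\to x$, $\alpha_{x,y,z}:(x\otimes y)\otimes z\to x\otimes(y\otimes z)$. The coslice category $I/\mathcal V$ of pairs $(v,p)$, $p:I\to v$, is monoidal with unit $I^{ptd}:=(I,1_I)$ and tensor $(v,p)\otimes^{ptd}(w,q):=(v\otimes w,\lambda_I^{-1}\cdot(p\otimes q))$. A pointed tensorial strength for an endofunctor $H$ on $\mathcal V$ is a family $\theta_{(v,p),x}:v\otimes Hx\to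 H(v\otimes x)$, natural in $(v,p)\in I/\mathcal V$ and $x\in\mathcal V$, with $\theta_{I^{ptd},x}\cdot H\lambda_x=\lambda_{Hx}$ and $\theta_{(v,p)\otimes^{ptd}(w,q),x}\cdot H\alpha_{v,w,x}=\alpha_{v,w,Hx}\cdot(1_v\otimes\theta_{(w,q),x})\cdot\theta_{(v,p),w\otimes x}$. An MHSS for $(\mathcal V,H,\theta)$ is a triple $(t,\eta,\tau)$ with $\eta:I\to t$, $\tau:Ht\to t$ such that for all $z\in\mathcal V$, $e:I\to z$, $f:z\to t$ there is a unique $h:z\otimes t\to t$ with $(1_z\otimes\eta)\cdot h=\rho_z\cdot f$ and $(1_z\otimes\tau)\cdot h=\theta_{(z,e),t}\cdot Hh\cdot\tau$. A $\mathcal V$-monoid is $(v,\eta,\mu)$ with $\eta:I\to v$, $\mu:v\otimes v\to v$ satisfying $(\eta\otimes1_v)\cdot\mu=\lambda_v$, $(1_v\otimes\eta)\cdot\mu=\rho_v$, $(\mu\otimes1_v)\cdot\mu=\alpha_{v,v,v}\cdot(1_v\otimes\mu)\cdot\mu$. An $(H,\theta)$-monoid is $(v,\eta,\mu,\tau)$ with $(v,\eta,\mu)$ a $\mathcal V$-monoid and $\tau:Hv\to v$ such that $(1_v\otimes\tau)\cdot\mu=\theta_{(v,\eta),v}\cdot H\mu\cdot\tau$. *)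

theory Defs
  imports Main "HOL-Library.FuncSet"
begin

section \<open>Categories, functors, natural transformations\<close>

text \<open>Composition is written in diagrammatic order throughout: \<open>f \<cdot> g\<close> is first \<open>f\<close>, then \<open>g\<close>.\<close>

record ('o, 'm) category =
  Obj :: "'o set"
  Arr :: "'m set"
  Dom :: "'m \<Rightarrow> 'o"
  Cod :: "'m \<Rightarrow> 'o"
  Idt :: "'o \<Rightarrow> 'm"
  Comp :: "'m \<Rightarrow> 'm \<Rightarrow> 'm"  (infixl "\<cdot>\<index>" 70)

definition hom :: "('o, 'm, 'z) category_scheme \<Rightarrow> 'o \<Rightarrow> 'o \<Rightarrow> 'm set" where
  "hom C a b = {f \<in> Arr C. Dom C f = a \<and> Cod C f = b}"

locale category =
  fixes C :: "('o, 'm, 'z) category_scheme" (structure)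
  assumes dom_obj: "f \<in> Arr C \<Longrightarrow> Dom C f \<in> Obj C"
    and cod_obj: "f \<in> Arr C \<Longrightarrow> Cod C f \<in> Obj C"
    and idt_hom: "a \<in> Obj C \<Longrightarrow> Idt C a \<in> hom C a a"
    and comp_hom: "\<lbrakk>f \<in> hom C a b; g \<in> hom C b c\<rbrakk> \<Longrightarrow> f \<cdot> g \<in> hom C a c"
    and idt_comp: "f \<in> hom C a b \<Longrightarrow> Idt C a \<cdot> f = f"
    and comp_idt: "f \<in> hom C a b \<Longrightarrow> f \<cdot> Idt C b = f"
    and comp_assoc: "\<lbrakk>f \<in> hom C a b; g \<in> hom C b c; h \<in> hom C c d\<rbrakk>
      \<Longrightarrow> (f \<cdot> g) \<cdot> h = f \<cdot> (g \<cdot> h)"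

definition is_inverse :: "('o, 'm, 'z) category_scheme \<Rightarrow> 'm \<Rightarrow> 'm \<Rightarrow> bool" where
  "is_inverse C f g \<longleftrightarrow> f \<in> Arr C \<and> g \<in> hom C (Cod C f) (Dom C f)
     \<and> f \<cdot>\<^bsub>C\<^esub> g = Idt C (Dom C f) \<and> g \<cdot>\<^bsub>C\<^esub> f = Idt C (Cod C f)"

definition is_iso :: "('o, 'm, 'z) category_scheme \<Rightarrow> 'm \<Rightarrow> bool" where
  "is_iso C f \<longleftrightarrow> (\<exists>g. is_inverse C f g)"

definition inv_arr :: "('o, 'm, 'z) category_scheme \<Rightarrow> 'm \<Rightarrow> 'm" where
  "inv_arr C f = (THE g. is_inverse C f g)"

text \<open>The two functions of a functor, and the component function of a natural transformation,
  are required to be extensional (undefined outside the source category). Hence equality of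
  these records is the mathematical equality of functors and of natural transformations.\<close>

record ('o, 'm, 'p, 'n) func =
  FObj :: "'o \<Rightarrow> 'p"
  FArr :: "'m \<Rightarrow> 'n"

record ('o, 'm, 'p, 'n) ntrans =
  NDom :: "('o, 'm, 'p, 'n) func"
  NCod :: "('o, 'm, 'p, 'n) func"
  NMap :: "'o \<Rightarrow> 'n"

locale is_functor = A: category A + B: category B
  for A :: "('o, 'm, 'y) category_scheme" and B :: "('p, 'n, 'z) category_scheme" +
  fixes F :: "('o, 'm, 'p, 'n) func"
  assumes FObj_ext: "FObj F \<in> extensional (Obj A)"
    and FArr_ext: "FArr F \<in> extensional (Arr A)"
    and FObj_obj: "a \<in> Obj A \<Longrightarrow> FObj F a \<in> Obj B"
    and FArr_hom: "f \<in> hom A a b \<Longrightarrow> FArr F f \<in> hom B (FObj F a) (FObj F b)"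
    and FArr_idt: "a \<in> Obj A \<Longrightarrow> FArr F (Idt A a) = Idt B (FObj F a)"
    and FArr_comp: "\<lbrakk>f \<in> hom A a b; g \<in> hom A b c\<rbrakk>
      \<Longrightarrow> FArr F (f \<cdot>\<^bsub>A\<^esub> g) = FArr F f \<cdot>\<^bsub>B\<^esub> FArr F g"

locale is_ntrans = D: is_functor A B "NDom \<alpha>" + E: is_functor A B "NCod \<alpha>"
  for A :: "('o, 'm, 'y) category_scheme" and B :: "('p, 'n, 'z) category_scheme"
    and \<alpha> :: "('o, 'm, 'p, 'n) ntrans" +
  assumes NMap_ext: "NMap \<alpha> \<in> extensional (Obj A)"
    and NMap_hom: "a \<in> Obj A \<Longrightarrow> NMap \<alpha> a \<in> hom B (FObj (NDom \<alpha>) a) (FObj (NCod \<alpha>) a)"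
    and naturality: "f \<in> hom A a b
      \<Longrightarrow> FArr (NDom \<alpha>) f \<cdot>\<^bsub>B\<^esub> NMap \<alpha> b = NMap \<alpha> a \<cdot>\<^bsub>B\<^esub> FArr (NCod \<alpha>) f"

definition mk_nt :: "('o, 'm, 'y) category_scheme \<Rightarrow> ('o, 'm, 'p, 'n) func \<Rightarrow> ('o, 'm, 'p, 'n) func
    \<Rightarrow> ('o \<Rightarrow> 'n) \<Rightarrow> ('o, 'm, 'p, 'n) ntrans" where
  "mk_nt A F G \<alpha> = \<lparr>NDom = F, NCod = G, NMap = restrict \<alpha> (Obj A)\<rparr>"

definition functor_cat :: "('o, 'm, 'y) category_scheme \<Rightarrow> ('p, 'n, 'z) category_scheme
    \<Rightarrow> (('o, 'm, 'p, 'n) func, ('o, 'm, 'p, 'n) ntrans) category" where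
  "functor_cat A B = \<lparr>
     Obj = {F. is_functor A B F},
     Arr = {\<alpha>. is_ntrans A B \<alpha>},
     Dom = NDom,
     Cod = NCod,
     Idt = (\<lambda>F. mk_nt A F F (\<lambda>a. Idt B (FObj F a))),
     Comp = (\<lambda>\<alpha> \<beta>. mk_nt A (NDom \<alpha>) (NCod \<beta>) (\<lambda>a. NMap \<alpha> a \<cdot>\<^bsub>B\<^esub> NMap \<beta> a))\<rparr>"

definition fid :: "('o, 'm, 'y) category_scheme \<Rightarrow> ('o, 'm, 'o, 'm) func" where
  "fid A = \<lparr>FObj = (\<lambda>a\<in>Obj A. a), FArr = (\<lambda>f\<in>Arr A. f)\<rparr>"

text \<open>In \<open>fcomp A F G\<close> and \<open>hcomp A C \<alpha> \<beta>\<close>, \<open>A\<close> is the source of the first functor (or natural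
  transformation) and \<open>C\<close> is the target of the second.\<close>

definition fcomp :: "('o, 'm, 'y) category_scheme \<Rightarrow> ('o, 'm, 'p, 'n) func \<Rightarrow> ('p, 'n, 'q, 'k) func
    \<Rightarrow> ('o, 'm, 'q, 'k) func" where
  "fcomp A F G = \<lparr>FObj = (\<lambda>a\<in>Obj A. FObj G (FObj F a)), FArr = (\<lambda>f\<in>Arr A. FArr G (FArr F f))\<rparr>"

definition hcomp :: "('o, 'm, 'y) category_scheme \<Rightarrow> ('q, 'k, 'z) category_scheme
    \<Rightarrow> ('o, 'm, 'p, 'n) ntrans \<Rightarrow> ('p, 'n, 'q, 'k) ntrans \<Rightarrow> ('o, 'm, 'q, 'k) ntrans" where
  "hcomp A C \<alpha> \<beta> = mk_nt A (fcomp A (NDom \<alpha>) (NDom \<beta>)) (fcomp A (NCod \<alpha>) (NCod \<beta>))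
     (\<lambda>a. FArr (NDom \<beta>) (NMap \<alpha> a) \<cdot>\<^bsub>C\<^esub> NMap \<beta> (FObj (NCod \<alpha>) a))"

definition const_functor :: "('o, 'm, 'y) category_scheme \<Rightarrow> ('p, 'n, 'z) category_scheme \<Rightarrow> 'p
    \<Rightarrow> ('o, 'm, 'p, 'n) func" where
  "const_functor A B b = \<lparr>FObj = (\<lambda>a\<in>Obj A. b), FArr = (\<lambda>f\<in>Arr A. Idt B b)\<rparr>"


section \<open>Limits and colimits\<close>

text \<open>For each universal construction there is a predicate, an existence statement, and an
  arbitrary but fixed choice made by \<open>SOME\<close>. The choice only makes sense if the
  construction exists.\<close>

definition is_terminal :: "('o, 'm, 'z) category_scheme \<Rightarrow> 'o \<Rightarrow> bool" where
  "is_terminal C u \<longleftrightarrow> u \<in> Obj C \<and> (\<forall>a \<in> Obj C. \<exists>!f. f \<in> hom C a u)"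

definition has_terminal :: "('o, 'm, 'z) category_scheme \<Rightarrow> bool" where
  "has_terminal C \<longleftrightarrow> (\<exists>u. is_terminal C u)"

definition terminal :: "('o, 'm, 'z) category_scheme \<Rightarrow> 'o" where
  "terminal C = (SOME u. is_terminal C u)"

definition is_product ::
  "('o, 'm, 'z) category_scheme \<Rightarrow> 'o \<Rightarrow> 'o \<Rightarrow> 'o \<Rightarrow> 'm \<Rightarrow> 'm \<Rightarrow> bool" where
  "is_product C a b p \<pi>\<^sub>1 \<pi>\<^sub>2 \<longleftrightarrow> p \<in> Obj C \<and> \<pi>\<^sub>1 \<in> hom C p a \<and> \<pi>\<^sub>2 \<in> hom C p b
     \<and> (\<forall>c f g. f \<in> hom C c a \<and> g \<in> hom C c b \<longrightarrow>
          (\<exists>!h. h \<in> hom C c p \<and> h \<cdot>\<^bsub>C\<^esub> \<pi>\<^sub>1 = f \<and> h \<cdot>\<^bsub>C\<^esub> \<pi>\<^sub>2 = g))"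

definition has_binary_products :: "('o, 'm, 'z) category_scheme \<Rightarrow> bool" where
  "has_binary_products C \<longleftrightarrow>
     (\<forall>a \<in> Obj C. \<forall>b \<in> Obj C. \<exists>p \<pi>\<^sub>1 \<pi>\<^sub>2. is_product C a b p \<pi>\<^sub>1 \<pi>\<^sub>2)"

definition prod_cone :: "('o, 'm, 'z) category_scheme \<Rightarrow> 'o \<Rightarrow> 'o \<Rightarrow> 'o \<times> 'm \<times> 'm" where
  "prod_cone C a b = (SOME (p, \<pi>\<^sub>1, \<pi>\<^sub>2). is_product C a b p \<pi>\<^sub>1 \<pi>\<^sub>2)"

definition prod_obj :: "('o, 'm, 'z) category_scheme \<Rightarrow> 'o \<Rightarrow> 'o \<Rightarrow> 'o" where
  "prod_obj C a b = fst (prod_cone C a b)"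

definition prod_fst :: "('o, 'm, 'z) category_scheme \<Rightarrow> 'o \<Rightarrow> 'o \<Rightarrow> 'm" where
  "prod_fst C a b = fst (snd (prod_cone C a b))"

definition prod_snd :: "('o, 'm, 'z) category_scheme \<Rightarrow> 'o \<Rightarrow> 'o \<Rightarrow> 'm" where
  "prod_snd C a b = snd (snd (prod_cone C a b))"

definition prod_map :: "('o, 'm, 'z) category_scheme \<Rightarrow> 'm \<Rightarrow> 'm \<Rightarrow> 'm" where
  "prod_map C f g = (THE h.
     h \<in> hom C (prod_obj C (Dom C f) (Dom C g)) (prod_obj C (Cod C f) (Cod C g))
     \<and> h \<cdot>\<^bsub>C\<^esub> prod_fst C (Cod C f) (Cod C g) = prod_fst C (Dom C f) (Dom C g) \<cdot>\<^bsub>C\<^esub> f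
     \<and> h \<cdot>\<^bsub>C\<^esub> prod_snd C (Cod C f) (Cod C g) = prod_snd C (Dom C f) (Dom C g) \<cdot>\<^bsub>C\<^esub> g)"

definition is_coproduct ::
  "('o, 'm, 'z) category_scheme \<Rightarrow> 'j set \<Rightarrow> ('j \<Rightarrow> 'o) \<Rightarrow> 'o \<Rightarrow> ('j \<Rightarrow> 'm) \<Rightarrow> bool" where
  "is_coproduct C J x c \<iota> \<longleftrightarrow> c \<in> Obj C \<and> (\<forall>j \<in> J. \<iota> j \<in> hom C (x j) c)
     \<and> (\<forall>d f. d \<in> Obj C \<and> (\<forall>j \<in> J. f j \<in> hom C (x j) d) \<longrightarrow>
          (\<exists>!h. h \<in> hom C c d \<and> (\<forall>j \<in> J. \<iota> j \<cdot>\<^bsub>C\<^esub> h = f j)))"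

definition has_coproducts :: "('o, 'm, 'z) category_scheme \<Rightarrow> 'j set \<Rightarrow> bool" where
  "has_coproducts C J \<longleftrightarrow> (\<forall>x. (\<forall>j \<in> J. x j \<in> Obj C) \<longrightarrow> (\<exists>c \<iota>. is_coproduct C J x c \<iota>))"

definition coprod_cone ::
  "('o, 'm, 'z) category_scheme \<Rightarrow> 'j set \<Rightarrow> ('j \<Rightarrow> 'o) \<Rightarrow> 'o \<times> ('j \<Rightarrow> 'm)" where
  "coprod_cone C J x = (SOME (c, \<iota>). is_coproduct C J x c \<iota>)"

definition coprod_obj :: "('o, 'm, 'z) category_scheme \<Rightarrow> 'j set \<Rightarrow> ('j \<Rightarrow> 'o) \<Rightarrow> 'o" where
  "coprod_obj C J x = fst (coprod_cone C J x)"

definition coprod_inj :: "('o, 'm, 'z) category_scheme \<Rightarrow> 'j set \<Rightarrow> ('j \<Rightarrow> 'o) \<Rightarrow> 'j \<Rightarrow> 'm" where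
  "coprod_inj C J x = snd (coprod_cone C J x)"

definition cotuple ::
  "('o, 'm, 'z) category_scheme \<Rightarrow> 'j set \<Rightarrow> ('j \<Rightarrow> 'o) \<Rightarrow> 'o \<Rightarrow> ('j \<Rightarrow> 'm) \<Rightarrow> 'm" where
  "cotuple C J x d f = (THE h. h \<in> hom C (coprod_obj C J x) d
     \<and> (\<forall>j \<in> J. coprod_inj C J x j \<cdot>\<^bsub>C\<^esub> h = f j))"

definition coprod_map :: "('o, 'm, 'z) category_scheme \<Rightarrow> 'j set \<Rightarrow> ('j \<Rightarrow> 'm) \<Rightarrow> 'm" where
  "coprod_map C J f = cotuple C J (\<lambda>j. Dom C (f j)) (coprod_obj C J (\<lambda>j. Cod C (f j)))
     (\<lambda>j. f j \<cdot>\<^bsub>C\<^esub> coprod_inj C J (\<lambda>j. Cod C (f j)) j)"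

text \<open>Binary coproducts are coproducts indexed by \<^typ>\<open>bool\<close>, with \<^const>\<open>True\<close> on the left.\<close>

definition plus_obj :: "('o, 'm, 'z) category_scheme \<Rightarrow> 'o \<Rightarrow> 'o \<Rightarrow> 'o" where
  "plus_obj C a b = coprod_obj C (UNIV :: bool set) (\<lambda>i. if i then a else b)"

definition plus_inl :: "('o, 'm, 'z) category_scheme \<Rightarrow> 'o \<Rightarrow> 'o \<Rightarrow> 'm" where
  "plus_inl C a b = coprod_inj C (UNIV :: bool set) (\<lambda>i. if i then a else b) True"

definition plus_inr :: "('o, 'm, 'z) category_scheme \<Rightarrow> 'o \<Rightarrow> 'o \<Rightarrow> 'm" where
  "plus_inr C a b = coprod_inj C (UNIV :: bool set) (\<lambda>i. if i then a else b) False"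

definition copair :: "('o, 'm, 'z) category_scheme \<Rightarrow> 'm \<Rightarrow> 'm \<Rightarrow> 'm" where
  "copair C f g = cotuple C (UNIV :: bool set) (\<lambda>i. if i then Dom C f else Dom C g) (Cod C f)
     (\<lambda>i. if i then f else g)"

definition plus_map :: "('o, 'm, 'z) category_scheme \<Rightarrow> 'm \<Rightarrow> 'm \<Rightarrow> 'm" where
  "plus_map C f g = coprod_map C (UNIV :: bool set) (\<lambda>i. if i then f else g)"

definition is_cochain ::
  "('o, 'm, 'z) category_scheme \<Rightarrow> (nat \<Rightarrow> 'o) \<Rightarrow> (nat \<Rightarrow> 'm) \<Rightarrow> bool" where
  "is_cochain C x d \<longleftrightarrow> (\<forall>n. x n \<in> Obj C \<and> d n \<in> hom C (x (Suc n)) (x n))"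

definition is_omega_cone ::
  "('o, 'm, 'z) category_scheme \<Rightarrow> (nat \<Rightarrow> 'o) \<Rightarrow> (nat \<Rightarrow> 'm) \<Rightarrow> 'o \<Rightarrow> (nat \<Rightarrow> 'm) \<Rightarrow> bool" where
  "is_omega_cone C x d a f \<longleftrightarrow>
     a \<in> Obj C \<and> (\<forall>n. f n \<in> hom C a (x n) \<and> f (Suc n) \<cdot>\<^bsub>C\<^esub> d n = f n)"

definition is_omega_limit ::
  "('o, 'm, 'z) category_scheme \<Rightarrow> (nat \<Rightarrow> 'o) \<Rightarrow> (nat \<Rightarrow> 'm) \<Rightarrow> 'o \<Rightarrow> (nat \<Rightarrow> 'm) \<Rightarrow> bool" where
  "is_omega_limit C x d l \<pi> \<longleftrightarrow> is_omega_cone C x d l \<pi>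
     \<and> (\<forall>a f. is_omega_cone C x d a f \<longrightarrow>
          (\<exists>!h. h \<in> hom C a l \<and> (\<forall>n. h \<cdot>\<^bsub>C\<^esub> \<pi> n = f n)))"

definition has_omega_limits :: "('o, 'm, 'z) category_scheme \<Rightarrow> bool" where
  "has_omega_limits C \<longleftrightarrow> (\<forall>x d. is_cochain C x d \<longrightarrow> (\<exists>l \<pi>. is_omega_limit C x d l \<pi>))"

definition omega_lim_cone ::
  "('o, 'm, 'z) category_scheme \<Rightarrow> (nat \<Rightarrow> 'o) \<Rightarrow> (nat \<Rightarrow> 'm) \<Rightarrow> 'o \<times> (nat \<Rightarrow> 'm)" where
  "omega_lim_cone C x d = (SOME (l, \<pi>). is_omega_limit C x d l \<pi>)"

definition omega_lim :: "('o, 'm, 'z) category_scheme \<Rightarrow> (nat \<Rightarrow> 'o) \<Rightarrow> (nat \<Rightarrow> 'm) \<Rightarrow> 'o" where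
  "omega_lim C x d = fst (omega_lim_cone C x d)"

definition omega_proj ::
  "('o, 'm, 'z) category_scheme \<Rightarrow> (nat \<Rightarrow> 'o) \<Rightarrow> (nat \<Rightarrow> 'm) \<Rightarrow> nat \<Rightarrow> 'm" where
  "omega_proj C x d = snd (omega_lim_cone C x d)"

definition omega_tuple ::
  "('o, 'm, 'z) category_scheme \<Rightarrow> (nat \<Rightarrow> 'o) \<Rightarrow> (nat \<Rightarrow> 'm) \<Rightarrow> 'o \<Rightarrow> (nat \<Rightarrow> 'm) \<Rightarrow> 'm" where
  "omega_tuple C x d a f = (THE h. h \<in> hom C a (omega_lim C x d)
     \<and> (\<forall>n. h \<cdot>\<^bsub>C\<^esub> omega_proj C x d n = f n))"

text \<open>The canonical morphism from \<open>\<Coprod>\<^sub>j lim\<^sub>n x\<^sub>j\<^sub>,\<^sub>n\<close> to \<open>lim\<^sub>n \<Coprod>\<^sub>j x\<^sub>j\<^sub>,\<^sub>n\<close>.\<close>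

definition distrib_map ::
  "('o, 'm, 'z) category_scheme \<Rightarrow> 'j set \<Rightarrow> ('j \<Rightarrow> nat \<Rightarrow> 'o) \<Rightarrow> ('j \<Rightarrow> nat \<Rightarrow> 'm) \<Rightarrow> 'm" where
  "distrib_map C J x d =
     (let cx = (\<lambda>n. coprod_obj C J (\<lambda>j. x j n));
          cd = (\<lambda>n. coprod_map C J (\<lambda>j. d j n))
      in cotuple C J (\<lambda>j. omega_lim C (x j) (d j)) (omega_lim C cx cd)
           (\<lambda>j. omega_tuple C cx cd (omega_lim C (x j) (d j))
              (\<lambda>n. omega_proj C (x j) (d j) n \<cdot>\<^bsub>C\<^esub> coprod_inj C J (\<lambda>j. x j n) j)))"

definition omega_limits_distribute :: "('o, 'm, 'z) category_scheme \<Rightarrow> 'j set \<Rightarrow> bool" where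
  "omega_limits_distribute C J \<longleftrightarrow>
     (\<forall>x d. (\<forall>j \<in> J. is_cochain C (x j) (d j)) \<longrightarrow> is_iso C (distrib_map C J x d))"


section \<open>Monoidal categories, strengths, substitution systems and monoids\<close>

record ('o, 'm) monoidal = "('o, 'm) category" +
  TensO :: "'o \<Rightarrow> 'o \<Rightarrow> 'o"  (infixl "\<otimes>\<index>" 75)
  TensA :: "'m \<Rightarrow> 'm \<Rightarrow> 'm"  (infixl "\<odot>\<index>" 75)
  Unit :: "'o"
  Lam :: "'o \<Rightarrow> 'm"
  Rho :: "'o \<Rightarrow> 'm"
  Assoc :: "'o \<Rightarrow> 'o \<Rightarrow> 'o \<Rightarrow> 'm"

text \<open>\<open>x \<otimes> y\<close> is the tensor of objects, \<open>f \<odot> g\<close> is the tensor of morphisms.\<close>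

locale monoidal_category = category V
  for V :: "('o, 'm, 'z) monoidal_scheme" (structure) +
  assumes unit_obj: "Unit V \<in> Obj V"
    and tens_obj: "\<lbrakk>x \<in> Obj V; y \<in> Obj V\<rbrakk> \<Longrightarrow> x \<otimes> y \<in> Obj V"
    and tens_hom: "\<lbrakk>f \<in> hom V x x'; g \<in> hom V y y'\<rbrakk> \<Longrightarrow> f \<odot> g \<in> hom V (x \<otimes> y) (x' \<otimes> y')"
    and tens_idt: "\<lbrakk>x \<in> Obj V; y \<in> Obj V\<rbrakk> \<Longrightarrow> Idt V x \<odot> Idt V y = Idt V (x \<otimes> y)"
    and tens_comp: "\<lbrakk>f \<in> hom V x x'; f' \<in> hom V x' x''; g \<in> hom V y y'; g' \<in> hom V y' y''\<rbrakk>
      \<Longrightarrow> (f \<cdot> f') \<odot> (g \<cdot> g') = (f \<odot> g) \<cdot> (f' \<odot> g')"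
    and lam_hom: "x \<in> Obj V \<Longrightarrow> Lam V x \<in> hom V (Unit V \<otimes> x) x"
    and lam_iso: "x \<in> Obj V \<Longrightarrow> is_iso V (Lam V x)"
    and lam_natural: "f \<in> hom V x y \<Longrightarrow> (Idt V (Unit V) \<odot> f) \<cdot> Lam V y = Lam V x \<cdot> f"
    and rho_hom: "x \<in> Obj V \<Longrightarrow> Rho V x \<in> hom V (x \<otimes> Unit V) x"
    and rho_iso: "x \<in> Obj V \<Longrightarrow> is_iso V (Rho V x)"
    and rho_natural: "f \<in> hom V x y \<Longrightarrow> (f \<odot> Idt V (Unit V)) \<cdot> Rho V y = Rho V x \<cdot> f"
    and assoc_hom: "\<lbrakk>x \<in> Obj V; y \<in> Obj V; z \<in> Obj V\<rbrakk>
      \<Longrightarrow> Assoc V x y z \<in> hom V ((x \<otimes> y) \<otimes> z) (x \<otimes> (y \<otimes> z))"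
    and assoc_iso: "\<lbrakk>x \<in> Obj V; y \<in> Obj V; z \<in> Obj V\<rbrakk> \<Longrightarrow> is_iso V (Assoc V x y z)"
    and assoc_natural: "\<lbrakk>f \<in> hom V x x'; g \<in> hom V y y'; h \<in> hom V z z'\<rbrakk>
      \<Longrightarrow> ((f \<odot> g) \<odot> h) \<cdot> Assoc V x' y' z' = Assoc V x y z \<cdot> (f \<odot> (g \<odot> h))"
    and triangle: "\<lbrakk>x \<in> Obj V; y \<in> Obj V\<rbrakk>
      \<Longrightarrow> Assoc V x (Unit V) y \<cdot> (Idt V x \<odot> Lam V y) = Rho V x \<odot> Idt V y"
    and pentagon: "\<lbrakk>w \<in> Obj V; x \<in> Obj V; y \<in> Obj V; z \<in> Obj V\<rbrakk>
      \<Longrightarrow> (Assoc V w x y \<odot> Idt V z) \<cdot> Assoc V w (x \<otimes> y) z \<cdot> (Idt V w \<odot> Assoc V x y z)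
          = Assoc V (w \<otimes> x) y z \<cdot> Assoc V w x (y \<otimes> z)"

text \<open>Objects, morphisms, unit and tensor of the coslice category under the monoidal unit.\<close>

definition ptd_obj :: "('o, 'm, 'z) monoidal_scheme \<Rightarrow> ('o \<times> 'm) set" where
  "ptd_obj V = {(v, p). v \<in> Obj V \<and> p \<in> hom V (Unit V) v}"

definition ptd_hom :: "('o, 'm, 'z) monoidal_scheme \<Rightarrow> 'o \<times> 'm \<Rightarrow> 'o \<times> 'm \<Rightarrow> 'm set" where
  "ptd_hom V vp wq = {f \<in> hom V (fst vp) (fst wq). snd vp \<cdot>\<^bsub>V\<^esub> f = snd wq}"

definition ptd_unit :: "('o, 'm, 'z) monoidal_scheme \<Rightarrow> 'o \<times> 'm" where
  "ptd_unit V = (Unit V, Idt V (Unit V))"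

definition ptd_tens :: "('o, 'm, 'z) monoidal_scheme \<Rightarrow> 'o \<times> 'm \<Rightarrow> 'o \<times> 'm \<Rightarrow> 'o \<times> 'm" where
  "ptd_tens V vp wq = (fst vp \<otimes>\<^bsub>V\<^esub> fst wq,
     inv_arr V (Lam V (Unit V)) \<cdot>\<^bsub>V\<^esub> (snd vp \<odot>\<^bsub>V\<^esub> snd wq))"

locale pointed_strength = monoidal_category V + H: is_functor V V H
  for V :: "('o, 'm, 'z) monoidal_scheme" (structure) and H :: "('o, 'm, 'o, 'm) func" +
  fixes \<theta> :: "'o \<times> 'm \<Rightarrow> 'o \<Rightarrow> 'm"
  assumes strength_hom: "\<lbrakk>vp \<in> ptd_obj V; x \<in> Obj V\<rbrakk>
      \<Longrightarrow> \<theta> vp x \<in> hom V (fst vp \<otimes> FObj H x) (FObj H (fst vp \<otimes> x))"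
    and strength_natural:
      "\<lbrakk>vp \<in> ptd_obj V; wq \<in> ptd_obj V; f \<in> ptd_hom V vp wq; g \<in> hom V x y\<rbrakk>
      \<Longrightarrow> (f \<odot> FArr H g) \<cdot> \<theta> wq y = \<theta> vp x \<cdot> FArr H (f \<odot> g)"
    and strength_unit: "x \<in> Obj V \<Longrightarrow> \<theta> (ptd_unit V) x \<cdot> FArr H (Lam V x) = Lam V (FObj H x)"
    and strength_tens: "\<lbrakk>vp \<in> ptd_obj V; wq \<in> ptd_obj V; x \<in> Obj V\<rbrakk>
      \<Longrightarrow> \<theta> (ptd_tens V vp wq) x \<cdot> FArr H (Assoc V (fst vp) (fst wq) x)
          = Assoc V (fst vp) (fst wq) (FObj H x) \<cdot> (Idt V (fst vp) \<odot> \<theta> wq x) \<cdot> \<theta> vp (fst wq \<otimes> x)"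

definition is_mhss_map :: "('o, 'm, 'z) monoidal_scheme \<Rightarrow> ('o, 'm, 'o, 'm) func
    \<Rightarrow> ('o \<times> 'm \<Rightarrow> 'o \<Rightarrow> 'm) \<Rightarrow> 'o \<Rightarrow> 'm \<Rightarrow> 'm \<Rightarrow> 'o \<Rightarrow> 'm \<Rightarrow> 'm \<Rightarrow> 'm \<Rightarrow> bool" where
  "is_mhss_map V H \<theta> t \<eta> \<tau> z e f h \<longleftrightarrow> h \<in> hom V (z \<otimes>\<^bsub>V\<^esub> t) t
     \<and> (Idt V z \<odot>\<^bsub>V\<^esub> \<eta>) \<cdot>\<^bsub>V\<^esub> h = Rho V z \<cdot>\<^bsub>V\<^esub> f
     \<and> (Idt V z \<odot>\<^bsub>V\<^esub> \<tau>) \<cdot>\<^bsub>V\<^esub> h = \<theta> (z, e) t \<cdot>\<^bsub>V\<^esub> FArr H h \<cdot>\<^bsub>V\<^esub> \<tau>"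

definition is_mhss :: "('o, 'm, 'z) monoidal_scheme \<Rightarrow> ('o, 'm, 'o, 'm) func
    \<Rightarrow> ('o \<times> 'm \<Rightarrow> 'o \<Rightarrow> 'm) \<Rightarrow> 'o \<Rightarrow> 'm \<Rightarrow> 'm \<Rightarrow> bool" where
  "is_mhss V H \<theta> t \<eta> \<tau> \<longleftrightarrow> t \<in> Obj V \<and> \<eta> \<in> hom V (Unit V) t \<and> \<tau> \<in> hom V (FObj H t) t
     \<and> (\<forall>z e f. z \<in> Obj V \<and> e \<in> hom V (Unit V) z \<and> f \<in> hom V z t \<longrightarrow>
          (\<exists>!h. is_mhss_map V H \<theta> t \<eta> \<tau> z e f h))"

definition mhss_map :: "('o, 'm, 'z) monoidal_scheme \<Rightarrow> ('o, 'm, 'o, 'm) func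
    \<Rightarrow> ('o \<times> 'm \<Rightarrow> 'o \<Rightarrow> 'm) \<Rightarrow> 'o \<Rightarrow> 'm \<Rightarrow> 'm \<Rightarrow> 'o \<Rightarrow> 'm \<Rightarrow> 'm \<Rightarrow> 'm" where
  "mhss_map V H \<theta> t \<eta> \<tau> z e f = (THE h. is_mhss_map V H \<theta> t \<eta> \<tau> z e f h)"

definition is_monoid :: "('o, 'm, 'z) monoidal_scheme \<Rightarrow> 'o \<Rightarrow> 'm \<Rightarrow> 'm \<Rightarrow> bool" where
  "is_monoid V v \<eta> \<mu> \<longleftrightarrow> v \<in> Obj V \<and> \<eta> \<in> hom V (Unit V) v \<and> \<mu> \<in> hom V (v \<otimes>\<^bsub>V\<^esub> v) v
     \<and> (\<eta> \<odot>\<^bsub>V\<^esub> Idt V v) \<cdot>\<^bsub>V\<^esub> \<mu> = Lam V v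
     \<and> (Idt V v \<odot>\<^bsub>V\<^esub> \<eta>) \<cdot>\<^bsub>V\<^esub> \<mu> = Rho V v
     \<and> (\<mu> \<odot>\<^bsub>V\<^esub> Idt V v) \<cdot>\<^bsub>V\<^esub> \<mu> = Assoc V v v v \<cdot>\<^bsub>V\<^esub> (Idt V v \<odot>\<^bsub>V\<^esub> \<mu>) \<cdot>\<^bsub>V\<^esub> \<mu>"

definition is_strength_monoid :: "('o, 'm, 'z) monoidal_scheme \<Rightarrow> ('o, 'm, 'o, 'm) func
    \<Rightarrow> ('o \<times> 'm \<Rightarrow> 'o \<Rightarrow> 'm) \<Rightarrow> 'o \<Rightarrow> 'm \<Rightarrow> 'm \<Rightarrow> 'm \<Rightarrow> bool" where
  "is_strength_monoid V H \<theta> v \<eta> \<mu> \<tau> \<longleftrightarrow> is_monoid V v \<eta> \<mu> \<and> \<tau> \<in> hom V (FObj H v) v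
     \<and> (Idt V v \<odot>\<^bsub>V\<^esub> \<tau>) \<cdot>\<^bsub>V\<^esub> \<mu> = \<theta> (v, \<eta>) v \<cdot>\<^bsub>V\<^esub> FArr H \<mu> \<cdot>\<^bsub>V\<^esub> \<tau>"

definition is_final_coalgebra ::
  "('o, 'm, 'z) category_scheme \<Rightarrow> ('o, 'm, 'o, 'm) func \<Rightarrow> 'o \<Rightarrow> 'm \<Rightarrow> bool" where
  "is_final_coalgebra V F t c \<longleftrightarrow> is_functor V V F \<and> t \<in> Obj V \<and> c \<in> hom V t (FObj F t)
     \<and> (\<forall>x d. x \<in> Obj V \<and> d \<in> hom V x (FObj F x) \<longrightarrow>
          (\<exists>!h. h \<in> hom V x t \<and> h \<cdot>\<^bsub>V\<^esub> c = d \<cdot>\<^bsub>V\<^esub> FArr F h))"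

definition is_monad :: "('o, 'm, 'z) category_scheme \<Rightarrow> ('o, 'm, 'o, 'm) func
    \<Rightarrow> ('o, 'm, 'o, 'm) ntrans \<Rightarrow> ('o, 'm, 'o, 'm) ntrans \<Rightarrow> bool" where
  "is_monad A T \<eta> \<mu> \<longleftrightarrow> is_functor A A T
     \<and> is_ntrans A A \<eta> \<and> NDom \<eta> = fid A \<and> NCod \<eta> = T
     \<and> is_ntrans A A \<mu> \<and> NDom \<mu> = fcomp A T T \<and> NCod \<mu> = T
     \<and> (\<forall>a \<in> Obj A.
           FArr T (NMap \<eta> a) \<cdot>\<^bsub>A\<^esub> NMap \<mu> a = Idt A (FObj T a)
         \<and> NMap \<eta> (FObj T a) \<cdot>\<^bsub>A\<^esub> NMap \<mu> a = Idt A (FObj T a)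
         \<and> FArr T (NMap \<mu> a) \<cdot>\<^bsub>A\<^esub> NMap \<mu> a = NMap \<mu> (FObj T a) \<cdot>\<^bsub>A\<^esub> NMap \<mu> a)"

text \<open>The monoidal category of endofunctors of \<open>A\<close>, with \<open>X \<otimes> Y\<close> first \<open>X\<close>, then \<open>Y\<close>. Composition of
  functors is strictly associative and unital, so \<^const>\<open>Lam\<close>, \<^const>\<open>Rho\<close> and \<^const>\<open>Assoc\<close> have identity
  components.\<close>

definition endo :: "('o, 'm, 'y) category_scheme
    \<Rightarrow> (('o, 'm, 'o, 'm) func, ('o, 'm, 'o, 'm) ntrans) monoidal" where
  "endo A = \<lparr>
     Obj = Obj (functor_cat A A),
     Arr = Arr (functor_cat A A),
     Dom = Dom (functor_cat A A),
     Cod = Cod (functor_cat A A),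
     Idt = Idt (functor_cat A A),
     Comp = Comp (functor_cat A A),
     TensO = fcomp A,
     TensA = hcomp A A,
     Unit = fid A,
     Lam = (\<lambda>X. mk_nt A (fcomp A (fid A) X) X (\<lambda>a. Idt A (FObj X a))),
     Rho = (\<lambda>X. mk_nt A (fcomp A X (fid A)) X (\<lambda>a. Idt A (FObj X a))),
     Assoc = (\<lambda>X Y Z. mk_nt A (fcomp A (fcomp A X Y) Z) (fcomp A X (fcomp A Y Z))
                (\<lambda>a. Idt A (FObj Z (FObj Y (FObj X a)))))\<rparr>"


section \<open>Sorted families\<close>

definition discrete :: "'s set \<Rightarrow> ('s, 's) category" where
  "discrete S = \<lparr>Obj = S, Arr = S, Dom = (\<lambda>s. s), Cod = (\<lambda>s. s), Idt = (\<lambda>s. s), Comp = (\<lambda>s t. s)\<rparr>"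

type_synonym ('s, 'o, 'm) fam = "('s, 's, 'o, 'm) func"
type_synonym ('s, 'o, 'm) famarr = "('s, 's, 'o, 'm) ntrans"
type_synonym ('s, 'o, 'm) endofun =
  "(('s, 'o, 'm) fam, ('s, 'o, 'm) famarr, ('s, 'o, 'm) fam, ('s, 'o, 'm) famarr) func"
type_synonym ('s, 'o, 'm) endotrans =
  "(('s, 'o, 'm) fam, ('s, 'o, 'm) famarr, ('s, 'o, 'm) fam, ('s, 'o, 'm) famarr) ntrans"

definition fam_cat :: "('o, 'm, 'z) category_scheme \<Rightarrow> 's set
    \<Rightarrow> (('s, 'o, 'm) fam, ('s, 'o, 'm) famarr) category" where
  "fam_cat C S = functor_cat (discrete S) C"

definition fam_obj :: "('o, 'm, 'z) category_scheme \<Rightarrow> 's set \<Rightarrow> ('s \<Rightarrow> 'o) \<Rightarrow> ('s, 'o, 'm) fam" where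
  "fam_obj C S x = \<lparr>FObj = (\<lambda>s\<in>S. x s), FArr = (\<lambda>s\<in>S. Idt C (x s))\<rparr>"

definition fam_arr :: "('o, 'm, 'z) category_scheme \<Rightarrow> 's set \<Rightarrow> ('s \<Rightarrow> 'm) \<Rightarrow> ('s, 'o, 'm) famarr" where
  "fam_arr C S f = mk_nt (discrete S) (fam_obj C S (\<lambda>s. Dom C (f s))) (fam_obj C S (\<lambda>s. Cod C (f s))) f"

definition pr :: "('o, 'm, 'z) category_scheme \<Rightarrow> 's set \<Rightarrow> 's
    \<Rightarrow> (('s, 'o, 'm) fam, ('s, 'o, 'm) famarr, 'o, 'm) func" where
  "pr C S s = \<lparr>FObj = (\<lambda>\<xi>\<in>Obj (fam_cat C S). FObj \<xi> s), FArr = (\<lambda>f\<in>Arr (fam_cat C S). NMap f s)\<rparr>"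

text \<open>The subsingleton of proofs of an equation is rendered as a subset of \<^typ>\<open>unit\<close>.\<close>

definition eq_proofs :: "'s \<Rightarrow> 's \<Rightarrow> unit set" where
  "eq_proofs s t = {u. s = t}"

definition hat :: "('o, 'm, 'z) category_scheme \<Rightarrow> 's set \<Rightarrow> 's
    \<Rightarrow> ('o, 'm, ('s, 'o, 'm) fam, ('s, 'o, 'm) famarr) func" where
  "hat C S s = \<lparr>
     FObj = (\<lambda>c\<in>Obj C. fam_obj C S (\<lambda>t. coprod_obj C (eq_proofs s t) (\<lambda>_. c))),
     FArr = (\<lambda>f\<in>Arr C. fam_arr C S (\<lambda>t. coprod_map C (eq_proofs s t) (\<lambda>_. f)))\<rparr>"

text \<open>Pointwise coproducts and binary products of endofunctors of \<open>C\<^sup>S\<close>.\<close>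

definition pw_coprod :: "('o, 'm, 'z) category_scheme \<Rightarrow> 's set \<Rightarrow> 'j set
    \<Rightarrow> ('j \<Rightarrow> ('s, 'o, 'm) endofun) \<Rightarrow> ('s, 'o, 'm) endofun" where
  "pw_coprod C S J F = \<lparr>
     FObj = (\<lambda>\<xi>\<in>Obj (fam_cat C S). fam_obj C S (\<lambda>t. coprod_obj C J (\<lambda>j. FObj (FObj (F j) \<xi>) t))),
     FArr = (\<lambda>f\<in>Arr (fam_cat C S). fam_arr C S (\<lambda>t. coprod_map C J (\<lambda>j. NMap (FArr (F j) f) t)))\<rparr>"

definition pw_coprod_map :: "('o, 'm, 'z) category_scheme \<Rightarrow> 's set \<Rightarrow> 'j set
    \<Rightarrow> ('j \<Rightarrow> ('s, 'o, 'm) endotrans) \<Rightarrow> ('s, 'o, 'm) endotrans" where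
  "pw_coprod_map C S J \<alpha> =
     mk_nt (fam_cat C S) (pw_coprod C S J (\<lambda>j. NDom (\<alpha> j))) (pw_coprod C S J (\<lambda>j. NCod (\<alpha> j)))
       (\<lambda>\<xi>. fam_arr C S (\<lambda>t. coprod_map C J (\<lambda>j. NMap (NMap (\<alpha> j) \<xi>) t)))"

definition pw_coprod_inj :: "('o, 'm, 'z) category_scheme \<Rightarrow> 's set \<Rightarrow> 'j set
    \<Rightarrow> ('j \<Rightarrow> ('s, 'o, 'm) endofun) \<Rightarrow> 'j \<Rightarrow> ('s, 'o, 'm) endotrans" where
  "pw_coprod_inj C S J F i = mk_nt (fam_cat C S) (F i) (pw_coprod C S J F)
     (\<lambda>\<xi>. fam_arr C S (\<lambda>t. coprod_inj C J (\<lambda>j. FObj (FObj (F j) \<xi>) t) i))"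

definition pw_prod :: "('o, 'm, 'z) category_scheme \<Rightarrow> 's set
    \<Rightarrow> ('s, 'o, 'm) endofun \<Rightarrow> ('s, 'o, 'm) endofun \<Rightarrow> ('s, 'o, 'm) endofun" where
  "pw_prod C S F G = \<lparr>
     FObj = (\<lambda>\<xi>\<in>Obj (fam_cat C S).
               fam_obj C S (\<lambda>t. prod_obj C (FObj (FObj F \<xi>) t) (FObj (FObj G \<xi>) t))),
     FArr = (\<lambda>f\<in>Arr (fam_cat C S).
               fam_arr C S (\<lambda>t. prod_map C (NMap (FArr F f) t) (NMap (FArr G f) t)))\<rparr>"

definition pw_prod_map :: "('o, 'm, 'z) category_scheme \<Rightarrow> 's set
    \<Rightarrow> ('s, 'o, 'm) endotrans \<Rightarrow> ('s, 'o, 'm) endotrans \<Rightarrow> ('s, 'o, 'm) endotrans" where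
  "pw_prod_map C S \<alpha> \<beta> =
     mk_nt (fam_cat C S) (pw_prod C S (NDom \<alpha>) (NDom \<beta>)) (pw_prod C S (NCod \<alpha>) (NCod \<beta>))
       (\<lambda>\<xi>. fam_arr C S (\<lambda>t. prod_map C (NMap (NMap \<alpha> \<xi>) t) (NMap (NMap \<beta> \<xi>) t)))"


section \<open>The signature functor\<close>

definition binding_signature :: "'s set \<Rightarrow> 'i set \<Rightarrow> ('i \<Rightarrow> ('s list \<times> 's) list \<times> 's) \<Rightarrow> bool" where
  "binding_signature S I ar \<longleftrightarrow> (\<forall>i \<in> I. ar i \<in> lists (lists S \<times> S) \<times> S)"

definition option_obj :: "('o, 'm, 'z) category_scheme \<Rightarrow> 's set \<Rightarrow> 's
    \<Rightarrow> ('s, 'o, 'm) fam \<Rightarrow> ('s, 'o, 'm) fam" where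
  "option_obj C S s \<xi> =
     fam_obj C S (\<lambda>t. plus_obj C (coprod_obj C (eq_proofs s t) (\<lambda>_. terminal C)) (FObj \<xi> t))"

definition option :: "('o, 'm, 'z) category_scheme \<Rightarrow> 's set \<Rightarrow> 's \<Rightarrow> ('s, 'o, 'm) endofun" where
  "option C S s = \<lparr>
     FObj = (\<lambda>\<xi>\<in>Obj (fam_cat C S). option_obj C S s \<xi>),
     FArr = (\<lambda>f\<in>Arr (fam_cat C S). fam_arr C S (\<lambda>t.
               plus_map C (Idt C (coprod_obj C (eq_proofs s t) (\<lambda>_. terminal C))) (NMap f t)))\<rparr>"

primrec option_list :: "('o, 'm, 'z) category_scheme \<Rightarrow> 's set \<Rightarrow> 's list \<Rightarrow> ('s, 'o, 'm) endofun" where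
  "option_list C S [] = fid (fam_cat C S)"
| "option_list C S (s # l) = fcomp (fam_cat C S) (option C S s) (option_list C S l)"

definition arg_obj :: "('o, 'm, 'z) category_scheme \<Rightarrow> 's set \<Rightarrow> 's list \<times> 's \<Rightarrow> 's
    \<Rightarrow> ('s, 'o, 'm) endofun \<Rightarrow> ('s, 'o, 'm) endofun" where
  "arg_obj C S a t X =
     fcomp (fam_cat C S) (option_list C S (fst a))
       (fcomp (fam_cat C S) X (fcomp (fam_cat C S) (pr C S (snd a)) (hat C S t)))"

definition arg_arr :: "('o, 'm, 'z) category_scheme \<Rightarrow> 's set \<Rightarrow> 's list \<times> 's \<Rightarrow> 's
    \<Rightarrow> ('s, 'o, 'm) endotrans \<Rightarrow> ('s, 'o, 'm) endotrans" where
  "arg_arr C S a t \<alpha> =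
     mk_nt (fam_cat C S) (arg_obj C S a t (NDom \<alpha>)) (arg_obj C S a t (NCod \<alpha>))
       (\<lambda>\<xi>. FArr (hat C S t) (FArr (pr C S (snd a)) (NMap \<alpha> (FObj (option_list C S (fst a)) \<xi>))))"

fun arity_obj :: "('o, 'm, 'z) category_scheme \<Rightarrow> 's set \<Rightarrow> ('s list \<times> 's) list \<Rightarrow> 's
    \<Rightarrow> ('s, 'o, 'm) endofun \<Rightarrow> ('s, 'o, 'm) endofun" where
  "arity_obj C S [] t X =
     const_functor (fam_cat C S) (fam_cat C S) (FObj (hat C S t) (terminal C))"
| "arity_obj C S [a] t X = arg_obj C S a t X"
| "arity_obj C S (a # b # as) t X =
     pw_prod C S (arg_obj C S a t X) (arity_obj C S (b # as) t X)"

fun arity_arr :: "('o, 'm, 'z) category_scheme \<Rightarrow> 's set \<Rightarrow> ('s list \<times> 's) list \<Rightarrow> 's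
    \<Rightarrow> ('s, 'o, 'm) endotrans \<Rightarrow> ('s, 'o, 'm) endotrans" where
  "arity_arr C S [] t \<alpha> = Idt (endo (fam_cat C S)) (arity_obj C S [] t (NDom \<alpha>))"
| "arity_arr C S [a] t \<alpha> = arg_arr C S a t \<alpha>"
| "arity_arr C S (a # b # as) t \<alpha> =
     pw_prod_map C S (arg_arr C S a t \<alpha>) (arity_arr C S (b # as) t \<alpha>)"

definition sig_functor :: "('o, 'm, 'z) category_scheme \<Rightarrow> 's set \<Rightarrow> 'i set
    \<Rightarrow> ('i \<Rightarrow> ('s list \<times> 's) list \<times> 's)
    \<Rightarrow> (('s, 'o, 'm) endofun, ('s, 'o, 'm) endotrans,
        ('s, 'o, 'm) endofun, ('s, 'o, 'm) endotrans) func" where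
  "sig_functor C S I ar = \<lparr>
     FObj = (\<lambda>X\<in>Obj (endo (fam_cat C S)).
               pw_coprod C S I (\<lambda>i. arity_obj C S (fst (ar i)) (snd (ar i)) X)),
     FArr = (\<lambda>\<alpha>\<in>Arr (endo (fam_cat C S)).
               pw_coprod_map C S I (\<lambda>i. arity_arr C S (fst (ar i)) (snd (ar i)) \<alpha>))\<rparr>"

text \<open>The functor \<open>Id + H-\<close> and the injections of the (pointwise) coproduct \<open>Id + HX\<close>.\<close>

definition id_plus_family :: "('o, 'm, 'z) category_scheme \<Rightarrow> 's set
    \<Rightarrow> (('s, 'o, 'm) endofun, ('s, 'o, 'm) endotrans,
        ('s, 'o, 'm) endofun, ('s, 'o, 'm) endotrans) func
    \<Rightarrow> ('s, 'o, 'm) endofun \<Rightarrow> bool \<Rightarrow> ('s, 'o, 'm) endofun" where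
  "id_plus_family C S H X = (\<lambda>i. if i then fid (fam_cat C S) else FObj H X)"

definition id_plus :: "('o, 'm, 'z) category_scheme \<Rightarrow> 's set
    \<Rightarrow> (('s, 'o, 'm) endofun, ('s, 'o, 'm) endotrans,
        ('s, 'o, 'm) endofun, ('s, 'o, 'm) endotrans) func
    \<Rightarrow> (('s, 'o, 'm) endofun, ('s, 'o, 'm) endotrans,
        ('s, 'o, 'm) endofun, ('s, 'o, 'm) endotrans) func" where
  "id_plus C S H = \<lparr>
     FObj = (\<lambda>X\<in>Obj (endo (fam_cat C S)). pw_coprod C S UNIV (id_plus_family C S H X)),
     FArr = (\<lambda>\<alpha>\<in>Arr (endo (fam_cat C S)). pw_coprod_map C S (UNIV :: bool set)
               (\<lambda>i. if i then Idt (endo (fam_cat C S)) (fid (fam_cat C S)) else FArr H \<alpha>))\<rparr>"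

definition id_plus_inl :: "('o, 'm, 'z) category_scheme \<Rightarrow> 's set
    \<Rightarrow> (('s, 'o, 'm) endofun, ('s, 'o, 'm) endotrans,
        ('s, 'o, 'm) endofun, ('s, 'o, 'm) endotrans) func
    \<Rightarrow> ('s, 'o, 'm) endofun \<Rightarrow> ('s, 'o, 'm) endotrans" where
  "id_plus_inl C S H X = pw_coprod_inj C S UNIV (id_plus_family C S H X) True"

definition id_plus_inr :: "('o, 'm, 'z) category_scheme \<Rightarrow> 's set
    \<Rightarrow> (('s, 'o, 'm) endofun, ('s, 'o, 'm) endotrans,
        ('s, 'o, 'm) endofun, ('s, 'o, 'm) endotrans) func
    \<Rightarrow> ('s, 'o, 'm) endofun \<Rightarrow> ('s, 'o, 'm) endotrans" where
  "id_plus_inr C S H X = pw_coprod_inj C S UNIV (id_plus_family C S H X) False"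


section \<open>The strength of the signature functor\<close>

definition option_inr :: "('o, 'm, 'z) category_scheme \<Rightarrow> 's set \<Rightarrow> 's
    \<Rightarrow> ('s, 'o, 'm) fam \<Rightarrow> ('s, 'o, 'm) famarr" where
  "option_inr C S s \<xi> =
     fam_arr C S (\<lambda>t. plus_inr C (coprod_obj C (eq_proofs s t) (\<lambda>_. terminal C)) (FObj \<xi> t))"

definition gamma :: "('o, 'm, 'z) category_scheme \<Rightarrow> 's set
    \<Rightarrow> ('s, 'o, 'm) endofun \<times> ('s, 'o, 'm) endotrans \<Rightarrow> 's
    \<Rightarrow> ('s, 'o, 'm) fam \<Rightarrow> ('s, 'o, 'm) famarr" where
  "gamma C S Ye s \<xi> = fam_arr C S (\<lambda>t. copair C
     (plus_inl C (coprod_obj C (eq_proofs s t) (\<lambda>_. terminal C)) (FObj \<xi> t)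
        \<cdot>\<^bsub>C\<^esub> NMap (NMap (snd Ye) (option_obj C S s \<xi>)) t)
     (NMap (FArr (fst Ye) (option_inr C S s \<xi>)) t))"

primrec gamma_list :: "('o, 'm, 'z) category_scheme \<Rightarrow> 's set
    \<Rightarrow> ('s, 'o, 'm) endofun \<times> ('s, 'o, 'm) endotrans \<Rightarrow> 's list
    \<Rightarrow> ('s, 'o, 'm) fam \<Rightarrow> ('s, 'o, 'm) famarr" where
  "gamma_list C S Ye [] \<xi> = Idt (fam_cat C S) (FObj (fst Ye) \<xi>)"
| "gamma_list C S Ye (s # l) \<xi> =
     FArr (option_list C S l) (gamma C S Ye s \<xi>)
       \<cdot>\<^bsub>fam_cat C S\<^esub> gamma_list C S Ye l (option_obj C S s \<xi>)"

definition arg_strength :: "('o, 'm, 'z) category_scheme \<Rightarrow> 's set \<Rightarrow> 's list \<times> 's \<Rightarrow> 's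
    \<Rightarrow> ('s, 'o, 'm) endofun \<times> ('s, 'o, 'm) endotrans \<Rightarrow> ('s, 'o, 'm) endofun
    \<Rightarrow> ('s, 'o, 'm) endotrans" where
  "arg_strength C S a t Ye X =
     mk_nt (fam_cat C S)
       (fcomp (fam_cat C S) (fst Ye) (arg_obj C S a t X))
       (arg_obj C S a t (fcomp (fam_cat C S) (fst Ye) X))
       (\<lambda>\<xi>. FArr (hat C S t) (FArr (pr C S (snd a)) (FArr X (gamma_list C S Ye (fst a) \<xi>))))"

text \<open>Precomposition with \<open>Y\<close> commutes strictly with pointwise products, so no
  coherence isomorphism is inserted in the product case.\<close>

fun arity_strength :: "('o, 'm, 'z) category_scheme \<Rightarrow> 's set \<Rightarrow> ('s list \<times> 's) list \<Rightarrow> 's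
    \<Rightarrow> ('s, 'o, 'm) endofun \<times> ('s, 'o, 'm) endotrans \<Rightarrow> ('s, 'o, 'm) endofun
    \<Rightarrow> ('s, 'o, 'm) endotrans" where
  "arity_strength C S [] t Ye X =
     mk_nt (fam_cat C S)
       (fcomp (fam_cat C S) (fst Ye) (arity_obj C S [] t X))
       (arity_obj C S [] t (fcomp (fam_cat C S) (fst Ye) X))
       (\<lambda>\<xi>. Idt (fam_cat C S) (FObj (hat C S t) (terminal C)))"
| "arity_strength C S [a] t Ye X = arg_strength C S a t Ye X"
| "arity_strength C S (a # b # as) t Ye X =
     pw_prod_map C S (arg_strength C S a t Ye X) (arity_strength C S (b # as) t Ye X)"

text \<open>The canonical isomorphism from \<open>Y \<cdot> \<Coprod>\<^sub>j F\<^sub>j\<close> to \<open>\<Coprod>\<^sub>j (Y \<cdot> F\<^sub>j)\<close> has identity components, because the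
  coproducts are computed pointwise.\<close>

definition precomp_coprod :: "('o, 'm, 'z) category_scheme \<Rightarrow> 's set \<Rightarrow> 'j set
    \<Rightarrow> ('s, 'o, 'm) endofun \<Rightarrow> ('j \<Rightarrow> ('s, 'o, 'm) endofun) \<Rightarrow> ('s, 'o, 'm) endotrans" where
  "precomp_coprod C S J Y F =
     mk_nt (fam_cat C S)
       (fcomp (fam_cat C S) Y (pw_coprod C S J F))
       (pw_coprod C S J (\<lambda>j. fcomp (fam_cat C S) Y (F j)))
       (\<lambda>\<xi>. Idt (fam_cat C S) (FObj (pw_coprod C S J F) (FObj Y \<xi>)))"

definition sig_strength :: "('o, 'm, 'z) category_scheme \<Rightarrow> 's set \<Rightarrow> 'i set
    \<Rightarrow> ('i \<Rightarrow> ('s list \<times> 's) list \<times> 's)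
    \<Rightarrow> ('s, 'o, 'm) endofun \<times> ('s, 'o, 'm) endotrans \<Rightarrow> ('s, 'o, 'm) endofun
    \<Rightarrow> ('s, 'o, 'm) endotrans" where
  "sig_strength C S I ar Ye X =
     precomp_coprod C S I (fst Ye) (\<lambda>i. arity_obj C S (fst (ar i)) (snd (ar i)) X)
       \<cdot>\<^bsub>endo (fam_cat C S)\<^esub>
     pw_coprod_map C S I (\<lambda>i. arity_strength C S (fst (ar i)) (snd (ar i)) Ye X)"

end

theory Submission
  imports Defs
begin

text \<open>
  Composition of endofunctors is strictly associative and unital, so all coherence isomorphisms are
  identities. At a sort \<open>t\<close>, every summand of \<open>H X \<xi>\<close> is obtained from values \<open>X (option\<^sup>* l \<xi>) s\<close> by
  coproducts over subsingletons, products and a coproduct over \<open>I\<close>. These operations are functorial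
  and preserve \<open>\<omega>\<close>-limits by distributivity, so a strength on the evaluations \<open>X (option\<^sup>* l \<xi>) s\<close>, given by
  \<open>\<gamma>\<close>, induces one on \<open>H\<close>, and \<open>Id + H-\<close> preserves pointwise \<open>\<omega>\<close>-limits; its final coalgebra is the limit of
  the terminal chain. Precomposition with \<open>Z\<close> preserves the coproduct \<open>Id + H T\<close>, so a morphism
  \<open>Z \<cdot> T \<rightarrow> T\<close> as required by an MHSS is one defined by primitive corecursion. Unit and associativity laws of the
  monoid follow from the uniqueness of these morphisms.
\<close>

text \<open>The distributivity hypotheses enter at different places. In
  \<open>option^* l . X . pr_s . hat t\<close> context extension comes before X, so it only moves
  the family at which X is evaluated; preservation of limits is asked of \<open>hat\<close>
  (subsingletons), of the sum of the arities (the set I) and of \<open>Id + H\<close> (two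
  elements). These hypotheses speak of chosen coproducts over sets in one type, whereas the
  definitions use coproducts over \<open>unit\<close> and \<open>bool\<close>; hence distributivity
  is first restated for arbitrary coproducts and limits, a form that can be carried along
  bijections. Substitution is not itself given by a coalgebra on \<open>Z . T\<close>: once a
  variable is reached it has to go on with a tree already in T, which is why the corecursion runs on
  \<open>Z . T + T\<close>. The strength is defined by recursion on lists. Instead of repeating each
  law for each constructor, a component packages functoriality, limit preservation and the strength
  laws at one sort, and these are shown once to survive every operation on C that is functorial and
  preserves \<open>\<omega>\<close>-limits.\<close>

section \<open>Categories\<close>

text \<open>\<open>is_omega_limit\<close> constrains the cone but not the maps \<open>d n\<close>,
  whose source and target are fixed only by \<open>is_cochain\<close>. Bundling the two makes every
  composite with \<open>d n\<close> well typed.\<close>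

definition cochain_limit :: "('o, 'm, 'z) category_scheme \<Rightarrow> (nat \<Rightarrow> 'o) \<Rightarrow> (nat \<Rightarrow> 'm)
    \<Rightarrow> 'o \<Rightarrow> (nat \<Rightarrow> 'm) \<Rightarrow> bool" where
  "cochain_limit C x d l \<pi> \<longleftrightarrow> is_cochain C x d \<and> is_omega_limit C x d l \<pi>"

context category
begin

lemma homI: "\<lbrakk>f \<in> Arr C; Dom C f = a; Cod C f = b\<rbrakk> \<Longrightarrow> f \<in> hom C a b"
  by (simp add: hom_def)

lemma homD: "f \<in> hom C a b \<Longrightarrow> f \<in> Arr C \<and> Dom C f = a \<and> Cod C f = b"
  by (simp add: hom_def)

lemma hom_obj: "f \<in> hom C a b \<Longrightarrow> a \<in> Obj C \<and> b \<in> Obj C"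
  using dom_obj cod_obj by (auto simp: hom_def)

lemma dom_cod_obj [simp]: "f \<in> Arr C \<Longrightarrow> Dom C f \<in> Obj C" "f \<in> Arr C \<Longrightarrow> Cod C f \<in> Obj C"
  using dom_obj cod_obj by auto

lemma idt_simps [simp]:
  assumes "a \<in> Obj C"
  shows "Idt C a \<in> Arr C" "Dom C (Idt C a) = a" "Cod C (Idt C a) = a"
  using idt_hom[OF assms] by (auto simp: hom_def)

lemma comp_simps [simp]:
  assumes "f \<in> Arr C" "g \<in> Arr C" "Cod C f = Dom C g"
  shows "f \<cdot> g \<in> Arr C" "Dom C (f \<cdot> g) = Dom C f" "Cod C (f \<cdot> g) = Cod C g"
  using comp_hom[of f "Dom C f" "Cod C f" g "Cod C g"] assms by (auto simp: hom_def)

lemma idl [simp]: "\<lbrakk>f \<in> Arr C; Dom C f = a\<rbrakk> \<Longrightarrow> Idt C a \<cdot> f = f"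
  using idt_comp[of f a "Cod C f"] by (auto simp: hom_def)

lemma idr [simp]: "\<lbrakk>f \<in> Arr C; Cod C f = a\<rbrakk> \<Longrightarrow> f \<cdot> Idt C a = f"
  using comp_idt[of f "Dom C f" a] by (auto simp: hom_def)

lemma assoc [simp]:
  "\<lbrakk>f \<in> Arr C; g \<in> Arr C; h \<in> Arr C; Cod C f = Dom C g; Cod C g = Dom C h\<rbrakk>
    \<Longrightarrow> (f \<cdot> g) \<cdot> h = f \<cdot> (g \<cdot> h)"
  using comp_assoc[of f "Dom C f" "Cod C f" g "Cod C g" h "Cod C h"] by (auto simp: hom_def)

text \<open>Associativity holds only for composable arrows, so replacing one side of a commuting
  square in front of a further factor needs the types of all arrows involved; they are collected
  here once.\<close>

lemma comp_eq_extend: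
  assumes "f \<cdot> g = f' \<cdot> g'" "f \<in> hom C a b" "g \<in> hom C b c" "f' \<in> hom C a b'" "g' \<in> hom C b' c"
    and "h \<in> hom C c d"
  shows "f \<cdot> (g \<cdot> h) = f' \<cdot> (g' \<cdot> h)"
  using comp_assoc[OF assms(2,3,6)] comp_assoc[OF assms(4,5,6)] assms(1) by simp

subsection \<open>Isomorphisms\<close>

lemma is_inverse_iff:
  "f \<in> hom C a b \<Longrightarrow> is_inverse C f g \<longleftrightarrow> g \<in> hom C b a \<and> f \<cdot> g = Idt C a \<and> g \<cdot> f = Idt C b"
  by (auto simp: is_inverse_def hom_def)

lemma is_inverse_unique:
  assumes "is_inverse C f g" "is_inverse C f h"
  shows "g = h"
proof -
  have f: "f \<in> hom C (Dom C f) (Cod C f)" using assms(1) by (simp add: is_inverse_def hom_def)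
  have g: "g \<in> hom C (Cod C f) (Dom C f)" "g \<cdot> f = Idt C (Cod C f)"
    and h: "h \<in> hom C (Cod C f) (Dom C f)" "f \<cdot> h = Idt C (Dom C f)"
    using assms by (auto simp: is_inverse_def)
  have "g = g \<cdot> (f \<cdot> h)" using g h by (simp add: hom_def)
  also have "\<dots> = (g \<cdot> f) \<cdot> h" using comp_assoc[OF g(1) f h(1)] ..
  also have "\<dots> = h" using g h by (simp add: hom_def)
  finally show ?thesis .
qed

lemma inv_arr_eq: "is_inverse C f g \<Longrightarrow> inv_arr C f = g"
  unfolding inv_arr_def using is_inverse_unique by blast

lemma is_inverse_inv_arr: "is_iso C f \<Longrightarrow> is_inverse C f (inv_arr C f)"
  using inv_arr_eq unfolding is_iso_def by auto

lemma is_inverse_idt: "a \<in> Obj C \<Longrightarrow> is_inverse C (Idt C a) (Idt C a)"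
  by (simp add: is_inverse_def hom_def)

lemma is_inverse_comp:
  assumes "f \<in> hom C a b" "g \<in> hom C b c" "is_inverse C f f'" "is_inverse C g g'"
  shows "is_inverse C (f \<cdot> g) (g' \<cdot> f')"
proof -
  have f: "f' \<in> hom C b a" "f \<cdot> f' = Idt C a" "f' \<cdot> f = Idt C b"
    and g: "g' \<in> hom C c b" "g \<cdot> g' = Idt C b" "g' \<cdot> g = Idt C c"
    using assms is_inverse_iff by auto
  have "(f \<cdot> g) \<cdot> (g' \<cdot> f') = f \<cdot> ((g \<cdot> g') \<cdot> f')"
    using assms(1,2) f(1) g(1) by (simp add: hom_def)
  also have "\<dots> = Idt C a" using f g by (simp add: hom_def)
  finally have 1: "(f \<cdot> g) \<cdot> (g' \<cdot> f') = Idt C a" .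
  have "(g' \<cdot> f') \<cdot> (f \<cdot> g) = g' \<cdot> ((f' \<cdot> f) \<cdot> g)"
    using assms(1,2) f(1) g(1) by (simp add: hom_def)
  also have "\<dots> = Idt C c" using f g assms(2) by (simp add: hom_def)
  finally show ?thesis using 1 assms(1,2) f(1) g(1) comp_hom by (subst is_inverse_iff) auto
qed

subsection \<open>Universal properties\<close>

lemma coproduct_eqI:
  assumes "is_coproduct C J x c \<iota>" "h \<in> hom C c d" "h' \<in> hom C c d"
    and "\<And>j. j \<in> J \<Longrightarrow> \<iota> j \<cdot> h = \<iota> j \<cdot> h'"
  shows "h = h'"
proof -
  have "d \<in> Obj C" using hom_obj assms(2) by blast
  moreover have "\<forall>j\<in>J. \<iota> j \<cdot> h \<in> hom C (x j) d"
    using assms(1,2) comp_hom unfolding is_coproduct_def by blast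
  ultimately have "\<exists>!k. k \<in> hom C c d \<and> (\<forall>j \<in> J. \<iota> j \<cdot> k = \<iota> j \<cdot> h)"
    using assms(1) unfolding is_coproduct_def by (elim conjE allE[of _ d] allE[of _ "\<lambda>j. \<iota> j \<cdot> h"]) blast
  then show ?thesis using assms(2-4) by metis
qed

lemma coproduct_descE:
  assumes "is_coproduct C J x c \<iota>" "d \<in> Obj C" "\<And>j. j \<in> J \<Longrightarrow> f j \<in> hom C (x j) d"
  obtains h where "h \<in> hom C c d" "\<And>j. j \<in> J \<Longrightarrow> \<iota> j \<cdot> h = f j"
  using assms unfolding is_coproduct_def by (elim conjE allE[of _ d] allE[of _ f]) blast

lemma is_coproductI:
  assumes "c \<in> Obj C" "\<And>j. j \<in> J \<Longrightarrow> \<iota> j \<in> hom C (x j) c"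
    and "\<And>d f. \<lbrakk>d \<in> Obj C; \<And>j. j \<in> J \<Longrightarrow> f j \<in> hom C (x j) d\<rbrakk>
      \<Longrightarrow> \<exists>h. h \<in> hom C c d \<and> (\<forall>j \<in> J. \<iota> j \<cdot> h = f j)"
    and "\<And>d h k. \<lbrakk>h \<in> hom C c d; k \<in> hom C c d; \<And>j. j \<in> J \<Longrightarrow> \<iota> j \<cdot> h = \<iota> j \<cdot> k\<rbrakk> \<Longrightarrow> h = k"
  shows "is_coproduct C J x c \<iota>"
  unfolding is_coproduct_def
proof (intro conjI ballI allI impI)
  fix d f assume df: "d \<in> Obj C \<and> (\<forall>j\<in>J. f j \<in> hom C (x j) d)"
  then obtain h where h: "h \<in> hom C c d" "\<forall>j \<in> J. \<iota> j \<cdot> h = f j"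
    using assms(3)[of d f] by blast
  show "\<exists>!h. h \<in> hom C c d \<and> (\<forall>j\<in>J. \<iota> j \<cdot> h = f j)"
  proof (rule ex1I[of _ h])
    show "h \<in> hom C c d \<and> (\<forall>j\<in>J. \<iota> j \<cdot> h = f j)" using h by blast
    fix k assume k: "k \<in> hom C c d \<and> (\<forall>j\<in>J. \<iota> j \<cdot> k = f j)"
    show "k = h" using assms(4)[of k d h] h k by auto
  qed
qed (use assms in auto)

lemma is_coproduct_cong:
  assumes "is_coproduct C J x c \<iota>" "\<And>j. j \<in> J \<Longrightarrow> x j = y j" "\<And>j. j \<in> J \<Longrightarrow> \<iota> j = \<kappa> j"
  shows "is_coproduct C J y c \<kappa>"
  using assms unfolding is_coproduct_def by simp

text \<open>A cocone on \<open>y\<close> becomes one on \<open>x\<close> after composition with the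
  inverses of the \<open>s j\<close>, and the map it induces out of \<open>c\<close> is moved to
  \<open>c'\<close> by \<open>v\<close>. The \<open>s j\<close> point from the new summands to the
  old ones, since injections start at the summands.\<close>

lemma coproduct_transport_iso:
  assumes c: "is_coproduct C J x c \<iota>"
    and s: "\<And>j. j \<in> J \<Longrightarrow> s j \<in> hom C (y j) (x j) \<and> is_iso C (s j)"
    and u: "u \<in> hom C c c'" "is_inverse C u v"
  shows "is_coproduct C J y c' (\<lambda>j. s j \<cdot> (\<iota> j \<cdot> u))"
proof (rule is_coproductI)
  have \<iota>: "\<iota> j \<in> hom C (x j) c" if "j \<in> J" for j using c that unfolding is_coproduct_def by blast
  have v: "v \<in> hom C c' c" "u \<cdot> v = Idt C c" "v \<cdot> u = Idt C c'" using u is_inverse_iff by auto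
  define r where "r j = inv_arr C (s j)" for j
  have r: "r j \<in> hom C (x j) (y j)" "s j \<cdot> r j = Idt C (y j)" "r j \<cdot> s j = Idt C (x j)"
    if "j \<in> J" for j
    using is_inverse_inv_arr[of "s j"] s[OF that] is_inverse_iff unfolding r_def by auto
  show "c' \<in> Obj C" using u hom_obj by blast
  show i: "s j \<cdot> (\<iota> j \<cdot> u) \<in> hom C (y j) c'" if "j \<in> J" for j
    using comp_hom[OF _ comp_hom[OF \<iota>[OF that] u(1)]] s[OF that] by blast
  show "\<exists>h. h \<in> hom C c' d \<and> (\<forall>j\<in>J. s j \<cdot> (\<iota> j \<cdot> u) \<cdot> h = f j)"
    if d: "d \<in> Obj C" and f: "\<And>j. j \<in> J \<Longrightarrow> f j \<in> hom C (y j) d" for d f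
  proof -
    have "r j \<cdot> f j \<in> hom C (x j) d" if "j \<in> J" for j using comp_hom[OF r(1) f] that by blast
    then obtain h where h: "h \<in> hom C c d" "\<And>j. j \<in> J \<Longrightarrow> \<iota> j \<cdot> h = r j \<cdot> f j"
      using coproduct_descE[OF c d, of "\<lambda>j. r j \<cdot> f j"] by blast
    have "s j \<cdot> (\<iota> j \<cdot> u) \<cdot> (v \<cdot> h) = f j" if j: "j \<in> J" for j
    proof -
      have "s j \<cdot> (\<iota> j \<cdot> u) \<cdot> (v \<cdot> h) = s j \<cdot> (\<iota> j \<cdot> ((u \<cdot> v) \<cdot> h))"
        using s[OF j] \<iota>[OF j] u(1) v(1) h(1) by (simp add: hom_def)
      also have "\<dots> = s j \<cdot> (r j \<cdot> f j)" using v h(1) h(2)[OF j] by (simp add: hom_def)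
      also have "\<dots> = (s j \<cdot> r j) \<cdot> f j" using s[OF j] r(1)[OF j] f[OF j] by (simp add: hom_def)
      also have "\<dots> = f j" using r(2)[OF j] f[OF j] by (simp add: hom_def)
      finally show ?thesis .
    qed
    then show ?thesis using v(1) h(1) comp_hom by blast
  qed
  show "h = k" if h: "h \<in> hom C c' d" and k: "k \<in> hom C c' d"
    and e: "\<And>j. j \<in> J \<Longrightarrow> s j \<cdot> (\<iota> j \<cdot> u) \<cdot> h = s j \<cdot> (\<iota> j \<cdot> u) \<cdot> k" for d h k
  proof -
    have R: "\<iota> j \<cdot> (u \<cdot> g) = r j \<cdot> (s j \<cdot> (\<iota> j \<cdot> u) \<cdot> g)" if j: "j \<in> J" and g: "g \<in> hom C c' d" for j g
    proof -
      have "r j \<cdot> (s j \<cdot> (\<iota> j \<cdot> u) \<cdot> g) = (r j \<cdot> s j) \<cdot> (\<iota> j \<cdot> (u \<cdot> g))"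
        using s[OF j] \<iota>[OF j] r(1)[OF j] u(1) g by (simp add: hom_def)
      then show ?thesis using r(3)[OF j] \<iota>[OF j] u(1) g by (simp add: hom_def)
    qed
    have "u \<cdot> h = u \<cdot> k"
      by (rule coproduct_eqI[OF c comp_hom[OF u(1) h] comp_hom[OF u(1) k]])
        (simp only: R[OF _ h] R[OF _ k] e)
    then have "v \<cdot> (u \<cdot> h) = v \<cdot> (u \<cdot> k)" by simp
    then have "(v \<cdot> u) \<cdot> h = (v \<cdot> u) \<cdot> k" using v(1) u(1) h k by (simp add: hom_def)
    then show ?thesis using v(3) h k by (simp add: hom_def)
  qed
qed

text \<open>Composing the injections of \<open>c'\<close> with the isomorphisms \<open>s j\<close>
  makes \<open>c'\<close> a second coproduct of the family \<open>x\<close>; then \<open>u\<close>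
  compares two coproducts of one family.\<close>

lemma coproduct_comparison_iso:
  assumes c: "is_coproduct C J x c \<iota>" and c': "is_coproduct C J y c' \<kappa>"
    and s: "\<And>j. j \<in> J \<Longrightarrow> s j \<in> hom C (x j) (y j) \<and> is_iso C (s j)"
    and u: "u \<in> hom C c c'" "\<And>j. j \<in> J \<Longrightarrow> \<iota> j \<cdot> u = s j \<cdot> \<kappa> j"
  shows "is_iso C u"
proof -
  have o: "c \<in> Obj C" "c' \<in> Obj C" using u hom_obj by auto
  have \<iota>: "\<iota> j \<in> hom C (x j) c" and \<kappa>: "\<kappa> j \<in> hom C (y j) c'" if "j \<in> J" for j
    using c c' that unfolding is_coproduct_def by blast+
  have c'': "is_coproduct C J x c' (\<lambda>j. s j \<cdot> \<kappa> j)"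
    by (rule is_coproduct_cong[OF coproduct_transport_iso[OF c' s idt_hom[OF o(2)] is_inverse_idt[OF o(2)]]])
      (use \<kappa> in \<open>auto simp: hom_def\<close>)
  obtain v where v: "v \<in> hom C c' c" "\<And>j. j \<in> J \<Longrightarrow> s j \<cdot> \<kappa> j \<cdot> v = \<iota> j"
    using coproduct_descE[OF c'' o(1), of \<iota>] \<iota> by metis
  have "u \<cdot> v = Idt C c"
  proof (rule coproduct_eqI[OF c comp_hom[OF u(1) v(1)] idt_hom[OF o(1)]])
    fix j assume j: "j \<in> J"
    have "\<iota> j \<cdot> (u \<cdot> v) = (\<iota> j \<cdot> u) \<cdot> v" using \<iota>[OF j] u(1) v(1) by (simp add: hom_def)
    then show "\<iota> j \<cdot> (u \<cdot> v) = \<iota> j \<cdot> Idt C c" using u(2)[OF j] v(2)[OF j] \<iota>[OF j] by (simp add: hom_def)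
  qed
  moreover have "v \<cdot> u = Idt C c'"
  proof (rule coproduct_eqI[OF c'' comp_hom[OF v(1) u(1)] idt_hom[OF o(2)]])
    fix j assume j: "j \<in> J"
    have sk: "s j \<cdot> \<kappa> j \<in> hom C (x j) c'" using \<kappa>[OF j] s[OF j] comp_hom by blast
    then have "s j \<cdot> \<kappa> j \<cdot> (v \<cdot> u) = (s j \<cdot> \<kappa> j \<cdot> v) \<cdot> u"
      using comp_assoc[OF sk v(1) u(1)] by simp
    then show "s j \<cdot> \<kappa> j \<cdot> (v \<cdot> u) = s j \<cdot> \<kappa> j \<cdot> Idt C c'"
      using u(2)[OF j] v(2)[OF j] comp_idt[OF sk] by simp
  qed
  ultimately show ?thesis using u(1) v(1) is_inverse_iff unfolding is_iso_def by blast
qed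

lemma cochain_limitD:
  assumes "cochain_limit C x d l \<pi>"
  shows "x n \<in> Obj C" "d n \<in> hom C (x (Suc n)) (x n)" "l \<in> Obj C" "\<pi> n \<in> hom C l (x n)"
    "\<pi> (Suc n) \<cdot> d n = \<pi> n"
  using assms unfolding cochain_limit_def is_cochain_def is_omega_limit_def is_omega_cone_def by auto

lemma limit_eqI:
  assumes "cochain_limit C x d l \<pi>" "h \<in> hom C a l" "k \<in> hom C a l" "\<And>n. h \<cdot> \<pi> n = k \<cdot> \<pi> n"
  shows "h = k"
proof -
  note l = cochain_limitD[OF assms(1)]
  have "is_omega_cone C x d a (\<lambda>n. h \<cdot> \<pi> n)"
    unfolding is_omega_cone_def
  proof (intro conjI allI)
    show "a \<in> Obj C" using assms(2) hom_obj by blast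
    fix n
    show "h \<cdot> \<pi> n \<in> hom C a (x n)" using l assms(2) comp_hom by blast
    show "h \<cdot> \<pi> (Suc n) \<cdot> d n = h \<cdot> \<pi> n" using comp_assoc[OF assms(2) l(4) l(2)] l(5) by simp
  qed
  then have "\<exists>!h'. h' \<in> hom C a l \<and> (\<forall>n. h' \<cdot> \<pi> n = h \<cdot> \<pi> n)"
    using assms(1) unfolding cochain_limit_def is_omega_limit_def
    by (elim conjE allE[of _ a] allE[of _ "\<lambda>n. h \<cdot> \<pi> n"]) blast
  then show ?thesis using assms(2-4) by metis
qed

lemma limit_tupleE:
  assumes "cochain_limit C x d l \<pi>" "a \<in> Obj C"
    and "\<And>n. f n \<in> hom C a (x n)" "\<And>n. f (Suc n) \<cdot> d n = f n"
  obtains h where "h \<in> hom C a l" "\<And>n. h \<cdot> \<pi> n = f n"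
proof -
  have "is_omega_cone C x d a f" using assms by (simp add: is_omega_cone_def)
  then show ?thesis using assms(1) that unfolding cochain_limit_def is_omega_limit_def
    by (elim conjE allE[of _ a] allE[of _ f]) blast
qed

lemma cochain_limitI:
  assumes "\<And>n. x n \<in> Obj C" "\<And>n. d n \<in> hom C (x (Suc n)) (x n)" "l \<in> Obj C"
    and "\<And>n. \<pi> n \<in> hom C l (x n)" "\<And>n. \<pi> (Suc n) \<cdot> d n = \<pi> n"
    and "\<And>a f. \<lbrakk>a \<in> Obj C; \<And>n. f n \<in> hom C a (x n); \<And>n. f (Suc n) \<cdot> d n = f n\<rbrakk>
      \<Longrightarrow> \<exists>h. h \<in> hom C a l \<and> (\<forall>n. h \<cdot> \<pi> n = f n)"
    and "\<And>a h k. \<lbrakk>h \<in> hom C a l; k \<in> hom C a l; \<And>n. h \<cdot> \<pi> n = k \<cdot> \<pi> n\<rbrakk> \<Longrightarrow> h = k"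
  shows "cochain_limit C x d l \<pi>"
proof -
  have "\<exists>!h. h \<in> hom C a l \<and> (\<forall>n. h \<cdot> \<pi> n = f n)" if c: "is_omega_cone C x d a f" for a f
  proof -
    obtain h where h: "h \<in> hom C a l" "\<forall>n. h \<cdot> \<pi> n = f n"
      using assms(6)[of a f] c unfolding is_omega_cone_def by blast
    show ?thesis
    proof (rule ex1I[of _ h])
      show "h \<in> hom C a l \<and> (\<forall>n. h \<cdot> \<pi> n = f n)" using h by blast
      fix k assume "k \<in> hom C a l \<and> (\<forall>n. k \<cdot> \<pi> n = f n)"
      then show "k = h" using h by (intro assms(7)[of k a h]) auto
    qed
  qed
  then show ?thesis
    using assms(1-5) unfolding cochain_limit_def is_cochain_def is_omega_limit_def is_omega_cone_def
    by blast
qed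

text \<open>Dual to the transport of coproducts, with one more datum: the squares in
  \<open>e\<close>, which make \<open>s\<close> an isomorphism of cochains. The map \<open>u\<close>
  points from the new vertex to the old one.\<close>

lemma limit_transport_iso:
  assumes l: "cochain_limit C x d l \<pi>"
    and u: "u \<in> hom C k l" "is_iso C u"
    and s: "\<And>n. s n \<in> hom C (x n) (y n) \<and> is_iso C (s n)"
    and e: "\<And>n. e n \<in> hom C (y (Suc n)) (y n)" "\<And>n. s (Suc n) \<cdot> e n = d n \<cdot> s n"
  shows "cochain_limit C y e k (\<lambda>n. u \<cdot> (\<pi> n \<cdot> s n))"
proof (rule cochain_limitI)
  note ld = cochain_limitD[OF l]
  define v where "v = inv_arr C u"
  have v: "v \<in> hom C l k" "u \<cdot> v = Idt C k" "v \<cdot> u = Idt C l"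
    using is_inverse_inv_arr u is_inverse_iff unfolding v_def by blast+
  define r where "r j = inv_arr C (s j)" for j
  have r: "r n \<in> hom C (y n) (x n)" "s n \<cdot> r n = Idt C (x n)" "r n \<cdot> s n = Idt C (y n)" for n
    using is_inverse_inv_arr[of "s n"] s[of n] is_inverse_iff unfolding r_def by auto
  have s1: "s n \<in> hom C (x n) (y n)" for n using s by blast
  show "y n \<in> Obj C" for n using s hom_obj by blast
  show "e n \<in> hom C (y (Suc n)) (y n)" for n by fact
  show "k \<in> Obj C" using u hom_obj by blast
  show i: "u \<cdot> (\<pi> n \<cdot> s n) \<in> hom C k (y n)" for n using comp_hom[OF u(1) comp_hom[OF ld(4) s1]] .
  \<comment> \<open>The inverses \<open>r n\<close> commute with the cochain maps too; a cone over
    \<open>y\<close> thereby yields a cone over \<open>x\<close>.\<close>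
  have re: "e n \<cdot> r n = r (Suc n) \<cdot> d n" for n
  proof -
    have "e n \<cdot> r n = (r (Suc n) \<cdot> s (Suc n)) \<cdot> (e n \<cdot> r n)" using r e(1) by (simp add: hom_def)
    also have "\<dots> = r (Suc n) \<cdot> (s (Suc n) \<cdot> e n) \<cdot> r n" using r(1) s1 e(1) by (simp add: hom_def)
    also have "\<dots> = r (Suc n) \<cdot> (d n \<cdot> (s n \<cdot> r n))" using r(1) s1 e ld by (simp add: hom_def)
    also have "\<dots> = r (Suc n) \<cdot> d n" using r(1) r(2) ld by (simp add: hom_def)
    finally show ?thesis .
  qed
  show "u \<cdot> (\<pi> (Suc n) \<cdot> s (Suc n)) \<cdot> e n = u \<cdot> (\<pi> n \<cdot> s n)" for n
  proof -
    have "u \<cdot> (\<pi> (Suc n) \<cdot> s (Suc n)) \<cdot> e n = u \<cdot> (\<pi> (Suc n) \<cdot> (s (Suc n) \<cdot> e n))"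
      using u(1) ld(4)[of "Suc n"] s1[of "Suc n"] e(1)[of n] by (simp add: hom_def)
    also have "\<dots> = u \<cdot> ((\<pi> (Suc n) \<cdot> d n) \<cdot> s n)"
      using u(1) ld(4)[of "Suc n"] s1[of n] ld(2)[of n] e(2)[of n] by (simp add: hom_def)
    finally show ?thesis using ld(5)[of n] by simp
  qed
  show "\<exists>h. h \<in> hom C a k \<and> (\<forall>n. h \<cdot> (u \<cdot> (\<pi> n \<cdot> s n)) = f n)"
    if a: "a \<in> Obj C" and f: "\<And>n. f n \<in> hom C a (y n)" "\<And>n. f (Suc n) \<cdot> e n = f n" for a f
  proof -
    have "(f (Suc n) \<cdot> r (Suc n)) \<cdot> d n = f n \<cdot> r n" for n
    proof -
      have "(f (Suc n) \<cdot> r (Suc n)) \<cdot> d n = f (Suc n) \<cdot> (e n \<cdot> r n)"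
        using f(1)[of "Suc n"] r(1)[of "Suc n"] ld(2)[of n] re[of n] by (simp add: hom_def)
      also have "\<dots> = (f (Suc n) \<cdot> e n) \<cdot> r n"
        using f(1)[of "Suc n"] r(1)[of "n"] e(1)[of n] by (simp add: hom_def)
      finally show ?thesis using f(2) by simp
    qed
    then obtain h where h: "h \<in> hom C a l" "\<And>n. h \<cdot> \<pi> n = f n \<cdot> r n"
      using limit_tupleE[OF l a comp_hom[OF f(1) r(1)]] by blast
    have "(h \<cdot> v) \<cdot> (u \<cdot> (\<pi> n \<cdot> s n)) = f n" for n
    proof -
      have "(h \<cdot> v) \<cdot> (u \<cdot> (\<pi> n \<cdot> s n)) = h \<cdot> ((v \<cdot> u) \<cdot> (\<pi> n \<cdot> s n))"
        using h(1) v(1) u(1) ld(4)[of n] s1[of n] by (simp add: hom_def)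
      also have "\<dots> = (h \<cdot> \<pi> n) \<cdot> s n"
        using v(3) h(1) ld(4)[of n] s1[of n] by (simp add: hom_def)
      also have "\<dots> = f n \<cdot> (r n \<cdot> s n)"
        unfolding h(2) using r(1)[of n] s1[of n] f(1)[of n] by (simp add: hom_def)
      finally show ?thesis using r(3) f(1)[of n] by (simp add: hom_def)
    qed
    then show ?thesis using comp_hom h(1) v(1) by blast
  qed
  show "h = h'" if h: "h \<in> hom C a k" "h' \<in> hom C a k"
    and eq: "\<And>n. h \<cdot> (u \<cdot> (\<pi> n \<cdot> s n)) = h' \<cdot> (u \<cdot> (\<pi> n \<cdot> s n))" for a h h'
  proof -
    have R: "g \<cdot> u \<cdot> \<pi> n = (g \<cdot> (u \<cdot> (\<pi> n \<cdot> s n))) \<cdot> r n" if "g \<in> hom C a k" for g n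
    proof -
      have "(g \<cdot> (u \<cdot> (\<pi> n \<cdot> s n))) \<cdot> r n = g \<cdot> (u \<cdot> (\<pi> n \<cdot> (s n \<cdot> r n)))"
        using that u(1) ld(4)[of n] s1[of n] r(1)[of n] by (simp add: hom_def)
      then show ?thesis using r(2) that u(1) ld(4)[of n] by (simp add: hom_def)
    qed
    have "h \<cdot> u = h' \<cdot> u"
      by (rule limit_eqI[OF l comp_hom[OF h(1) u(1)] comp_hom[OF h(2) u(1)]])
        (simp only: R[OF h(1)] R[OF h(2)] eq)
    then have "(h \<cdot> u) \<cdot> v = (h' \<cdot> u) \<cdot> v" by simp
    then show ?thesis using h u(1) v(1) v(2) by (simp add: hom_def)
  qed
qed

lemma limit_comparison_iso:
  assumes l: "cochain_limit C x d l \<pi>" and l': "cochain_limit C x d l' \<pi>'"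
    and u: "u \<in> hom C l l'" "\<And>n. u \<cdot> \<pi>' n = \<pi> n"
  shows "is_iso C u"
proof -
  note ld = cochain_limitD[OF l] and ld' = cochain_limitD[OF l']
  obtain v where v: "v \<in> hom C l' l" "\<And>n. v \<cdot> \<pi> n = \<pi>' n"
    using limit_tupleE[OF l ld'(3), of \<pi>'] ld' by metis
  have "u \<cdot> v = Idt C l"
  proof (rule limit_eqI[OF l comp_hom[OF u(1) v(1)] idt_hom[OF ld(3)]])
    show "u \<cdot> v \<cdot> \<pi> n = Idt C l \<cdot> \<pi> n" for n
      using comp_assoc[OF u(1) v(1) ld(4)] idt_comp[OF ld(4)] u(2) v(2) by simp
  qed
  moreover have "v \<cdot> u = Idt C l'"
  proof (rule limit_eqI[OF l' comp_hom[OF v(1) u(1)] idt_hom[OF ld'(3)]])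
    show "v \<cdot> u \<cdot> \<pi>' n = Idt C l' \<cdot> \<pi>' n" for n
      using comp_assoc[OF v(1) u(1) ld'(4)] idt_comp[OF ld'(4)] u(2) v(2) by simp
  qed
  ultimately show ?thesis using u(1) v(1) is_inverse_iff unfolding is_iso_def by blast
qed

subsection \<open>Chosen coproducts, products and limits\<close>

text \<open>The choice is \<open>SOME\<close> applied to a predicate that reads \<open>x\<close>
  only on \<open>J\<close>. Families that agree on \<open>J\<close> therefore get the very same
  chosen coproduct and not just an isomorphic one, and later equalities of functors rely on
  this.\<close>

lemma coprod_cone_cong:
  assumes "\<And>j. j \<in> J \<Longrightarrow> x j = y j"
  shows "coprod_cone C J x = coprod_cone C J y"
proof -
  have "(\<lambda>(c, \<iota>). is_coproduct C J x c \<iota>) = (\<lambda>(c, \<iota>). is_coproduct C J y c \<iota>)"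
    using assms by (auto simp: fun_eq_iff is_coproduct_def)
  then show ?thesis unfolding coprod_cone_def by simp
qed

lemma coprod_obj_cong: "(\<And>j. j \<in> J \<Longrightarrow> x j = y j) \<Longrightarrow> coprod_obj C J x = coprod_obj C J y"
  unfolding coprod_obj_def using coprod_cone_cong[of J x y] by simp

lemma coprod_inj_cong: "(\<And>j. j \<in> J \<Longrightarrow> x j = y j) \<Longrightarrow> coprod_inj C J x = coprod_inj C J y"
  unfolding coprod_inj_def using coprod_cone_cong[of J x y] by simp

lemma coprod_map_cong:
  assumes "\<And>j. j \<in> J \<Longrightarrow> f j = g j"
  shows "coprod_map C J f = coprod_map C J g"
proof -
  have "coprod_obj C J (\<lambda>j. Dom C (f j)) = coprod_obj C J (\<lambda>j. Dom C (g j))"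
    "coprod_obj C J (\<lambda>j. Cod C (f j)) = coprod_obj C J (\<lambda>j. Cod C (g j))"
    "coprod_inj C J (\<lambda>j. Dom C (f j)) = coprod_inj C J (\<lambda>j. Dom C (g j))"
    "coprod_inj C J (\<lambda>j. Cod C (f j)) = coprod_inj C J (\<lambda>j. Cod C (g j))"
    using assms by (auto intro!: coprod_obj_cong coprod_inj_cong)
  then show ?thesis using assms unfolding coprod_map_def cotuple_def by simp
qed

lemma is_coproduct_coprod:
  assumes "has_coproducts C J" "\<And>j. j \<in> J \<Longrightarrow> x j \<in> Obj C"
  shows "is_coproduct C J x (coprod_obj C J x) (coprod_inj C J x)"
proof -
  have "\<exists>p. case p of (c, \<iota>) \<Rightarrow> is_coproduct C J x c \<iota>"
    using assms unfolding has_coproducts_def by auto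
  then have "case coprod_cone C J x of (c, \<iota>) \<Rightarrow> is_coproduct C J x c \<iota>"
    unfolding coprod_cone_def by (rule someI_ex)
  then show ?thesis unfolding coprod_obj_def coprod_inj_def by (simp add: case_prod_beta)
qed

lemma coproductD:
  assumes "is_coproduct C J x c \<iota>"
  shows "c \<in> Obj C" "j \<in> J \<Longrightarrow> \<iota> j \<in> hom C (x j) c"
  using assms unfolding is_coproduct_def by auto

lemma cotuple:
  assumes hc: "has_coproducts C J" and d: "d \<in> Obj C" and f: "\<And>j. j \<in> J \<Longrightarrow> f j \<in> hom C (x j) d"
  shows "cotuple C J x d f \<in> hom C (coprod_obj C J x) d"
    "j \<in> J \<Longrightarrow> coprod_inj C J x j \<cdot> cotuple C J x d f = f j"
proof -
  have "is_coproduct C J x (coprod_obj C J x) (coprod_inj C J x)"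
    using f hom_obj by (intro is_coproduct_coprod[OF hc]) blast
  then have "\<exists>!h. h \<in> hom C (coprod_obj C J x) d \<and> (\<forall>j \<in> J. coprod_inj C J x j \<cdot> h = f j)"
    using d f unfolding is_coproduct_def by (elim conjE allE[of _ d] allE[of _ f]) blast
  from theI'[OF this] show "cotuple C J x d f \<in> hom C (coprod_obj C J x) d"
    "j \<in> J \<Longrightarrow> coprod_inj C J x j \<cdot> cotuple C J x d f = f j"
    unfolding cotuple_def by auto
qed

text \<open>The definition reads the source and target families off the arrows \<open>f j\<close>,
  which are arbitrary outside \<open>J\<close>; the congruence of chosen cones replaces these
  families by \<open>x\<close> and \<open>y\<close>.\<close>

lemma coprod_map:
  assumes hc: "has_coproducts C J" and f: "\<And>j. j \<in> J \<Longrightarrow> f j \<in> hom C (x j) (y j)"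
  shows "coprod_map C J f \<in> hom C (coprod_obj C J x) (coprod_obj C J y)"
    "j \<in> J \<Longrightarrow> coprod_inj C J x j \<cdot> coprod_map C J f = f j \<cdot> coprod_inj C J y j"
proof -
  have xy: "\<And>j. j \<in> J \<Longrightarrow> Dom C (f j) = x j" "\<And>j. j \<in> J \<Longrightarrow> Cod C (f j) = y j"
    using f homD by auto
  have c: "coprod_obj C J (\<lambda>j. Dom C (f j)) = coprod_obj C J x"
    "coprod_obj C J (\<lambda>j. Cod C (f j)) = coprod_obj C J y"
    "coprod_inj C J (\<lambda>j. Dom C (f j)) = coprod_inj C J x"
    "coprod_inj C J (\<lambda>j. Cod C (f j)) = coprod_inj C J y"
    using xy by (auto intro!: coprod_obj_cong coprod_inj_cong)
  have e: "coprod_map C J f = cotuple C J x (coprod_obj C J y) (\<lambda>j. f j \<cdot> coprod_inj C J y j)"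
    unfolding coprod_map_def cotuple_def c ..
  have Y: "is_coproduct C J y (coprod_obj C J y) (coprod_inj C J y)"
    using f hom_obj by (intro is_coproduct_coprod[OF hc]) blast
  have "f j \<cdot> coprod_inj C J y j \<in> hom C (x j) (coprod_obj C J y)" if "j \<in> J" for j
    using comp_hom[OF f coproductD(2)[OF Y]] that by blast
  then show "coprod_map C J f \<in> hom C (coprod_obj C J x) (coprod_obj C J y)"
    "j \<in> J \<Longrightarrow> coprod_inj C J x j \<cdot> coprod_map C J f = f j \<cdot> coprod_inj C J y j"
    using cotuple[OF hc coproductD(1)[OF Y], of "\<lambda>j. f j \<cdot> coprod_inj C J y j" x] unfolding e by blast+
qed

lemma terminal: "has_terminal C \<Longrightarrow> is_terminal C (terminal C)"
  unfolding has_terminal_def terminal_def by (rule someI_ex)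

lemma is_product_prod:
  assumes "has_binary_products C" "a \<in> Obj C" "b \<in> Obj C"
  shows "is_product C a b (prod_obj C a b) (prod_fst C a b) (prod_snd C a b)"
proof -
  have "\<exists>q. case q of (p, \<pi>1, \<pi>2) \<Rightarrow> is_product C a b p \<pi>1 \<pi>2"
    using assms unfolding has_binary_products_def by auto
  then have "case prod_cone C a b of (p, \<pi>1, \<pi>2) \<Rightarrow> is_product C a b p \<pi>1 \<pi>2"
    unfolding prod_cone_def by (rule someI_ex)
  then show ?thesis unfolding prod_obj_def prod_fst_def prod_snd_def by (simp add: case_prod_beta)
qed

lemma productD:
  assumes "is_product C a b p q r"
  shows "p \<in> Obj C" "q \<in> hom C p a" "r \<in> hom C p b"
  using assms unfolding is_product_def by auto

lemma product_eqI:
  assumes "is_product C a b p q r" "h \<in> hom C c p" "k \<in> hom C c p" "h \<cdot> q = k \<cdot> q" "h \<cdot> r = k \<cdot> r"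
  shows "h = k"
proof -
  have "h \<cdot> q \<in> hom C c a" "h \<cdot> r \<in> hom C c b"
    using productD[OF assms(1)] assms(2) comp_hom by blast+
  then have "\<exists>!g. g \<in> hom C c p \<and> g \<cdot> q = h \<cdot> q \<and> g \<cdot> r = h \<cdot> r"
    using assms(1) unfolding is_product_def by blast
  then show ?thesis using assms(2-5) by metis
qed

lemma prod_map:
  assumes hp: "has_binary_products C" and f: "f \<in> hom C a b" and g: "g \<in> hom C a' b'"
  shows "prod_map C f g \<in> hom C (prod_obj C a a') (prod_obj C b b')"
    "prod_map C f g \<cdot> prod_fst C b b' = prod_fst C a a' \<cdot> f"
    "prod_map C f g \<cdot> prod_snd C b b' = prod_snd C a a' \<cdot> g"
proof -
  have o: "a \<in> Obj C" "b \<in> Obj C" "a' \<in> Obj C" "b' \<in> Obj C" using f g hom_obj by auto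
  note A = productD[OF is_product_prod[OF hp o(1,3)]]
  have "prod_fst C a a' \<cdot> f \<in> hom C (prod_obj C a a') b" "prod_snd C a a' \<cdot> g \<in> hom C (prod_obj C a a') b'"
    using A f g comp_hom by blast+
  then have *: "\<exists>!h. h \<in> hom C (prod_obj C a a') (prod_obj C b b')
      \<and> h \<cdot> prod_fst C b b' = prod_fst C a a' \<cdot> f \<and> h \<cdot> prod_snd C b b' = prod_snd C a a' \<cdot> g"
    using is_product_prod[OF hp o(2,4)] unfolding is_product_def by blast
  have "prod_map C f g = (THE h. h \<in> hom C (prod_obj C a a') (prod_obj C b b')
      \<and> h \<cdot> prod_fst C b b' = prod_fst C a a' \<cdot> f \<and> h \<cdot> prod_snd C b b' = prod_snd C a a' \<cdot> g)"
    using homD[OF f] homD[OF g] unfolding prod_map_def by simp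
  with theI'[OF *] show "prod_map C f g \<in> hom C (prod_obj C a a') (prod_obj C b b')"
    "prod_map C f g \<cdot> prod_fst C b b' = prod_fst C a a' \<cdot> f"
    "prod_map C f g \<cdot> prod_snd C b b' = prod_snd C a a' \<cdot> g"
    by simp_all
qed

lemma cochain_limit_omega_lim:
  assumes "has_omega_limits C" "is_cochain C x d"
  shows "cochain_limit C x d (omega_lim C x d) (omega_proj C x d)"
proof -
  have "\<exists>p. case p of (l, \<pi>) \<Rightarrow> is_omega_limit C x d l \<pi>"
    using assms unfolding has_omega_limits_def by auto
  then have "case omega_lim_cone C x d of (l, \<pi>) \<Rightarrow> is_omega_limit C x d l \<pi>"
    unfolding omega_lim_cone_def by (rule someI_ex)
  then show ?thesis using assms(2) unfolding cochain_limit_def omega_lim_def omega_proj_def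
    by (simp add: case_prod_beta)
qed

lemma omega_tuple:
  assumes l: "has_omega_limits C" "is_cochain C x d" and c: "is_omega_cone C x d a f"
  shows "omega_tuple C x d a f \<in> hom C a (omega_lim C x d)"
    "omega_tuple C x d a f \<cdot> omega_proj C x d n = f n"
proof -
  have "\<exists>!h. h \<in> hom C a (omega_lim C x d) \<and> (\<forall>n. h \<cdot> omega_proj C x d n = f n)"
    using cochain_limit_omega_lim[OF l] c unfolding cochain_limit_def is_omega_limit_def by blast
  from theI'[OF this] show "omega_tuple C x d a f \<in> hom C a (omega_lim C x d)"
    "omega_tuple C x d a f \<cdot> omega_proj C x d n = f n"
    unfolding omega_tuple_def by auto
qed

end

section \<open>Operations preserving omega-limits\<close>

text \<open>Distributivity freed of choices: it speaks of every coproduct cocone and every limit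
  cone instead of those picked by \<open>SOME\<close>, and the maps \<open>e n\<close> and
  \<open>q n\<close> are pinned down by the injections. In this form the index set can be exchanged
  along a bijection without following a canonical map.\<close>

definition coproducts_preserve_limits :: "('o, 'm, 'z) category_scheme \<Rightarrow> 'j set \<Rightarrow> bool" where
  "coproducts_preserve_limits C J \<longleftrightarrow> (\<forall>x d l \<pi> c \<iota> e k \<kappa> q.
     (\<forall>j\<in>J. cochain_limit C (x j) (d j) (l j) (\<pi> j)) \<longrightarrow>
     (\<forall>n. is_coproduct C J (\<lambda>j. x j n) (c n) (\<iota> n)) \<longrightarrow>
     (\<forall>n. e n \<in> hom C (c (Suc n)) (c n)) \<longrightarrow>
     (\<forall>n. \<forall>j\<in>J. \<iota> (Suc n) j \<cdot>\<^bsub>C\<^esub> e n = d j n \<cdot>\<^bsub>C\<^esub> \<iota> n j) \<longrightarrow>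
     is_coproduct C J l k \<kappa> \<longrightarrow>
     (\<forall>n. q n \<in> hom C k (c n)) \<longrightarrow>
     (\<forall>n. \<forall>j\<in>J. \<kappa> j \<cdot>\<^bsub>C\<^esub> q n = \<pi> j n \<cdot>\<^bsub>C\<^esub> \<iota> n j) \<longrightarrow>
     cochain_limit C c e k q)"

context category
begin

lemma is_iso_comp:
  assumes "f \<in> hom C a b" "g \<in> hom C b c" "is_iso C f" "is_iso C g"
  shows "is_iso C (f \<cdot> g)"
  using assms is_inverse_comp unfolding is_iso_def by blast

lemma is_iso_idt: "a \<in> Obj C \<Longrightarrow> is_iso C (Idt C a)"
  using is_inverse_idt unfolding is_iso_def by blast

text \<open>The canonical map is a cotuple of tuples, so it is determined by what happens on
  entering a summand and leaving by a projection. These composites are recorded with their types,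
  and later arguments need no other access to the definition.\<close>

lemma distrib_map:
  assumes hc: "has_coproducts C J" and hl: "has_omega_limits C"
    and xd: "\<And>j. j \<in> J \<Longrightarrow> is_cochain C (x j) (d j)"
  defines "cx \<equiv> \<lambda>n. coprod_obj C J (\<lambda>j. x j n)"
    and "cd \<equiv> \<lambda>n. coprod_map C J (\<lambda>j. d j n)"
    and "l \<equiv> \<lambda>j. omega_lim C (x j) (d j)"
  shows "is_cochain C cx cd"
    and "distrib_map C J x d \<in> hom C (coprod_obj C J l) (omega_lim C cx cd)"
    and "j \<in> J \<Longrightarrow> coprod_inj C J l j \<cdot> (distrib_map C J x d \<cdot> omega_proj C cx cd n)
      = omega_proj C (x j) (d j) n \<cdot> coprod_inj C J (\<lambda>j. x j n) j"
proof -
  have x: "\<And>j n. j \<in> J \<Longrightarrow> x j n \<in> Obj C" and d: "\<And>j n. j \<in> J \<Longrightarrow> d j n \<in> hom C (x j (Suc n)) (x j n)"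
    using xd unfolding is_cochain_def by auto
  have X: "is_coproduct C J (\<lambda>j. x j n) (cx n) (coprod_inj C J (\<lambda>j. x j n))" for n
    unfolding cx_def using x by (intro is_coproduct_coprod[OF hc])
  have cd: "cd n \<in> hom C (cx (Suc n)) (cx n)"
    "j \<in> J \<Longrightarrow> coprod_inj C J (\<lambda>j. x j (Suc n)) j \<cdot> cd n = d j n \<cdot> coprod_inj C J (\<lambda>j. x j n) j" for n j
    unfolding cd_def cx_def by (rule coprod_map(1)[OF hc d], assumption) (rule coprod_map(2)[OF hc d], assumption+)
  show cc: "is_cochain C cx cd"
    unfolding is_cochain_def using coproductD(1)[OF X] cd by blast
  note L = cochain_limit_omega_lim[OF hl xd] and CL = cochain_limit_omega_lim[OF hl cc]
  have il: "coprod_inj C J (\<lambda>j. x j n) j \<in> hom C (x j n) (cx n)" if "j \<in> J" for j n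
    using coproductD(2)[OF X that] .
  define u where "u j n = omega_proj C (x j) (d j) n \<cdot> coprod_inj C J (\<lambda>j. x j n) j" for j n
  have "is_omega_cone C cx cd (l j) (u j)" if j: "j \<in> J" for j
  proof -
    note ld = cochain_limitD[OF L[OF j]]
    have "u j (Suc n) \<cdot> cd n = (omega_proj C (x j) (d j) (Suc n) \<cdot> d j n) \<cdot> coprod_inj C J (\<lambda>j. x j n) j" for n
      using comp_assoc[OF ld(4) il[OF j] cd(1)[of n]] comp_assoc[OF ld(4) d[OF j] il[OF j]] cd(2)[OF j, of n]
      unfolding u_def by simp
    then show ?thesis
      using ld comp_hom[OF ld(4) il[OF j]] unfolding is_omega_cone_def u_def l_def by simp
  qed
  note T = omega_tuple[OF hl cc this]
  have e: "distrib_map C J x d = cotuple C J l (omega_lim C cx cd)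
      (\<lambda>j. omega_tuple C cx cd (l j) (u j))"
    unfolding distrib_map_def Let_def cx_def cd_def l_def u_def ..
  have c: "cotuple C J l (omega_lim C cx cd) (\<lambda>j. omega_tuple C cx cd (l j) (u j))
      \<in> hom C (coprod_obj C J l) (omega_lim C cx cd)"
    "j \<in> J \<Longrightarrow> coprod_inj C J l j \<cdot> cotuple C J l (omega_lim C cx cd) (\<lambda>j. omega_tuple C cx cd (l j) (u j))
      = omega_tuple C cx cd (l j) (u j)" for j
    by (rule cotuple(1)[OF hc cochain_limitD(3)[OF CL] T(1)], assumption)
      (rule cotuple(2)[OF hc cochain_limitD(3)[OF CL] T(1)])
  show dm: "distrib_map C J x d \<in> hom C (coprod_obj C J l) (omega_lim C cx cd)"
    unfolding e by (rule c(1))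
  have l: "is_coproduct C J l (coprod_obj C J l) (coprod_inj C J l)"
    by (rule is_coproduct_coprod[OF hc]) (simp add: l_def cochain_limitD(3)[OF L])
  assume j: "j \<in> J"
  have "coprod_inj C J l j \<cdot> distrib_map C J x d = omega_tuple C cx cd (l j) (u j)"
    unfolding e by (rule c(2)[OF j])
  then show "coprod_inj C J l j \<cdot> (distrib_map C J x d \<cdot> omega_proj C cx cd n)
      = omega_proj C (x j) (d j) n \<cdot> coprod_inj C J (\<lambda>j. x j n) j"
    using T(2)[OF j, of n] comp_assoc[OF coproductD(2)[OF l j] dm cochain_limitD(4)[OF CL]]
    unfolding u_def by metis
qed

text \<open>The given data differ from the chosen data by isomorphisms: \<open>w\<close> between the
  coproducts of the limits, \<open>s n\<close> between the coproducts at stage \<open>n\<close>. As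
  the canonical map \<open>\<phi>\<close> is invertible, the chosen limit can be transported along
  \<open>w \<cdot> \<phi>\<close> and the \<open>s n\<close>, and it remains to recognise the
  projections as \<open>q n\<close>.\<close>

lemma coproducts_preserve_limitsI:
  assumes hc: "has_coproducts C J" and hl: "has_omega_limits C"
    and dist: "omega_limits_distribute C J"
  shows "coproducts_preserve_limits C J"
  unfolding coproducts_preserve_limits_def
proof (intro allI impI)
  fix x d l \<pi> c \<iota> e k \<kappa> q
  assume xl: "\<forall>j\<in>J. cochain_limit C (x j) (d j) (l j) (\<pi> j)"
    and c: "\<forall>n. is_coproduct C J (\<lambda>j. x j n) (c n) (\<iota> n)"
    and e: "\<forall>n. e n \<in> hom C (c (Suc n)) (c n)"
      "\<forall>n. \<forall>j\<in>J. \<iota> (Suc n) j \<cdot> e n = d j n \<cdot> \<iota> n j"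
    and k: "is_coproduct C J l k \<kappa>"
    and q: "\<forall>n. q n \<in> hom C k (c n)" "\<forall>n. \<forall>j\<in>J. \<kappa> j \<cdot> q n = \<pi> j n \<cdot> \<iota> n j"
  have xd: "is_cochain C (x j) (d j)" if "j \<in> J" for j
    using xl that unfolding cochain_limit_def by blast
  have x: "x j n \<in> Obj C" and d: "d j n \<in> hom C (x j (Suc n)) (x j n)" if "j \<in> J" for j n
    using xd[OF that] unfolding is_cochain_def by auto
  define cx where "cx n = coprod_obj C J (\<lambda>j. x j n)" for n
  define ci where "ci n = coprod_inj C J (\<lambda>j. x j n)" for n
  define cd where "cd n = coprod_map C J (\<lambda>j. d j n)" for n
  define L where "L j = omega_lim C (x j) (d j)" for j
  define P where "P j = omega_proj C (x j) (d j)" for j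
  define PP where "PP = omega_proj C cx cd"
  define \<phi> where "\<phi> = distrib_map C J x d"
  have cc: "is_cochain C cx cd" unfolding cx_def cd_def by (rule distrib_map(1)[OF hc hl xd])
  have \<phi>: "\<phi> \<in> hom C (coprod_obj C J L) (omega_lim C cx cd)"
    unfolding cx_def cd_def L_def \<phi>_def by (rule distrib_map(2)[OF hc hl xd])
  have \<phi>2: "coprod_inj C J L j \<cdot> (\<phi> \<cdot> PP n) = P j n \<cdot> ci n j" if "j \<in> J" for j n
    unfolding cx_def cd_def L_def \<phi>_def PP_def P_def ci_def by (rule distrib_map(3)[OF hc hl xd that])
  have iso: "is_iso C \<phi>" using dist xd unfolding omega_limits_distribute_def \<phi>_def by blast
  have CL: "cochain_limit C cx cd (omega_lim C cx cd) PP"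
    unfolding PP_def using cochain_limit_omega_lim[OF hl cc] .
  have xL: "cochain_limit C (x j) (d j) (L j) (P j)" if "j \<in> J" for j
    unfolding L_def P_def using cochain_limit_omega_lim[OF hl xd[OF that]] .
  have X: "is_coproduct C J (\<lambda>j. x j n) (cx n) (ci n)" for n
    unfolding cx_def ci_def using x by (intro is_coproduct_coprod[OF hc])
  have cd: "cd n \<in> hom C (cx (Suc n)) (cx n)"
    "j \<in> J \<Longrightarrow> ci (Suc n) j \<cdot> cd n = d j n \<cdot> ci n j" for n j
    unfolding cd_def cx_def ci_def
    by (rule coprod_map(1)[OF hc d], assumption) (rule coprod_map(2)[OF hc d], assumption+)
  have K: "is_coproduct C J L (coprod_obj C J L) (coprod_inj C J L)"
    using cochain_limitD(3)[OF xL] by (intro is_coproduct_coprod[OF hc]) blast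

  \<comment> \<open>\<open>t j\<close> identifies the given limit of the \<open>j\<close>-th cochain
    with the chosen one; together the \<open>t j\<close> induce \<open>w\<close>.\<close>
  have "\<exists>t. t \<in> hom C (l j) (L j) \<and> is_iso C t \<and> (\<forall>n. t \<cdot> P j n = \<pi> j n)" if j: "j \<in> J" for j
  proof -
    have l: "cochain_limit C (x j) (d j) (l j) (\<pi> j)" using xl j by blast
    note ld = cochain_limitD[OF l]
    obtain t where t: "t \<in> hom C (l j) (L j)" "\<And>n. t \<cdot> P j n = \<pi> j n"
      using limit_tupleE[OF xL[OF j] ld(3), of "\<pi> j"] ld by metis
    then show ?thesis using limit_comparison_iso[OF l xL[OF j]] by blast
  qed
  then obtain t where t: "\<And>j. j \<in> J \<Longrightarrow> t j \<in> hom C (l j) (L j) \<and> is_iso C (t j)"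
    "\<And>j n. j \<in> J \<Longrightarrow> t j \<cdot> P j n = \<pi> j n"
    by metis
  have tL: "t j \<cdot> coprod_inj C J L j \<in> hom C (l j) (coprod_obj C J L)" if "j \<in> J" for j
    using comp_hom[OF _ coproductD(2)[OF K that]] t(1)[OF that] by blast
  obtain w where w: "w \<in> hom C k (coprod_obj C J L)" "\<And>j. j \<in> J \<Longrightarrow> \<kappa> j \<cdot> w = t j \<cdot> coprod_inj C J L j"
    using coproduct_descE[OF k coproductD(1)[OF K], of "\<lambda>j. t j \<cdot> coprod_inj C J L j"] tL by blast
  have w_iso: "is_iso C w" using coproduct_comparison_iso[OF k K t(1) w] .
  \<comment> \<open>At each stage the chosen coproduct is identified with the given one, by a map
    that is the identity on summands.\<close>
  have "\<exists>s. s \<in> hom C (cx n) (c n) \<and> is_iso C s \<and> (\<forall>j\<in>J. ci n j \<cdot> s = \<iota> n j)" for n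
  proof -
    have cn: "is_coproduct C J (\<lambda>j. x j n) (c n) (\<iota> n)" using c by blast
    note cnD = coproductD[OF cn]
    obtain s where s: "s \<in> hom C (cx n) (c n)" "\<And>j. j \<in> J \<Longrightarrow> ci n j \<cdot> s = \<iota> n j"
      using coproduct_descE[OF X cnD(1), where f = "\<iota> n"] cnD(2) by blast
    have "is_iso C s"
      by (rule coproduct_comparison_iso[OF X cn _ s(1), of "\<lambda>j. Idt C (x j n)"])
        (use s(2) x is_iso_idt idt_hom idt_comp[OF cnD(2)] in auto)
    then show ?thesis using s by blast
  qed
  then obtain s where s: "\<And>n. s n \<in> hom C (cx n) (c n) \<and> is_iso C (s n)"
    "\<And>j n. j \<in> J \<Longrightarrow> ci n j \<cdot> s n = \<iota> n j"
    by metis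
  have s1: "s n \<in> hom C (cx n) (c n)" for n using s by blast
  have e1: "e n \<in> hom C (c (Suc n)) (c n)" for n using e by blast
  have ci: "ci n j \<in> hom C (x j n) (cx n)" if "j \<in> J" for n j using coproductD(2)[OF X that] .
  have se: "s (Suc n) \<cdot> e n = cd n \<cdot> s n" for n
  proof (rule coproduct_eqI[OF X comp_hom[OF s1 e1] comp_hom[OF cd(1) s1]])
    fix j assume j: "j \<in> J"
    have "ci (Suc n) j \<cdot> (s (Suc n) \<cdot> e n) = \<iota> (Suc n) j \<cdot> e n"
      using comp_assoc[OF ci[OF j] s1 e1] s(2)[OF j] by simp
    also have "\<dots> = d j n \<cdot> (ci n j \<cdot> s n)" using e(2) j s(2)[OF j] by simp
    also have "\<dots> = ci (Suc n) j \<cdot> (cd n \<cdot> s n)"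
      using comp_assoc[OF d[OF j] ci[OF j] s1] comp_assoc[OF ci[OF j] cd(1) s1] cd(2)[OF j] by simp
    finally show "ci (Suc n) j \<cdot> (s (Suc n) \<cdot> e n) = ci (Suc n) j \<cdot> (cd n \<cdot> s n)" .
  qed
  have wp: "w \<cdot> \<phi> \<in> hom C k (omega_lim C cx cd)" using comp_hom[OF w(1) \<phi>] .
  have PP: "PP n \<in> hom C (omega_lim C cx cd) (cx n)" for n using cochain_limitD(4)[OF CL] .
  have lim: "cochain_limit C c e k (\<lambda>n. (w \<cdot> \<phi>) \<cdot> (PP n \<cdot> s n))"
    using limit_transport_iso[OF CL wp is_iso_comp[OF w(1) \<phi> w_iso iso] s(1) e1 se] .
  \<comment> \<open>A map out of the coproduct \<open>k\<close> is tested on the injections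
    \<open>\<kappa> j\<close>, where both sides reduce to \<open>\<pi> j n\<close> followed by
    \<open>\<iota> n j\<close>.\<close>
  have "(w \<cdot> \<phi>) \<cdot> (PP n \<cdot> s n) = q n" for n
  proof (rule coproduct_eqI[OF k comp_hom[OF wp comp_hom[OF PP s1]]])
    show "q n \<in> hom C k (c n)" using q by blast
    fix j assume j: "j \<in> J"
    have hs: "\<kappa> j \<in> hom C (l j) k" "coprod_inj C J L j \<in> hom C (L j) (coprod_obj C J L)" "P j n \<in> hom C (L j) (x j n)"
      "t j \<in> hom C (l j) (L j)"
      using coproductD(2)[OF k j] coproductD(2)[OF K j] cochain_limitD(4)[OF xL[OF j]] t(1)[OF j] by auto
    have "\<kappa> j \<cdot> ((w \<cdot> \<phi>) \<cdot> (PP n \<cdot> s n)) = (\<kappa> j \<cdot> w) \<cdot> ((\<phi> \<cdot> PP n) \<cdot> s n)"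
      using hs w(1) \<phi> PP[of n] s1[of n] by (simp add: hom_def)
    also have "\<dots> = t j \<cdot> ((coprod_inj C J L j \<cdot> (\<phi> \<cdot> PP n)) \<cdot> s n)"
      unfolding w(2)[OF j] using hs \<phi> PP[of n] s1[of n] by (simp add: hom_def)
    also have "\<dots> = (t j \<cdot> P j n) \<cdot> (ci n j \<cdot> s n)"
      unfolding \<phi>2[OF j] using hs ci[OF j, of n] s1[of n] by (simp add: hom_def)
    also have "\<dots> = \<kappa> j \<cdot> q n" using t(2)[OF j] s(2)[OF j] q(2) j by simp
    finally show "\<kappa> j \<cdot> ((w \<cdot> \<phi>) \<cdot> (PP n \<cdot> s n)) = \<kappa> j \<cdot> q n" .
  qed
  with lim show "cochain_limit C c e k q" by simp
qed

section \<open>Change of index set along a bijection\<close>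

lemma is_coproduct_reindex:
  assumes b: "bij_betw b K J" and c: "is_coproduct C J x c \<iota>"
  shows "is_coproduct C K (\<lambda>i. x (b i)) c (\<lambda>i. \<iota> (b i))"
proof (rule is_coproductI)
  have bK: "b i \<in> J" if "i \<in> K" for i using b that by (auto simp: bij_betw_def)
  let ?a = "inv_into K b"
  have a: "?a j \<in> K" "b (?a j) = j" if "j \<in> J" for j
    using b that bij_betw_inv_into_right by (auto simp: bij_betw_def inv_into_into)
  have ab: "?a (b i) = i" if "i \<in> K" for i using b that bij_betw_inv_into_left by metis
  show "c \<in> Obj C" using coproductD(1)[OF c] .
  show "\<iota> (b i) \<in> hom C (x (b i)) c" if "i \<in> K" for i using coproductD(2)[OF c] bK that by blast
  show "\<exists>h. h \<in> hom C c d \<and> (\<forall>i\<in>K. \<iota> (b i) \<cdot> h = f i)"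
    if d: "d \<in> Obj C" and f: "\<And>i. i \<in> K \<Longrightarrow> f i \<in> hom C (x (b i)) d" for d f
  proof -
    have "f (?a j) \<in> hom C (x j) d" if "j \<in> J" for j using f[of "?a j"] a that by simp
    then obtain h where "h \<in> hom C c d" "\<And>j. j \<in> J \<Longrightarrow> \<iota> j \<cdot> h = f (?a j)"
      using coproduct_descE[OF c d, of "\<lambda>j. f (?a j)"] by blast
    then show ?thesis using bK ab by auto
  qed
  show "h = k" if "h \<in> hom C c d" "k \<in> hom C c d" "\<And>i. i \<in> K \<Longrightarrow> \<iota> (b i) \<cdot> h = \<iota> (b i) \<cdot> k" for d h k
  proof (rule coproduct_eqI[OF c that(1,2)])
    fix j assume "j \<in> J"
    then show "\<iota> j \<cdot> h = \<iota> j \<cdot> k" using that(3)[of "?a j"] a by simp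
  qed
qed

lemma has_coproducts_reindex:
  assumes b: "bij_betw b K J" and c: "has_coproducts C J"
  shows "has_coproducts C K"
  unfolding has_coproducts_def
proof (intro allI impI)
  fix x assume x: "\<forall>i\<in>K. x i \<in> Obj C"
  let ?a = "inv_into K b"
  have "\<forall>j\<in>J. x (?a j) \<in> Obj C" using x b by (auto simp: bij_betw_def inv_into_into)
  then obtain c \<iota> where "is_coproduct C J (\<lambda>j. x (?a j)) c \<iota>"
    using c[unfolded has_coproducts_def, rule_format, of "\<lambda>j. x (?a j)"] by blast
  note k = is_coproduct_reindex[OF b this]
  have "is_coproduct C K x c (\<lambda>i. \<iota> (b i))"
    by (rule is_coproduct_cong[OF k]) (simp_all only: bij_betw_inv_into_left[OF b])
  then show "\<exists>c \<iota>. is_coproduct C K x c \<iota>" by blast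
qed

text \<open>Only the indexing changes: families over \<open>K\<close> are pulled back along the
  inverse of \<open>b\<close>, while the vertices \<open>c n\<close> and \<open>k\<close> and the
  maps \<open>e\<close> and \<open>q\<close> stay, so the conclusion for \<open>J\<close> is
  literally the one for \<open>K\<close>.\<close>

lemma coproducts_preserve_limits_reindex:
  assumes b: "bij_betw b K J" and p: "coproducts_preserve_limits C J"
  shows "coproducts_preserve_limits C K"
  unfolding coproducts_preserve_limits_def
proof (intro allI impI)
  fix x d l \<pi> c \<iota> e k \<kappa> q
  let ?a = "inv_into K b"
  have a: "?a j \<in> K" if "j \<in> J" for j
    using b that by (auto simp: bij_betw_def inv_into_into)
  have ba: "bij_betw ?a J K" using bij_betw_inv_into[OF b] .
  assume xl: "\<forall>j\<in>K. cochain_limit C (x j) (d j) (l j) (\<pi> j)"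
    and c: "\<forall>n. is_coproduct C K (\<lambda>j. x j n) (c n) (\<iota> n)"
    and e: "\<forall>n. e n \<in> hom C (c (Suc n)) (c n)"
      "\<forall>n. \<forall>j\<in>K. \<iota> (Suc n) j \<cdot> e n = d j n \<cdot> \<iota> n j"
    and k: "is_coproduct C K l k \<kappa>"
    and q: "\<forall>n. q n \<in> hom C k (c n)" "\<forall>n. \<forall>j\<in>K. \<kappa> j \<cdot> q n = \<pi> j n \<cdot> \<iota> n j"
  have c': "is_coproduct C J (\<lambda>j. x (?a j) n) (c n) (\<lambda>j. \<iota> n (?a j))" for n
    using is_coproduct_reindex[OF ba, of "\<lambda>j. x j n"] c by blast
  have k': "is_coproduct C J (\<lambda>j. l (?a j)) k (\<lambda>j. \<kappa> (?a j))"
    using is_coproduct_reindex[OF ba k] .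
  show "cochain_limit C c e k q"
    by (rule p[unfolded coproducts_preserve_limits_def, rule_format, where x = "\<lambda>j. x (?a j)" and d = "\<lambda>j. d (?a j)"
        and l = "\<lambda>j. l (?a j)" and \<pi> = "\<lambda>j. \<pi> (?a j)", OF _ c' _ _ k'])
      (use xl e q a in auto)
qed

end

text \<open>An operation of arity \<open>J\<close> on \<open>C\<close>: a functor from a power of
  \<open>C\<close> that preserves \<open>\<omega>\<close>-limits, with families given as total
  functions. The two congruence axioms express that values outside \<open>J\<close> do not matter.
  Coproducts, constants and binary products are the instances.\<close>

locale continuous_operation = category C
  for C :: "('o, 'm, 'z) category_scheme" (structure) +
  fixes J :: "'j set" and Q :: "('j \<Rightarrow> 'o) \<Rightarrow> 'o" and M :: "('j \<Rightarrow> 'm) \<Rightarrow> 'm"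
  assumes op_obj: "(\<And>j. j \<in> J \<Longrightarrow> x j \<in> Obj C) \<Longrightarrow> Q x \<in> Obj C"
    and op_hom: "(\<And>j. j \<in> J \<Longrightarrow> f j \<in> hom C (x j) (y j)) \<Longrightarrow> M f \<in> hom C (Q x) (Q y)"
    and op_idt: "(\<And>j. j \<in> J \<Longrightarrow> x j \<in> Obj C) \<Longrightarrow> M (\<lambda>j. Idt C (x j)) = Idt C (Q x)"
    and op_comp: "\<lbrakk>\<And>j. j \<in> J \<Longrightarrow> f j \<in> hom C (x j) (y j); \<And>j. j \<in> J \<Longrightarrow> g j \<in> hom C (y j) (z j)\<rbrakk>
      \<Longrightarrow> M (\<lambda>j. f j \<cdot> g j) = M f \<cdot> M g"
    and op_obj_cong: "(\<And>j. j \<in> J \<Longrightarrow> x j = y j) \<Longrightarrow> Q x = Q y"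
    and op_cong: "(\<And>j. j \<in> J \<Longrightarrow> f j = g j) \<Longrightarrow> M f = M g"
    and op_limit: "(\<And>j. j \<in> J \<Longrightarrow> cochain_limit C (X j) (d j) (l j) (\<pi> j))
      \<Longrightarrow> cochain_limit C (\<lambda>n. Q (\<lambda>j. X j n)) (\<lambda>n. M (\<lambda>j. d j n)) (Q l) (\<lambda>n. M (\<lambda>j. \<pi> j n))"

context category
begin

text \<open>Functoriality is tested on injections; \<open>op_limit\<close> is the preservation
  property read for the chosen coproducts, with the induced maps in the places of \<open>e\<close>
  and \<open>q\<close>.\<close>

lemma continuous_operation_coprod:
  assumes hc: "has_coproducts C J" and p: "coproducts_preserve_limits C J"
  shows "continuous_operation C J (coprod_obj C J) (coprod_map C J)"
proof unfold_locales
  note cop = is_coproduct_coprod[OF hc]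
  fix x y z :: "'a \<Rightarrow> 'o" and f g :: "'a \<Rightarrow> 'm"
  show "coprod_obj C J x \<in> Obj C" if "\<And>j. j \<in> J \<Longrightarrow> x j \<in> Obj C"
    using coproductD(1)[OF cop] that by blast
  show "coprod_map C J f \<in> hom C (coprod_obj C J x) (coprod_obj C J y)"
    if "\<And>j. j \<in> J \<Longrightarrow> f j \<in> hom C (x j) (y j)"
    by (rule coprod_map(1)[OF hc that])
  show "coprod_map C J (\<lambda>j. Idt C (x j)) = Idt C (coprod_obj C J x)" if x: "\<And>j. j \<in> J \<Longrightarrow> x j \<in> Obj C"
  proof -
    note X = cop[OF x]
    have I: "coprod_map C J (\<lambda>j. Idt C (x j)) \<in> hom C (coprod_obj C J x) (coprod_obj C J x)"
      "j \<in> J \<Longrightarrow> coprod_inj C J x j \<cdot> coprod_map C J (\<lambda>j. Idt C (x j)) = Idt C (x j) \<cdot> coprod_inj C J x j" for j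
      by (rule coprod_map(1)[OF hc idt_hom[OF x]], assumption) (rule coprod_map(2)[OF hc idt_hom[OF x]])
    show ?thesis
    proof (rule coproduct_eqI[OF X, where d = "coprod_obj C J x"])
      show "coprod_map C J (\<lambda>j. Idt C (x j)) \<in> hom C (coprod_obj C J x) (coprod_obj C J x)"
        by (rule I)
      show "Idt C (coprod_obj C J x) \<in> hom C (coprod_obj C J x) (coprod_obj C J x)"
        by (rule idt_hom[OF coproductD(1)[OF X]])
      fix j assume j: "j \<in> J"
      show "coprod_inj C J x j \<cdot> coprod_map C J (\<lambda>j. Idt C (x j)) = coprod_inj C J x j \<cdot> Idt C (coprod_obj C J x)"
        using I(2)[OF j] idt_comp[OF coproductD(2)[OF X j]] comp_idt[OF coproductD(2)[OF X j]] by simp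
    qed
  qed
  show "coprod_map C J (\<lambda>j. f j \<cdot> g j) = coprod_map C J f \<cdot> coprod_map C J g"
    if f: "\<And>j. j \<in> J \<Longrightarrow> f j \<in> hom C (x j) (y j)" and g: "\<And>j. j \<in> J \<Longrightarrow> g j \<in> hom C (y j) (z j)"
  proof -
    have o: "\<And>j. j \<in> J \<Longrightarrow> x j \<in> Obj C" "\<And>j. j \<in> J \<Longrightarrow> y j \<in> Obj C" "\<And>j. j \<in> J \<Longrightarrow> z j \<in> Obj C"
      using f g hom_obj by blast+
    have X: "is_coproduct C J x (coprod_obj C J x) (coprod_inj C J x)"
      and Y: "is_coproduct C J y (coprod_obj C J y) (coprod_inj C J y)"
      and Z: "is_coproduct C J z (coprod_obj C J z) (coprod_inj C J z)"
      using o by (auto intro: cop)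
    have F: "coprod_map C J f \<in> hom C (coprod_obj C J x) (coprod_obj C J y)"
      "\<And>j. j \<in> J \<Longrightarrow> coprod_inj C J x j \<cdot> coprod_map C J f = f j \<cdot> coprod_inj C J y j"
      by (rule coprod_map(1)[OF hc f], assumption) (rule coprod_map(2)[OF hc f])
    have G: "coprod_map C J g \<in> hom C (coprod_obj C J y) (coprod_obj C J z)"
      "\<And>j. j \<in> J \<Longrightarrow> coprod_inj C J y j \<cdot> coprod_map C J g = g j \<cdot> coprod_inj C J z j"
      by (rule coprod_map(1)[OF hc g], assumption) (rule coprod_map(2)[OF hc g])
    have FG: "coprod_map C J (\<lambda>j. f j \<cdot> g j) \<in> hom C (coprod_obj C J x) (coprod_obj C J z)"
      "\<And>j. j \<in> J \<Longrightarrow> coprod_inj C J x j \<cdot> coprod_map C J (\<lambda>j. f j \<cdot> g j) = (f j \<cdot> g j) \<cdot> coprod_inj C J z j"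
      by (rule coprod_map(1)[OF hc comp_hom[OF f g]], assumption+) (rule coprod_map(2)[OF hc comp_hom[OF f g]])
    show ?thesis
    proof (rule coproduct_eqI[OF X FG(1) comp_hom[OF F(1) G(1)]])
      fix j assume j: "j \<in> J"
      have "coprod_inj C J x j \<cdot> (coprod_map C J f \<cdot> coprod_map C J g) = f j \<cdot> (coprod_inj C J y j \<cdot> coprod_map C J g)"
        using comp_assoc[OF coproductD(2)[OF X j] F(1) G(1)] comp_assoc[OF f[OF j] coproductD(2)[OF Y j] G(1)] F(2)[OF j]
        by simp
      also have "\<dots> = (f j \<cdot> g j) \<cdot> coprod_inj C J z j"
        using comp_assoc[OF f[OF j] g[OF j] coproductD(2)[OF Z j]] G(2)[OF j] by simp
      finally show "coprod_inj C J x j \<cdot> coprod_map C J (\<lambda>j. f j \<cdot> g j)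
          = coprod_inj C J x j \<cdot> (coprod_map C J f \<cdot> coprod_map C J g)"
        using FG(2)[OF j] by simp
    qed
  qed
  show "coprod_obj C J x = coprod_obj C J y" if "\<And>j. j \<in> J \<Longrightarrow> x j = y j"
    using coprod_obj_cong that by blast
  show "coprod_map C J f = coprod_map C J g" if "\<And>j. j \<in> J \<Longrightarrow> f j = g j"
    using coprod_map_cong that by blast
next
  fix X :: "'a \<Rightarrow> nat \<Rightarrow> 'o" and d l \<pi>
  assume X: "\<And>j. j \<in> J \<Longrightarrow> cochain_limit C (X j) (d j) (l j) (\<pi> j)"
  note ld = cochain_limitD[OF X]
  show "cochain_limit C (\<lambda>n. coprod_obj C J (\<lambda>j. X j n)) (\<lambda>n. coprod_map C J (\<lambda>j. d j n)) (coprod_obj C J l)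
     (\<lambda>n. coprod_map C J (\<lambda>j. \<pi> j n))"
  proof (rule p[unfolded coproducts_preserve_limits_def, rule_format, where x = X and d = d and l = l and \<pi> = \<pi>
        and \<iota> = "\<lambda>n. coprod_inj C J (\<lambda>j. X j n)" and \<kappa> = "coprod_inj C J l"])
    fix n
    show "is_coproduct C J (\<lambda>j. X j n) (coprod_obj C J (\<lambda>j. X j n)) (coprod_inj C J (\<lambda>j. X j n))"
      by (rule is_coproduct_coprod[OF hc ld(1)])
    show "is_coproduct C J l (coprod_obj C J l) (coprod_inj C J l)"
      by (rule is_coproduct_coprod[OF hc ld(3)])
    show "coprod_map C J (\<lambda>j. d j n) \<in> hom C (coprod_obj C J (\<lambda>j. X j (Suc n))) (coprod_obj C J (\<lambda>j. X j n))"
      by (rule coprod_map(1)[OF hc ld(2)])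
    show "coprod_inj C J (\<lambda>j. X j (Suc n)) j \<cdot> coprod_map C J (\<lambda>j. d j n) = d j n \<cdot> coprod_inj C J (\<lambda>j. X j n) j"
      if "j \<in> J" for j
      by (rule coprod_map(2)[OF hc ld(2) that])
    show "coprod_map C J (\<lambda>j. \<pi> j n) \<in> hom C (coprod_obj C J l) (coprod_obj C J (\<lambda>j. X j n))"
      by (rule coprod_map(1)[OF hc ld(4)])
    show "coprod_inj C J l j \<cdot> coprod_map C J (\<lambda>j. \<pi> j n) = \<pi> j n \<cdot> coprod_inj C J (\<lambda>j. X j n) j"
      if "j \<in> J" for j
      by (rule coprod_map(2)[OF hc ld(4) that])
  qed (use X in auto)
qed

text \<open>A constant is an operation without arguments. A cone over the constant cochain with
  identity maps has all its legs equal, hence amounts to a single morphism.\<close>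

lemma continuous_operation_const:
  assumes c: "c \<in> Obj C"
  shows "continuous_operation C {} (\<lambda>_. c) (\<lambda>_. Idt C c)"
proof unfold_locales
  show "cochain_limit C (\<lambda>n. c) (\<lambda>n. Idt C c) c (\<lambda>n. Idt C c)"
  proof (rule cochain_limitI)
    show "\<exists>h. h \<in> hom C a c \<and> (\<forall>n. h \<cdot> Idt C c = f n)"
      if f: "\<And>n. f n \<in> hom C a c" "\<And>n. f (Suc n) \<cdot> Idt C c = f n" for a f
    proof -
      have "f n = f 0" for n by (induction n) (use f comp_idt in metis)+
      then show ?thesis using f comp_idt by metis
    qed
    show "h = k" if "h \<in> hom C a c" "k \<in> hom C a c" "\<And>n. h \<cdot> Idt C c = k \<cdot> Idt C c" for a h k
      using that comp_idt by metis
  qed (use c idt_hom in auto)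
qed (use c in \<open>auto intro: idt_hom\<close>)

text \<open>Products commute with limits: a cone over the products splits into two cones, whose
  mediating maps are paired.\<close>

lemma continuous_operation_prod:
  assumes hp: "has_binary_products C"
  shows "continuous_operation C UNIV (\<lambda>x. prod_obj C (x True) (x False)) (\<lambda>f. prod_map C (f True) (f False))"
proof unfold_locales
  note prd = is_product_prod[OF hp]
  note pm = prod_map[OF hp]
  fix x y z :: "bool \<Rightarrow> 'o" and f g :: "bool \<Rightarrow> 'm"
  show "prod_obj C (x True) (x False) \<in> Obj C" if "\<And>j. j \<in> UNIV \<Longrightarrow> x j \<in> Obj C"
    using productD(1)[OF prd] that by blast
  show "prod_map C (f True) (f False) \<in> hom C (prod_obj C (x True) (x False)) (prod_obj C (y True) (y False))"
    if "\<And>j. j \<in> UNIV \<Longrightarrow> f j \<in> hom C (x j) (y j)"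
    using pm(1) that by blast
  show "prod_map C (Idt C (x True)) (Idt C (x False)) = Idt C (prod_obj C (x True) (x False))"
    if x: "\<And>j. j \<in> UNIV \<Longrightarrow> x j \<in> Obj C"
  proof -
    have o: "x True \<in> Obj C" "x False \<in> Obj C" using x by auto
    note X = prd[OF o]
    note I = pm[OF idt_hom[OF o(1)] idt_hom[OF o(2)]]
    show ?thesis
      by (rule product_eqI[OF X I(1) idt_hom[OF productD(1)[OF X]]])
        (simp_all only: I idt_comp[OF productD(2)[OF X]] idt_comp[OF productD(3)[OF X]]
          comp_idt[OF productD(2)[OF X]] comp_idt[OF productD(3)[OF X]])
  qed
  show "prod_map C (f True \<cdot> g True) (f False \<cdot> g False) = prod_map C (f True) (f False) \<cdot> prod_map C (g True) (g False)"
    if f: "\<And>j. j \<in> UNIV \<Longrightarrow> f j \<in> hom C (x j) (y j)" and g: "\<And>j. j \<in> UNIV \<Longrightarrow> g j \<in> hom C (y j) (z j)"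
  proof -
    have f': "f j \<in> hom C (x j) (y j)" "g j \<in> hom C (y j) (z j)" for j using f g by auto
    have o: "x j \<in> Obj C" "y j \<in> Obj C" "z j \<in> Obj C" for j using f' hom_obj by blast+
    note X = productD[OF prd[OF o(1) o(1)]] and Y = productD[OF prd[OF o(2) o(2)]]
    note F = pm[OF f'(1)[of True] f'(1)[of False]] and G = pm[OF f'(2)[of True] f'(2)[of False]]
    note FG = pm[OF comp_hom[OF f'(1)[of True] f'(2)[of True]] comp_hom[OF f'(1)[of False] f'(2)[of False]]]
    show ?thesis
    proof (rule product_eqI[OF prd[OF o(3) o(3)] FG(1) comp_hom[OF F(1) G(1)]], goal_cases)
      case 1
      show ?case using FG(2) F(2) G(2) comp_assoc[OF F(1) G(1) productD(2)[OF prd[OF o(3) o(3)]]]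
          comp_assoc[OF F(1) Y(2) f'(2)] comp_assoc[OF X(2) f'(1) f'(2)] by simp
    next
      case 2
      show ?case using FG(3) F(3) G(3) comp_assoc[OF F(1) G(1) productD(3)[OF prd[OF o(3) o(3)]]]
          comp_assoc[OF F(1) Y(3) f'(2)] comp_assoc[OF X(3) f'(1) f'(2)] by simp
    qed
  qed
  show "prod_obj C (x True) (x False) = prod_obj C (y True) (y False)" if "\<And>j. j \<in> UNIV \<Longrightarrow> x j = y j"
    using that by simp
  show "prod_map C (f True) (f False) = prod_map C (g True) (g False)" if "\<And>j. j \<in> UNIV \<Longrightarrow> f j = g j"
    using that by simp
next
  note prd = is_product_prod[OF hp]
  note pm = prod_map[OF hp]
  fix X :: "bool \<Rightarrow> nat \<Rightarrow> 'o" and d l \<pi>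
  assume X: "\<And>j. j \<in> UNIV \<Longrightarrow> cochain_limit C (X j) (d j) (l j) (\<pi> j)"
  have X': "cochain_limit C (X j) (d j) (l j) (\<pi> j)" for j using X by blast
  note ld = cochain_limitD[OF X']
  have P: "is_product C (X True n) (X False n) (prod_obj C (X True n) (X False n))
      (prod_fst C (X True n) (X False n)) (prod_snd C (X True n) (X False n))" for n
    by (rule prd[OF ld(1) ld(1)])
  have L: "is_product C (l True) (l False) (prod_obj C (l True) (l False))
      (prod_fst C (l True) (l False)) (prod_snd C (l True) (l False))"
    by (rule prd[OF ld(3) ld(3)])
  note PD = productD[OF P] and LD = productD[OF L]
  note D = pm[OF ld(2)[of True] ld(2)[of False]] and PI = pm[OF ld(4)[of True] ld(4)[of False]]
  show "cochain_limit C (\<lambda>n. prod_obj C (X True n) (X False n)) (\<lambda>n. prod_map C (d True n) (d False n))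
     (prod_obj C (l True) (l False)) (\<lambda>n. prod_map C (\<pi> True n) (\<pi> False n))"
  proof (rule cochain_limitI)
    fix n
    show "prod_obj C (X True n) (X False n) \<in> Obj C" by (rule PD)
    show "prod_map C (d True n) (d False n) \<in> hom C (prod_obj C (X True (Suc n)) (X False (Suc n))) (prod_obj C (X True n) (X False n))"
      by (rule D)
    show "prod_obj C (l True) (l False) \<in> Obj C" by (rule LD)
    show "prod_map C (\<pi> True n) (\<pi> False n) \<in> hom C (prod_obj C (l True) (l False)) (prod_obj C (X True n) (X False n))"
      by (rule PI)
    show "prod_map C (\<pi> True (Suc n)) (\<pi> False (Suc n)) \<cdot> prod_map C (d True n) (d False n) = prod_map C (\<pi> True n) (\<pi> False n)"
    proof (rule product_eqI[OF P comp_hom[OF PI(1) D(1)] PI(1)])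
      show "prod_map C (\<pi> True (Suc n)) (\<pi> False (Suc n)) \<cdot> prod_map C (d True n) (d False n) \<cdot> prod_fst C (X True n) (X False n)
        = prod_map C (\<pi> True n) (\<pi> False n) \<cdot> prod_fst C (X True n) (X False n)"
        using comp_assoc[OF PI(1) D(1) PD(2)] D(2)[of n] PI(2)[of n] PI(2)[of "Suc n"] comp_assoc[OF PI(1) PD(2) ld(2)[of True], symmetric]
          comp_assoc[OF LD(2) ld(4) ld(2)] ld(5)[of True n] by simp
      show "prod_map C (\<pi> True (Suc n)) (\<pi> False (Suc n)) \<cdot> prod_map C (d True n) (d False n) \<cdot> prod_snd C (X True n) (X False n)
        = prod_map C (\<pi> True n) (\<pi> False n) \<cdot> prod_snd C (X True n) (X False n)"
        using comp_assoc[OF PI(1) D(1) PD(3)] D(3)[of n] PI(3)[of n] PI(3)[of "Suc n"] comp_assoc[OF PI(1) PD(3) ld(2)[of False], symmetric]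
          comp_assoc[OF LD(3) ld(4) ld(2)] ld(5)[of False n] by simp
    qed
  next
    fix a f
    assume a: "a \<in> Obj C" and f: "\<And>n. f n \<in> hom C a (prod_obj C (X True n) (X False n))"
      "\<And>n. f (Suc n) \<cdot> prod_map C (d True n) (d False n) = f n"
    have f1: "(f (Suc n) \<cdot> prod_fst C (X True (Suc n)) (X False (Suc n))) \<cdot> d True n = f n \<cdot> prod_fst C (X True n) (X False n)" for n
      using comp_assoc[OF f(1) PD(2) ld(2)[of True]] D(2)[symmetric] comp_assoc[OF f(1) D(1) PD(2), symmetric] f(2)[of n] by simp
    have f2: "(f (Suc n) \<cdot> prod_snd C (X True (Suc n)) (X False (Suc n))) \<cdot> d False n = f n \<cdot> prod_snd C (X True n) (X False n)" for n
      using comp_assoc[OF f(1) PD(3) ld(2)[of False]] D(3)[symmetric] comp_assoc[OF f(1) D(1) PD(3), symmetric] f(2)[of n] by simp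
    obtain h1 where h1: "h1 \<in> hom C a (l True)" "\<And>n. h1 \<cdot> \<pi> True n = f n \<cdot> prod_fst C (X True n) (X False n)"
      using limit_tupleE[OF X' a comp_hom[OF f(1) PD(2)] f1] by blast
    obtain h2 where h2: "h2 \<in> hom C a (l False)" "\<And>n. h2 \<cdot> \<pi> False n = f n \<cdot> prod_snd C (X True n) (X False n)"
      using limit_tupleE[OF X' a comp_hom[OF f(1) PD(3)] f2] by blast
    obtain h where h: "h \<in> hom C a (prod_obj C (l True) (l False))" "h \<cdot> prod_fst C (l True) (l False) = h1" "h \<cdot> prod_snd C (l True) (l False) = h2"
      using L h1(1) h2(1) unfolding is_product_def by blast
    have "h \<cdot> prod_map C (\<pi> True n) (\<pi> False n) = f n" for n
    proof (rule product_eqI[OF P comp_hom[OF h(1) PI(1)] f(1)])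
      show "h \<cdot> prod_map C (\<pi> True n) (\<pi> False n) \<cdot> prod_fst C (X True n) (X False n) = f n \<cdot> prod_fst C (X True n) (X False n)"
        using comp_assoc[OF h(1) PI(1) PD(2)] PI(2)[of n] comp_assoc[OF h(1) LD(2) ld(4)] h(2) h1(2)[of n] by simp
      show "h \<cdot> prod_map C (\<pi> True n) (\<pi> False n) \<cdot> prod_snd C (X True n) (X False n) = f n \<cdot> prod_snd C (X True n) (X False n)"
        using comp_assoc[OF h(1) PI(1) PD(3)] PI(3)[of n] comp_assoc[OF h(1) LD(3) ld(4)] h(3) h2(2)[of n] by simp
    qed
    then show "\<exists>h. h \<in> hom C a (prod_obj C (l True) (l False)) \<and> (\<forall>n. h \<cdot> prod_map C (\<pi> True n) (\<pi> False n) = f n)"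
      using h(1) by blast
  next
    fix a h k
    assume h: "h \<in> hom C a (prod_obj C (l True) (l False))" and k: "k \<in> hom C a (prod_obj C (l True) (l False))"
      and e: "\<And>n. h \<cdot> prod_map C (\<pi> True n) (\<pi> False n) = k \<cdot> prod_map C (\<pi> True n) (\<pi> False n)"
    have *: "(g \<cdot> prod_fst C (l True) (l False)) \<cdot> \<pi> True n = (g \<cdot> prod_map C (\<pi> True n) (\<pi> False n)) \<cdot> prod_fst C (X True n) (X False n)"
      "(g \<cdot> prod_snd C (l True) (l False)) \<cdot> \<pi> False n = (g \<cdot> prod_map C (\<pi> True n) (\<pi> False n)) \<cdot> prod_snd C (X True n) (X False n)"
      if g: "g \<in> hom C a (prod_obj C (l True) (l False))" for g n
      using comp_assoc[OF g PI(1) PD(2)] PI(2)[of n] comp_assoc[OF g LD(2) ld(4)]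
        comp_assoc[OF g PI(1) PD(3)] PI(3)[of n] comp_assoc[OF g LD(3) ld(4)] by simp_all
    show "h = k"
    proof (rule product_eqI[OF L h k])
      show "h \<cdot> prod_fst C (l True) (l False) = k \<cdot> prod_fst C (l True) (l False)"
        by (rule limit_eqI[OF X' comp_hom[OF h LD(2)] comp_hom[OF k LD(2)]]) (simp only: *[OF h] *[OF k] e)
      show "h \<cdot> prod_snd C (l True) (l False) = k \<cdot> prod_snd C (l True) (l False)"
        by (rule limit_eqI[OF X' comp_hom[OF h LD(3)] comp_hom[OF k LD(3)]]) (simp only: *[OF h] *[OF k] e)
    qed
  qed
qed

end

section \<open>Functor categories\<close>

lemma mk_nt_simps [simp]:
  "NDom (mk_nt A F G \<alpha>) = F" "NCod (mk_nt A F G \<alpha>) = G"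
  "a \<in> Obj A \<Longrightarrow> NMap (mk_nt A F G \<alpha>) a = \<alpha> a"
  by (simp_all add: mk_nt_def)

lemma functor_cat_simps [simp]:
  "Dom (functor_cat A B) = NDom" "Cod (functor_cat A B) = NCod"
  "NDom (Idt (functor_cat A B) F) = F" "NCod (Idt (functor_cat A B) F) = F"
  "NDom (\<alpha> \<cdot>\<^bsub>functor_cat A B\<^esub> \<beta>) = NDom \<alpha>" "NCod (\<alpha> \<cdot>\<^bsub>functor_cat A B\<^esub> \<beta>) = NCod \<beta>"
  "a \<in> Obj A \<Longrightarrow> NMap (Idt (functor_cat A B) F) a = Idt B (FObj F a)"
  "a \<in> Obj A \<Longrightarrow> NMap (\<alpha> \<cdot>\<^bsub>functor_cat A B\<^esub> \<beta>) a = NMap \<alpha> a \<cdot>\<^bsub>B\<^esub> NMap \<beta> a"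
  by (simp_all add: functor_cat_def)

lemma functor_cat_obj: "F \<in> Obj (functor_cat A B) \<longleftrightarrow> is_functor A B F"
  by (simp add: functor_cat_def)

lemma functor_cat_hom:
  "\<alpha> \<in> hom (functor_cat A B) F G \<longleftrightarrow> is_ntrans A B \<alpha> \<and> NDom \<alpha> = F \<and> NCod \<alpha> = G"
  by (simp add: functor_cat_def hom_def)

text \<open>The component functions are extensional, so agreement on the objects and arrows of
  \<open>A\<close> already gives equality of the records. Strict equations between composites of
  functors come from here.\<close>

lemma func_eqI:
  assumes "is_functor A B F" "is_functor A B G" "\<And>a. a \<in> Obj A \<Longrightarrow> FObj F a = FObj G a"
    "\<And>f. f \<in> Arr A \<Longrightarrow> FArr F f = FArr G f"
  shows "F = (G :: ('a, 'b, 'c, 'd) func)"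
proof (rule func.equality)
  show "FObj F = FObj G" using assms(3) is_functor.FObj_ext[OF assms(1)] is_functor.FObj_ext[OF assms(2)]
    by (rule extensionalityI[rotated 2])
  show "FArr F = FArr G" using assms(4) is_functor.FArr_ext[OF assms(1)] is_functor.FArr_ext[OF assms(2)]
    by (rule extensionalityI[rotated 2])
qed simp

lemma nt_eqI:
  assumes "\<alpha> \<in> hom (functor_cat A B) F G" "\<beta> \<in> hom (functor_cat A B) F G"
    "\<And>a. a \<in> Obj A \<Longrightarrow> NMap \<alpha> a = NMap \<beta> a"
  shows "\<alpha> = (\<beta> :: ('a, 'b, 'c, 'd) ntrans)"
proof (rule ntrans.equality)
  have "is_ntrans A B \<alpha>" "is_ntrans A B \<beta>" using assms(1,2) by (auto simp: functor_cat_hom)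
  then have "NMap \<alpha> \<in> extensional (Obj A)" "NMap \<beta> \<in> extensional (Obj A)"
    using is_ntrans.NMap_ext by auto
  then show "NMap \<alpha> = NMap \<beta>" using assms(3) by (rule extensionalityI)
qed (use assms(1,2) in \<open>auto simp: functor_cat_hom\<close>)

lemma is_functor_fid: "category A \<Longrightarrow> is_functor A A (fid A)"
  by (intro is_functor.intro is_functor_axioms.intro)
    (auto simp: fid_def hom_def category.comp_simps category.idt_simps category.dom_cod_obj)

lemma FObj_fid [simp]: "a \<in> Obj A \<Longrightarrow> FObj (fid A) a = a"
  and FArr_fid [simp]: "f \<in> Arr A \<Longrightarrow> FArr (fid A) f = f"
  by (simp_all add: fid_def)

lemma FObj_fcomp [simp]: "a \<in> Obj A \<Longrightarrow> FObj (fcomp A F G) a = FObj G (FObj F a)"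
  and FArr_fcomp [simp]: "f \<in> Arr A \<Longrightarrow> FArr (fcomp A F G) f = FArr G (FArr F f)"
  by (simp_all add: fcomp_def)

locale functor_category = A: category A + B: category B
  for A :: "('o, 'm, 'y) category_scheme" and B :: "('p, 'n, 'z) category_scheme"
begin

abbreviation FC where "FC \<equiv> functor_cat A B"

lemma FArr_simps [simp]:
  assumes "F \<in> Obj FC" "f \<in> Arr A"
  shows "FArr F f \<in> Arr B" "Dom B (FArr F f) = FObj F (Dom A f)" "Cod B (FArr F f) = FObj F (Cod A f)"
  using is_functor.FArr_hom[of A B F f "Dom A f" "Cod A f"] assms by (auto simp: hom_def functor_cat_obj)

lemma FObj_simps [simp]:
  assumes "F \<in> Obj FC" "a \<in> Obj A"
  shows "FObj F a \<in> Obj B" "FArr F (Idt A a) = Idt B (FObj F a)"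
  using is_functor.FObj_obj is_functor.FArr_idt assms by (auto simp: functor_cat_obj)

lemma FArr_comp [simp]:
  assumes "F \<in> Obj FC" "f \<in> Arr A" "g \<in> Arr A" "Cod A f = Dom A g"
  shows "FArr F (f \<cdot>\<^bsub>A\<^esub> g) = FArr F f \<cdot>\<^bsub>B\<^esub> FArr F g"
  using is_functor.FArr_comp[of A B F f "Dom A f" "Cod A f" g "Cod A g"] assms
  by (auto simp: hom_def functor_cat_obj)

lemma functorI:
  assumes "FObj F \<in> extensional (Obj A)" "FArr F \<in> extensional (Arr A)"
    "\<And>a. a \<in> Obj A \<Longrightarrow> FObj F a \<in> Obj B"
    "\<And>f a b. f \<in> hom A a b \<Longrightarrow> FArr F f \<in> hom B (FObj F a) (FObj F b)"
    "\<And>a. a \<in> Obj A \<Longrightarrow> FArr F (Idt A a) = Idt B (FObj F a)"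
    "\<And>f a b g c. \<lbrakk>f \<in> hom A a b; g \<in> hom A b c\<rbrakk> \<Longrightarrow> FArr F (f \<cdot>\<^bsub>A\<^esub> g) = FArr F f \<cdot>\<^bsub>B\<^esub> FArr F g"
  shows "F \<in> Obj FC"
  unfolding functor_cat_obj by unfold_locales (use assms in auto)

lemma ntD:
  assumes "\<alpha> \<in> Arr FC"
  shows "NDom \<alpha> \<in> Obj FC" "NCod \<alpha> \<in> Obj FC"
    "a \<in> Obj A \<Longrightarrow> NMap \<alpha> a \<in> hom B (FObj (NDom \<alpha>) a) (FObj (NCod \<alpha>) a)"
    "f \<in> hom A a b \<Longrightarrow> FArr (NDom \<alpha>) f \<cdot>\<^bsub>B\<^esub> NMap \<alpha> b = NMap \<alpha> a \<cdot>\<^bsub>B\<^esub> FArr (NCod \<alpha>) f"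
proof -
  have "is_ntrans A B \<alpha>" using assms by (simp add: functor_cat_def)
  then interpret is_ntrans A B \<alpha> .
  show "NDom \<alpha> \<in> Obj FC" "NCod \<alpha> \<in> Obj FC"
    "a \<in> Obj A \<Longrightarrow> NMap \<alpha> a \<in> hom B (FObj (NDom \<alpha>) a) (FObj (NCod \<alpha>) a)"
    "f \<in> hom A a b \<Longrightarrow> FArr (NDom \<alpha>) f \<cdot>\<^bsub>B\<^esub> NMap \<alpha> b = NMap \<alpha> a \<cdot>\<^bsub>B\<^esub> FArr (NCod \<alpha>) f"
    unfolding functor_cat_obj using NMap_hom naturality D.is_functor_axioms E.is_functor_axioms by blast+
qed

lemma NMap_simps [simp]:
  assumes "\<alpha> \<in> Arr FC"
  shows "NDom \<alpha> \<in> Obj FC" "NCod \<alpha> \<in> Obj FC"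
    "a \<in> Obj A \<Longrightarrow> NMap \<alpha> a \<in> Arr B" "a \<in> Obj A \<Longrightarrow> Dom B (NMap \<alpha> a) = FObj (NDom \<alpha>) a"
    "a \<in> Obj A \<Longrightarrow> Cod B (NMap \<alpha> a) = FObj (NCod \<alpha>) a"
  using ntD[OF assms] by (auto simp: hom_def)

lemma NMap_hom: "\<lbrakk>\<alpha> \<in> hom FC F G; a \<in> Obj A\<rbrakk> \<Longrightarrow> NMap \<alpha> a \<in> hom B (FObj F a) (FObj G a)"
  using ntD(3)[of \<alpha> a] by (simp add: hom_def)

lemma naturality:
  "\<lbrakk>\<alpha> \<in> hom FC F G; f \<in> hom A a b\<rbrakk> \<Longrightarrow> FArr F f \<cdot>\<^bsub>B\<^esub> NMap \<alpha> b = NMap \<alpha> a \<cdot>\<^bsub>B\<^esub> FArr G f"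
  using ntD(4)[of \<alpha> f a b] by (simp add: hom_def)

lemma FArr_hom: "\<lbrakk>F \<in> Obj FC; f \<in> hom A a b\<rbrakk> \<Longrightarrow> FArr F f \<in> hom B (FObj F a) (FObj F b)"
  by (auto simp: hom_def)

lemma nt_homI:
  assumes "F \<in> Obj FC" "G \<in> Obj FC" "NDom \<alpha> = F" "NCod \<alpha> = G" "NMap \<alpha> \<in> extensional (Obj A)"
    "\<And>a. a \<in> Obj A \<Longrightarrow> NMap \<alpha> a \<in> hom B (FObj F a) (FObj G a)"
    "\<And>f a b. f \<in> hom A a b \<Longrightarrow> FArr F f \<cdot>\<^bsub>B\<^esub> NMap \<alpha> b = NMap \<alpha> a \<cdot>\<^bsub>B\<^esub> FArr G f"
  shows "\<alpha> \<in> hom FC F G"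
  unfolding functor_cat_hom
  using assms by (intro conjI is_ntrans.intro is_ntrans_axioms.intro) (auto simp: functor_cat_obj)

lemma mk_nt_hom:
  assumes "F \<in> Obj FC" "G \<in> Obj FC"
    "\<And>a. a \<in> Obj A \<Longrightarrow> \<alpha> a \<in> hom B (FObj F a) (FObj G a)"
    "\<And>f a b. f \<in> hom A a b \<Longrightarrow> FArr F f \<cdot>\<^bsub>B\<^esub> \<alpha> b = \<alpha> a \<cdot>\<^bsub>B\<^esub> FArr G f"
  shows "mk_nt A F G \<alpha> \<in> hom FC F G"
proof (rule nt_homI[OF assms(1,2)])
  show "NMap (mk_nt A F G \<alpha>) \<in> extensional (Obj A)" by (simp add: mk_nt_def)
  show "FArr F f \<cdot>\<^bsub>B\<^esub> NMap (mk_nt A F G \<alpha>) b = NMap (mk_nt A F G \<alpha>) a \<cdot>\<^bsub>B\<^esub> FArr G f"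
    if "f \<in> hom A a b" for f a b
    using assms(4)[OF that] A.hom_obj[OF that] by simp
qed (use assms(3) in auto)

lemma comp_FC_hom:
  assumes "\<alpha> \<in> hom FC F G" "\<beta> \<in> hom FC G K"
  shows "\<alpha> \<cdot>\<^bsub>FC\<^esub> \<beta> \<in> hom FC F K"
proof -
  have ab: "\<alpha> \<in> Arr FC" "\<beta> \<in> Arr FC" "NDom \<alpha> = F" "NCod \<alpha> = G" "NDom \<beta> = G" "NCod \<beta> = K"
    using assms by (auto simp: hom_def)
  have e: "\<alpha> \<cdot>\<^bsub>FC\<^esub> \<beta> = mk_nt A F K (\<lambda>a. NMap \<alpha> a \<cdot>\<^bsub>B\<^esub> NMap \<beta> a)"
    using ab by (simp add: functor_cat_def)
  have o: "F \<in> Obj FC" "G \<in> Obj FC" "K \<in> Obj FC" using NMap_simps(1,2) ab by blast+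
  show ?thesis unfolding e
  proof (rule mk_nt_hom[OF o(1,3)])
    show "NMap \<alpha> a \<cdot>\<^bsub>B\<^esub> NMap \<beta> a \<in> hom B (FObj F a) (FObj K a)" if "a \<in> Obj A" for a
      using B.comp_hom[OF NMap_hom[OF assms(1) that] NMap_hom[OF assms(2) that]] .
    fix f a b assume f: "f \<in> hom A a b"
    then have a: "a \<in> Obj A" "b \<in> Obj A" using A.hom_obj by auto
    note h = FArr_hom[OF o(1) f] FArr_hom[OF o(2) f] FArr_hom[OF o(3) f] NMap_hom[OF assms(1) a(1)]
      NMap_hom[OF assms(1) a(2)] NMap_hom[OF assms(2) a(1)] NMap_hom[OF assms(2) a(2)]
    show "FArr F f \<cdot>\<^bsub>B\<^esub> (NMap \<alpha> b \<cdot>\<^bsub>B\<^esub> NMap \<beta> b) = (NMap \<alpha> a \<cdot>\<^bsub>B\<^esub> NMap \<beta> a) \<cdot>\<^bsub>B\<^esub> FArr K f"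
      using B.comp_assoc[OF h(1) h(5) h(7)] B.comp_assoc[OF h(4) h(2) h(7)] B.comp_assoc[OF h(4) h(6) h(3)]
        naturality[OF assms(1) f] naturality[OF assms(2) f] by simp
  qed
qed

lemma category_FC: "category FC"
proof
  fix f assume f: "f \<in> Arr FC"
  show "Dom FC f \<in> Obj FC" "Cod FC f \<in> Obj FC" using f by simp_all
next
  fix F assume F: "F \<in> Obj FC"
  have "Idt FC F = mk_nt A F F (\<lambda>a. Idt B (FObj F a))" by (simp add: functor_cat_def)
  moreover have "mk_nt A F F (\<lambda>a. Idt B (FObj F a)) \<in> hom FC F F"
    using F by (intro mk_nt_hom) (auto simp: hom_def)
  ultimately show "Idt FC F \<in> hom FC F F" by (simp only:)
next
  fix \<alpha> \<beta> F G K assume "\<alpha> \<in> hom FC F G" "\<beta> \<in> hom FC G K"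
  then show "\<alpha> \<cdot>\<^bsub>FC\<^esub> \<beta> \<in> hom FC F K" by (rule comp_FC_hom)
next
  fix \<alpha> F G assume a: "\<alpha> \<in> hom FC F G"
  then have o: "F \<in> Obj FC" "G \<in> Obj FC" by (auto simp: hom_def)
  have i: "Idt FC F \<in> hom FC F F" if F: "F \<in> Obj FC" for F
  proof -
    have "Idt FC F = mk_nt A F F (\<lambda>a. Idt B (FObj F a))" by (simp add: functor_cat_def)
    moreover have "mk_nt A F F (\<lambda>a. Idt B (FObj F a)) \<in> hom FC F F"
      using F by (intro mk_nt_hom) (auto simp: hom_def)
    ultimately show ?thesis by (simp only:)
  qed
  show "Idt FC F \<cdot>\<^bsub>FC\<^esub> \<alpha> = \<alpha>"
    by (rule nt_eqI[OF comp_FC_hom[OF i[OF o(1)] a] a]) (use a in \<open>auto simp: hom_def\<close>)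
  show "\<alpha> \<cdot>\<^bsub>FC\<^esub> Idt FC G = \<alpha>"
    by (rule nt_eqI[OF comp_FC_hom[OF a i[OF o(2)]] a]) (use a in \<open>auto simp: hom_def\<close>)
next
  fix \<alpha> \<beta> \<gamma> F G K L assume a: "\<alpha> \<in> hom FC F G" and b: "\<beta> \<in> hom FC G K" and c: "\<gamma> \<in> hom FC K L"
  show "\<alpha> \<cdot>\<^bsub>FC\<^esub> \<beta> \<cdot>\<^bsub>FC\<^esub> \<gamma> = \<alpha> \<cdot>\<^bsub>FC\<^esub> (\<beta> \<cdot>\<^bsub>FC\<^esub> \<gamma>)"
    by (rule nt_eqI[OF comp_FC_hom[OF comp_FC_hom[OF a b] c] comp_FC_hom[OF a comp_FC_hom[OF b c]]])
      (use a b c in \<open>auto simp: hom_def\<close>)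
qed

sublocale FC: category FC by (rule category_FC)

subsection \<open>Pointwise limits and colimits\<close>

text \<open>Mediating maps are chosen at each object. They are natural because both sides of a
  naturality square agree after every projection of the limit at the target
  \<open>b\<close>.\<close>

lemma cochain_limit_pointwise:
  assumes X: "\<And>n. X n \<in> Obj FC" and d: "\<And>n. d n \<in> hom FC (X (Suc n)) (X n)"
    and L: "L \<in> Obj FC" and p: "\<And>n. p n \<in> hom FC L (X n)"
    and lim: "\<And>a. a \<in> Obj A \<Longrightarrow> cochain_limit B (\<lambda>n. FObj (X n) a) (\<lambda>n. NMap (d n) a) (FObj L a) (\<lambda>n. NMap (p n) a)"
  shows "cochain_limit FC X d L p"
proof (rule FC.cochain_limitI)
  show "X n \<in> Obj FC" "d n \<in> hom FC (X (Suc n)) (X n)" "L \<in> Obj FC" "p n \<in> hom FC L (X n)" for n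
    by fact+
  note ld = B.cochain_limitD[OF lim]
  show "p (Suc n) \<cdot>\<^bsub>FC\<^esub> d n = p n" for n
    by (rule nt_eqI[OF FC.comp_hom[OF p d] p]) (simp add: ld(5))
  show "\<exists>h. h \<in> hom FC K L \<and> (\<forall>n. h \<cdot>\<^bsub>FC\<^esub> p n = f n)"
    if K: "K \<in> Obj FC" and f: "\<And>n. f n \<in> hom FC K (X n)" "\<And>n. f (Suc n) \<cdot>\<^bsub>FC\<^esub> d n = f n" for K f
  proof -
    have "\<exists>h. h \<in> hom B (FObj K a) (FObj L a) \<and> (\<forall>n. h \<cdot>\<^bsub>B\<^esub> NMap (p n) a = NMap (f n) a)"
      if a: "a \<in> Obj A" for a
    proof -
      have "NMap (f (Suc n)) a \<cdot>\<^bsub>B\<^esub> NMap (d n) a = NMap (f n) a" for n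
        using f(2)[of n] a functor_cat_simps(8)[OF a, of B "f (Suc n)" "d n"] by simp
      then show ?thesis
        using B.limit_tupleE[OF lim[OF a], of "FObj K a" "\<lambda>n. NMap (f n) a"] K NMap_hom[OF f(1) a] a
        by (metis FObj_simps(1))
    qed
    then obtain h where h: "\<And>a. a \<in> Obj A \<Longrightarrow> h a \<in> hom B (FObj K a) (FObj L a)"
      "\<And>a n. a \<in> Obj A \<Longrightarrow> h a \<cdot>\<^bsub>B\<^esub> NMap (p n) a = NMap (f n) a"
      by metis
    have H: "mk_nt A K L h \<in> hom FC K L"
    proof (rule mk_nt_hom[OF K L h(1)])
      fix g a b assume g: "g \<in> hom A a b"
      then have ab: "a \<in> Obj A" "b \<in> Obj A" using A.hom_obj by auto
      note Kg = FArr_hom[OF K g] and Lg = FArr_hom[OF L g]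
      show "FArr K g \<cdot>\<^bsub>B\<^esub> h b = h a \<cdot>\<^bsub>B\<^esub> FArr L g"
      proof (rule B.limit_eqI[OF lim[OF ab(2)] B.comp_hom[OF Kg h(1)[OF ab(2)]] B.comp_hom[OF h(1)[OF ab(1)] Lg]])
        fix n
        note pa = NMap_hom[OF p ab(1), of n] and pb = NMap_hom[OF p ab(2), of n]
        note Xg = FArr_hom[OF X g, of n]
        show "FArr K g \<cdot>\<^bsub>B\<^esub> h b \<cdot>\<^bsub>B\<^esub> NMap (p n) b = h a \<cdot>\<^bsub>B\<^esub> FArr L g \<cdot>\<^bsub>B\<^esub> NMap (p n) b"
          using B.comp_assoc[OF Kg h(1)[OF ab(2)] pb] B.comp_assoc[OF h(1)[OF ab(1)] Lg pb]
            h(2)[OF ab(2), of n] naturality[OF p g, of n] naturality[OF f(1) g, of n]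
            B.comp_assoc[OF h(1)[OF ab(1)] pa Xg] h(2)[OF ab(1), of n] by simp
      qed
    qed
    moreover have "mk_nt A K L h \<cdot>\<^bsub>FC\<^esub> p n = f n" for n
      by (rule nt_eqI[OF FC.comp_hom[OF H p] f(1)]) (simp add: h(2))
    ultimately show ?thesis by blast
  qed
  show "h = k" if h: "h \<in> hom FC K L" and k: "k \<in> hom FC K L" and e: "\<And>n. h \<cdot>\<^bsub>FC\<^esub> p n = k \<cdot>\<^bsub>FC\<^esub> p n" for K h k
  proof (rule nt_eqI[OF h k])
    fix a assume a: "a \<in> Obj A"
    show "NMap h a = NMap k a"
    proof (rule B.limit_eqI[OF lim[OF a] NMap_hom[OF h a] NMap_hom[OF k a]])
      show "NMap h a \<cdot>\<^bsub>B\<^esub> NMap (p n) a = NMap k a \<cdot>\<^bsub>B\<^esub> NMap (p n) a" for n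
        using arg_cong[OF e[of n], of "\<lambda>\<alpha>. NMap \<alpha> a"] a by simp
    qed
  qed
qed

text \<open>The arrow action of \<open>L\<close> is forced: \<open>FArr L f\<close> mediates the
  cone formed by the \<open>\<pi> a n\<close> followed by \<open>FArr (X n) f\<close>, and
  uniqueness gives functoriality. The values of \<open>L\<close> and \<open>p\<close> are returned
  as equations with the given \<open>l\<close> and \<open>\<pi>\<close>, so that a caller still
  knows how these were built.\<close>

lemma pointwise_limitE:
  assumes X: "\<And>n. X n \<in> Obj FC" and d: "\<And>n. d n \<in> hom FC (X (Suc n)) (X n)"
    and lim: "\<And>a. a \<in> Obj A \<Longrightarrow> cochain_limit B (\<lambda>n. FObj (X n) a) (\<lambda>n. NMap (d n) a) (l a) (\<lambda>n. \<pi> a n)"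
  obtains L p where "L \<in> Obj FC" "\<And>n. p n \<in> hom FC L (X n)" "\<And>a. a \<in> Obj A \<Longrightarrow> FObj L a = l a"
    "\<And>a n. a \<in> Obj A \<Longrightarrow> NMap (p n) a = \<pi> a n"
proof -
  note ld = B.cochain_limitD[OF lim]
  have "\<exists>h. h \<in> hom B (l a) (l b) \<and> (\<forall>n. h \<cdot>\<^bsub>B\<^esub> \<pi> b n = \<pi> a n \<cdot>\<^bsub>B\<^esub> FArr (X n) f)"
    if f: "f \<in> hom A a b" for f a b
  proof -
    have ab: "a \<in> Obj A" "b \<in> Obj A" using f A.hom_obj by auto
    have "(\<pi> a (Suc n) \<cdot>\<^bsub>B\<^esub> FArr (X (Suc n)) f) \<cdot>\<^bsub>B\<^esub> NMap (d n) b = \<pi> a n \<cdot>\<^bsub>B\<^esub> FArr (X n) f" for n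
      using B.comp_assoc[OF ld(4)[OF ab(1)] FArr_hom[OF X f] NMap_hom[OF d ab(2)], of n]
        B.comp_assoc[OF ld(4)[OF ab(1)] NMap_hom[OF d ab(1)] FArr_hom[OF X f], of n]
        naturality[OF d f, of n] ld(5)[OF ab(1), of n] by simp
    then show ?thesis
      using B.limit_tupleE[OF lim[OF ab(2)] ld(3)[OF ab(1)] B.comp_hom[OF ld(4)[OF ab(1)] FArr_hom[OF X f]]]
      by blast
  qed
  \<comment> \<open>The map obtained here may depend on the endpoints as separate arguments;
    \<open>h\<close> below reads them off \<open>f\<close>.\<close>
  then obtain h0 where h0: "\<And>f a b. f \<in> hom A a b \<Longrightarrow> h0 f a b \<in> hom B (l a) (l b)"
    "\<And>f a b n. f \<in> hom A a b \<Longrightarrow> h0 f a b \<cdot>\<^bsub>B\<^esub> \<pi> b n = \<pi> a n \<cdot>\<^bsub>B\<^esub> FArr (X n) f"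
    by metis
  define h where "h f = h0 f (Dom A f) (Cod A f)" for f
  have h: "h f \<in> hom B (l a) (l b)" "h f \<cdot>\<^bsub>B\<^esub> \<pi> b n = \<pi> a n \<cdot>\<^bsub>B\<^esub> FArr (X n) f" if "f \<in> hom A a b" for f a b n
    using h0[OF that] that unfolding h_def by (auto simp: hom_def)
  define L where "L = \<lparr>FObj = restrict l (Obj A), FArr = restrict h (Arr A)\<rparr>"
  have Lo: "FObj L a = l a" if "a \<in> Obj A" for a using that by (simp add: L_def)
  have La: "FArr L f = h f" if "f \<in> hom A a b" for f a b using that by (simp add: L_def hom_def)
  have L: "L \<in> Obj FC"
  proof (rule functorI)
    show "FObj L \<in> extensional (Obj A)" "FArr L \<in> extensional (Arr A)" by (simp_all add: L_def)
    show "FObj L a \<in> Obj B" if "a \<in> Obj A" for a using that ld(3) Lo by simp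
    show "FArr L f \<in> hom B (FObj L a) (FObj L b)" if f: "f \<in> hom A a b" for f a b
      using h(1)[OF f] La[OF f] Lo A.hom_obj[OF f] by simp
    show "FArr L (Idt A a) = Idt B (FObj L a)" if a: "a \<in> Obj A" for a
    proof -
      note i = A.idt_hom[OF a]
      have "h (Idt A a) = Idt B (l a)"
        by (rule B.limit_eqI[OF lim[OF a] h(1)[OF i] B.idt_hom[OF ld(3)[OF a]]])
          (simp only: h(2)[OF i] B.idt_comp[OF ld(4)[OF a]] FObj_simps(2)[OF X a] B.comp_idt[OF ld(4)[OF a]])
      then show ?thesis using La[OF i] Lo[OF a] by simp
    qed
    show "FArr L (f \<cdot>\<^bsub>A\<^esub> g) = FArr L f \<cdot>\<^bsub>B\<^esub> FArr L g" if f: "f \<in> hom A a b" and g: "g \<in> hom A b c" for f a b g c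
    proof -
      note fg = A.comp_hom[OF f g]
      have o: "a \<in> Obj A" "b \<in> Obj A" "c \<in> Obj A" using f g A.hom_obj by auto
      have "h (f \<cdot>\<^bsub>A\<^esub> g) = h f \<cdot>\<^bsub>B\<^esub> h g"
      proof (rule B.limit_eqI[OF lim[OF o(3)] h(1)[OF fg] B.comp_hom[OF h(1)[OF f] h(1)[OF g]]])
        fix n
        have e: "FArr (X n) (f \<cdot>\<^bsub>A\<^esub> g) = FArr (X n) f \<cdot>\<^bsub>B\<^esub> FArr (X n) g"
          using f g X by (intro FArr_comp) (auto simp: hom_def)
        show "h (f \<cdot>\<^bsub>A\<^esub> g) \<cdot>\<^bsub>B\<^esub> \<pi> c n = h f \<cdot>\<^bsub>B\<^esub> h g \<cdot>\<^bsub>B\<^esub> \<pi> c n"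
          using h(2)[OF fg, of n] B.comp_assoc[OF h(1)[OF f] h(1)[OF g] ld(4)[OF o(3)], of n]
            h(2)[OF g, of n] h(2)[OF f, of n] B.comp_assoc[OF h(1)[OF f] ld(4)[OF o(2)] FArr_hom[OF X g], of n]
            B.comp_assoc[OF ld(4)[OF o(1)] FArr_hom[OF X f] FArr_hom[OF X g], of n] e by simp
      qed
      then show ?thesis using La[OF fg] La[OF f] La[OF g] by simp
    qed
  qed
  define p where "p n = mk_nt A L (X n) (\<lambda>a. \<pi> a n)" for n
  have "p n \<in> hom FC L (X n)" for n
    unfolding p_def using ld(4) Lo La h(2) by (intro mk_nt_hom[OF L X]) auto
  then show ?thesis using that[of L p] L Lo by (simp add: p_def)
qed

text \<open>The vertex and the injections are already functorial and natural, so only mediating maps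
  are built; their naturality is tested on the injections at the source \<open>a\<close>.\<close>

lemma is_coproduct_pointwise:
  assumes X: "\<And>j. j \<in> J \<Longrightarrow> X j \<in> Obj FC" and P: "P \<in> Obj FC"
    and i: "\<And>j. j \<in> J \<Longrightarrow> \<iota> j \<in> hom FC (X j) P"
    and cop: "\<And>a. a \<in> Obj A \<Longrightarrow> is_coproduct B J (\<lambda>j. FObj (X j) a) (FObj P a) (\<lambda>j. NMap (\<iota> j) a)"
  shows "is_coproduct FC J X P \<iota>"
proof (rule FC.is_coproductI[OF P i])
  show "\<exists>h. h \<in> hom FC P K \<and> (\<forall>j\<in>J. \<iota> j \<cdot>\<^bsub>FC\<^esub> h = f j)"
    if K: "K \<in> Obj FC" and f: "\<And>j. j \<in> J \<Longrightarrow> f j \<in> hom FC (X j) K" for K f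
  proof -
    have "\<exists>h. h \<in> hom B (FObj P a) (FObj K a) \<and> (\<forall>j\<in>J. NMap (\<iota> j) a \<cdot>\<^bsub>B\<^esub> h = NMap (f j) a)"
      if a: "a \<in> Obj A" for a
      using B.coproduct_descE[OF cop[OF a] FObj_simps(1)[OF K a], of "\<lambda>j. NMap (f j) a"] NMap_hom[OF f a]
      by metis
    then obtain h where h: "\<And>a. a \<in> Obj A \<Longrightarrow> h a \<in> hom B (FObj P a) (FObj K a)"
      "\<And>a j. \<lbrakk>a \<in> Obj A; j \<in> J\<rbrakk> \<Longrightarrow> NMap (\<iota> j) a \<cdot>\<^bsub>B\<^esub> h a = NMap (f j) a"
      by metis
    have H: "mk_nt A P K h \<in> hom FC P K"
    proof (rule mk_nt_hom[OF P K h(1)])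
      fix g a b assume g: "g \<in> hom A a b"
      then have ab: "a \<in> Obj A" "b \<in> Obj A" using A.hom_obj by auto
      note Kg = FArr_hom[OF K g] and Pg = FArr_hom[OF P g]
      show "FArr P g \<cdot>\<^bsub>B\<^esub> h b = h a \<cdot>\<^bsub>B\<^esub> FArr K g"
      proof (rule B.coproduct_eqI[OF cop[OF ab(1)] B.comp_hom[OF Pg h(1)[OF ab(2)]] B.comp_hom[OF h(1)[OF ab(1)] Kg]])
        fix j assume j: "j \<in> J"
        note ia = NMap_hom[OF i[OF j] ab(1)] and ib = NMap_hom[OF i[OF j] ab(2)] and Xg = FArr_hom[OF X[OF j] g]
        show "NMap (\<iota> j) a \<cdot>\<^bsub>B\<^esub> (FArr P g \<cdot>\<^bsub>B\<^esub> h b) = NMap (\<iota> j) a \<cdot>\<^bsub>B\<^esub> (h a \<cdot>\<^bsub>B\<^esub> FArr K g)"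
          using B.comp_assoc[OF ia Pg h(1)[OF ab(2)]] B.comp_assoc[OF ia h(1)[OF ab(1)] Kg]
            B.comp_assoc[OF Xg ib h(1)[OF ab(2)]] naturality[OF i[OF j] g] naturality[OF f[OF j] g]
            h(2)[OF ab(1) j] h(2)[OF ab(2) j] by simp
      qed
    qed
    moreover have "\<iota> j \<cdot>\<^bsub>FC\<^esub> mk_nt A P K h = f j" if j: "j \<in> J" for j
      by (rule nt_eqI[OF FC.comp_hom[OF i[OF j] H] f[OF j]]) (simp add: h(2) j)
    ultimately show ?thesis by blast
  qed
  show "h = k" if h: "h \<in> hom FC P K" and k: "k \<in> hom FC P K" and e: "\<And>j. j \<in> J \<Longrightarrow> \<iota> j \<cdot>\<^bsub>FC\<^esub> h = \<iota> j \<cdot>\<^bsub>FC\<^esub> k" for K h k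
  proof (rule nt_eqI[OF h k])
    fix a assume a: "a \<in> Obj A"
    show "NMap h a = NMap k a"
    proof (rule B.coproduct_eqI[OF cop[OF a] NMap_hom[OF h a] NMap_hom[OF k a]])
      show "NMap (\<iota> j) a \<cdot>\<^bsub>B\<^esub> NMap h a = NMap (\<iota> j) a \<cdot>\<^bsub>B\<^esub> NMap k a" if "j \<in> J" for j
        using arg_cong[OF e[OF that], of "\<lambda>\<alpha>. NMap \<alpha> a"] a by simp
    qed
  qed
qed

text \<open>This provides the start of the terminal chain. It is applied twice, once for families
  and once for endofunctors of families.\<close>

lemma is_terminal_const_functor:
  assumes u: "is_terminal B u"
  shows "is_terminal FC (const_functor A B u)"
proof -
  have uo: "u \<in> Obj B" and u1: "\<And>a. a \<in> Obj B \<Longrightarrow> \<exists>!f. f \<in> hom B a u"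
    using u unfolding is_terminal_def by auto
  have T: "const_functor A B u \<in> Obj FC"
    by (rule functorI) (auto simp: const_functor_def hom_def uo)
  have To: "FObj (const_functor A B u) a = u" if "a \<in> Obj A" for a using that by (simp add: const_functor_def)
  show ?thesis unfolding is_terminal_def
  proof (intro conjI ballI T)
    fix F assume F: "F \<in> Obj FC"
    obtain h where h: "\<And>a. a \<in> Obj B \<Longrightarrow> h a \<in> hom B a u" using u1 by metis
    have H: "mk_nt A F (const_functor A B u) (\<lambda>a. h (FObj F a)) \<in> hom FC F (const_functor A B u)"
    proof (rule mk_nt_hom[OF F T])
      show "h (FObj F a) \<in> hom B (FObj F a) (FObj (const_functor A B u) a)" if "a \<in> Obj A" for a
        using h F To that by simp
      fix f a b assume f: "f \<in> hom A a b"
      have o: "a \<in> Obj A" "b \<in> Obj A" using f A.hom_obj by auto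
      have "FArr F f \<cdot>\<^bsub>B\<^esub> h (FObj F b) \<in> hom B (FObj F a) u"
        using B.comp_hom[OF FArr_hom[OF F f] h] F o by simp
      moreover have "h (FObj F a) \<cdot>\<^bsub>B\<^esub> FArr (const_functor A B u) f \<in> hom B (FObj F a) u"
        using B.comp_hom[OF h FArr_hom[OF T f, unfolded To[OF o(1)] To[OF o(2)]]] h F o To
          FArr_hom[OF T f, unfolded To[OF o(1)] To[OF o(2)]] f by (auto simp: hom_def)
      ultimately show "FArr F f \<cdot>\<^bsub>B\<^esub> h (FObj F b) = h (FObj F a) \<cdot>\<^bsub>B\<^esub> FArr (const_functor A B u) f"
        using u1[of "FObj F a"] F o by auto
    qed
    moreover have "f = g" if f: "f \<in> hom FC F (const_functor A B u)" and g: "g \<in> hom FC F (const_functor A B u)" for f g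
    proof (rule nt_eqI[OF f g])
      fix a assume a: "a \<in> Obj A"
      show "NMap f a = NMap g a"
        using NMap_hom[OF f a] NMap_hom[OF g a] To[OF a] u1[of "FObj F a"] F a by auto
    qed
    ultimately show "\<exists>!f. f \<in> hom FC F (const_functor A B u)" by blast
  qed
qed

end

lemma fcomp_obj:
  assumes "F \<in> Obj (functor_cat A B)" "G \<in> Obj (functor_cat B K)"
  shows "fcomp A F G \<in> Obj (functor_cat A K)"
proof -
  interpret F: is_functor A B F using assms by (simp add: functor_cat_obj)
  interpret G: is_functor B K G using assms by (simp add: functor_cat_obj)
  interpret AB: functor_category A B by unfold_locales
  interpret BK: functor_category B K by unfold_locales
  interpret AK: functor_category A K by unfold_locales
  show ?thesis
  proof (rule AK.functorI)
    fix f a b assume f: "f \<in> hom A a b"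
    then have o: "a \<in> Obj A" "b \<in> Obj A" "f \<in> Arr A" using F.A.hom_obj by (auto simp: hom_def)
    show "FArr (fcomp A F G) f \<in> hom K (FObj (fcomp A F G) a) (FObj (fcomp A F G) b)"
      using G.FArr_hom[OF F.FArr_hom[OF f]] o by simp
    fix g c assume g: "g \<in> hom A b c"
    then have g': "g \<in> Arr A" "f \<cdot>\<^bsub>A\<^esub> g \<in> Arr A" using F.A.comp_hom[OF f g] by (auto simp: hom_def)
    show "FArr (fcomp A F G) (f \<cdot>\<^bsub>A\<^esub> g) = FArr (fcomp A F G) f \<cdot>\<^bsub>K\<^esub> FArr (fcomp A F G) g"
      using G.FArr_comp[OF F.FArr_hom[OF f] F.FArr_hom[OF g]] F.FArr_comp[OF f g] o g' by simp
  qed (auto simp: F.FObj_obj G.FObj_obj F.FArr_idt G.FArr_idt fcomp_def)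
qed

section \<open>The monoidal category of endofunctors\<close>

lemma endo_simps [simp]:
  "Obj (endo A) = Obj (functor_cat A A)" "Arr (endo A) = Arr (functor_cat A A)"
  "Dom (endo A) = NDom" "Cod (endo A) = NCod"
  "Idt (endo A) = Idt (functor_cat A A)" "Comp (endo A) = Comp (functor_cat A A)"
  "TensO (endo A) = fcomp A" "TensA (endo A) = hcomp A A" "Unit (endo A) = fid A"
  by (simp_all add: endo_def)

lemma endo_hom [simp]: "hom (endo A) X Y = hom (functor_cat A A) X Y"
  by (simp add: hom_def)

lemma endo_limits [simp]:
  "cochain_limit (endo A) = cochain_limit (functor_cat A A)"
  "is_coproduct (endo A) = is_coproduct (functor_cat A A)"
  "is_terminal (endo A) = is_terminal (functor_cat A A)"
  "is_inverse (endo A) = is_inverse (functor_cat A A)"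
  by (simp_all add: fun_eq_iff cochain_limit_def is_cochain_def is_omega_limit_def is_omega_cone_def
      is_coproduct_def is_terminal_def is_inverse_def)

locale endofunctors = A: category A for A :: "('o, 'm, 'z) category_scheme"
begin

sublocale functor_category A A by unfold_locales

lemma fid_obj [simp]: "fid A \<in> Obj FC"
  using is_functor_fid A.category_axioms by (simp add: functor_cat_obj)

lemma fcomp_endo [simp]: "\<lbrakk>X \<in> Obj FC; Y \<in> Obj FC\<rbrakk> \<Longrightarrow> fcomp A X Y \<in> Obj FC"
  by (rule fcomp_obj)

text \<open>These are equations and not isomorphisms, since functors are extensional records;
  through them the coherence morphisms of \<open>endo A\<close> become identities.\<close>

lemma fcomp_fid [simp]:
  "X \<in> Obj FC \<Longrightarrow> fcomp A (fid A) X = X" "X \<in> Obj FC \<Longrightarrow> fcomp A X (fid A) = X"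
  "\<lbrakk>X \<in> Obj FC; Y \<in> Obj FC; Z \<in> Obj FC\<rbrakk> \<Longrightarrow> fcomp A (fcomp A X Y) Z = fcomp A X (fcomp A Y Z)"
  by (rule func_eqI[of A A]; simp add: functor_cat_obj[symmetric])+

lemma hcomp_simps [simp]:
  "NDom (hcomp A A \<alpha> \<beta>) = fcomp A (NDom \<alpha>) (NDom \<beta>)"
  "NCod (hcomp A A \<alpha> \<beta>) = fcomp A (NCod \<alpha>) (NCod \<beta>)"
  "a \<in> Obj A \<Longrightarrow> NMap (hcomp A A \<alpha> \<beta>) a
    = FArr (NDom \<beta>) (NMap \<alpha> a) \<cdot>\<^bsub>A\<^esub> NMap \<beta> (FObj (NCod \<alpha>) a)"
  by (simp_all add: hcomp_def)

text \<open>Naturality pastes two squares: that of \<open>f\<close> with \<open>Y\<close> applied to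
  it, and that of \<open>g\<close> at the image of the arrow under \<open>X'\<close>.\<close>

lemma hcomp_hom:
  assumes f: "f \<in> hom FC X X'" and g: "g \<in> hom FC Y Y'"
  shows "hcomp A A f g \<in> hom FC (fcomp A X Y) (fcomp A X' Y')"
proof -
  have o: "X \<in> Obj FC" "X' \<in> Obj FC" "Y \<in> Obj FC" "Y' \<in> Obj FC"
    using f g FC.hom_obj by auto
  have d: "NDom f = X" "NCod f = X'" "NDom g = Y" "NCod g = Y'" "f \<in> Arr FC" "g \<in> Arr FC"
    using f g by (auto simp: hom_def)
  show ?thesis unfolding hcomp_def d
  proof (rule mk_nt_hom)
    show "fcomp A X Y \<in> Obj FC" "fcomp A X' Y' \<in> Obj FC" using o by simp_all
    show "FArr Y (NMap f a) \<cdot>\<^bsub>A\<^esub> NMap g (FObj X' a) \<in> hom A (FObj (fcomp A X Y) a) (FObj (fcomp A X' Y') a)"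
      if "a \<in> Obj A" for a using o d that by (simp add: hom_def)
    fix h a b assume h: "h \<in> hom A a b"
    have ab: "a \<in> Obj A" "b \<in> Obj A" "h \<in> Arr A" "Dom A h = a" "Cod A h = b" using h A.hom_obj by (auto simp: hom_def)
    have n1: "FArr X h \<cdot>\<^bsub>A\<^esub> NMap f b = NMap f a \<cdot>\<^bsub>A\<^esub> FArr X' h" using naturality[OF f h] .
    have n2: "FArr Y (FArr X' h) \<cdot>\<^bsub>A\<^esub> NMap g (FObj X' b) = NMap g (FObj X' a) \<cdot>\<^bsub>A\<^esub> FArr Y' (FArr X' h)"
      using naturality[OF g FArr_hom[OF o(2) h]] .
    have "FArr Y (FArr X h) \<cdot>\<^bsub>A\<^esub> (FArr Y (NMap f b) \<cdot>\<^bsub>A\<^esub> NMap g (FObj X' b))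
        = FArr Y (FArr X h \<cdot>\<^bsub>A\<^esub> NMap f b) \<cdot>\<^bsub>A\<^esub> NMap g (FObj X' b)"
      using o d ab by simp
    also have "\<dots> = FArr Y (NMap f a) \<cdot>\<^bsub>A\<^esub> (FArr Y (FArr X' h) \<cdot>\<^bsub>A\<^esub> NMap g (FObj X' b))"
      unfolding n1 using o d ab by simp
    also have "\<dots> = (FArr Y (NMap f a) \<cdot>\<^bsub>A\<^esub> NMap g (FObj X' a)) \<cdot>\<^bsub>A\<^esub> FArr Y' (FArr X' h)"
      unfolding n2 using o d ab by simp
    finally show "FArr (fcomp A X Y) h \<cdot>\<^bsub>A\<^esub> (FArr Y (NMap f b) \<cdot>\<^bsub>A\<^esub> NMap g (FObj X' b))
        = (FArr Y (NMap f a) \<cdot>\<^bsub>A\<^esub> NMap g (FObj X' a)) \<cdot>\<^bsub>A\<^esub> FArr (fcomp A X' Y') h"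
      using ab by simp
  qed
qed

lemma mk_nt_idt:
  assumes "X \<in> Obj FC" "\<And>a. a \<in> Obj A \<Longrightarrow> f a = Idt A (FObj X a)"
  shows "mk_nt A X X f = Idt FC X"
  using assms by (auto simp: functor_cat_def mk_nt_def)

lemma coherence_endo [simp]:
  "X \<in> Obj FC \<Longrightarrow> Lam (endo A) X = Idt FC X" "X \<in> Obj FC \<Longrightarrow> Rho (endo A) X = Idt FC X"
  "\<lbrakk>X \<in> Obj FC; Y \<in> Obj FC; Z \<in> Obj FC\<rbrakk>
    \<Longrightarrow> Assoc (endo A) X Y Z = Idt FC (fcomp A X (fcomp A Y Z))"
  by (auto simp: endo_def intro!: mk_nt_idt)

lemma category_endo: "category (endo A)"
  using FC.category_axioms by (simp add: category_def)

lemma hcomp_idt [simp]: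
  "\<lbrakk>X \<in> Obj FC; Y \<in> Obj FC\<rbrakk> \<Longrightarrow> hcomp A A (Idt FC X) (Idt FC Y) = Idt FC (fcomp A X Y)"
  by (rule nt_eqI[OF hcomp_hom[OF FC.idt_hom FC.idt_hom] FC.idt_hom]) simp_all

lemma hcomp_idt_fid [simp]:
  assumes "f \<in> Arr FC"
  shows "hcomp A A (Idt FC (fid A)) f = f" "hcomp A A f (Idt FC (fid A)) = f"
proof -
  have f: "f \<in> hom FC (NDom f) (NCod f)" using assms by (simp add: hom_def)
  note o = FC.hom_obj[OF f]
  have "hcomp A A (Idt FC (fid A)) f \<in> hom FC (NDom f) (NCod f)"
    "hcomp A A f (Idt FC (fid A)) \<in> hom FC (NDom f) (NCod f)"
    using hcomp_hom[OF FC.idt_hom[OF fid_obj] f] hcomp_hom[OF f FC.idt_hom[OF fid_obj]] o by simp_all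
  then show "hcomp A A (Idt FC (fid A)) f = f" "hcomp A A f (Idt FC (fid A)) = f"
    using assms o by (auto intro!: nt_eqI[OF _ f])
qed

lemma hcomp_assoc:
  assumes f: "f \<in> hom FC X X'" and g: "g \<in> hom FC Y Y'" and h: "h \<in> hom FC Z Z'"
  shows "hcomp A A (hcomp A A f g) h = hcomp A A f (hcomp A A g h)"
proof (rule nt_eqI)
  note o = FC.hom_obj[OF f] FC.hom_obj[OF g] FC.hom_obj[OF h]
  show "hcomp A A (hcomp A A f g) h \<in> hom FC (fcomp A X (fcomp A Y Z)) (fcomp A X' (fcomp A Y' Z'))"
    using hcomp_hom[OF hcomp_hom[OF f g] h] o by simp
  show "hcomp A A f (hcomp A A g h) \<in> hom FC (fcomp A X (fcomp A Y Z)) (fcomp A X' (fcomp A Y' Z'))"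
    using hcomp_hom[OF f hcomp_hom[OF g h]] .
  fix a assume a: "a \<in> Obj A"
  show "NMap (hcomp A A (hcomp A A f g) h) a = NMap (hcomp A A f (hcomp A A g h)) a"
    using f g h o a by (simp add: hom_def)
qed

text \<open>Interchange law. Naturality of \<open>g\<close> at the components of \<open>f'\<close>
  swaps the two middle factors; the rest is functoriality and associativity.\<close>

lemma hcomp_comp:
  assumes f: "f \<in> hom FC X X'" and f': "f' \<in> hom FC X' X''" and g: "g \<in> hom FC Y Y'" and g': "g' \<in> hom FC Y' Y''"
  shows "hcomp A A (f \<cdot>\<^bsub>FC\<^esub> f') (g \<cdot>\<^bsub>FC\<^esub> g') = hcomp A A f g \<cdot>\<^bsub>FC\<^esub> hcomp A A f' g'"
proof (rule nt_eqI[OF hcomp_hom[OF FC.comp_hom[OF f f'] FC.comp_hom[OF g g']]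
      FC.comp_hom[OF hcomp_hom[OF f g] hcomp_hom[OF f' g']]])
  note o = FC.hom_obj[OF f] FC.hom_obj[OF f'] FC.hom_obj[OF g] FC.hom_obj[OF g']
  have d: "NDom f = X" "NCod f = X'" "NDom f' = X'" "NCod f' = X''" "NDom g = Y" "NCod g = Y'"
    "NDom g' = Y'" "NCod g' = Y''" "f \<in> Arr FC" "g \<in> Arr FC" "f' \<in> Arr FC" "g' \<in> Arr FC"
    using f g f' g' by (auto simp: hom_def)
  fix a assume a: "a \<in> Obj A"
  have n: "FArr Y (NMap f' a) \<cdot>\<^bsub>A\<^esub> NMap g (FObj X'' a) = NMap g (FObj X' a) \<cdot>\<^bsub>A\<^esub> FArr Y' (NMap f' a)"
    using naturality[OF g NMap_hom[OF f' a]] .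
  have "FArr Y (NMap f a \<cdot>\<^bsub>A\<^esub> NMap f' a) \<cdot>\<^bsub>A\<^esub> (NMap g (FObj X'' a) \<cdot>\<^bsub>A\<^esub> NMap g' (FObj X'' a))
      = FArr Y (NMap f a) \<cdot>\<^bsub>A\<^esub> ((FArr Y (NMap f' a) \<cdot>\<^bsub>A\<^esub> NMap g (FObj X'' a)) \<cdot>\<^bsub>A\<^esub> NMap g' (FObj X'' a))"
    using o d a by simp
  also have "\<dots> = (FArr Y (NMap f a) \<cdot>\<^bsub>A\<^esub> NMap g (FObj X' a)) \<cdot>\<^bsub>A\<^esub> (FArr Y' (NMap f' a) \<cdot>\<^bsub>A\<^esub> NMap g' (FObj X'' a))"
    unfolding n using o d a by simp
  finally show "NMap (hcomp A A (f \<cdot>\<^bsub>FC\<^esub> f') (g \<cdot>\<^bsub>FC\<^esub> g')) a = NMap (hcomp A A f g \<cdot>\<^bsub>FC\<^esub> hcomp A A f' g') a"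
    using o d a by simp
qed

lemma monoidal_category_endo: "monoidal_category (endo A)"
proof (intro monoidal_category.intro monoidal_category_axioms.intro category_endo)
  have iso: "is_iso (endo A) (Idt FC X)" if "X \<in> Obj FC" for X
    using FC.is_inverse_idt[OF that] unfolding is_iso_def by auto
  show "is_iso (endo A) (Lam (endo A) x)" "is_iso (endo A) (Rho (endo A) x)" if "x \<in> Obj (endo A)" for x
    using iso that by simp_all
  show "is_iso (endo A) (Assoc (endo A) x y z)"
    if "x \<in> Obj (endo A)" "y \<in> Obj (endo A)" "z \<in> Obj (endo A)" for x y z
    using iso that by simp
  fix f x x' g y y' h z z'
  assume "f \<in> hom (endo A) x x'" "g \<in> hom (endo A) y y'" "h \<in> hom (endo A) z z'"
  then have h: "f \<in> hom FC x x'" "g \<in> hom FC y y'" "h \<in> hom FC z z'" by simp_all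
  note o = FC.hom_obj[OF h(1)] FC.hom_obj[OF h(2)] FC.hom_obj[OF h(3)]
  show "f \<odot>\<^bsub>endo A\<^esub> g \<odot>\<^bsub>endo A\<^esub> h \<cdot>\<^bsub>endo A\<^esub> Assoc (endo A) x' y' z'
       = Assoc (endo A) x y z \<cdot>\<^bsub>endo A\<^esub> (f \<odot>\<^bsub>endo A\<^esub> (g \<odot>\<^bsub>endo A\<^esub> h))"
    using hcomp_hom[OF h(1) hcomp_hom[OF h(2,3)]] o hcomp_assoc[OF h] by (simp add: FC.comp_idt FC.idt_comp)
next
  fix f x y assume "f \<in> hom (endo A) x y"
  then have "f \<in> Arr FC" "NDom f = x" "NCod f = y" "x \<in> Obj FC" "y \<in> Obj FC"
    using FC.hom_obj[of f x y] by (auto simp: hom_def)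
  then show "(Idt (endo A) (Unit (endo A)) \<odot>\<^bsub>endo A\<^esub> f) \<cdot>\<^bsub>endo A\<^esub> Lam (endo A) y = Lam (endo A) x \<cdot>\<^bsub>endo A\<^esub> f"
    "(f \<odot>\<^bsub>endo A\<^esub> Idt (endo A) (Unit (endo A))) \<cdot>\<^bsub>endo A\<^esub> Rho (endo A) y = Rho (endo A) x \<cdot>\<^bsub>endo A\<^esub> f"
    by simp_all
qed (auto intro: hcomp_hom hcomp_comp FC.idt_hom)

end

section \<open>Final coalgebras\<close>

text \<open>A coproduct over \<open>bool\<close> with its two branches written out, so that the
  general lemmas on coproducts apply.\<close>

definition is_coproduct2 ::
  "('o, 'm, 'z) category_scheme \<Rightarrow> 'o \<Rightarrow> 'o \<Rightarrow> 'o \<Rightarrow> 'm \<Rightarrow> 'm \<Rightarrow> bool" where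
  "is_coproduct2 C a b p i j \<longleftrightarrow>
     is_coproduct C (UNIV :: bool set) (\<lambda>k. if k then a else b) p (\<lambda>k. if k then i else j)"

context category
begin

lemma coproduct2D:
  assumes "is_coproduct2 C a b p i j"
  shows "p \<in> Obj C" "i \<in> hom C a p" "j \<in> hom C b p"
  using coproductD[OF assms[unfolded is_coproduct2_def]] coproductD(2)[OF assms[unfolded is_coproduct2_def], of True]
    coproductD(2)[OF assms[unfolded is_coproduct2_def], of False] by auto

lemma copairE:
  assumes c: "is_coproduct2 C a b p i j" and f: "f \<in> hom C a d" "g \<in> hom C b d"
  obtains h where "h \<in> hom C p d" "i \<cdot> h = f" "j \<cdot> h = g"
proof -
  have "(if k then f else g) \<in> hom C (if k then a else b) d" for k using f by simp
  then obtain h where h: "h \<in> hom C p d" "\<And>k. k \<in> UNIV \<Longrightarrow> (if k then i else j) \<cdot> h = (if k then f else g)"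
    using coproduct_descE[OF c[unfolded is_coproduct2_def], of d "\<lambda>k. if k then f else g"] hom_obj[OF f(1)]
    by blast
  then show ?thesis using that[OF h(1)] h(2)[of True] h(2)[of False] by simp
qed

lemma copair_eqI:
  assumes "is_coproduct2 C a b p i j" "h \<in> hom C p d" "k \<in> hom C p d" "i \<cdot> h = i \<cdot> k" "j \<cdot> h = j \<cdot> k"
  shows "h = k"
  using coproduct_eqI[OF assms(1)[unfolded is_coproduct2_def] assms(2,3)] assms(4,5) by simp

lemma coproduct2_transport_iso:
  assumes c: "is_coproduct2 C a b p i j" and u: "u \<in> hom C p q" "is_inverse C u v"
  shows "is_coproduct2 C a b q (i \<cdot> u) (j \<cdot> u)"
proof -
  note D = coproduct2D[OF c]
  have o: "a \<in> Obj C" "b \<in> Obj C" using D(2,3) hom_obj by auto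
  have "is_coproduct C UNIV (\<lambda>k. if k then a else b) q
      (\<lambda>k. Idt C (if k then a else b) \<cdot> ((if k then i else j) \<cdot> u))"
    by (rule coproduct_transport_iso[OF c[unfolded is_coproduct2_def] _ u])
      (use o in \<open>auto simp: idt_hom is_iso_idt\<close>)
  then show ?thesis unfolding is_coproduct2_def
    by (rule is_coproduct_cong) (use D u in \<open>auto simp: hom_def\<close>)
qed

text \<open>Dual of Adamek's fixed point theorem: \<open>X\<close> is the terminal chain, and
  \<open>FL\<close> says that \<open>F\<close> preserves its limit. The first map \<open>d 0\<close>
  is left open; as an arrow into the terminal object it is determined.\<close>

theorem final_coalgebra_limit:
  assumes F: "is_functor C C F" and u: "is_terminal C u"
    and X: "X 0 = u" "\<And>n. X (Suc n) = FObj F (X n)" and d: "\<And>n. d (Suc n) = FArr F (d n)"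
    and L: "cochain_limit C X d L p"
    and FL: "cochain_limit C (\<lambda>n. FObj F (X n)) (\<lambda>n. FArr F (d n)) (FObj F L) (\<lambda>n. FArr F (p n))"
  obtains out where "is_final_coalgebra C F L out"
proof -
  interpret F: is_functor C C F by fact
  note ld = cochain_limitD[OF L] and fd = cochain_limitD[OF FL]
  have u_eq: "f = g" if "f \<in> hom C a u" "g \<in> hom C a u" for f g a
    using u that hom_obj[OF that(1)] unfolding is_terminal_def by blast
  \<comment> \<open>Applying \<open>F\<close> shifts the chain by one, so the projections
    \<open>p (Suc n)\<close> form a cone over the chain whose limit is \<open>FObj F L\<close>; the
    induced map is \<open>out\<close>.\<close>
  have "p (Suc n) \<in> hom C L (FObj F (X n))" for n using ld(4)[of "Suc n"] X by simp
  moreover have "p (Suc (Suc n)) \<cdot> FArr F (d n) = p (Suc n)" for n using ld(5)[of "Suc n"] d by simp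
  ultimately obtain out where out: "out \<in> hom C L (FObj F L)" "\<And>n. out \<cdot> FArr F (p n) = p (Suc n)"
    using limit_tupleE[OF FL ld(3), of "\<lambda>n. p (Suc n)"] by blast
  have "is_final_coalgebra C F L out"
    unfolding is_final_coalgebra_def
  proof (intro conjI allI impI F ld(3) out(1))
    fix x c assume "x \<in> Obj C \<and> c \<in> hom C x (FObj F x)"
    then have x: "x \<in> Obj C" and c: "c \<in> hom C x (FObj F x)" by auto
    obtain t where t: "t \<in> hom C x u" using u x unfolding is_terminal_def by blast
    \<comment> \<open>\<open>f n\<close> unfolds the coalgebra \<open>c\<close> to depth
      \<open>n\<close> and forgets what lies below, by means of the map \<open>t\<close> into the
      terminal object.\<close>
    define f where "f = rec_nat t (\<lambda>n r. c \<cdot> FArr F r)"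
    have fS: "f (Suc n) = c \<cdot> FArr F (f n)" for n by (simp add: f_def)
    have f: "f n \<in> hom C x (X n)" for n
    proof (induction n)
      case 0 then show ?case using t X by (simp add: f_def)
    next
      case (Suc n) then show ?case using comp_hom[OF c F.FArr_hom[OF Suc]] X fS by simp
    qed
    have cone: "f (Suc n) \<cdot> d n = f n" for n
    proof (induction n)
      case 0
      show ?case using u_eq[of "f (Suc 0) \<cdot> d 0" x "f 0"] comp_hom[OF f[of "Suc 0"] ld(2)[of 0]] f[of 0] X by simp
    next
      case (Suc n)
      have "f (Suc (Suc n)) \<cdot> d (Suc n) = c \<cdot> (FArr F (f (Suc n)) \<cdot> FArr F (d n))"
        using comp_assoc[OF c F.FArr_hom[OF f[of "Suc n"]] F.FArr_hom[OF ld(2)[of n]]] fS d by simp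
      also have "\<dots> = c \<cdot> FArr F (f n)" using F.FArr_comp[OF f[of "Suc n"] ld(2)[of n]] Suc by simp
      finally show ?case using fS by simp
    qed
    obtain h where h: "h \<in> hom C x L" "\<And>n. h \<cdot> p n = f n"
      using limit_tupleE[OF L x f cone] by blast
    have "h \<cdot> out = c \<cdot> FArr F h"
    proof (rule limit_eqI[OF FL comp_hom[OF h(1) out(1)] comp_hom[OF c F.FArr_hom[OF h(1)]]])
      fix n
      show "h \<cdot> out \<cdot> FArr F (p n) = c \<cdot> FArr F h \<cdot> FArr F (p n)"
        using comp_assoc[OF h(1) out(1) fd(4), of n] comp_assoc[OF c F.FArr_hom[OF h(1)] fd(4), of n] out(2)[of n]
          h(2)[of n] h(2)[of "Suc n"] F.FArr_comp[OF h(1) ld(4), of n] fS by simp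
    qed
    \<comment> \<open>A coalgebra morphism has no freedom: by induction its \<open>n\<close>-th
      projection must be \<open>f n\<close>, the base case being a map into the terminal
      object.\<close>
    moreover have "k = h" if k: "k \<in> hom C x L" "k \<cdot> out = c \<cdot> FArr F k" for k
    proof (rule limit_eqI[OF L k(1) h(1)])
      fix n
      have "k \<cdot> p n = f n"
      proof (induction n)
        case 0
        show ?case using u_eq[of "k \<cdot> p 0" x "f 0"] comp_hom[OF k(1) ld(4)[of 0]] f[of 0] X by simp
      next
        case (Suc n)
        have "k \<cdot> p (Suc n) = (k \<cdot> out) \<cdot> FArr F (p n)"
          using comp_assoc[OF k(1) out(1) fd(4), of n] out(2)[of n] by simp
        also have "\<dots> = c \<cdot> FArr F (k \<cdot> p n)"
          using comp_assoc[OF c F.FArr_hom[OF k(1)] fd(4), of n] k(2) F.FArr_comp[OF k(1) ld(4), of n] by simp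
        finally show ?case using Suc fS by simp
      qed
      then show "k \<cdot> p n = h \<cdot> p n" using h(2) by simp
    qed
    ultimately show "\<exists>!h. h \<in> hom C x L \<and> h \<cdot> out = c \<cdot> FArr F h" using h(1) by blast
  qed
  then show ?thesis using that by blast
qed

text \<open>Lambek's lemma. The inverse is the morphism from the coalgebra
  \<open>FArr F out\<close>; then \<open>out \<cdot> h\<close> is an endomorphism of the final
  coalgebra, hence the identity.\<close>

lemma final_coalgebra_iso:
  assumes fin: "is_final_coalgebra C F T out"
  shows "is_iso C out"
proof -
  have F: "is_functor C C F" and T: "T \<in> Obj C" and out: "out \<in> hom C T (FObj F T)"
    and ex: "\<And>x d. \<lbrakk>x \<in> Obj C; d \<in> hom C x (FObj F x)\<rbrakk> \<Longrightarrow> \<exists>!h. h \<in> hom C x T \<and> h \<cdot> out = d \<cdot> FArr F h"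
    using fin unfolding is_final_coalgebra_def by auto
  interpret F: is_functor C C F by fact
  have Fo: "FArr F out \<in> hom C (FObj F T) (FObj F (FObj F T))" using F.FArr_hom[OF out] .
  obtain h where h: "h \<in> hom C (FObj F T) T" "h \<cdot> out = FArr F out \<cdot> FArr F h"
    using ex[OF F.FObj_obj[OF T] Fo] by blast
  have "(out \<cdot> h) \<cdot> out = out \<cdot> FArr F (out \<cdot> h)"
    using comp_assoc[OF out h(1) out] h(2) F.FArr_comp[OF out h(1)] by simp
  moreover have "Idt C T \<cdot> out = out \<cdot> FArr F (Idt C T)"
    using idt_comp[OF out] comp_idt[OF out] F.FArr_idt[OF T] by simp
  ultimately have 1: "out \<cdot> h = Idt C T"
    using ex[OF T out] comp_hom[OF out h(1)] idt_hom[OF T] by blast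
  have "h \<cdot> out = Idt C (FObj F T)" using h(2) F.FArr_comp[OF out h(1)] 1 F.FArr_idt[OF T] by simp
  then show ?thesis using 1 h(1) is_inverse_iff[OF out] unfolding is_iso_def by blast
qed

end

section \<open>Substitution systems\<close>

context monoidal_category
begin

lemma tens_whisker:
  assumes f: "f \<in> hom V x x'" and g: "g \<in> hom V y y'"
  shows "(Idt V x \<odot> g) \<cdot> (f \<odot> Idt V y') = (f \<odot> Idt V y) \<cdot> (Idt V x' \<odot> g)"
proof -
  note o = hom_obj[OF f] hom_obj[OF g]
  have "(Idt V x \<odot> g) \<cdot> (f \<odot> Idt V y') = (Idt V x \<cdot> f) \<odot> (g \<cdot> Idt V y')"
    using tens_comp[OF idt_hom f g idt_hom] o by simp
  moreover have "(f \<odot> Idt V y) \<cdot> (Idt V x' \<odot> g) = (f \<cdot> Idt V x') \<odot> (Idt V y \<cdot> g)"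
    using tens_comp[OF f idt_hom idt_hom g] o by simp
  ultimately show ?thesis using idt_comp comp_idt f g by simp
qed

lemma tens_idt_comp:
  assumes f: "f \<in> hom V x y" and g: "g \<in> hom V y z" and w: "w \<in> Obj V"
  shows "Idt V w \<odot> (f \<cdot> g) = (Idt V w \<odot> f) \<cdot> (Idt V w \<odot> g)"
  using tens_comp[OF idt_hom[OF w] idt_hom[OF w] f g] idt_comp[OF idt_hom[OF w]] by simp

end

context pointed_strength
begin

text \<open>Primitive corecursion: a coalgebra on \<open>Z \<otimes> T + T\<close> that is \<open>out\<close> on the right summand.\<close>

theorem is_mhss_final_coalgebra:
  assumes fin: "is_final_coalgebra V F T out"
    and sum: "\<And>X. X \<in> Obj V \<Longrightarrow> is_coproduct2 V (Unit V) (FObj H X) (FObj F X) (inl X) (inr X)"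
    and sum_map: "\<And>f X Y. f \<in> hom V X Y \<Longrightarrow> inl X \<cdot> FArr F f = inl Y"
      "\<And>f X Y. f \<in> hom V X Y \<Longrightarrow> inr X \<cdot> FArr F f = FArr H f \<cdot> inr Y"
    and tens_sum: "\<And>Z X. \<lbrakk>Z \<in> Obj V; X \<in> Obj V\<rbrakk> \<Longrightarrow>
      is_coproduct2 V (Z \<otimes> Unit V) (Z \<otimes> FObj H X) (Z \<otimes> FObj F X) (Idt V Z \<odot> inl X) (Idt V Z \<odot> inr X)"
    and sums: "\<And>X Y. \<lbrakk>X \<in> Obj V; Y \<in> Obj V\<rbrakk> \<Longrightarrow> \<exists>P i j. is_coproduct2 V X Y P i j"
  shows "is_mhss V H \<theta> T (inl T \<cdot> inv_arr V out) (inr T \<cdot> inv_arr V out)"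
proof -
  define \<eta> where "\<eta> = inl T \<cdot> inv_arr V out"
  define \<tau> where "\<tau> = inr T \<cdot> inv_arr V out"
  have F: "is_functor V V F" and T: "T \<in> Obj V" and out: "out \<in> hom V T (FObj F T)"
    and ex: "\<And>x d. \<lbrakk>x \<in> Obj V; d \<in> hom V x (FObj F x)\<rbrakk> \<Longrightarrow> \<exists>!h. h \<in> hom V x T \<and> h \<cdot> out = d \<cdot> FArr F h"
    using fin unfolding is_final_coalgebra_def by auto
  interpret F: is_functor V V F by fact
  define o' where "o' = inv_arr V out"
  have o': "o' \<in> hom V (FObj F T) T" "out \<cdot> o' = Idt V T" "o' \<cdot> out = Idt V (FObj F T)"
    using is_inverse_inv_arr[OF final_coalgebra_iso[OF fin]] is_inverse_iff[OF out] unfolding o'_def by auto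
  note S = coproduct2D[OF sum]
  have \<eta>: "\<eta> \<in> hom V (Unit V) T" and \<tau>: "\<tau> \<in> hom V (FObj H T) T"
    unfolding \<eta>_def \<tau>_def o'_def[symmetric] using comp_hom[OF S(2)[OF T] o'(1)] comp_hom[OF S(3)[OF T] o'(1)] by auto
  have \<eta>_out: "\<eta> \<cdot> out = inl T" and \<tau>_out: "\<tau> \<cdot> out = inr T"
    unfolding \<eta>_def \<tau>_def o'_def[symmetric]
    using comp_assoc[OF S(2)[OF T] o'(1) out] comp_assoc[OF S(3)[OF T] o'(1) out] o'(3)
      comp_idt[OF S(2)[OF T]] comp_idt[OF S(3)[OF T]] by simp_all
  have out_cancel: "h = k" if "h \<in> hom V a T" "k \<in> hom V a T" "h \<cdot> out = k \<cdot> out" for h k a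
  proof -
    have *: "g = (g \<cdot> out) \<cdot> o'" if "g \<in> hom V a T" for g
      using comp_assoc[OF that out o'(1)] o'(2) comp_idt[OF that] by (simp only:)
    show ?thesis using *[OF that(1)] *[OF that(2)] that(3) by (simp only:)
  qed
  have "is_mhss V H \<theta> T \<eta> \<tau>"
    unfolding is_mhss_def
  proof (intro conjI allI impI T \<eta> \<tau>)
    fix z e f assume "z \<in> Obj V \<and> e \<in> hom V (Unit V) z \<and> f \<in> hom V z T"
    then have z: "z \<in> Obj V" and e: "e \<in> hom V (Unit V) z" and f: "f \<in> hom V z T" by auto
    have zT: "z \<otimes> T \<in> Obj V" using tens_obj[OF z T] .
    have ze: "(z, e) \<in> ptd_obj V" using z e by (simp add: ptd_obj_def)
    have th: "\<theta> (z, e) T \<in> hom V (z \<otimes> FObj H T) (FObj H (z \<otimes> T))" using strength_hom[OF ze T] by simp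
    have zo: "Idt V z \<odot> o' \<in> hom V (z \<otimes> FObj F T) (z \<otimes> T)" "Idt V z \<odot> out \<in> hom V (z \<otimes> T) (z \<otimes> FObj F T)"
      using tens_hom[OF idt_hom[OF z] o'(1)] tens_hom[OF idt_hom[OF z] out] by auto
    have "is_inverse V (Idt V z \<odot> o') (Idt V z \<odot> out)"
      unfolding is_inverse_iff[OF zo(1)]
      using zo(2) tens_idt_comp[OF out o'(1) z] tens_idt_comp[OF o'(1) out z] o' tens_idt[OF z T] tens_idt[OF z F.FObj_obj[OF T]]
      by simp
    \<comment> \<open>Tensoring the decomposition of \<open>FObj F T\<close> with \<open>z\<close>
      and moving it along \<open>o'\<close> splits \<open>z \<otimes> T\<close> into a part for
      \<open>\<eta>\<close> and a part for \<open>\<tau>\<close>. The two MHSS equations prescribe a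
      map on exactly these parts.\<close>
    from coproduct2_transport_iso[OF tens_sum[OF z T] zo(1) this]
    have ZT: "is_coproduct2 V (z \<otimes> Unit V) (z \<otimes> FObj H T) (z \<otimes> T) (Idt V z \<odot> \<eta>) (Idt V z \<odot> \<tau>)"
      unfolding \<eta>_def \<tau>_def o'_def[symmetric]
      using tens_idt_comp[OF S(2)[OF T] o'(1) z] tens_idt_comp[OF S(3)[OF T] o'(1) z] by simp
    note ZTD = coproduct2D[OF ZT]
    obtain P i j where P: "is_coproduct2 V (z \<otimes> T) T P i j" using sums[OF zT T] by blast
    note PD = coproduct2D[OF P]
    have rf: "Rho V z \<cdot> f \<in> hom V (z \<otimes> Unit V) T" using comp_hom[OF rho_hom[OF z] f] .
    note Fj = F.FArr_hom[OF PD(3)] and Hi = H.FArr_hom[OF PD(2)]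
    \<comment> \<open>\<open>c\<close> is one step of substitution. On the part for
      \<open>\<eta>\<close> it applies \<open>f\<close> and unfolds the result once in
      \<open>T\<close>, marking what remains by \<open>j\<close> as finished; on the part for
      \<open>\<tau>\<close> it pushes \<open>z\<close> inside by the strength and marks what remains
      by \<open>i\<close> as still to be treated.\<close>
    obtain c where c: "c \<in> hom V (z \<otimes> T) (FObj F P)"
      "(Idt V z \<odot> \<eta>) \<cdot> c = (Rho V z \<cdot> f) \<cdot> (out \<cdot> FArr F j)"
      "(Idt V z \<odot> \<tau>) \<cdot> c = \<theta> (z, e) T \<cdot> (FArr H i \<cdot> inr P)"
      using copairE[OF ZT comp_hom[OF rf comp_hom[OF out Fj]] comp_hom[OF th comp_hom[OF Hi S(3)[OF PD(1)]]]] by blast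
    obtain d where d: "d \<in> hom V P (FObj F P)" "i \<cdot> d = c" "j \<cdot> d = out \<cdot> FArr F j"
      using copairE[OF P c(1) comp_hom[OF out Fj]] by blast
    \<comment> \<open>The MHSS equations are equations of maps into \<open>T\<close>. Composed with
      the isomorphism \<open>out\<close> and tested on the summands of \<open>P\<close> and of
      \<open>z \<otimes> T\<close>, they say that \<open>u\<close> is a coalgebra morphism. The
      assumption \<open>ju\<close> expresses that finished parts are left alone.\<close>
    have key: "is_mhss_map V H \<theta> T \<eta> \<tau> z e f (i \<cdot> u) \<longleftrightarrow> u \<cdot> out = d \<cdot> FArr F u"
      if u: "u \<in> hom V P T" and ju: "j \<cdot> u = Idt V T" for u
    proof -
      note Fu = F.FArr_hom[OF u]
      have iu: "i \<cdot> u \<in> hom V (z \<otimes> T) T" using comp_hom[OF PD(2) u] .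
      have cu: "c \<cdot> FArr F u \<in> hom V (z \<otimes> T) (FObj F T)" using comp_hom[OF c(1) Fu] .
      have j1: "j \<cdot> (u \<cdot> out) = out" using comp_assoc[OF PD(3) u out] ju idt_comp[OF out] by simp
      have "FArr F j \<cdot> FArr F u = Idt V (FObj F T)" using F.FArr_comp[OF PD(3) u] ju F.FArr_idt[OF T] by simp
      then have oj: "(out \<cdot> FArr F j) \<cdot> FArr F u = out"
        using comp_assoc[OF out Fj Fu] comp_idt[OF out] by simp
      then have j2: "j \<cdot> (d \<cdot> FArr F u) = out" using comp_assoc[OF PD(3) d(1) Fu] d(3) by simp
      have i1: "i \<cdot> (u \<cdot> out) = (i \<cdot> u) \<cdot> out" using comp_assoc[OF PD(2) u out] by simp
      have i2: "i \<cdot> (d \<cdot> FArr F u) = c \<cdot> FArr F u" using comp_assoc[OF PD(2) d(1) Fu] d(2) by simp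
      have A: "u \<cdot> out = d \<cdot> FArr F u \<longleftrightarrow> (i \<cdot> u) \<cdot> out = c \<cdot> FArr F u"
        using copair_eqI[OF P comp_hom[OF u out] comp_hom[OF d(1) Fu]] j1 j2 i1 i2 by auto
      have e1: "(Idt V z \<odot> \<eta>) \<cdot> (c \<cdot> FArr F u) = (Rho V z \<cdot> f) \<cdot> out"
        using comp_assoc[OF ZTD(2) c(1) Fu] c(2) comp_assoc[OF rf comp_hom[OF out Fj] Fu] oj by simp
      have "(FArr H i \<cdot> inr P) \<cdot> FArr F u = FArr H (i \<cdot> u) \<cdot> inr T"
        using comp_assoc[OF Hi S(3)[OF PD(1)] Fu] sum_map(2)[OF u] H.FArr_comp[OF PD(2) u]
          comp_assoc[OF Hi H.FArr_hom[OF u] S(3)[OF T]] by simp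
      also have "\<dots> = (FArr H (i \<cdot> u) \<cdot> \<tau>) \<cdot> out"
        using \<tau>_out comp_assoc[OF H.FArr_hom[OF iu] \<tau> out] by simp
      finally have e2: "(Idt V z \<odot> \<tau>) \<cdot> (c \<cdot> FArr F u) = (\<theta> (z, e) T \<cdot> FArr H (i \<cdot> u) \<cdot> \<tau>) \<cdot> out"
        using comp_assoc[OF ZTD(3) c(1) Fu] c(3) comp_assoc[OF th comp_hom[OF Hi S(3)[OF PD(1)]] Fu]
          comp_assoc[OF th comp_hom[OF H.FArr_hom[OF iu] \<tau>] out] comp_assoc[OF th H.FArr_hom[OF iu] \<tau>] by simp
      have thH: "\<theta> (z, e) T \<cdot> FArr H (i \<cdot> u) \<cdot> \<tau> \<in> hom V (z \<otimes> FObj H T) T"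
        using comp_hom[OF comp_hom[OF th H.FArr_hom[OF iu]] \<tau>] .
      have "(i \<cdot> u) \<cdot> out = c \<cdot> FArr F u \<longleftrightarrow>
          (Idt V z \<odot> \<eta>) \<cdot> ((i \<cdot> u) \<cdot> out) = (Rho V z \<cdot> f) \<cdot> out \<and>
          (Idt V z \<odot> \<tau>) \<cdot> ((i \<cdot> u) \<cdot> out) = (\<theta> (z, e) T \<cdot> FArr H (i \<cdot> u) \<cdot> \<tau>) \<cdot> out"
        using copair_eqI[OF ZT comp_hom[OF iu out] cu] e1 e2 by auto
      also have "\<dots> \<longleftrightarrow> (Idt V z \<odot> \<eta>) \<cdot> (i \<cdot> u) = Rho V z \<cdot> f \<and>
          (Idt V z \<odot> \<tau>) \<cdot> (i \<cdot> u) = \<theta> (z, e) T \<cdot> FArr H (i \<cdot> u) \<cdot> \<tau>"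
        using comp_assoc[OF ZTD(2) iu out] comp_assoc[OF ZTD(3) iu out]
          out_cancel[OF comp_hom[OF ZTD(2) iu] rf] out_cancel[OF comp_hom[OF ZTD(3) iu] thH] by auto
      finally show ?thesis using A iu unfolding is_mhss_map_def by blast
    qed
    obtain u where u: "u \<in> hom V P T" "u \<cdot> out = d \<cdot> FArr F u"
      and u_unique: "\<And>k. \<lbrakk>k \<in> hom V P T; k \<cdot> out = d \<cdot> FArr F k\<rbrakk> \<Longrightarrow> k = u"
      using ex[OF PD(1) d(1)] by blast
    \<comment> \<open>On the right summand \<open>d\<close> acts as \<open>out\<close>, so
      \<open>j \<cdot> u\<close> is an endomorphism of the final coalgebra.\<close>
    have ju: "j \<cdot> u = Idt V T"
    proof -
      have "(j \<cdot> u) \<cdot> out = out \<cdot> FArr F (j \<cdot> u)"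
        using comp_assoc[OF PD(3) u(1) out] u(2) comp_assoc[OF PD(3) d(1) F.FArr_hom[OF u(1)]] d(3)
          comp_assoc[OF out Fj F.FArr_hom[OF u(1)]] F.FArr_comp[OF PD(3) u(1)] by simp
      moreover have "Idt V T \<cdot> out = out \<cdot> FArr F (Idt V T)"
        using idt_comp[OF out] comp_idt[OF out] F.FArr_idt[OF T] by simp
      ultimately show ?thesis using ex[OF T out] comp_hom[OF PD(3) u(1)] idt_hom[OF T] by blast
    qed
    show "\<exists>!h. is_mhss_map V H \<theta> T \<eta> \<tau> z e f h"
    proof (rule ex1I[of _ "i \<cdot> u"])
      show "is_mhss_map V H \<theta> T \<eta> \<tau> z e f (i \<cdot> u)" using key[OF u(1) ju] u(2) by blast
      fix h assume h: "is_mhss_map V H \<theta> T \<eta> \<tau> z e f h"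
      then have hh: "h \<in> hom V (z \<otimes> T) T" unfolding is_mhss_map_def by blast
      \<comment> \<open>A competing solution \<open>h\<close> is extended to \<open>P\<close> by the
        identity on \<open>T\<close>; by \<open>key\<close> the extension is a coalgebra morphism
        and hence equals \<open>u\<close>.\<close>
      obtain k where k: "k \<in> hom V P T" "i \<cdot> k = h" "j \<cdot> k = Idt V T"
        using copairE[OF P hh idt_hom[OF T]] by blast
      then show "h = i \<cdot> u" using key[OF k(1,3)] h u_unique by auto
    qed
  qed
  then show ?thesis unfolding \<eta>_def \<tau>_def .
qed

text \<open>The two coherence hypotheses hold in every monoidal category (Kelly), but are not part of the
  definition used here.\<close>

theorem is_strength_monoid_mhss:
  assumes mhss: "is_mhss V H \<theta> T \<eta> \<tau>"
    and lam_rho: "Lam V (Unit V) = Rho V (Unit V)"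
    and rho_tens: "Assoc V T T (Unit V) \<cdot> (Idt V T \<odot> Rho V T) = Rho V (T \<otimes> T)"
  shows "is_strength_monoid V H \<theta> T \<eta> (mhss_map V H \<theta> T \<eta> \<tau> T \<eta> (Idt V T)) \<tau>"
proof -
  define \<mu> where "\<mu> = mhss_map V H \<theta> T \<eta> \<tau> T \<eta> (Idt V T)"
  have T: "T \<in> Obj V" and \<eta>: "\<eta> \<in> hom V (Unit V) T" and \<tau>: "\<tau> \<in> hom V (FObj H T) T"
    and ex: "\<And>z e f. \<lbrakk>z \<in> Obj V; e \<in> hom V (Unit V) z; f \<in> hom V z T\<rbrakk>
      \<Longrightarrow> \<exists>!h. is_mhss_map V H \<theta> T \<eta> \<tau> z e f h"
    using mhss unfolding is_mhss_def by auto
  have HT: "FObj H T \<in> Obj V" using H.FObj_obj[OF T] .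
  have 1: "Idt V T \<in> hom V T T" using idt_hom[OF T] .
  have I1: "Idt V (Unit V) \<in> hom V (Unit V) (Unit V)" using idt_hom[OF unit_obj] .
  have H1: "Idt V (FObj H T) \<in> hom V (FObj H T) (FObj H T)" using idt_hom[OF HT] .
  have TT: "T \<otimes> T \<in> Obj V" using tens_obj[OF T T] .
  have "is_mhss_map V H \<theta> T \<eta> \<tau> T \<eta> (Idt V T) \<mu>"
    unfolding \<mu>_def mhss_map_def by (rule theI'[OF ex[OF T \<eta> 1]])
  then have \<mu>: "\<mu> \<in> hom V (T \<otimes> T) T" and \<eta>\<mu>: "(Idt V T \<odot> \<eta>) \<cdot> \<mu> = Rho V T"
    and \<tau>\<mu>: "(Idt V T \<odot> \<tau>) \<cdot> \<mu> = \<theta> (T, \<eta>) T \<cdot> FArr H \<mu> \<cdot> \<tau>"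
    using comp_idt[OF rho_hom[OF T]] unfolding is_mhss_map_def by auto
  have T\<eta>: "(T, \<eta>) \<in> ptd_obj V" and I: "ptd_unit V \<in> ptd_obj V"
    using T \<eta> unit_obj I1 by (auto simp: ptd_obj_def ptd_unit_def)
  have th: "\<theta> (T, \<eta>) X \<in> hom V (T \<otimes> FObj H X) (FObj H (T \<otimes> X))" if "X \<in> Obj V" for X
    using strength_hom[OF T\<eta> that] by simp
  note H\<mu> = H.FArr_hom[OF \<mu>]
  \<comment> \<open>If \<open>f\<close> is a morphism of pointed objects from \<open>(z, e)\<close>
    to \<open>(T, \<eta>)\<close>, then \<open>f \<odot> Idt V T\<close> followed by
    \<open>\<mu>\<close> solves the MHSS equations for \<open>z\<close>, \<open>e\<close>,
    \<open>f\<close>: naturality of the strength in its pointed argument carries the equations of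
    \<open>\<mu>\<close> over. The left unit law and associativity both rest on this.\<close>
  have pre: "(Idt V z \<odot> \<tau>) \<cdot> ((f \<odot> Idt V T) \<cdot> \<mu>) = \<theta> (z, e) T \<cdot> FArr H ((f \<odot> Idt V T) \<cdot> \<mu>) \<cdot> \<tau>"
    "(Idt V z \<odot> \<eta>) \<cdot> ((f \<odot> Idt V T) \<cdot> \<mu>) = Rho V z \<cdot> f"
    if z: "z \<in> Obj V" and e: "e \<in> hom V (Unit V) z" and f: "f \<in> hom V z T" and ef: "e \<cdot> f = \<eta>" for z e f
  proof -
    note z1 = idt_hom[OF z]
    have f1: "f \<odot> Idt V T \<in> hom V (z \<otimes> T) (T \<otimes> T)" using tens_hom[OF f 1] .
    have ze: "(z, e) \<in> ptd_obj V" using z e by (simp add: ptd_obj_def)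
    have thz: "\<theta> (z, e) T \<in> hom V (z \<otimes> FObj H T) (FObj H (z \<otimes> T))" using strength_hom[OF ze T] by simp
    have "f \<in> ptd_hom V (z, e) (T, \<eta>)" using f ef by (simp add: ptd_hom_def)
    from strength_natural[OF ze T\<eta> this 1]
    have nat: "(f \<odot> Idt V (FObj H T)) \<cdot> \<theta> (T, \<eta>) T = \<theta> (z, e) T \<cdot> FArr H (f \<odot> Idt V T)"
      using H.FArr_idt[OF T] by simp
    have fH: "f \<odot> Idt V (FObj H T) \<in> hom V (z \<otimes> FObj H T) (T \<otimes> FObj H T)" using tens_hom[OF f H1] .
    have "(Idt V z \<odot> \<tau>) \<cdot> ((f \<odot> Idt V T) \<cdot> \<mu>) = (f \<odot> Idt V (FObj H T)) \<cdot> ((Idt V T \<odot> \<tau>) \<cdot> \<mu>)"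
      by (rule comp_eq_extend[OF tens_whisker[OF f \<tau>] tens_hom[OF z1 \<tau>] f1 fH tens_hom[OF 1 \<tau>] \<mu>])
    also have "\<dots> = ((f \<odot> Idt V (FObj H T)) \<cdot> \<theta> (T, \<eta>) T) \<cdot> (FArr H \<mu> \<cdot> \<tau>)"
      unfolding \<tau>\<mu> using comp_assoc[OF th[OF T] H\<mu> \<tau>] comp_assoc[OF fH th[OF T] comp_hom[OF H\<mu> \<tau>]] by simp
    also have "\<dots> = \<theta> (z, e) T \<cdot> (FArr H (f \<odot> Idt V T) \<cdot> FArr H \<mu>) \<cdot> \<tau>"
      unfolding nat using comp_assoc[OF thz H.FArr_hom[OF f1] comp_hom[OF H\<mu> \<tau>]] comp_assoc[OF H.FArr_hom[OF f1] H\<mu> \<tau>]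
        comp_assoc[OF thz comp_hom[OF H.FArr_hom[OF f1] H\<mu>] \<tau>] by simp
    finally show "(Idt V z \<odot> \<tau>) \<cdot> ((f \<odot> Idt V T) \<cdot> \<mu>) = \<theta> (z, e) T \<cdot> FArr H ((f \<odot> Idt V T) \<cdot> \<mu>) \<cdot> \<tau>"
      using H.FArr_comp[OF f1 \<mu>] by simp
    have "(Idt V z \<odot> \<eta>) \<cdot> ((f \<odot> Idt V T) \<cdot> \<mu>) = (f \<odot> Idt V (Unit V)) \<cdot> ((Idt V T \<odot> \<eta>) \<cdot> \<mu>)"
      by (rule comp_eq_extend[OF tens_whisker[OF f \<eta>] tens_hom[OF z1 \<eta>] f1 tens_hom[OF f I1] tens_hom[OF 1 \<eta>] \<mu>])
    then show "(Idt V z \<odot> \<eta>) \<cdot> ((f \<odot> Idt V T) \<cdot> \<mu>) = Rho V z \<cdot> f"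
      unfolding \<eta>\<mu> using rho_natural[OF f] by simp
  qed
  \<comment> \<open>The left unitor also solves the equations for the unit object with
    \<open>f = \<eta>\<close>, by naturality of \<open>Lam\<close> and the unit law of the
    strength.\<close>
  have left_unit: "(\<eta> \<odot> Idt V T) \<cdot> \<mu> = Lam V T"
  proof -
    have "is_mhss_map V H \<theta> T \<eta> \<tau> (Unit V) (Idt V (Unit V)) \<eta> ((\<eta> \<odot> Idt V T) \<cdot> \<mu>)"
      unfolding is_mhss_map_def
      using pre[OF unit_obj I1 \<eta> idt_comp[OF \<eta>]] comp_hom[OF tens_hom[OF \<eta> 1] \<mu>] by blast
    moreover have "is_mhss_map V H \<theta> T \<eta> \<tau> (Unit V) (Idt V (Unit V)) \<eta> (Lam V T)"
      unfolding is_mhss_map_def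
      using lam_hom[OF T] lam_natural[OF \<eta>] lam_natural[OF \<tau>] lam_rho strength_unit[OF T, unfolded ptd_unit_def] by simp
    ultimately show ?thesis using ex[OF unit_obj I1 \<eta>] by blast
  qed
  define li where "li = inv_arr V (Lam V (Unit V))"
  have li: "li \<in> hom V (Unit V) (Unit V \<otimes> Unit V)" "li \<cdot> Lam V (Unit V) = Idt V (Unit V)"
    using is_inverse_inv_arr[OF lam_iso[OF unit_obj]] is_inverse_iff[OF lam_hom[OF unit_obj]]
    unfolding li_def by auto
  \<comment> \<open>The point of \<open>T \<otimes> T\<close> is written exactly as in
    \<open>ptd_tens\<close>, so that the tensor law of the strength applies to it.\<close>
  define e where "e = li \<cdot> (\<eta> \<odot> \<eta>)"
  have ee: "\<eta> \<odot> \<eta> \<in> hom V (Unit V \<otimes> Unit V) (T \<otimes> T)" using tens_hom[OF \<eta> \<eta>] .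
  have e: "e \<in> hom V (Unit V) (T \<otimes> T)" unfolding e_def using comp_hom[OF li(1) ee] .
  have \<eta>\<eta>: "\<eta> \<odot> \<eta> = (Idt V (Unit V) \<odot> \<eta>) \<cdot> (\<eta> \<odot> Idt V T)"
    using tens_comp[OF I1 \<eta> \<eta> 1] idt_comp[OF \<eta>] comp_idt[OF \<eta>] by simp
  have "(\<eta> \<odot> \<eta>) \<cdot> \<mu> = Lam V (Unit V) \<cdot> \<eta>"
    unfolding \<eta>\<eta> using comp_assoc[OF tens_hom[OF I1 \<eta>] tens_hom[OF \<eta> 1] \<mu>] left_unit lam_natural[OF \<eta>] by simp
  \<comment> \<open>\<open>\<mu>\<close> preserves points, which is what \<open>pre\<close> requires
    when \<open>z\<close> is \<open>T \<otimes> T\<close> and \<open>f\<close> is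
    \<open>\<mu>\<close>.\<close>
  then have e\<mu>: "e \<cdot> \<mu> = \<eta>"
    unfolding e_def using comp_assoc[OF li(1) ee \<mu>] comp_assoc[OF li(1) lam_hom[OF unit_obj] \<eta>] li(2) idt_comp[OF \<eta>]
    by simp
  \<comment> \<open>Both sides are maps out of \<open>(T \<otimes> T) \<otimes> T\<close> that
    restrict to \<open>\<mu>\<close> along \<open>\<eta>\<close> in the last factor; they are two
    solutions of one MHSS problem, posed for the pointed object
    \<open>(T \<otimes> T, e)\<close>.\<close>
  have assoc_law: "(\<mu> \<odot> Idt V T) \<cdot> \<mu> = Assoc V T T T \<cdot> (Idt V T \<odot> \<mu>) \<cdot> \<mu>"
  proof -
    have "is_mhss_map V H \<theta> T \<eta> \<tau> (T \<otimes> T) e \<mu> ((\<mu> \<odot> Idt V T) \<cdot> \<mu>)"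
      unfolding is_mhss_map_def
      using pre[OF TT e \<mu> e\<mu>] comp_hom[OF tens_hom[OF \<mu> 1] \<mu>] by blast
    moreover have "is_mhss_map V H \<theta> T \<eta> \<tau> (T \<otimes> T) e \<mu> (Assoc V T T T \<cdot> (Idt V T \<odot> \<mu>) \<cdot> \<mu>)"
      unfolding is_mhss_map_def
    proof (intro conjI)
      let ?a = "Assoc V T T T"
      have a: "?a \<in> hom V (T \<otimes> T \<otimes> T) (T \<otimes> (T \<otimes> T))" using assoc_hom[OF T T T] .
      have m1: "Idt V T \<odot> \<mu> \<in> hom V (T \<otimes> (T \<otimes> T)) (T \<otimes> T)" using tens_hom[OF 1 \<mu>] .
      show "?a \<cdot> (Idt V T \<odot> \<mu>) \<cdot> \<mu> \<in> hom V (T \<otimes> T \<otimes> T) T" using comp_hom[OF comp_hom[OF a m1] \<mu>] .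
      \<comment> \<open>Naturality of the associator moves a map on the third factor next to the
        inner \<open>\<mu>\<close>, where the equations \<open>\<eta>\<mu>\<close> and
        \<open>\<tau>\<mu>\<close> can be used; it is needed for \<open>\<eta>\<close> and for
        \<open>\<tau>\<close>.\<close>
      have step: "(Idt V (T \<otimes> T) \<odot> g) \<cdot> (?a \<cdot> (Idt V T \<odot> \<mu>) \<cdot> \<mu>)
          = Assoc V T T X \<cdot> ((Idt V T \<odot> ((Idt V T \<odot> g) \<cdot> \<mu>)) \<cdot> \<mu>)" if g: "g \<in> hom V X T" for g X
      proof -
        have X: "X \<in> Obj V" using hom_obj[OF g] by blast
        have g2: "Idt V (T \<otimes> T) \<odot> g \<in> hom V (T \<otimes> T \<otimes> X) (T \<otimes> T \<otimes> T)" using tens_hom[OF idt_hom[OF TT] g] .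
        have g1: "Idt V T \<odot> g \<in> hom V (T \<otimes> X) (T \<otimes> T)" using tens_hom[OF 1 g] .
        have g3: "Idt V T \<odot> (Idt V T \<odot> g) \<in> hom V (T \<otimes> (T \<otimes> X)) (T \<otimes> (T \<otimes> T))" using tens_hom[OF 1 g1] .
        have ax: "Assoc V T T X \<in> hom V (T \<otimes> T \<otimes> X) (T \<otimes> (T \<otimes> X))" using assoc_hom[OF T T X] .
        have n: "(Idt V (T \<otimes> T) \<odot> g) \<cdot> ?a = Assoc V T T X \<cdot> (Idt V T \<odot> (Idt V T \<odot> g))"
          using assoc_natural[OF 1 1 g] tens_idt[OF T T] by simp
        have "(Idt V (T \<otimes> T) \<odot> g) \<cdot> (?a \<cdot> (Idt V T \<odot> \<mu>) \<cdot> \<mu>) = ((Idt V (T \<otimes> T) \<odot> g) \<cdot> ?a) \<cdot> ((Idt V T \<odot> \<mu>) \<cdot> \<mu>)"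
          using comp_assoc[OF a m1 \<mu>] comp_assoc[OF g2 a comp_hom[OF m1 \<mu>]] by simp
        also have "\<dots> = Assoc V T T X \<cdot> (((Idt V T \<odot> (Idt V T \<odot> g)) \<cdot> (Idt V T \<odot> \<mu>)) \<cdot> \<mu>)"
          unfolding n using comp_assoc[OF ax g3 comp_hom[OF m1 \<mu>]] comp_assoc[OF g3 m1 \<mu>] by simp
        finally show ?thesis using tens_idt_comp[OF g1 \<mu> T] by simp
      qed
      show "(Idt V (T \<otimes> T) \<odot> \<eta>) \<cdot> (?a \<cdot> (Idt V T \<odot> \<mu>) \<cdot> \<mu>) = Rho V (T \<otimes> T) \<cdot> \<mu>"
        unfolding step[OF \<eta>] \<eta>\<mu> rho_tens[symmetric]
        using comp_assoc[OF assoc_hom[OF T T unit_obj] tens_hom[OF 1 rho_hom[OF T]] \<mu>] by simp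
      let ?aH = "Assoc V T T (FObj H T)" and ?t = "\<theta> (T, \<eta>) T" and ?t2 = "\<theta> (T, \<eta>) (T \<otimes> T)"
      have aH: "?aH \<in> hom V (T \<otimes> T \<otimes> FObj H T) (T \<otimes> (T \<otimes> FObj H T))" using assoc_hom[OF T T HT] .
      have t1: "Idt V T \<odot> ?t \<in> hom V (T \<otimes> (T \<otimes> FObj H T)) (T \<otimes> FObj H (T \<otimes> T))" using tens_hom[OF 1 th[OF T]] .
      have t2: "?t2 \<in> hom V (T \<otimes> FObj H (T \<otimes> T)) (FObj H (T \<otimes> (T \<otimes> T)))" using th[OF TT] .
      have H1\<mu>: "Idt V T \<odot> FArr H \<mu> \<in> hom V (T \<otimes> FObj H (T \<otimes> T)) (T \<otimes> FObj H T)" using tens_hom[OF 1 H\<mu>] .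
      have T1: "Idt V T \<in> ptd_hom V (T, \<eta>) (T, \<eta>)" using 1 comp_idt[OF \<eta>] by (simp add: ptd_hom_def)
      \<comment> \<open>Naturality of the strength in its second argument, at \<open>\<mu>\<close>.
        Together with the tensor law \<open>tt\<close> it merges two applications of the strength of
        \<open>T\<close> into one for \<open>T \<otimes> T\<close>.\<close>
      have nat: "(Idt V T \<odot> FArr H \<mu>) \<cdot> ?t = ?t2 \<cdot> FArr H (Idt V T \<odot> \<mu>)"
        using strength_natural[OF T\<eta> T\<eta> T1 \<mu>] .
      have pt: "ptd_tens V (T, \<eta>) (T, \<eta>) = (T \<otimes> T, e)" by (simp add: ptd_tens_def e_def li_def)
      have tt: "\<theta> (T \<otimes> T, e) T \<cdot> FArr H ?a = ?aH \<cdot> (Idt V T \<odot> ?t) \<cdot> ?t2"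
        using strength_tens[OF T\<eta> T\<eta> T] pt by simp
      have TTe: "(T \<otimes> T, e) \<in> ptd_obj V" using TT e by (simp add: ptd_obj_def)
      have tht: "\<theta> (T \<otimes> T, e) T \<in> hom V (T \<otimes> T \<otimes> FObj H T) (FObj H (T \<otimes> T \<otimes> T))"
        using strength_hom[OF TTe T] by simp
      note Ha = H.FArr_hom[OF a] and Hm = H.FArr_hom[OF m1]
      have x1: "?t \<cdot> FArr H \<mu> \<in> hom V (T \<otimes> FObj H T) (FObj H T)" using comp_hom[OF th[OF T] H\<mu>] .
      have "Idt V T \<odot> (?t \<cdot> FArr H \<mu> \<cdot> \<tau>) = (Idt V T \<odot> ?t) \<cdot> ((Idt V T \<odot> FArr H \<mu>) \<cdot> (Idt V T \<odot> \<tau>))"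
        using tens_idt_comp[OF x1 \<tau> T] tens_idt_comp[OF th[OF T] H\<mu> T] comp_assoc[OF t1 H1\<mu> tens_hom[OF 1 \<tau>]] by simp
      then have "(Idt V T \<odot> (?t \<cdot> FArr H \<mu> \<cdot> \<tau>)) \<cdot> \<mu> = (Idt V T \<odot> ?t) \<cdot> ((Idt V T \<odot> FArr H \<mu>) \<cdot> ((Idt V T \<odot> \<tau>) \<cdot> \<mu>))"
        using comp_assoc[OF t1 comp_hom[OF H1\<mu> tens_hom[OF 1 \<tau>]] \<mu>] comp_assoc[OF H1\<mu> tens_hom[OF 1 \<tau>] \<mu>] by simp
      also have "\<dots> = (Idt V T \<odot> ?t) \<cdot> (((Idt V T \<odot> FArr H \<mu>) \<cdot> ?t) \<cdot> (FArr H \<mu> \<cdot> \<tau>))"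
        unfolding \<tau>\<mu> using comp_assoc[OF th[OF T] H\<mu> \<tau>] comp_assoc[OF H1\<mu> th[OF T] comp_hom[OF H\<mu> \<tau>]] by simp
      also have "\<dots> = (Idt V T \<odot> ?t) \<cdot> (?t2 \<cdot> (FArr H (Idt V T \<odot> \<mu>) \<cdot> (FArr H \<mu> \<cdot> \<tau>)))"
        unfolding nat using comp_assoc[OF t2 Hm comp_hom[OF H\<mu> \<tau>]] by simp
      finally have "?aH \<cdot> ((Idt V T \<odot> (?t \<cdot> FArr H \<mu> \<cdot> \<tau>)) \<cdot> \<mu>)
          = (?aH \<cdot> (Idt V T \<odot> ?t) \<cdot> ?t2) \<cdot> (FArr H (Idt V T \<odot> \<mu>) \<cdot> (FArr H \<mu> \<cdot> \<tau>))"
        using comp_assoc[OF comp_hom[OF aH t1] t2 comp_hom[OF Hm comp_hom[OF H\<mu> \<tau>]]]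
          comp_assoc[OF aH t1 comp_hom[OF t2 comp_hom[OF Hm comp_hom[OF H\<mu> \<tau>]]]] by simp
      also have "\<dots> = \<theta> (T \<otimes> T, e) T \<cdot> (FArr H ?a \<cdot> FArr H (Idt V T \<odot> \<mu>) \<cdot> FArr H \<mu>) \<cdot> \<tau>"
        unfolding tt[symmetric]
        using tht Ha Hm H\<mu> \<tau> by (simp add: hom_def)
      finally show "(Idt V (T \<otimes> T) \<odot> \<tau>) \<cdot> (?a \<cdot> (Idt V T \<odot> \<mu>) \<cdot> \<mu>)
          = \<theta> (T \<otimes> T, e) T \<cdot> FArr H (?a \<cdot> (Idt V T \<odot> \<mu>) \<cdot> \<mu>) \<cdot> \<tau>"
        unfolding step[OF \<tau>] \<tau>\<mu> using H.FArr_comp[OF comp_hom[OF a m1] \<mu>] H.FArr_comp[OF a m1] by simp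
    qed
    ultimately show ?thesis using ex[OF TT e \<mu>] by blast
  qed
  show ?thesis
    unfolding is_strength_monoid_def is_monoid_def \<mu>_def[symmetric]
    using T \<eta> \<mu> left_unit \<eta>\<mu> assoc_law \<tau> \<tau>\<mu> by blast
qed

end

section \<open>Sorted families\<close>

context category
begin

lemma is_coproduct2_plus:
  assumes "has_coproducts C (UNIV :: bool set)" "a \<in> Obj C" "b \<in> Obj C"
  shows "is_coproduct2 C a b (plus_obj C a b) (plus_inl C a b) (plus_inr C a b)"
  unfolding is_coproduct2_def
  by (rule is_coproduct_cong[OF is_coproduct_coprod[OF assms(1), of "\<lambda>k. if k then a else b", folded plus_obj_def]])
    (use assms in \<open>auto simp: plus_inl_def plus_inr_def\<close>)

lemma plus_map:
  assumes hc: "has_coproducts C (UNIV :: bool set)" and f: "f \<in> hom C a a'" and g: "g \<in> hom C b b'"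
  shows "plus_map C f g \<in> hom C (plus_obj C a b) (plus_obj C a' b')"
    "plus_inl C a b \<cdot> plus_map C f g = f \<cdot> plus_inl C a' b'"
    "plus_inr C a b \<cdot> plus_map C f g = g \<cdot> plus_inr C a' b'"
proof -
  have "(if i then f else g) \<in> hom C (if i then a else b) (if i then a' else b')" for i using f g by simp
  note m = coprod_map[OF hc this]
  show "plus_map C f g \<in> hom C (plus_obj C a b) (plus_obj C a' b')"
    unfolding plus_map_def plus_obj_def using m(1) by simp
  show "plus_inl C a b \<cdot> plus_map C f g = f \<cdot> plus_inl C a' b'"
    "plus_inr C a b \<cdot> plus_map C f g = g \<cdot> plus_inr C a' b'"
    unfolding plus_map_def plus_inl_def plus_inr_def using m(2)[of True] m(2)[of False] by simp_all
qed

lemma copair: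
  assumes hc: "has_coproducts C (UNIV :: bool set)" and f: "f \<in> hom C a d" and g: "g \<in> hom C b d"
  shows "copair C f g \<in> hom C (plus_obj C a b) d"
    "plus_inl C a b \<cdot> copair C f g = f" "plus_inr C a b \<cdot> copair C f g = g"
proof -
  have d: "d \<in> Obj C" "Dom C f = a" "Dom C g = b" "Cod C f = d" using f g hom_obj by (auto simp: hom_def)
  have "(if i then f else g) \<in> hom C (if i then a else b) d" for i using f g by simp
  note m = cotuple[OF hc d(1) this]
  show "copair C f g \<in> hom C (plus_obj C a b) d"
    unfolding copair_def plus_obj_def d using m(1) by simp
  show "plus_inl C a b \<cdot> copair C f g = f" "plus_inr C a b \<cdot> copair C f g = g"
    unfolding copair_def plus_inl_def plus_inr_def d using m(2)[of True] m(2)[of False] by simp_all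
qed

end

lemma category_discrete: "category (discrete S)"
  by unfold_locales (auto simp: discrete_def hom_def)

lemma discrete_simps [simp]: "Obj (discrete S) = S" "Arr (discrete S) = S"
  by (simp_all add: discrete_def)

lemma discrete_hom: "f \<in> hom (discrete S) a b \<longleftrightarrow> f \<in> S \<and> a = f \<and> b = f"
  by (auto simp: discrete_def hom_def)

lemma Idt_discrete: "Idt (discrete S) s = s" and Comp_discrete: "s \<cdot>\<^bsub>discrete S\<^esub> t = s"
  by (simp_all add: discrete_def)

locale sorted_families = category C
  for C :: "('o, 'm) category" (structure) and S :: "'s set"
begin

abbreviation D where "D \<equiv> fam_cat C S"

sublocale fam: functor_category "discrete S" C
  by (intro functor_category.intro category_discrete category_axioms)

sublocale D: category D
  unfolding fam_cat_def by (rule fam.category_FC)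

sublocale E: endofunctors D
  by unfold_locales

abbreviation E where "E \<equiv> functor_cat D D"

lemma fam_simps [simp]:
  "\<lbrakk>\<xi> \<in> Obj D; s \<in> S\<rbrakk> \<Longrightarrow> FObj \<xi> s \<in> Obj C"
  "\<lbrakk>f \<in> Arr D; s \<in> S\<rbrakk> \<Longrightarrow> NMap f s \<in> Arr C"
  "\<lbrakk>f \<in> Arr D; s \<in> S\<rbrakk> \<Longrightarrow> Dom C (NMap f s) = FObj (Dom D f) s"
  "\<lbrakk>f \<in> Arr D; s \<in> S\<rbrakk> \<Longrightarrow> Cod C (NMap f s) = FObj (Cod D f) s"
  "s \<in> S \<Longrightarrow> NMap (Idt D \<xi>) s = Idt C (FObj \<xi> s)"
  "s \<in> S \<Longrightarrow> NMap (f \<cdot>\<^bsub>D\<^esub> g) s = NMap f s \<cdot> NMap g s"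
  by (simp_all add: fam_cat_def)

lemma fam_hom: "\<lbrakk>f \<in> hom D \<xi> \<zeta>; s \<in> S\<rbrakk> \<Longrightarrow> NMap f s \<in> hom C (FObj \<xi> s) (FObj \<zeta> s)"
  by (auto simp: hom_def)

lemma fam_arr_eqI:
  "\<lbrakk>f \<in> hom D \<xi> \<zeta>; g \<in> hom D \<xi> \<zeta>; \<And>s. s \<in> S \<Longrightarrow> NMap f s = NMap g s\<rbrakk> \<Longrightarrow> f = g"
  unfolding fam_cat_def by (rule nt_eqI) auto

lemma fam_FObj [simp]: "s \<in> S \<Longrightarrow> FObj (fam_obj C S x) s = x s"
  by (simp add: fam_obj_def)

lemma fam_NMap [simp]: "s \<in> S \<Longrightarrow> NMap (fam_arr C S f) s = f s"
  by (simp add: fam_arr_def)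

lemma fam_obj_obj [simp]: "(\<And>s. s \<in> S \<Longrightarrow> x s \<in> Obj C) \<Longrightarrow> fam_obj C S x \<in> Obj D"
  unfolding fam_cat_def
  by (rule fam.functorI)
    (auto simp: fam_obj_def discrete_hom Idt_discrete Comp_discrete idt_hom)

lemma fam_obj_cong: "(\<And>s. s \<in> S \<Longrightarrow> x s = y s) \<Longrightarrow> fam_obj C S x = fam_obj C S y"
  by (auto simp: fam_obj_def)

lemma fam_arr_cong: "(\<And>s. s \<in> S \<Longrightarrow> f s = g s) \<Longrightarrow> fam_arr C S f = fam_arr C S g"
  by (auto simp: fam_arr_def mk_nt_def intro!: fam_obj_cong)

text \<open>Every arrow of a discrete category is an identity, so a functor out of it sends each
  sort to the identity of its value and is determined by its values.\<close>

lemma fam_obj_eta: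
  assumes \<xi>: "\<xi> \<in> Obj D"
  shows "fam_obj C S (FObj \<xi>) = \<xi>"
proof (rule func_eqI)
  show "is_functor (discrete S) C (fam_obj C S (FObj \<xi>))" "is_functor (discrete S) C \<xi>"
    using \<xi> fam_obj_obj[of "FObj \<xi>"] by (simp_all add: functor_cat_obj[symmetric] flip: fam_cat_def)
  show "FArr (fam_obj C S (FObj \<xi>)) s = FArr \<xi> s" if "s \<in> Arr (discrete S)" for s
    using fam.FObj_simps(2)[of \<xi> s] \<xi> that by (simp add: fam_obj_def Idt_discrete flip: fam_cat_def)
qed simp

text \<open>\<open>fam_arr\<close> rebuilds its endpoints from the components by
  \<open>fam_obj\<close>; by \<open>fam_obj_eta\<close> these are the given families. Naturality
  squares over a discrete category involve only identities.\<close>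

lemma fam_arr_hom:
  assumes o: "\<xi> \<in> Obj D" "\<zeta> \<in> Obj D" and f: "\<And>s. s \<in> S \<Longrightarrow> f s \<in> hom C (FObj \<xi> s) (FObj \<zeta> s)"
  shows "fam_arr C S f \<in> hom D \<xi> \<zeta>"
proof -
  have e: "fam_obj C S (\<lambda>s. Dom C (f s)) = fam_obj C S (FObj \<xi>)" "fam_obj C S (\<lambda>s. Cod C (f s)) = fam_obj C S (FObj \<zeta>)"
    using homD[OF f] by (auto intro!: fam_obj_cong)
  have i: "FArr \<xi> s = Idt C (FObj \<xi> s)" "FArr \<zeta> s = Idt C (FObj \<zeta> s)" if "s \<in> S" for s
    using fam.FObj_simps(2)[of _ s] that o unfolding fam_cat_def by (simp_all add: Idt_discrete)
  show ?thesis
    unfolding fam_arr_def e fam_obj_eta[OF o(1)] fam_obj_eta[OF o(2)] unfolding fam_cat_def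
    by (rule fam.mk_nt_hom)
      (use o f i idt_comp[OF f] comp_idt[OF f] in \<open>auto simp: discrete_hom simp flip: fam_cat_def\<close>)
qed

lemma fam_arr_hom':
  assumes "\<And>s. s \<in> S \<Longrightarrow> f s \<in> hom C (x s) (y s)"
  shows "fam_arr C S f \<in> hom D (fam_obj C S x) (fam_obj C S y)"
  by (rule fam_arr_hom) (use assms hom_obj[OF assms] in auto)

lemma fam_arr_eta: "f \<in> Arr D \<Longrightarrow> fam_arr C S (NMap f) = f"
  by (rule fam_arr_eqI[OF fam_arr_hom D.homI[OF _ refl refl]]) (auto intro: fam_hom[OF D.homI[OF _ refl refl]])

lemma is_coproduct_fam:
  assumes "\<And>j. j \<in> J \<Longrightarrow> x j \<in> Obj D" "P \<in> Obj D" "\<And>j. j \<in> J \<Longrightarrow> \<iota> j \<in> hom D (x j) P"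
    and "\<And>s. s \<in> S \<Longrightarrow> is_coproduct C J (\<lambda>j. FObj (x j) s) (FObj P s) (\<lambda>j. NMap (\<iota> j) s)"
  shows "is_coproduct D J x P \<iota>"
  using assms unfolding fam_cat_def by (intro fam.is_coproduct_pointwise) auto

end

subsection \<open>Context extension\<close>

locale option_families = sorted_families C S
  for C :: "('o, 'm) category" (structure) and S :: "'s set" +
  assumes C_terminal: "has_terminal C"
    and C_unit_coproducts: "\<And>J :: unit set. has_coproducts C J"
    and C_plus: "has_coproducts C (UNIV :: bool set)"
begin

lemma terminal_obj [simp]: "terminal C \<in> Obj C"
  using terminal[OF C_terminal] by (simp add: is_terminal_def)

text \<open>The family \<open>hat C S s\<close> takes at the terminal object: a single new variable
  of sort \<open>s\<close>.\<close>

definition new_var :: "'s \<Rightarrow> ('s, 'o, 'm) fam" where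
  "new_var s = fam_obj C S (\<lambda>t. coprod_obj C (eq_proofs s t) (\<lambda>_. terminal C))"

definition option_inl :: "'s \<Rightarrow> ('s, 'o, 'm) fam \<Rightarrow> ('s, 'o, 'm) famarr" where
  "option_inl s \<xi> =
     fam_arr C S (\<lambda>t. plus_inl C (coprod_obj C (eq_proofs s t) (\<lambda>_. terminal C)) (FObj \<xi> t))"

lemma new_var_value [simp]: "coprod_obj C (eq_proofs s t) (\<lambda>_. terminal C) \<in> Obj C"
  by (rule coproductD(1)[OF is_coproduct_coprod[OF C_unit_coproducts]]) simp

lemma FObj_option_obj [simp]:
  "t \<in> S \<Longrightarrow> FObj (option_obj C S s \<xi>) t
    = plus_obj C (coprod_obj C (eq_proofs s t) (\<lambda>_. terminal C)) (FObj \<xi> t)"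
  by (simp add: option_obj_def)

lemma NMap_option_inr [simp]:
  "t \<in> S \<Longrightarrow> NMap (option_inr C S s \<xi>) t
    = plus_inr C (coprod_obj C (eq_proofs s t) (\<lambda>_. terminal C)) (FObj \<xi> t)"
  by (simp add: option_inr_def)

text \<open>Coproducts of families are formed sort by sort. With this, equations about
  \<open>gamma\<close> can be proved in \<open>D\<close> by testing on two injections, without
  descending to sorts.\<close>

lemma is_coproduct2_option:
  assumes \<xi>: "\<xi> \<in> Obj D"
  shows "is_coproduct2 D (new_var s) \<xi> (option_obj C S s \<xi>) (option_inl s \<xi>) (option_inr C S s \<xi>)"
proof -
  let ?k = "\<lambda>t. coprod_obj C (eq_proofs s t) (\<lambda>_. terminal C)"
  have c: "is_coproduct2 C (?k t) (FObj \<xi> t) (plus_obj C (?k t) (FObj \<xi> t)) (plus_inl C (?k t) (FObj \<xi> t)) (plus_inr C (?k t) (FObj \<xi> t))"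
    if "t \<in> S" for t
    using \<xi> that by (intro is_coproduct2_plus[OF C_plus]) auto
  note cD = coproduct2D[OF c]
  have k: "new_var s \<in> Obj D" unfolding new_var_def by simp
  have p: "option_obj C S s \<xi> \<in> Obj D" unfolding option_obj_def using cD(1) by simp
  show ?thesis unfolding is_coproduct2_def
  proof (rule is_coproduct_fam)
    show "(if j then new_var s else \<xi>) \<in> Obj D" for j using k \<xi> by simp
    show "(if j then option_inl s \<xi> else option_inr C S s \<xi>) \<in> hom D (if j then new_var s else \<xi>) (option_obj C S s \<xi>)" for j
      using cD(2,3) k p \<xi> by (auto simp: option_inl_def option_inr_def new_var_def option_obj_def intro!: fam_arr_hom)
    show "is_coproduct C UNIV (\<lambda>j. FObj (if j then new_var s else \<xi>) t) (FObj (option_obj C S s \<xi>) t)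
          (\<lambda>j. NMap (if j then option_inl s \<xi> else option_inr C S s \<xi>) t)" if t: "t \<in> S" for t
      by (rule is_coproduct_cong[of UNIV "\<lambda>j. if j then ?k t else FObj \<xi> t" _ "\<lambda>j. if j then plus_inl C (?k t) (FObj \<xi> t) else plus_inr C (?k t) (FObj \<xi> t)"])
        (use c[OF t] t in \<open>auto simp: is_coproduct2_def option_obj_def option_inl_def option_inr_def new_var_def\<close>)
  qed (use p in auto)
qed

lemma FObj_option [simp]: "\<xi> \<in> Obj D \<Longrightarrow> FObj (option C S s) \<xi> = option_obj C S s \<xi>"
  by (simp add: option_def)

lemmas option_coproductD = D.coproduct2D[OF is_coproduct2_option]

lemma FArr_option:
  assumes f: "f \<in> hom D \<xi> \<zeta>"
  shows "FArr (option C S s) f \<in> hom D (option_obj C S s \<xi>) (option_obj C S s \<zeta>)"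
    "option_inl s \<xi> \<cdot>\<^bsub>D\<^esub> FArr (option C S s) f = option_inl s \<zeta>"
    "option_inr C S s \<xi> \<cdot>\<^bsub>D\<^esub> FArr (option C S s) f = f \<cdot>\<^bsub>D\<^esub> option_inr C S s \<zeta>"
proof -
  let ?k = "\<lambda>t. coprod_obj C (eq_proofs s t) (\<lambda>_. terminal C)"
  have o: "\<xi> \<in> Obj D" "\<zeta> \<in> Obj D" "f \<in> Arr D" using f D.hom_obj by (auto simp: hom_def)
  have ft: "NMap f t \<in> hom C (FObj \<xi> t) (FObj \<zeta> t)" if "t \<in> S" for t using fam_hom[OF f that] .
  note m = plus_map[OF C_plus idt_hom ft, OF new_var_value]
  have e: "FArr (option C S s) f = fam_arr C S (\<lambda>t. plus_map C (Idt C (?k t)) (NMap f t))"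
    using o by (simp add: option_def)
  show h: "FArr (option C S s) f \<in> hom D (option_obj C S s \<xi>) (option_obj C S s \<zeta>)"
    unfolding e option_obj_def by (rule fam_arr_hom') (rule m(1))
  have l: "plus_inl C (?k t) (FObj \<zeta> t) \<in> hom C (?k t) (plus_obj C (?k t) (FObj \<zeta> t))" if "t \<in> S" for t
    using coproduct2D(2)[OF is_coproduct2_plus[OF C_plus]] o that by simp
  show "option_inl s \<xi> \<cdot>\<^bsub>D\<^esub> FArr (option C S s) f = option_inl s \<zeta>"
    by (rule fam_arr_eqI[OF D.comp_hom[OF option_coproductD(2)[OF o(1)] h] option_coproductD(2)[OF o(2)]])
      (simp add: e option_inl_def m(2) idt_comp[OF l])
  show "option_inr C S s \<xi> \<cdot>\<^bsub>D\<^esub> FArr (option C S s) f = f \<cdot>\<^bsub>D\<^esub> option_inr C S s \<zeta>"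
    by (rule fam_arr_eqI[OF D.comp_hom[OF option_coproductD(3)[OF o(1)] h] D.comp_hom[OF f option_coproductD(3)[OF o(2)]]])
      (simp add: e option_inr_def m(3))
qed

lemma option_endo: "option C S s \<in> Obj E"
proof (rule E.functorI)
  show "FObj (option C S s) \<in> extensional (Obj D)" "FArr (option C S s) \<in> extensional (Arr D)"
    by (simp_all add: option_def)
  show "FObj (option C S s) \<xi> \<in> Obj D" if "\<xi> \<in> Obj D" for \<xi> using option_coproductD(1)[OF that] that by simp
  show "FArr (option C S s) f \<in> hom D (FObj (option C S s) \<xi>) (FObj (option C S s) \<zeta>)" if f: "f \<in> hom D \<xi> \<zeta>" for f \<xi> \<zeta>
    using FArr_option(1)[OF f] D.hom_obj[OF f] by simp
  show "FArr (option C S s) (Idt D \<xi>) = Idt D (FObj (option C S s) \<xi>)" if \<xi>: "\<xi> \<in> Obj D" for \<xi>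
  proof -
    note i = FArr_option[OF D.idt_hom[OF \<xi>]] and o = option_coproductD[OF \<xi>]
    show ?thesis unfolding FObj_option[OF \<xi>]
      by (rule D.copair_eqI[OF is_coproduct2_option[OF \<xi>] i(1) D.idt_hom[OF o(1)]])
        (simp_all only: i D.comp_idt[OF o(2)] D.comp_idt[OF o(3)] D.idt_comp[OF o(3)])
  qed
  show "FArr (option C S s) (f \<cdot>\<^bsub>D\<^esub> g) = FArr (option C S s) f \<cdot>\<^bsub>D\<^esub> FArr (option C S s) g"
    if f: "f \<in> hom D \<xi> \<zeta>" and g: "g \<in> hom D \<zeta> \<omega>" for f \<xi> \<zeta> g \<omega>
  proof -
    have o: "\<xi> \<in> Obj D" "\<zeta> \<in> Obj D" "\<omega> \<in> Obj D" using f g D.hom_obj by auto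
    note F = FArr_option[OF f, of s] and G = FArr_option[OF g, of s] and FG = FArr_option[OF D.comp_hom[OF f g], of s]
    show ?thesis
      by (rule D.copair_eqI[OF is_coproduct2_option[OF o(1)] FG(1) D.comp_hom[OF F(1) G(1)]])
        (simp_all only: FG F G D.comp_assoc[OF option_coproductD(2)[OF o(1)] F(1) G(1), symmetric]
          D.comp_assoc[OF option_coproductD(3)[OF o(1)] F(1) G(1), symmetric] D.comp_assoc[OF f g option_coproductD(3)[OF o(3)]]
          D.comp_assoc[OF f option_coproductD(3)[OF o(2)] G(1)])
  qed
qed

lemma option_list_endo: "option_list C S l \<in> Obj E"
  by (induction l) (auto simp: option_endo)

subsection \<open>Distributing context extension over pointed endofunctors\<close>

abbreviation Ptd where "Ptd \<equiv> ptd_obj (endo D)"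

lemma PtdD:
  assumes "Ye \<in> Ptd"
  shows "fst Ye \<in> Obj E" "snd Ye \<in> hom E (fid D) (fst Ye)"
    "\<xi> \<in> Obj D \<Longrightarrow> NMap (snd Ye) \<xi> \<in> hom D \<xi> (FObj (fst Ye) \<xi>)"
    "f \<in> hom D \<xi> \<zeta> \<Longrightarrow> f \<cdot>\<^bsub>D\<^esub> NMap (snd Ye) \<zeta> = NMap (snd Ye) \<xi> \<cdot>\<^bsub>D\<^esub> FArr (fst Ye) f"
proof -
  show 1: "fst Ye \<in> Obj E" and 2: "snd Ye \<in> hom E (fid D) (fst Ye)"
    using assms by (auto simp: ptd_obj_def)
  show "\<xi> \<in> Obj D \<Longrightarrow> NMap (snd Ye) \<xi> \<in> hom D \<xi> (FObj (fst Ye) \<xi>)"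
    using E.NMap_hom[OF 2, of \<xi>] by simp
  show "f \<in> hom D \<xi> \<zeta> \<Longrightarrow> f \<cdot>\<^bsub>D\<^esub> NMap (snd Ye) \<zeta> = NMap (snd Ye) \<xi> \<cdot>\<^bsub>D\<^esub> FArr (fst Ye) f"
    using E.naturality[OF 2, of f \<xi> \<zeta>] D.homD[of f \<xi> \<zeta>] by simp
qed

lemma ptd_unit_Ptd: "ptd_unit (endo D) \<in> Ptd"
  using E.FC.idt_hom[OF E.fid_obj] by (simp add: ptd_obj_def ptd_unit_def)

text \<open>The inverse of \<open>Lam\<close> at the unit is an identity, so the point of a tensor
  is just the horizontal composite of the points.\<close>

lemma ptd_tens_endo:
  assumes "Ye \<in> Ptd" "We \<in> Ptd"
  shows "ptd_tens (endo D) Ye We = (fcomp D (fst Ye) (fst We), hcomp D D (snd Ye) (snd We))"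
    and "ptd_tens (endo D) Ye We \<in> Ptd"
proof -
  note Y = PtdD[OF assms(1)] and W = PtdD[OF assms(2)]
  have "inv_arr (endo D) (Idt E (fid D)) = Idt E (fid D)"
    using E.FC.inv_arr_eq[OF E.FC.is_inverse_idt[OF E.fid_obj]] by (simp add: inv_arr_def)
  moreover have h: "hcomp D D (snd Ye) (snd We) \<in> hom E (fid D) (fcomp D (fst Ye) (fst We))"
    using E.hcomp_hom[OF Y(2) W(2)] by simp
  ultimately show e: "ptd_tens (endo D) Ye We = (fcomp D (fst Ye) (fst We), hcomp D D (snd Ye) (snd We))"
    using E.FC.idt_comp[OF h] by (simp add: ptd_tens_def)
  show "ptd_tens (endo D) Ye We \<in> Ptd"
    unfolding e using h Y(1) W(1) by (simp add: ptd_obj_def)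
qed

text \<open>This reads \<open>gamma\<close> as a copairing in \<open>D\<close>: the new variable
  goes to the point of \<open>Y\<close>, and the old part is mapped by \<open>Y\<close> of the right
  injection. The laws of \<open>gamma\<close> below are derived from these equations alone.\<close>

lemma gamma:
  assumes Ye: "Ye \<in> Ptd" and \<xi>: "\<xi> \<in> Obj D"
  shows "gamma C S Ye s \<xi> \<in> hom D (option_obj C S s (FObj (fst Ye) \<xi>)) (FObj (fst Ye) (option_obj C S s \<xi>))"
    "option_inl s (FObj (fst Ye) \<xi>) \<cdot>\<^bsub>D\<^esub> gamma C S Ye s \<xi> = option_inl s \<xi> \<cdot>\<^bsub>D\<^esub> NMap (snd Ye) (option_obj C S s \<xi>)"
    "option_inr C S s (FObj (fst Ye) \<xi>) \<cdot>\<^bsub>D\<^esub> gamma C S Ye s \<xi> = FArr (fst Ye) (option_inr C S s \<xi>)"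
proof -
  let ?k = "\<lambda>t. coprod_obj C (eq_proofs s t) (\<lambda>_. terminal C)" and ?Y = "fst Ye" and ?o = "option_obj C S s \<xi>"
  note Y = PtdD[OF Ye] and o = option_coproductD[OF \<xi>, of s]
  have Yo: "FObj ?Y \<xi> \<in> Obj D" "FObj ?Y ?o \<in> Obj D" using Y(1) \<xi> o(1) by simp_all
  have l: "option_inl s \<xi> \<cdot>\<^bsub>D\<^esub> NMap (snd Ye) ?o \<in> hom D (new_var s) (FObj ?Y ?o)"
    using D.comp_hom[OF o(2) Y(3)[OF o(1)]] .
  have r: "FArr ?Y (option_inr C S s \<xi>) \<in> hom D (FObj ?Y \<xi>) (FObj ?Y ?o)"
    using E.FArr_hom[OF Y(1) o(3)] .
  have lt: "plus_inl C (?k t) (FObj \<xi> t) \<cdot> NMap (NMap (snd Ye) ?o) t \<in> hom C (?k t) (FObj (FObj ?Y ?o) t)"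
    if "t \<in> S" for t using fam_hom[OF l that] that by (simp add: option_inl_def new_var_def)
  have rt: "NMap (FArr ?Y (option_inr C S s \<xi>)) t \<in> hom C (FObj (FObj ?Y \<xi>) t) (FObj (FObj ?Y ?o) t)"
    if "t \<in> S" for t using fam_hom[OF r that] .
  note c = copair[OF C_plus lt rt]
  show h: "gamma C S Ye s \<xi> \<in> hom D (option_obj C S s (FObj ?Y \<xi>)) (FObj ?Y ?o)"
    unfolding gamma_def
    by (rule fam_arr_hom[OF option_coproductD(1)[OF Yo(1)] Yo(2)]) (simp add: c(1))
  show "option_inl s (FObj ?Y \<xi>) \<cdot>\<^bsub>D\<^esub> gamma C S Ye s \<xi> = option_inl s \<xi> \<cdot>\<^bsub>D\<^esub> NMap (snd Ye) ?o"
    by (rule fam_arr_eqI[OF D.comp_hom[OF option_coproductD(2)[OF Yo(1)] h] l])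
      (simp add: gamma_def c(2) option_inl_def)
  show "option_inr C S s (FObj ?Y \<xi>) \<cdot>\<^bsub>D\<^esub> gamma C S Ye s \<xi> = FArr ?Y (option_inr C S s \<xi>)"
    by (rule fam_arr_eqI[OF D.comp_hom[OF option_coproductD(3)[OF Yo(1)] h] r])
      (simp add: gamma_def c(3))
qed

text \<open>On the new variable this is naturality of the point; on the old part it is
  \<open>Y\<close> applied to the naturality square of the right injection.\<close>

lemma gamma_natural:
  assumes Ye: "Ye \<in> Ptd" and f: "f \<in> hom D \<xi> \<zeta>"
  shows "FArr (option C S s) (FArr (fst Ye) f) \<cdot>\<^bsub>D\<^esub> gamma C S Ye s \<zeta>
    = gamma C S Ye s \<xi> \<cdot>\<^bsub>D\<^esub> FArr (fst Ye) (FArr (option C S s) f)"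
proof -
  let ?Y = "fst Ye" and ?O = "FArr (option C S s)"
  note Y = PtdD[OF Ye]
  have o: "\<xi> \<in> Obj D" "\<zeta> \<in> Obj D" using f D.hom_obj by auto
  have Yo: "FObj ?Y \<xi> \<in> Obj D" "FObj ?Y \<zeta> \<in> Obj D" using Y(1) o by simp_all
  have Yf: "FArr ?Y f \<in> hom D (FObj ?Y \<xi>) (FObj ?Y \<zeta>)" using E.FArr_hom[OF Y(1) f] .
  note F = FArr_option[OF f, of s] and YF = FArr_option[OF Yf, of s]
  have YO: "FArr ?Y (?O f) \<in> hom D (FObj ?Y (option_obj C S s \<xi>)) (FObj ?Y (option_obj C S s \<zeta>))"
    using E.FArr_hom[OF Y(1) F(1)] .
  note g\<xi> = gamma[OF Ye o(1), of s] and g\<zeta> = gamma[OF Ye o(2), of s]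
  have e: "FArr ?Y (g \<cdot>\<^bsub>D\<^esub> h) = FArr ?Y g \<cdot>\<^bsub>D\<^esub> FArr ?Y h" if "g \<in> hom D a b" "h \<in> hom D b c" for g h a b c
    using that Y(1) by (simp add: hom_def)
  show ?thesis
  proof (rule D.copair_eqI[OF is_coproduct2_option[OF Yo(1)] D.comp_hom[OF YF(1) g\<zeta>(1)] D.comp_hom[OF g\<xi>(1) YO]])
    have "option_inl s (FObj ?Y \<xi>) \<cdot>\<^bsub>D\<^esub> (?O (FArr ?Y f) \<cdot>\<^bsub>D\<^esub> gamma C S Ye s \<zeta>) = option_inl s \<zeta> \<cdot>\<^bsub>D\<^esub> NMap (snd Ye) (option_obj C S s \<zeta>)"
      using D.comp_assoc[OF option_coproductD(2)[OF Yo(1)] YF(1) g\<zeta>(1)] YF(2) g\<zeta>(2) by simp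
    also have "\<dots> = option_inl s \<xi> \<cdot>\<^bsub>D\<^esub> (?O f \<cdot>\<^bsub>D\<^esub> NMap (snd Ye) (option_obj C S s \<zeta>))"
      using D.comp_assoc[OF option_coproductD(2)[OF o(1)] F(1) Y(3)[OF option_coproductD(1)[OF o(2)]]] F(2) by simp
    also have "\<dots> = (option_inl s \<xi> \<cdot>\<^bsub>D\<^esub> NMap (snd Ye) (option_obj C S s \<xi>)) \<cdot>\<^bsub>D\<^esub> FArr ?Y (?O f)"
      using Y(4)[OF F(1)] D.comp_assoc[OF option_coproductD(2)[OF o(1)] Y(3)[OF option_coproductD(1)[OF o(1)]] YO] by simp
    finally show "option_inl s (FObj ?Y \<xi>) \<cdot>\<^bsub>D\<^esub> (?O (FArr ?Y f) \<cdot>\<^bsub>D\<^esub> gamma C S Ye s \<zeta>)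
        = option_inl s (FObj ?Y \<xi>) \<cdot>\<^bsub>D\<^esub> (gamma C S Ye s \<xi> \<cdot>\<^bsub>D\<^esub> FArr ?Y (?O f))"
      using D.comp_assoc[OF option_coproductD(2)[OF Yo(1)] g\<xi>(1) YO] g\<xi>(2) by simp
    have "option_inr C S s (FObj ?Y \<xi>) \<cdot>\<^bsub>D\<^esub> (?O (FArr ?Y f) \<cdot>\<^bsub>D\<^esub> gamma C S Ye s \<zeta>) = FArr ?Y f \<cdot>\<^bsub>D\<^esub> FArr ?Y (option_inr C S s \<zeta>)"
      using D.comp_assoc[OF option_coproductD(3)[OF Yo(1)] YF(1) g\<zeta>(1)] YF(3) g\<zeta>(3) D.comp_assoc[OF Yf option_coproductD(3)[OF Yo(2)] g\<zeta>(1)] by simp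
    also have "\<dots> = FArr ?Y (option_inr C S s \<xi>) \<cdot>\<^bsub>D\<^esub> FArr ?Y (?O f)"
      using F(3) e[OF f option_coproductD(3)[OF o(2)]] e[OF option_coproductD(3)[OF o(1)] F(1)] by simp
    finally show "option_inr C S s (FObj ?Y \<xi>) \<cdot>\<^bsub>D\<^esub> (?O (FArr ?Y f) \<cdot>\<^bsub>D\<^esub> gamma C S Ye s \<zeta>)
        = option_inr C S s (FObj ?Y \<xi>) \<cdot>\<^bsub>D\<^esub> (gamma C S Ye s \<xi> \<cdot>\<^bsub>D\<^esub> FArr ?Y (?O f))"
      using D.comp_assoc[OF option_coproductD(3)[OF Yo(1)] g\<xi>(1) YO] g\<xi>(3) by simp
  qed
qed

lemma ptd_homD:
  assumes "\<phi> \<in> ptd_hom (endo D) Ye We"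
  shows "\<phi> \<in> hom E (fst Ye) (fst We)" "\<xi> \<in> Obj D \<Longrightarrow> NMap (snd Ye) \<xi> \<cdot>\<^bsub>D\<^esub> NMap \<phi> \<xi> = NMap (snd We) \<xi>"
  using assms functor_cat_simps(8)[of \<xi> D D "snd Ye" \<phi>] by (auto simp: ptd_hom_def)

text \<open>On the new variable \<open>\<phi>\<close> takes one point to the other; on the old part
  it is natural at the right injection.\<close>

lemma gamma_ptd_natural:
  assumes Ye: "Ye \<in> Ptd" and We: "We \<in> Ptd" and \<phi>: "\<phi> \<in> ptd_hom (endo D) Ye We" and \<xi>: "\<xi> \<in> Obj D"
  shows "FArr (option C S s) (NMap \<phi> \<xi>) \<cdot>\<^bsub>D\<^esub> gamma C S We s \<xi>
    = gamma C S Ye s \<xi> \<cdot>\<^bsub>D\<^esub> NMap \<phi> (option_obj C S s \<xi>)"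
proof -
  let ?Y = "fst Ye" and ?W = "fst We" and ?o = "option_obj C S s \<xi>"
  note Y = PtdD[OF Ye] and W = PtdD[OF We] and P = ptd_homD[OF \<phi>]
  note o = option_coproductD[OF \<xi>, of s]
  have Yo: "FObj ?Y \<xi> \<in> Obj D" "FObj ?W \<xi> \<in> Obj D" using Y(1) W(1) \<xi> by simp_all
  note f = E.NMap_hom[OF P(1) \<xi>] and fo = E.NMap_hom[OF P(1) o(1)]
  note F = FArr_option[OF f, of s]
  note gY = gamma[OF Ye \<xi>, of s] and gW = gamma[OF We \<xi>, of s]
  show ?thesis
  proof (rule D.copair_eqI[OF is_coproduct2_option[OF Yo(1)] D.comp_hom[OF F(1) gW(1)] D.comp_hom[OF gY(1) fo]])
    show "option_inl s (FObj ?Y \<xi>) \<cdot>\<^bsub>D\<^esub> (FArr (option C S s) (NMap \<phi> \<xi>) \<cdot>\<^bsub>D\<^esub> gamma C S We s \<xi>)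
        = option_inl s (FObj ?Y \<xi>) \<cdot>\<^bsub>D\<^esub> (gamma C S Ye s \<xi> \<cdot>\<^bsub>D\<^esub> NMap \<phi> ?o)"
      using D.comp_assoc[OF option_coproductD(2)[OF Yo(1)] F(1) gW(1)] F(2) gW(2) D.comp_assoc[OF option_coproductD(2)[OF Yo(1)] gY(1) fo] gY(2)
        D.comp_assoc[OF o(2) Y(3)[OF o(1)] fo] P(2)[OF o(1)] by simp
    show "option_inr C S s (FObj ?Y \<xi>) \<cdot>\<^bsub>D\<^esub> (FArr (option C S s) (NMap \<phi> \<xi>) \<cdot>\<^bsub>D\<^esub> gamma C S We s \<xi>)
        = option_inr C S s (FObj ?Y \<xi>) \<cdot>\<^bsub>D\<^esub> (gamma C S Ye s \<xi> \<cdot>\<^bsub>D\<^esub> NMap \<phi> ?o)"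
      using D.comp_assoc[OF option_coproductD(3)[OF Yo(1)] F(1) gW(1)] F(3) gW(3) D.comp_assoc[OF option_coproductD(3)[OF Yo(1)] gY(1) fo] gY(3)
        D.comp_assoc[OF f option_coproductD(3)[OF Yo(2)] gW(1)] E.naturality[OF P(1) o(3)] by simp
  qed
qed

text \<open>With an identity as point, \<open>gamma\<close> is the copairing of the two
  injections.\<close>

lemma gamma_unit:
  assumes \<xi>: "\<xi> \<in> Obj D"
  shows "gamma C S (ptd_unit (endo D)) s \<xi> = Idt D (option_obj C S s \<xi>)"
proof -
  note o = option_coproductD[OF \<xi>, of s] and g = gamma[OF ptd_unit_Ptd \<xi>, of s]
  have e: "fst (ptd_unit (endo D)) = fid D" "snd (ptd_unit (endo D)) = Idt E (fid D)" by (simp_all add: ptd_unit_def)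
  have i: "option_inr C S s \<xi> \<in> Arr D" using o(3) by (simp add: hom_def)
  have g': "gamma C S (ptd_unit (endo D)) s \<xi> \<in> hom D (option_obj C S s \<xi>) (option_obj C S s \<xi>)"
    using g(1) o(1) \<xi> by (simp add: e)
  show ?thesis
    by (rule D.copair_eqI[OF is_coproduct2_option[OF \<xi>] g' D.idt_hom[OF o(1)]])
      (use g(2,3) o(1) \<xi> i in \<open>simp_all add: e D.comp_idt[OF o(2)] D.comp_idt[OF o(3)]\<close>)
qed

text \<open>A context extension passes the outer functor \<open>W\<close> before the inner functor
  \<open>Y\<close>. On the new variable the two points compose as required because that of
  \<open>W\<close> is natural along \<open>gamma\<close> for \<open>Y\<close>.\<close>

lemma gamma_tens:
  assumes Ye: "Ye \<in> Ptd" and We: "We \<in> Ptd" and \<xi>: "\<xi> \<in> Obj D"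
  shows "gamma C S (ptd_tens (endo D) Ye We) s \<xi>
    = gamma C S We s (FObj (fst Ye) \<xi>) \<cdot>\<^bsub>D\<^esub> FArr (fst We) (gamma C S Ye s \<xi>)"
proof -
  let ?Y = "fst Ye" and ?W = "fst We" and ?o = "option_obj C S s \<xi>"
  note Y = PtdD[OF Ye] and W = PtdD[OF We] and T = ptd_tens_endo[OF Ye We]
  note o = option_coproductD[OF \<xi>, of s]
  have Yo: "FObj ?Y \<xi> \<in> Obj D" "FObj ?Y ?o \<in> Obj D" using Y(1) \<xi> o(1) by simp_all
  have WYo: "FObj ?W (FObj ?Y \<xi>) \<in> Obj D" using W(1) Yo by simp
  note gY = gamma[OF Ye \<xi>, of s] and gW = gamma[OF We Yo(1), of s] and gT = gamma[OF T(2) \<xi>, of s]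
  note WgY = E.FArr_hom[OF W(1) gY(1)]

  have e: "FArr ?W (g \<cdot>\<^bsub>D\<^esub> h) = FArr ?W g \<cdot>\<^bsub>D\<^esub> FArr ?W h" if "g \<in> hom D a b" "h \<in> hom D b c" for g h a b c
    using that W(1) by (simp add: hom_def)
  have gT1: "gamma C S (ptd_tens (endo D) Ye We) s \<xi> \<in> hom D (option_obj C S s (FObj ?W (FObj ?Y \<xi>))) (FObj ?W (FObj ?Y ?o))"
    using gT(1) \<xi> o(1) by (simp add: T(1))
  have dc: "NDom (snd We) = fid D" "NCod (snd Ye) = ?Y" using Y(2) W(2) by (simp_all add: hom_def)
  have pe: "NMap (snd Ye) ?o \<in> Arr D" using Y(3)[OF o(1)] by (simp add: hom_def)
  have gT2: "option_inl s (FObj ?W (FObj ?Y \<xi>)) \<cdot>\<^bsub>D\<^esub> gamma C S (ptd_tens (endo D) Ye We) s \<xi>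
      = option_inl s \<xi> \<cdot>\<^bsub>D\<^esub> (NMap (snd Ye) ?o \<cdot>\<^bsub>D\<^esub> NMap (snd We) (FObj ?Y ?o))"
    using gT(2) \<xi> o(1) pe dc by (simp add: T(1))
  have gT3: "option_inr C S s (FObj ?W (FObj ?Y \<xi>)) \<cdot>\<^bsub>D\<^esub> gamma C S (ptd_tens (endo D) Ye We) s \<xi>
      = FArr ?W (FArr ?Y (option_inr C S s \<xi>))"
    using gT(3) \<xi> D.homD[OF o(3)] by (simp add: T(1))
  show ?thesis
  proof (rule D.copair_eqI[OF is_coproduct2_option[OF WYo] gT1 D.comp_hom[OF gW(1) WgY]])
    note oY = option_coproductD[OF Yo(1), of s] and oWY = option_coproductD[OF WYo, of s]
    have "option_inl s (FObj ?W (FObj ?Y \<xi>)) \<cdot>\<^bsub>D\<^esub> (gamma C S We s (FObj ?Y \<xi>) \<cdot>\<^bsub>D\<^esub> FArr ?W (gamma C S Ye s \<xi>))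
        = option_inl s (FObj ?Y \<xi>) \<cdot>\<^bsub>D\<^esub> (NMap (snd We) (option_obj C S s (FObj ?Y \<xi>)) \<cdot>\<^bsub>D\<^esub> FArr ?W (gamma C S Ye s \<xi>))"
      using D.comp_assoc[OF oWY(2) gW(1) WgY] gW(2) D.comp_assoc[OF oY(2) W(3)[OF oY(1)] WgY] by simp
    also have "\<dots> = (option_inl s (FObj ?Y \<xi>) \<cdot>\<^bsub>D\<^esub> gamma C S Ye s \<xi>) \<cdot>\<^bsub>D\<^esub> NMap (snd We) (FObj ?Y ?o)"
      using W(4)[OF gY(1)] D.comp_assoc[OF oY(2) gY(1) W(3)[OF Yo(2)]] by simp
    also have "\<dots> = option_inl s \<xi> \<cdot>\<^bsub>D\<^esub> (NMap (snd Ye) ?o \<cdot>\<^bsub>D\<^esub> NMap (snd We) (FObj ?Y ?o))"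
      unfolding gY(2) using D.comp_assoc[OF o(2) Y(3)[OF o(1)] W(3)[OF Yo(2)]] by simp
    finally show "option_inl s (FObj ?W (FObj ?Y \<xi>)) \<cdot>\<^bsub>D\<^esub> gamma C S (ptd_tens (endo D) Ye We) s \<xi>
        = option_inl s (FObj ?W (FObj ?Y \<xi>)) \<cdot>\<^bsub>D\<^esub> (gamma C S We s (FObj ?Y \<xi>) \<cdot>\<^bsub>D\<^esub> FArr ?W (gamma C S Ye s \<xi>))"
      using gT2 by simp
    show "option_inr C S s (FObj ?W (FObj ?Y \<xi>)) \<cdot>\<^bsub>D\<^esub> gamma C S (ptd_tens (endo D) Ye We) s \<xi>
        = option_inr C S s (FObj ?W (FObj ?Y \<xi>)) \<cdot>\<^bsub>D\<^esub> (gamma C S We s (FObj ?Y \<xi>) \<cdot>\<^bsub>D\<^esub> FArr ?W (gamma C S Ye s \<xi>))"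
      using gT3 D.comp_assoc[OF oWY(3) gW(1) WgY] gW(3) e[OF oY(3) gY(1)] gY(3) by simp
  qed
qed

end

section \<open>Distribution over a list of context extensions\<close>

context option_families
begin

lemma FObj_option_list_Cons [simp]:
  "\<xi> \<in> Obj D \<Longrightarrow> FObj (option_list C S (s # l)) \<xi> = FObj (option_list C S l) (option_obj C S s \<xi>)"
  by simp

lemma FArr_option_list_Cons:
  "f \<in> hom D \<xi> \<zeta> \<Longrightarrow> FArr (option_list C S (s # l)) f = FArr (option_list C S l) (FArr (option C S s) f)"
  by (simp add: hom_def)

lemma option_list_comp:
  "\<lbrakk>f \<in> hom D a b; g \<in> hom D b c\<rbrakk> \<Longrightarrow> FArr (option_list C S l) (f \<cdot>\<^bsub>D\<^esub> g)
    = FArr (option_list C S l) f \<cdot>\<^bsub>D\<^esub> FArr (option_list C S l) g"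
  using option_list_endo[of l] by (simp add: hom_def)

lemma gamma_list_hom:
  assumes Ye: "Ye \<in> Ptd"
  shows "\<xi> \<in> Obj D \<Longrightarrow> gamma_list C S Ye l \<xi>
    \<in> hom D (FObj (option_list C S l) (FObj (fst Ye) \<xi>)) (FObj (fst Ye) (FObj (option_list C S l) \<xi>))"
proof (induction l arbitrary: \<xi>)
  case Nil
  then show ?case using PtdD(1)[OF Ye] by (simp add: D.idt_hom)
next
  case (Cons s l)
  note o = option_coproductD(1)[OF Cons.prems, of s]
  have Yo: "FObj (fst Ye) \<xi> \<in> Obj D" using PtdD(1)[OF Ye] Cons.prems by simp
  show ?case
    unfolding gamma_list.simps FObj_option_list_Cons[OF Cons.prems] FObj_option_list_Cons[OF Yo]
    by (rule D.comp_hom[OF E.FArr_hom[OF option_list_endo gamma(1)[OF Ye Cons.prems]] Cons.IH[OF o]])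
qed

text \<open>The induction pastes two squares: that of \<open>gamma\<close> at the first sort with
  the remaining extensions applied to it, and that of the remaining list at the extended
  arrow.\<close>

lemma gamma_list_natural:
  assumes Ye: "Ye \<in> Ptd"
  shows "f \<in> hom D \<xi> \<zeta> \<Longrightarrow> FArr (option_list C S l) (FArr (fst Ye) f) \<cdot>\<^bsub>D\<^esub> gamma_list C S Ye l \<zeta>
    = gamma_list C S Ye l \<xi> \<cdot>\<^bsub>D\<^esub> FArr (fst Ye) (FArr (option_list C S l) f)"
proof (induction l arbitrary: f \<xi> \<zeta>)
  case Nil
  note Yf = E.FArr_hom[OF PtdD(1)[OF Ye] Nil]
  have "FArr (fst Ye) f \<in> Arr D" "f \<in> Arr D" using Yf Nil by (auto simp: hom_def)
  then show ?case using D.idt_comp[OF Yf] D.comp_idt[OF Yf] by simp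
next
  case (Cons s l)
  let ?Y = "fst Ye" and ?P = "FArr (option_list C S l)" and ?o = "option_obj C S s" and ?O = "FArr (option C S s)"
  note f = Cons.prems and Y = PtdD(1)[OF Ye]
  have \<xi>: "\<xi> \<in> Obj D" "\<zeta> \<in> Obj D" using f D.hom_obj by auto
  note Yf = E.FArr_hom[OF Y f]
  note Of = FArr_option(1)[OF f, of s] and OYf = FArr_option(1)[OF Yf, of s]
  note YOf = E.FArr_hom[OF Y Of]
  note g1 = gamma(1)[OF Ye \<xi>(1), of s] and g2 = gamma(1)[OF Ye \<xi>(2), of s]
  note P = E.FArr_hom[OF option_list_endo, of _ _ _ l]
  note o = option_coproductD(1)[OF \<xi>(1), of s] option_coproductD(1)[OF \<xi>(2), of s]
  note L1 = gamma_list_hom[OF Ye o(1), of l] and L2 = gamma_list_hom[OF Ye o(2), of l]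
  have "?P (?O (FArr ?Y f)) \<cdot>\<^bsub>D\<^esub> (?P (gamma C S Ye s \<zeta>) \<cdot>\<^bsub>D\<^esub> gamma_list C S Ye l (?o \<zeta>))
      = ?P (?O (FArr ?Y f) \<cdot>\<^bsub>D\<^esub> gamma C S Ye s \<zeta>) \<cdot>\<^bsub>D\<^esub> gamma_list C S Ye l (?o \<zeta>)"
    using D.comp_assoc[OF P[OF OYf] P[OF g2] L2] option_list_comp[OF OYf g2] by simp
  also have "\<dots> = ?P (gamma C S Ye s \<xi>) \<cdot>\<^bsub>D\<^esub> (?P (FArr ?Y (?O f)) \<cdot>\<^bsub>D\<^esub> gamma_list C S Ye l (?o \<zeta>))"
    unfolding gamma_natural[OF Ye f] using D.comp_assoc[OF P[OF g1] P[OF YOf] L2] option_list_comp[OF g1 YOf] by simp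
  also have "\<dots> = (?P (gamma C S Ye s \<xi>) \<cdot>\<^bsub>D\<^esub> gamma_list C S Ye l (?o \<xi>)) \<cdot>\<^bsub>D\<^esub> FArr ?Y (?P (?O f))"
    unfolding Cons.IH[OF Of] using D.comp_assoc[OF P[OF g1] L1 E.FArr_hom[OF Y P[OF Of]]] by simp
  finally show ?case
    unfolding gamma_list.simps FArr_option_list_Cons[OF f] FArr_option_list_Cons[OF Yf] .
qed

text \<open>The same pasting as in \<open>gamma_list_natural\<close>; the arrow is now a component
  of \<open>\<phi>\<close>, so the induction hypothesis is used at the extended family.\<close>

lemma gamma_list_ptd_natural:
  assumes Ye: "Ye \<in> Ptd" and We: "We \<in> Ptd" and \<phi>: "\<phi> \<in> ptd_hom (endo D) Ye We"
  shows "\<xi> \<in> Obj D \<Longrightarrow> FArr (option_list C S l) (NMap \<phi> \<xi>) \<cdot>\<^bsub>D\<^esub> gamma_list C S We l \<xi>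
    = gamma_list C S Ye l \<xi> \<cdot>\<^bsub>D\<^esub> NMap \<phi> (FObj (option_list C S l) \<xi>)"
proof (induction l arbitrary: \<xi>)
  case Nil
  note p = E.NMap_hom[OF ptd_homD(1)[OF \<phi>] Nil]
  have "NMap \<phi> \<xi> \<in> Arr D" using p by (auto simp: hom_def)
  then show ?case using D.idt_comp[OF p] D.comp_idt[OF p] Nil by simp
next
  case (Cons s l)
  let ?P = "FArr (option_list C S l)" and ?o = "option_obj C S s" and ?O = "FArr (option C S s)"
  note \<xi> = Cons.prems
  note o = option_coproductD(1)[OF \<xi>, of s]
  note p = E.NMap_hom[OF ptd_homD(1)[OF \<phi>] \<xi>] and po = E.NMap_hom[OF ptd_homD(1)[OF \<phi>] o]
  have opo: "FObj (option_list C S l) (?o \<xi>) \<in> Obj D" using option_list_endo o by simp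
  note ppo = E.NMap_hom[OF ptd_homD(1)[OF \<phi>] opo]
  note Op = FArr_option(1)[OF p, of s]
  note gY = gamma(1)[OF Ye \<xi>, of s] and gW = gamma(1)[OF We \<xi>, of s]
  note P = E.FArr_hom[OF option_list_endo, of _ _ _ l]
  note LY = gamma_list_hom[OF Ye o, of l] and LW = gamma_list_hom[OF We o, of l]
  have "?P (?O (NMap \<phi> \<xi>)) \<cdot>\<^bsub>D\<^esub> (?P (gamma C S We s \<xi>) \<cdot>\<^bsub>D\<^esub> gamma_list C S We l (?o \<xi>))
      = ?P (?O (NMap \<phi> \<xi>) \<cdot>\<^bsub>D\<^esub> gamma C S We s \<xi>) \<cdot>\<^bsub>D\<^esub> gamma_list C S We l (?o \<xi>)"
    using D.comp_assoc[OF P[OF Op] P[OF gW] LW] option_list_comp[OF Op gW] by simp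
  also have "\<dots> = ?P (gamma C S Ye s \<xi>) \<cdot>\<^bsub>D\<^esub> (?P (NMap \<phi> (?o \<xi>)) \<cdot>\<^bsub>D\<^esub> gamma_list C S We l (?o \<xi>))"
    unfolding gamma_ptd_natural[OF Ye We \<phi> \<xi>] using D.comp_assoc[OF P[OF gY] P[OF po] LW] option_list_comp[OF gY po] by simp
  also have "\<dots> = (?P (gamma C S Ye s \<xi>) \<cdot>\<^bsub>D\<^esub> gamma_list C S Ye l (?o \<xi>)) \<cdot>\<^bsub>D\<^esub> NMap \<phi> (FObj (option_list C S l) (?o \<xi>))"
    unfolding Cons.IH[OF o] using D.comp_assoc[OF P[OF gY] LY ppo] by simp
  finally show ?case
    unfolding gamma_list.simps FArr_option_list_Cons[OF p] FObj_option_list_Cons[OF \<xi>] .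
qed

lemma gamma_list_unit:
  "\<xi> \<in> Obj D \<Longrightarrow> gamma_list C S (ptd_unit (endo D)) l \<xi> = Idt D (FObj (option_list C S l) \<xi>)"
proof (induction l arbitrary: \<xi>)
  case Nil
  then show ?case by (simp add: ptd_unit_def)
next
  case (Cons s l)
  note o = option_coproductD(1)[OF Cons.prems, of s]
  show ?case
    unfolding gamma_list.simps FObj_option_list_Cons[OF Cons.prems] Cons.IH[OF o] gamma_unit[OF Cons.prems]
    using option_list_endo[of l] o by simp
qed

lemma gamma_list_tens:
  assumes Ye: "Ye \<in> Ptd" and We: "We \<in> Ptd"
  shows "\<xi> \<in> Obj D \<Longrightarrow> gamma_list C S (ptd_tens (endo D) Ye We) l \<xi>
    = gamma_list C S We l (FObj (fst Ye) \<xi>) \<cdot>\<^bsub>D\<^esub> FArr (fst We) (gamma_list C S Ye l \<xi>)"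
proof (induction l arbitrary: \<xi>)
  case Nil
  then show ?case using PtdD(1)[OF Ye] PtdD(1)[OF We] by (simp add: ptd_tens_endo[OF Ye We])
next
  case (Cons s l)
  let ?Y = "fst Ye" and ?W = "fst We" and ?P = "FArr (option_list C S l)" and ?o = "option_obj C S s"
  note \<xi> = Cons.prems and Y = PtdD(1)[OF Ye] and W = PtdD(1)[OF We]
  have Yo: "FObj ?Y \<xi> \<in> Obj D" using Y \<xi> by simp
  note o = option_coproductD(1)[OF \<xi>, of s] and oY = option_coproductD(1)[OF Yo, of s]
  have Yoo: "FObj ?Y (?o \<xi>) \<in> Obj D" using Y o by simp
  note gY = gamma(1)[OF Ye \<xi>, of s] and gW = gamma(1)[OF We Yo, of s]
  note P = E.FArr_hom[OF option_list_endo, of _ _ _ l] and WA = E.FArr_hom[OF W]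
  note LY = gamma_list_hom[OF Ye o, of l] and LW = gamma_list_hom[OF We Yoo, of l]
    and LWY = gamma_list_hom[OF We oY, of l]
  have e: "FArr ?W (g \<cdot>\<^bsub>D\<^esub> h) = FArr ?W g \<cdot>\<^bsub>D\<^esub> FArr ?W h" if "g \<in> hom D a b" "h \<in> hom D b c" for g h a b c
    using that W by (simp add: hom_def)
  have "?P (gamma C S (ptd_tens (endo D) Ye We) s \<xi>) \<cdot>\<^bsub>D\<^esub> gamma_list C S (ptd_tens (endo D) Ye We) l (?o \<xi>)
     = (?P (gamma C S We s (FObj ?Y \<xi>)) \<cdot>\<^bsub>D\<^esub> ?P (FArr ?W (gamma C S Ye s \<xi>)))
        \<cdot>\<^bsub>D\<^esub> (gamma_list C S We l (FObj ?Y (?o \<xi>)) \<cdot>\<^bsub>D\<^esub> FArr ?W (gamma_list C S Ye l (?o \<xi>)))"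
    unfolding gamma_tens[OF Ye We \<xi>] Cons.IH[OF o] option_list_comp[OF gW WA[OF gY]] ..
  also have "\<dots> = ?P (gamma C S We s (FObj ?Y \<xi>)) \<cdot>\<^bsub>D\<^esub> ((?P (FArr ?W (gamma C S Ye s \<xi>))
        \<cdot>\<^bsub>D\<^esub> gamma_list C S We l (FObj ?Y (?o \<xi>))) \<cdot>\<^bsub>D\<^esub> FArr ?W (gamma_list C S Ye l (?o \<xi>)))"
    using D.comp_assoc[OF P[OF gW] P[OF WA[OF gY]] D.comp_hom[OF LW WA[OF LY]]]
      D.comp_assoc[OF P[OF WA[OF gY]] LW WA[OF LY]] by simp
  \<comment> \<open>The middle factors are exchanged by naturality of the distribution for
    \<open>W\<close> at the arrow \<open>gamma C S Ye s \<xi>\<close>; afterwards the factors for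
    \<open>W\<close> and those for \<open>Y\<close> stand together.\<close>
  also have "\<dots> = ?P (gamma C S We s (FObj ?Y \<xi>)) \<cdot>\<^bsub>D\<^esub> ((gamma_list C S We l (?o (FObj ?Y \<xi>))
        \<cdot>\<^bsub>D\<^esub> FArr ?W (?P (gamma C S Ye s \<xi>))) \<cdot>\<^bsub>D\<^esub> FArr ?W (gamma_list C S Ye l (?o \<xi>)))"
    unfolding gamma_list_natural[OF We gY] ..
  also have "\<dots> = (?P (gamma C S We s (FObj ?Y \<xi>)) \<cdot>\<^bsub>D\<^esub> gamma_list C S We l (?o (FObj ?Y \<xi>)))
        \<cdot>\<^bsub>D\<^esub> FArr ?W (?P (gamma C S Ye s \<xi>) \<cdot>\<^bsub>D\<^esub> gamma_list C S Ye l (?o \<xi>))"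
    using D.comp_assoc[OF LWY WA[OF P[OF gY]] WA[OF LY]] e[OF P[OF gY] LY]
      D.comp_assoc[OF P[OF gW] LWY D.comp_hom[OF WA[OF P[OF gY]] WA[OF LY]]] by simp
  finally show ?case unfolding gamma_list.simps .
qed

end

section \<open>Components of signature functors\<close>

context continuous_operation
begin

lemma op_square:
  assumes "\<And>j. j \<in> J \<Longrightarrow> f j \<in> hom C (x j) (y j)" "\<And>j. j \<in> J \<Longrightarrow> g j \<in> hom C (y j) (z j)"
    "\<And>j. j \<in> J \<Longrightarrow> f' j \<in> hom C (x j) (y' j)" "\<And>j. j \<in> J \<Longrightarrow> g' j \<in> hom C (y' j) (z j)"
    "\<And>j. j \<in> J \<Longrightarrow> f j \<cdot> g j = f' j \<cdot> g' j"
  shows "M f \<cdot> M g = M f' \<cdot> M g'"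
  using op_comp[of f x y g z, OF assms(1,2)] op_comp[of f' x y' g' z, OF assms(3,4)] op_cong[OF assms(5)]
  by simp

lemma op_factor:
  assumes "\<And>j. j \<in> J \<Longrightarrow> f j \<in> hom C (x j) (y j)" "\<And>j. j \<in> J \<Longrightarrow> g j \<in> hom C (y j) (z j)"
    "\<And>j. j \<in> J \<Longrightarrow> k j = f j \<cdot> g j"
  shows "M k = M f \<cdot> M g"
  using op_comp[of f x y g z, OF assms(1,2)] op_cong[of k, OF assms(3)] by simp

end

text \<open>A component is the value at one sort of a functor between endofunctor categories: \<open>gO X \<xi>\<close> is its
  action on objects, \<open>gA \<alpha> \<xi>\<close> on natural transformations and \<open>gF X f\<close> on morphisms of families.\<close>

definition pointwise_limit :: "('o, 'm) category \<Rightarrow> 's set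
    \<Rightarrow> (nat \<Rightarrow> ('s, 'o, 'm) endofun) \<Rightarrow> (nat \<Rightarrow> ('s, 'o, 'm) endotrans)
    \<Rightarrow> ('s, 'o, 'm) endofun \<Rightarrow> (nat \<Rightarrow> ('s, 'o, 'm) endotrans) \<Rightarrow> bool" where
  "pointwise_limit C S X d L p \<longleftrightarrow>
     (\<forall>n. X n \<in> Obj (endo (fam_cat C S)) \<and> d n \<in> hom (endo (fam_cat C S)) (X (Suc n)) (X n))
     \<and> L \<in> Obj (endo (fam_cat C S)) \<and> (\<forall>n. p n \<in> hom (endo (fam_cat C S)) L (X n))
     \<and> (\<forall>\<xi> \<in> Obj (fam_cat C S). \<forall>t \<in> S. cochain_limit C (\<lambda>n. FObj (FObj (X n) \<xi>) t)
          (\<lambda>n. NMap (NMap (d n) \<xi>) t) (FObj (FObj L \<xi>) t) (\<lambda>n. NMap (NMap (p n) \<xi>) t))"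

locale component = sorted_families C S
  for C :: "('o, 'm) category" (structure) and S :: "'s set" +
  fixes gO :: "('s, 'o, 'm) endofun \<Rightarrow> ('s, 'o, 'm) fam \<Rightarrow> 'o"
    and gA :: "('s, 'o, 'm) endotrans \<Rightarrow> ('s, 'o, 'm) fam \<Rightarrow> 'm"
    and gF :: "('s, 'o, 'm) endofun \<Rightarrow> ('s, 'o, 'm) famarr \<Rightarrow> 'm"
  assumes gO_obj: "\<lbrakk>X \<in> Obj E; \<xi> \<in> Obj D\<rbrakk> \<Longrightarrow> gO X \<xi> \<in> Obj C"
    and gA_hom: "\<lbrakk>\<alpha> \<in> hom E X Y; \<xi> \<in> Obj D\<rbrakk> \<Longrightarrow> gA \<alpha> \<xi> \<in> hom C (gO X \<xi>) (gO Y \<xi>)"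
    and gA_idt: "\<lbrakk>X \<in> Obj E; \<xi> \<in> Obj D\<rbrakk> \<Longrightarrow> gA (Idt E X) \<xi> = Idt C (gO X \<xi>)"
    and gA_comp: "\<lbrakk>\<alpha> \<in> hom E X Y; \<beta> \<in> hom E Y Z; \<xi> \<in> Obj D\<rbrakk>
      \<Longrightarrow> gA (\<alpha> \<cdot>\<^bsub>E\<^esub> \<beta>) \<xi> = gA \<alpha> \<xi> \<cdot> gA \<beta> \<xi>"
    and gF_hom: "\<lbrakk>X \<in> Obj E; f \<in> hom D \<xi> \<zeta>\<rbrakk> \<Longrightarrow> gF X f \<in> hom C (gO X \<xi>) (gO X \<zeta>)"
    and gF_idt: "\<lbrakk>X \<in> Obj E; \<xi> \<in> Obj D\<rbrakk> \<Longrightarrow> gF X (Idt D \<xi>) = Idt C (gO X \<xi>)"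
    and gF_comp: "\<lbrakk>X \<in> Obj E; f \<in> hom D \<xi> \<zeta>; g \<in> hom D \<zeta> \<omega>\<rbrakk>
      \<Longrightarrow> gF X (f \<cdot>\<^bsub>D\<^esub> g) = gF X f \<cdot> gF X g"
    and gF_gA: "\<lbrakk>\<alpha> \<in> hom E X Y; f \<in> hom D \<xi> \<zeta>\<rbrakk> \<Longrightarrow> gF X f \<cdot> gA \<alpha> \<zeta> = gA \<alpha> \<xi> \<cdot> gF Y f"
    and g_limit: "\<lbrakk>pointwise_limit C S V d L p; \<xi> \<in> Obj D\<rbrakk>
      \<Longrightarrow> cochain_limit C (\<lambda>n. gO (V n) \<xi>) (\<lambda>n. gA (d n) \<xi>) (gO L \<xi>) (\<lambda>n. gA (p n) \<xi>)"

text \<open>The two coherence isomorphisms of strength are identities here, so they do not occur in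
  \<open>g\<theta>_unit\<close> and \<open>g\<theta>_tens\<close>.\<close>

locale strong_component = component C S gO gA gF
  for C :: "('o, 'm) category" (structure) and S :: "'s set" and gO gA gF +
  fixes g\<theta> :: "('s, 'o, 'm) endofun \<times> ('s, 'o, 'm) endotrans \<Rightarrow> ('s, 'o, 'm) endofun \<Rightarrow> ('s, 'o, 'm) fam \<Rightarrow> 'm"
  assumes g\<theta>_hom: "\<lbrakk>Ye \<in> ptd_obj (endo D); X \<in> Obj E; \<xi> \<in> Obj D\<rbrakk>
      \<Longrightarrow> g\<theta> Ye X \<xi> \<in> hom C (gO X (FObj (fst Ye) \<xi>)) (gO (fcomp D (fst Ye) X) \<xi>)"
    and g\<theta>_gF: "\<lbrakk>Ye \<in> ptd_obj (endo D); X \<in> Obj E; f \<in> hom D \<xi> \<zeta>\<rbrakk>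
      \<Longrightarrow> gF X (FArr (fst Ye) f) \<cdot> g\<theta> Ye X \<zeta> = g\<theta> Ye X \<xi> \<cdot> gF (fcomp D (fst Ye) X) f"
    and g\<theta>_natural: "\<lbrakk>Ye \<in> ptd_obj (endo D); We \<in> ptd_obj (endo D); \<phi> \<in> ptd_hom (endo D) Ye We;
        \<alpha> \<in> hom E X Z; \<xi> \<in> Obj D\<rbrakk>
      \<Longrightarrow> gF X (NMap \<phi> \<xi>) \<cdot> (gA \<alpha> (FObj (fst We) \<xi>) \<cdot> g\<theta> We Z \<xi>) = g\<theta> Ye X \<xi> \<cdot> gA (hcomp D D \<phi> \<alpha>) \<xi>"
    and g\<theta>_unit: "\<lbrakk>X \<in> Obj E; \<xi> \<in> Obj D\<rbrakk> \<Longrightarrow> g\<theta> (ptd_unit (endo D)) X \<xi> = Idt C (gO X \<xi>)"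
    and g\<theta>_tens: "\<lbrakk>Ye \<in> ptd_obj (endo D); We \<in> ptd_obj (endo D); X \<in> Obj E; \<xi> \<in> Obj D\<rbrakk>
      \<Longrightarrow> g\<theta> (ptd_tens (endo D) Ye We) X \<xi> = g\<theta> We X (FObj (fst Ye) \<xi>) \<cdot> g\<theta> Ye (fcomp D (fst We) X) \<xi>"

context sorted_families
begin

lemma pointwise_limitD:
  assumes "pointwise_limit C S X d L p"
  shows "X n \<in> Obj E" "d n \<in> hom E (X (Suc n)) (X n)" "L \<in> Obj E" "p n \<in> hom E L (X n)"
    "\<lbrakk>\<xi> \<in> Obj D; t \<in> S\<rbrakk> \<Longrightarrow> cochain_limit C (\<lambda>n. FObj (FObj (X n) \<xi>) t)
          (\<lambda>n. NMap (NMap (d n) \<xi>) t) (FObj (FObj L \<xi>) t) (\<lambda>n. NMap (NMap (p n) \<xi>) t)"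
  using assms unfolding pointwise_limit_def by auto

text \<open>Each axiom of a component is a typing statement or an equation between composites, which
  a functorial operation preserves, and \<open>op_limit\<close> takes care of
  \<open>g_limit\<close>. Components take values in \<open>C\<close> and not in families precisely
  so that operations on \<open>C\<close> can be applied to them.\<close>

lemma component_op:
  assumes op: "continuous_operation C J Q M" and g: "\<And>j. j \<in> J \<Longrightarrow> component C S (gO j) (gA j) (gF j)"
  shows "component C S (\<lambda>X \<xi>. Q (\<lambda>j. gO j X \<xi>)) (\<lambda>\<alpha> \<xi>. M (\<lambda>j. gA j \<alpha> \<xi>)) (\<lambda>X f. M (\<lambda>j. gF j X f))"
proof -
  interpret op: continuous_operation C J Q M by fact
  show ?thesis
  proof unfold_locales
    fix X \<xi> assume h: "X \<in> Obj E" "\<xi> \<in> Obj D"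
    show "Q (\<lambda>j. gO j X \<xi>) \<in> Obj C" by (rule op.op_obj) (rule component.gO_obj[OF g h])
    show "M (\<lambda>j. gA j (Idt E X) \<xi>) = Idt C (Q (\<lambda>j. gO j X \<xi>))"
      using op.op_cong[of "\<lambda>j. gA j (Idt E X) \<xi>" "\<lambda>j. Idt C (gO j X \<xi>)"] component.gA_idt[OF g h]
        op.op_idt[of "\<lambda>j. gO j X \<xi>"] component.gO_obj[OF g h] by simp
    show "M (\<lambda>j. gF j X (Idt D \<xi>)) = Idt C (Q (\<lambda>j. gO j X \<xi>))"
      using op.op_cong[of "\<lambda>j. gF j X (Idt D \<xi>)" "\<lambda>j. Idt C (gO j X \<xi>)"] component.gF_idt[OF g h]
        op.op_idt[of "\<lambda>j. gO j X \<xi>"] component.gO_obj[OF g h] by simp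
  next
    fix \<alpha> X Y \<xi> assume h: "\<alpha> \<in> hom E X Y" "\<xi> \<in> Obj D"
    show "M (\<lambda>j. gA j \<alpha> \<xi>) \<in> hom C (Q (\<lambda>j. gO j X \<xi>)) (Q (\<lambda>j. gO j Y \<xi>))"
      by (rule op.op_hom) (rule component.gA_hom[OF g h])
    fix \<beta> Z assume h': "\<beta> \<in> hom E Y Z"
    show "M (\<lambda>j. gA j (\<alpha> \<cdot>\<^bsub>E\<^esub> \<beta>) \<xi>) = M (\<lambda>j. gA j \<alpha> \<xi>) \<cdot> M (\<lambda>j. gA j \<beta> \<xi>)"
      by (rule op.op_factor[OF component.gA_hom[OF g h] component.gA_hom[OF g h' h(2)]
            component.gA_comp[OF g h(1) h' h(2)]])
  next
    fix X f \<xi> \<zeta> assume h: "X \<in> Obj E" "f \<in> hom D \<xi> \<zeta>"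
    show "M (\<lambda>j. gF j X f) \<in> hom C (Q (\<lambda>j. gO j X \<xi>)) (Q (\<lambda>j. gO j X \<zeta>))"
      by (rule op.op_hom) (rule component.gF_hom[OF g h])
    fix k \<omega> assume h': "k \<in> hom D \<zeta> \<omega>"
    show "M (\<lambda>j. gF j X (f \<cdot>\<^bsub>D\<^esub> k)) = M (\<lambda>j. gF j X f) \<cdot> M (\<lambda>j. gF j X k)"
      by (rule op.op_factor[OF component.gF_hom[OF g h] component.gF_hom[OF g h(1) h'] component.gF_comp[OF g h h']])
  next
    fix \<alpha> X Y f \<xi> \<zeta> assume \<alpha>: "\<alpha> \<in> hom E X Y" and f: "f \<in> hom D \<xi> \<zeta>"
    have o: "X \<in> Obj E" "Y \<in> Obj E" "\<xi> \<in> Obj D" "\<zeta> \<in> Obj D" using E.FC.hom_obj[OF \<alpha>] D.hom_obj[OF f] by auto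
    show "M (\<lambda>j. gF j X f) \<cdot> M (\<lambda>j. gA j \<alpha> \<zeta>) = M (\<lambda>j. gA j \<alpha> \<xi>) \<cdot> M (\<lambda>j. gF j Y f)"
      by (rule op.op_square[OF component.gF_hom[OF g o(1) f] component.gA_hom[OF g \<alpha> o(4)]
            component.gA_hom[OF g \<alpha> o(3)] component.gF_hom[OF g o(2) f] component.gF_gA[OF g \<alpha> f]])
  next
    fix V d L p \<xi> assume h: "pointwise_limit C S V d L p" "\<xi> \<in> Obj D"
    show "cochain_limit C (\<lambda>n. Q (\<lambda>j. gO j (V n) \<xi>)) (\<lambda>n. M (\<lambda>j. gA j (d n) \<xi>)) (Q (\<lambda>j. gO j L \<xi>)) (\<lambda>n. M (\<lambda>j. gA j (p n) \<xi>))"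
      by (rule op.op_limit) (rule component.g_limit[OF g h])
  qed
qed

lemma fcomp_ptd [simp]: "\<lbrakk>Ye \<in> ptd_obj (endo D); X \<in> Obj E\<rbrakk> \<Longrightarrow> fcomp D (fst Ye) X \<in> Obj E"
  by (auto simp: ptd_obj_def)

lemma fst_ptd [simp]: "Ye \<in> ptd_obj (endo D) \<Longrightarrow> fst Ye \<in> Obj E"
  by (auto simp: ptd_obj_def)

text \<open>The strength of the compound is the operation applied to the strengths of its parts.
  Each strength law is a commuting diagram for every part, and functoriality of the operation
  carries it over.\<close>

lemma strong_component_op:
  assumes op: "continuous_operation C J Q M"
    and g: "\<And>j. j \<in> J \<Longrightarrow> strong_component C S (gO j) (gA j) (gF j) (g\<theta> j)"
  shows "strong_component C S (\<lambda>X \<xi>. Q (\<lambda>j. gO j X \<xi>)) (\<lambda>\<alpha> \<xi>. M (\<lambda>j. gA j \<alpha> \<xi>)) (\<lambda>X f. M (\<lambda>j. gF j X f))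
    (\<lambda>Ye X \<xi>. M (\<lambda>j. g\<theta> j Ye X \<xi>))"
proof -
  interpret op: continuous_operation C J Q M by fact
  have g': "component C S (gO j) (gA j) (gF j)" if "j \<in> J" for j
    using g[OF that] by (simp add: strong_component_def)
  note gAh = component.gA_hom[OF g'] and gFh = component.gF_hom[OF g'] and g\<theta>h = strong_component.g\<theta>_hom[OF g]
  show ?thesis
  proof (intro strong_component.intro strong_component_axioms.intro component_op[OF op g'])
    fix Ye X \<xi> assume h: "Ye \<in> ptd_obj (endo D)" "X \<in> Obj E" "\<xi> \<in> Obj D"
    show "M (\<lambda>j. g\<theta> j Ye X \<xi>) \<in> hom C (Q (\<lambda>j. gO j X (FObj (fst Ye) \<xi>))) (Q (\<lambda>j. gO j (fcomp D (fst Ye) X) \<xi>))"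
      by (rule op.op_hom) (rule g\<theta>h[OF _ h])
    fix We assume h': "We \<in> ptd_obj (endo D)"
    have o: "fcomp D (fst We) X \<in> Obj E" "FObj (fst Ye) \<xi> \<in> Obj D" using h h' by simp_all
    have g1: "j \<in> J \<Longrightarrow> g\<theta> j Ye (fcomp D (fst We) X) \<xi> \<in> hom C (gO j (fcomp D (fst We) X) (FObj (fst Ye) \<xi>)) (gO j (fcomp D (fst Ye) (fcomp D (fst We) X)) \<xi>)" for j
      using g\<theta>h[OF _ h(1) o(1) h(3)] .
    have g2: "j \<in> J \<Longrightarrow> g\<theta> j We X (FObj (fst Ye) \<xi>) \<in> hom C (gO j X (FObj (fst We) (FObj (fst Ye) \<xi>))) (gO j (fcomp D (fst We) X) (FObj (fst Ye) \<xi>))" for j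
      using g\<theta>h[OF _ h' h(2) o(2)] .
    show "M (\<lambda>j. g\<theta> j (ptd_tens (endo D) Ye We) X \<xi>) = M (\<lambda>j. g\<theta> j We X (FObj (fst Ye) \<xi>)) \<cdot> M (\<lambda>j. g\<theta> j Ye (fcomp D (fst We) X) \<xi>)"
      by (rule op.op_factor[OF g2 g1 strong_component.g\<theta>_tens[OF g h(1) h' h(2,3)]])
  next
    fix X \<xi> assume h: "X \<in> Obj E" "\<xi> \<in> Obj D"
    show "M (\<lambda>j. g\<theta> j (ptd_unit (endo D)) X \<xi>) = Idt C (Q (\<lambda>j. gO j X \<xi>))"
      using op.op_cong[of "\<lambda>j. g\<theta> j (ptd_unit (endo D)) X \<xi>" "\<lambda>j. Idt C (gO j X \<xi>)"] strong_component.g\<theta>_unit[OF g h]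
        op.op_idt[of "\<lambda>j. gO j X \<xi>"] component.gO_obj[OF g' h] by simp
  next
    fix Ye X f \<xi> \<zeta> assume h: "Ye \<in> ptd_obj (endo D)" "X \<in> Obj E" "f \<in> hom D \<xi> \<zeta>"
    have o: "fcomp D (fst Ye) X \<in> Obj E" "\<xi> \<in> Obj D" "\<zeta> \<in> Obj D" "fst Ye \<in> Obj E" using h D.hom_obj[OF h(3)] by auto
    show "M (\<lambda>j. gF j X (FArr (fst Ye) f)) \<cdot> M (\<lambda>j. g\<theta> j Ye X \<zeta>) = M (\<lambda>j. g\<theta> j Ye X \<xi>) \<cdot> M (\<lambda>j. gF j (fcomp D (fst Ye) X) f)"
      by (rule op.op_square[OF gFh[OF _ h(2) E.FArr_hom[OF o(4) h(3)]] g\<theta>h[OF _ h(1,2) o(3)]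
            g\<theta>h[OF _ h(1,2) o(2)] gFh[OF _ o(1) h(3)] strong_component.g\<theta>_gF[OF g h]])
  next
    fix Ye We \<phi> \<alpha> X Z \<xi>
    assume h: "Ye \<in> ptd_obj (endo D)" "We \<in> ptd_obj (endo D)" "\<phi> \<in> ptd_hom (endo D) Ye We" "\<alpha> \<in> hom E X Z" "\<xi> \<in> Obj D"
    have \<phi>: "\<phi> \<in> hom E (fst Ye) (fst We)" using h(3) by (simp add: ptd_hom_def)
    have o: "X \<in> Obj E" "Z \<in> Obj E" "FObj (fst We) \<xi> \<in> Obj D" using h E.FC.hom_obj[OF h(4)] by auto
    note 1 = gFh[OF _ o(1) E.NMap_hom[OF \<phi> h(5)]] and 2 = gAh[OF _ h(4) o(3)] and 3 = g\<theta>h[OF _ h(2) o(2) h(5)]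
    note 4 = g\<theta>h[OF _ h(1) o(1) h(5)] and 5 = gAh[OF _ E.hcomp_hom[OF \<phi> h(4)] h(5)]
    show "M (\<lambda>j. gF j X (NMap \<phi> \<xi>)) \<cdot> (M (\<lambda>j. gA j \<alpha> (FObj (fst We) \<xi>)) \<cdot> M (\<lambda>j. g\<theta> j We Z \<xi>))
       = M (\<lambda>j. g\<theta> j Ye X \<xi>) \<cdot> M (\<lambda>j. gA j (hcomp D D \<phi> \<alpha>) \<xi>)"
    proof -
      \<comment> \<open>\<open>op_square\<close> has two factors on each side, so the last two of
        the three factors are merged first.\<close>
      have 6: "M (\<lambda>j. gA j \<alpha> (FObj (fst We) \<xi>) \<cdot> g\<theta> j We Z \<xi>)
          = M (\<lambda>j. gA j \<alpha> (FObj (fst We) \<xi>)) \<cdot> M (\<lambda>j. g\<theta> j We Z \<xi>)"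
        by (rule op.op_factor[OF 2 3 refl])
      show ?thesis unfolding 6[symmetric]
        by (rule op.op_square[OF 1 comp_hom[OF 2 3] 4 5 strong_component.g\<theta>_natural[OF g h]])
    qed
  qed
qed

text \<open>The summand \<open>Id\<close> of \<open>Id + H\<close>. It does not depend on the
  endofunctor, so its cochain is constant.\<close>

lemma component_id:
  assumes t: "t \<in> S"
  shows "component C S (\<lambda>X \<xi>. FObj \<xi> t) (\<lambda>\<alpha> \<xi>. Idt C (FObj \<xi> t)) (\<lambda>X f. NMap f t)"
proof unfold_locales
  fix V d L p \<xi> assume "pointwise_limit C S V d L p" "\<xi> \<in> Obj D"
  then show "cochain_limit C (\<lambda>n. FObj \<xi> t) (\<lambda>n. Idt C (FObj \<xi> t)) (FObj \<xi> t) (\<lambda>n. Idt C (FObj \<xi> t))"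
    using continuous_operation.op_limit[OF continuous_operation_const[of "FObj \<xi> t"]] t by simp
qed (use t D.hom_obj in \<open>auto simp: idt_hom hom_def\<close>)

end

context option_families
begin

text \<open>The endofunctor varies while the argument \<open>FObj P \<xi>\<close> stays fixed, so
  limit preservation is just the pointwise limit taken at that argument. The strength laws are those
  of \<open>gamma_list\<close> under \<open>FArr X\<close>.\<close>

lemma strong_component_eval:
  fixes l :: "'s list"
  assumes s: "s \<in> S"
  defines "P \<equiv> option_list C S l"
  shows "strong_component C S (\<lambda>X \<xi>. FObj (FObj X (FObj P \<xi>)) s) (\<lambda>\<alpha> \<xi>. NMap (NMap \<alpha> (FObj P \<xi>)) s)
    (\<lambda>X f. NMap (FArr X (FArr P f)) s) (\<lambda>Ye X \<xi>. NMap (FArr X (gamma_list C S Ye l \<xi>)) s)"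
proof -
  have P: "P \<in> Obj E" unfolding P_def by (rule option_list_endo)
  have n: "NMap f s \<cdot> NMap g s = NMap (f \<cdot>\<^bsub>D\<^esub> g) s" for f g using s by simp
  have XC: "FArr X f \<cdot>\<^bsub>D\<^esub> FArr X g = FArr X (f \<cdot>\<^bsub>D\<^esub> g)" if "X \<in> Obj E" "f \<in> hom D a b" "g \<in> hom D b c" for X f g a b c
    using that by (simp add: hom_def)
  show ?thesis
  proof unfold_locales
    fix X \<xi> assume h: "X \<in> Obj E" "\<xi> \<in> Obj D"
    show "FObj (FObj X (FObj P \<xi>)) s \<in> Obj C"
      "NMap (NMap (Idt E X) (FObj P \<xi>)) s = Idt C (FObj (FObj X (FObj P \<xi>)) s)"
      "NMap (FArr X (FArr P (Idt D \<xi>))) s = Idt C (FObj (FObj X (FObj P \<xi>)) s)"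
      using h P s by simp_all
    show "NMap (FArr X (gamma_list C S (ptd_unit (endo D)) l \<xi>)) s = Idt C (FObj (FObj X (FObj P \<xi>)) s)"
      using h P s by (simp add: gamma_list_unit P_def)
  next
    fix \<alpha> X Y \<xi> assume h: "\<alpha> \<in> hom E X Y" "\<xi> \<in> Obj D"
    show "NMap (NMap \<alpha> (FObj P \<xi>)) s \<in> hom C (FObj (FObj X (FObj P \<xi>)) s) (FObj (FObj Y (FObj P \<xi>)) s)"
      using h P s by (intro fam_hom E.NMap_hom) auto
    show "NMap (NMap (\<alpha> \<cdot>\<^bsub>E\<^esub> \<beta>) (FObj P \<xi>)) s = NMap (NMap \<alpha> (FObj P \<xi>)) s \<cdot> NMap (NMap \<beta> (FObj P \<xi>)) s" for \<beta>
      using h P s by simp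
  next
    fix \<alpha> X Y f \<xi> \<zeta> assume h: "\<alpha> \<in> hom E X Y" "f \<in> hom D \<xi> \<zeta>"
    show "NMap (FArr X (FArr P f)) s \<cdot> NMap (NMap \<alpha> (FObj P \<zeta>)) s
        = NMap (NMap \<alpha> (FObj P \<xi>)) s \<cdot> NMap (FArr Y (FArr P f)) s"
      by (simp only: n E.naturality[OF h(1) E.FArr_hom[OF P h(2)]])
  next
    fix X f \<xi> \<zeta> assume h: "X \<in> Obj E" "f \<in> hom D \<xi> \<zeta>"
    show "NMap (FArr X (FArr P f)) s \<in> hom C (FObj (FObj X (FObj P \<xi>)) s) (FObj (FObj X (FObj P \<zeta>)) s)"
      using h P s by (intro fam_hom E.FArr_hom) auto
    show "NMap (FArr X (FArr P (f \<cdot>\<^bsub>D\<^esub> g))) s = NMap (FArr X (FArr P f)) s \<cdot> NMap (FArr X (FArr P g)) s"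
      if "g \<in> hom D \<zeta> \<omega>" for g \<omega> using h that P s by (simp add: hom_def)
    fix Ye assume Ye: "Ye \<in> Ptd"
    have o: "\<xi> \<in> Obj D" "\<zeta> \<in> Obj D" using h D.hom_obj by auto
    note PYf = E.FArr_hom[OF P E.FArr_hom[OF fst_ptd[OF Ye] h(2)]] and YPf = E.FArr_hom[OF fst_ptd[OF Ye] E.FArr_hom[OF P h(2)]]
    have e: "FArr (fcomp D (fst Ye) X) (FArr P f) = FArr X (FArr (fst Ye) (FArr P f))"
      using E.FArr_hom[OF P h(2)] by (simp add: hom_def)
    show "NMap (FArr X (FArr P (FArr (fst Ye) f))) s \<cdot> NMap (FArr X (gamma_list C S Ye l \<zeta>)) s
       = NMap (FArr X (gamma_list C S Ye l \<xi>)) s \<cdot> NMap (FArr (fcomp D (fst Ye) X) (FArr P f)) s"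
      unfolding n e XC[OF h(1) PYf gamma_list_hom[OF Ye o(2), of l, folded P_def]]
        XC[OF h(1) gamma_list_hom[OF Ye o(1), of l, folded P_def] YPf]
      using gamma_list_natural[OF Ye h(2), of l] by (simp add: P_def)
  next
    fix Ye X \<xi> assume h: "Ye \<in> Ptd" "X \<in> Obj E" "\<xi> \<in> Obj D"
    have e: "FObj (fcomp D (fst Ye) X) (FObj P \<xi>) = FObj X (FObj (fst Ye) (FObj P \<xi>))" using P h by simp
    show "NMap (FArr X (gamma_list C S Ye l \<xi>)) s \<in> hom C (FObj (FObj X (FObj P (FObj (fst Ye) \<xi>))) s) (FObj (FObj (fcomp D (fst Ye) X) (FObj P \<xi>)) s)"
      unfolding e using fam_hom[OF E.FArr_hom[OF h(2) gamma_list_hom[OF h(1,3), of l, folded P_def]] s] .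
    fix We assume We: "We \<in> Ptd"
    have o: "FObj (fst Ye) \<xi> \<in> Obj D" using h by simp
    note gY = gamma_list_hom[OF h(1,3), of l] and gW = gamma_list_hom[OF We o, of l]
    have e: "FArr (fcomp D (fst We) X) (gamma_list C S Ye l \<xi>) = FArr X (FArr (fst We) (gamma_list C S Ye l \<xi>))"
      using gY by (simp add: hom_def)
    show "NMap (FArr X (gamma_list C S (ptd_tens (endo D) Ye We) l \<xi>)) s
       = NMap (FArr X (gamma_list C S We l (FObj (fst Ye) \<xi>))) s \<cdot> NMap (FArr (fcomp D (fst We) X) (gamma_list C S Ye l \<xi>)) s"
      by (simp only: n e XC[OF h(2) gW E.FArr_hom[OF fst_ptd[OF We] gY]] gamma_list_tens[OF h(1) We h(3)])
  next
    fix Ye We \<phi> \<alpha> X Z \<xi>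
    assume h: "Ye \<in> Ptd" "We \<in> Ptd" "\<phi> \<in> ptd_hom (endo D) Ye We" "\<alpha> \<in> hom E X Z" "\<xi> \<in> Obj D"
    note \<phi> = ptd_homD(1)[OF h(3)]
    have o: "X \<in> Obj E" "Z \<in> Obj E" "FObj (fst We) \<xi> \<in> Obj D" "FObj P \<xi> \<in> Obj D" using h P E.FC.hom_obj[OF h(4)] by auto
    note gY = gamma_list_hom[OF h(1,5), of l, folded P_def] and gW = gamma_list_hom[OF h(2,5), of l, folded P_def]
    note Pp = E.FArr_hom[OF P E.NMap_hom[OF \<phi> h(5)]] and pP = E.NMap_hom[OF \<phi> o(4)]
    have WP: "FObj (fst We) (FObj P \<xi>) \<in> Obj D" "FObj P (FObj (fst We) \<xi>) \<in> Obj D" using o P h by simp_all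
    note aP = E.NMap_hom[OF h(4) WP(1)] and aW = E.NMap_hom[OF h(4) WP(2)]
    have d: "NDom \<alpha> = X" "NCod \<phi> = fst We" using h(4) \<phi> by (simp_all add: hom_def)
    \<comment> \<open>First naturality of \<open>\<alpha>\<close> at the distribution map is used,
      then naturality of that map in the pointed endofunctor.\<close>
    have "FArr X (FArr P (NMap \<phi> \<xi>)) \<cdot>\<^bsub>D\<^esub> (NMap \<alpha> (FObj P (FObj (fst We) \<xi>)) \<cdot>\<^bsub>D\<^esub> FArr Z (gamma_list C S We l \<xi>))
        = FArr X (FArr P (NMap \<phi> \<xi>)) \<cdot>\<^bsub>D\<^esub> (FArr X (gamma_list C S We l \<xi>) \<cdot>\<^bsub>D\<^esub> NMap \<alpha> (FObj (fst We) (FObj P \<xi>)))"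
      using E.naturality[OF h(4) gW] by simp
    also have "\<dots> = FArr X (FArr P (NMap \<phi> \<xi>) \<cdot>\<^bsub>D\<^esub> gamma_list C S We l \<xi>) \<cdot>\<^bsub>D\<^esub> NMap \<alpha> (FObj (fst We) (FObj P \<xi>))"
      using D.comp_assoc[OF E.FArr_hom[OF o(1) Pp] E.FArr_hom[OF o(1) gW] aP] XC[OF o(1) Pp gW] by simp
    also have "\<dots> = FArr X (gamma_list C S Ye l \<xi> \<cdot>\<^bsub>D\<^esub> NMap \<phi> (FObj P \<xi>)) \<cdot>\<^bsub>D\<^esub> NMap \<alpha> (FObj (fst We) (FObj P \<xi>))"
      using gamma_list_ptd_natural[OF h(1,2,3,5), of l] by (simp add: P_def)
    also have "\<dots> = FArr X (gamma_list C S Ye l \<xi>) \<cdot>\<^bsub>D\<^esub> NMap (hcomp D D \<phi> \<alpha>) (FObj P \<xi>)"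
      using D.comp_assoc[OF E.FArr_hom[OF o(1) gY] E.FArr_hom[OF o(1) pP] aP] XC[OF o(1) gY pP] o(4) d by simp
    finally show "NMap (FArr X (FArr P (NMap \<phi> \<xi>))) s \<cdot> (NMap (NMap \<alpha> (FObj P (FObj (fst We) \<xi>))) s \<cdot> NMap (FArr Z (gamma_list C S We l \<xi>)) s)
       = NMap (FArr X (gamma_list C S Ye l \<xi>)) s \<cdot> NMap (NMap (hcomp D D \<phi> \<alpha>) (FObj P \<xi>)) s"
      unfolding n by simp
  next
    fix V d L p \<xi> assume h: "pointwise_limit C S V d L p" "\<xi> \<in> Obj D"
    show "cochain_limit C (\<lambda>n. FObj (FObj (V n) (FObj P \<xi>)) s) (\<lambda>n. NMap (NMap (d n) (FObj P \<xi>)) s)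
        (FObj (FObj L (FObj P \<xi>)) s) (\<lambda>n. NMap (NMap (p n) (FObj P \<xi>)) s)"
      using pointwise_limitD(5)[OF h(1) _ s] P h(2) by simp
  qed
qed

end

section \<open>Assembling components\<close>

context sorted_families
begin

definition assemble_obj where
  "assemble_obj gO gF X = \<lparr>FObj = (\<lambda>\<xi>\<in>Obj D. fam_obj C S (\<lambda>t. gO t X \<xi>)),
     FArr = (\<lambda>f\<in>Arr D. fam_arr C S (\<lambda>t. gF t X f))\<rparr>"

definition assemble_arr where
  "assemble_arr gO gA gF \<alpha> = mk_nt D (assemble_obj gO gF (NDom \<alpha>)) (assemble_obj gO gF (NCod \<alpha>))
     (\<lambda>\<xi>. fam_arr C S (\<lambda>t. gA t \<alpha> \<xi>))"

definition assemble_strength where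
  "assemble_strength gO gF g\<theta> Ye X =
     mk_nt D (fcomp D (fst Ye) (assemble_obj gO gF X)) (assemble_obj gO gF (fcomp D (fst Ye) X))
       (\<lambda>\<xi>. fam_arr C S (\<lambda>t. g\<theta> t Ye X \<xi>))"

lemma assemble_simps [simp]:
  "\<xi> \<in> Obj D \<Longrightarrow> FObj (assemble_obj gO gF X) \<xi> = fam_obj C S (\<lambda>t. gO t X \<xi>)"
  "f \<in> Arr D \<Longrightarrow> FArr (assemble_obj gO gF X) f = fam_arr C S (\<lambda>t. gF t X f)"
  "NDom (assemble_arr gO gA gF \<alpha>) = assemble_obj gO gF (NDom \<alpha>)"
  "NCod (assemble_arr gO gA gF \<alpha>) = assemble_obj gO gF (NCod \<alpha>)"
  "\<xi> \<in> Obj D \<Longrightarrow> NMap (assemble_arr gO gA gF \<alpha>) \<xi> = fam_arr C S (\<lambda>t. gA t \<alpha> \<xi>)"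
  "NDom (assemble_strength gO gF g\<theta> Ye X) = fcomp D (fst Ye) (assemble_obj gO gF X)"
  "NCod (assemble_strength gO gF g\<theta> Ye X) = assemble_obj gO gF (fcomp D (fst Ye) X)"
  "\<xi> \<in> Obj D \<Longrightarrow> NMap (assemble_strength gO gF g\<theta> Ye X) \<xi> = fam_arr C S (\<lambda>t. g\<theta> t Ye X \<xi>)"
  by (simp_all add: assemble_obj_def assemble_arr_def assemble_strength_def)

context
  fixes gO gA gF
  assumes g: "\<And>t. t \<in> S \<Longrightarrow> component C S (gO t) (gA t) (gF t)"
begin

lemma assemble_obj_endo:
  assumes X: "X \<in> Obj E"
  shows "assemble_obj gO gF X \<in> Obj E"
proof (rule E.functorI)
  note o = component.gO_obj[OF g X] and F = component.gF_hom[OF g X]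
  show "FObj (assemble_obj gO gF X) \<in> extensional (Obj D)" "FArr (assemble_obj gO gF X) \<in> extensional (Arr D)"
    by (simp_all add: assemble_obj_def)
  fix \<xi> assume \<xi>: "\<xi> \<in> Obj D"
  show "FObj (assemble_obj gO gF X) \<xi> \<in> Obj D" using o \<xi> by simp
  have i: "fam_arr C S (\<lambda>t. gF t X (Idt D \<xi>)) \<in> hom D (fam_obj C S (\<lambda>t. gO t X \<xi>)) (fam_obj C S (\<lambda>t. gO t X \<xi>))"
    by (rule fam_arr_hom'[OF F[OF _ D.idt_hom[OF \<xi>]]])
  have "fam_arr C S (\<lambda>t. gF t X (Idt D \<xi>)) = Idt D (fam_obj C S (\<lambda>t. gO t X \<xi>))"
    by (rule fam_arr_eqI[OF i D.idt_hom]) (use o \<xi> component.gF_idt[OF g X \<xi>] in auto)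
  then show "FArr (assemble_obj gO gF X) (Idt D \<xi>) = Idt D (FObj (assemble_obj gO gF X) \<xi>)"
    using \<xi> by simp
next
  note o = component.gO_obj[OF g X] and F = component.gF_hom[OF g X]
  fix f \<xi> \<zeta> assume f: "f \<in> hom D \<xi> \<zeta>"
  have f': "f \<in> Arr D" "\<xi> \<in> Obj D" "\<zeta> \<in> Obj D" using f D.hom_obj[OF f] by (auto simp: hom_def)
  show "FArr (assemble_obj gO gF X) f \<in> hom D (FObj (assemble_obj gO gF X) \<xi>) (FObj (assemble_obj gO gF X) \<zeta>)"
    using fam_arr_hom'[OF F[OF _ f]] f' by simp
  fix k \<omega> assume k: "k \<in> hom D \<zeta> \<omega>"
  note fk = D.comp_hom[OF f k]
  have k': "k \<in> Arr D" "f \<cdot>\<^bsub>D\<^esub> k \<in> Arr D" using k fk by (auto simp: hom_def)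
  have "fam_arr C S (\<lambda>t. gF t X (f \<cdot>\<^bsub>D\<^esub> k)) = fam_arr C S (\<lambda>t. gF t X f) \<cdot>\<^bsub>D\<^esub> fam_arr C S (\<lambda>t. gF t X k)"
    by (rule fam_arr_eqI[OF fam_arr_hom'[OF F[OF _ fk]] D.comp_hom[OF fam_arr_hom'[OF F[OF _ f]] fam_arr_hom'[OF F[OF _ k]]]])
      (use component.gF_comp[OF g X f k] in auto)
  then show "FArr (assemble_obj gO gF X) (f \<cdot>\<^bsub>D\<^esub> k) = FArr (assemble_obj gO gF X) f \<cdot>\<^bsub>D\<^esub> FArr (assemble_obj gO gF X) k"
    using f' k' by simp
qed

lemma assemble_arr_hom:
  assumes \<alpha>: "\<alpha> \<in> hom E X Y"
  shows "assemble_arr gO gA gF \<alpha> \<in> hom E (assemble_obj gO gF X) (assemble_obj gO gF Y)"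
proof -
  have o: "X \<in> Obj E" "Y \<in> Obj E" "NDom \<alpha> = X" "NCod \<alpha> = Y" using \<alpha> E.FC.hom_obj[OF \<alpha>] by (auto simp: hom_def)
  note A = fam_arr_hom'[OF component.gA_hom[OF g \<alpha>]]
  show ?thesis unfolding assemble_arr_def o(3,4)
  proof (rule E.mk_nt_hom[OF assemble_obj_endo[OF o(1)] assemble_obj_endo[OF o(2)]])
    show "fam_arr C S (\<lambda>t. gA t \<alpha> \<xi>) \<in> hom D (FObj (assemble_obj gO gF X) \<xi>) (FObj (assemble_obj gO gF Y) \<xi>)"
      if "\<xi> \<in> Obj D" for \<xi> using A[OF _ that] that by simp
    fix f \<xi> \<zeta> assume f: "f \<in> hom D \<xi> \<zeta>"
    have f': "f \<in> Arr D" "\<xi> \<in> Obj D" "\<zeta> \<in> Obj D" using f D.hom_obj[OF f] by (auto simp: hom_def)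
    have "fam_arr C S (\<lambda>t. gF t X f) \<cdot>\<^bsub>D\<^esub> fam_arr C S (\<lambda>t. gA t \<alpha> \<zeta>)
        = fam_arr C S (\<lambda>t. gA t \<alpha> \<xi>) \<cdot>\<^bsub>D\<^esub> fam_arr C S (\<lambda>t. gF t Y f)"
      by (rule fam_arr_eqI[OF D.comp_hom[OF fam_arr_hom'[OF component.gF_hom[OF g o(1) f]] A[OF _ f'(3)]]
            D.comp_hom[OF A[OF _ f'(2)] fam_arr_hom'[OF component.gF_hom[OF g o(2) f]]]])
        (use component.gF_gA[OF g \<alpha> f] in auto)
    then show "FArr (assemble_obj gO gF X) f \<cdot>\<^bsub>D\<^esub> fam_arr C S (\<lambda>t. gA t \<alpha> \<zeta>)
        = fam_arr C S (\<lambda>t. gA t \<alpha> \<xi>) \<cdot>\<^bsub>D\<^esub> FArr (assemble_obj gO gF Y) f"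
      using f' by simp
  qed
qed

lemma assemble_arr_idt:
  assumes X: "X \<in> Obj E"
  shows "assemble_arr gO gA gF (Idt E X) = Idt E (assemble_obj gO gF X)"
proof (rule nt_eqI[OF assemble_arr_hom[OF E.FC.idt_hom[OF X]] E.FC.idt_hom[OF assemble_obj_endo[OF X]]])
  fix \<xi> assume \<xi>: "\<xi> \<in> Obj D"
  have o: "fam_obj C S (\<lambda>t. gO t X \<xi>) \<in> Obj D" using component.gO_obj[OF g X \<xi>] by simp
  show "NMap (assemble_arr gO gA gF (Idt E X)) \<xi> = NMap (Idt E (assemble_obj gO gF X)) \<xi>"
    using fam_arr_eqI[OF fam_arr_hom'[OF component.gA_hom[OF g E.FC.idt_hom[OF X] \<xi>]] D.idt_hom[OF o]]
      component.gA_idt[OF g X \<xi>] \<xi> by simp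
qed

lemma assemble_arr_comp:
  assumes \<alpha>: "\<alpha> \<in> hom E X Y" and \<beta>: "\<beta> \<in> hom E Y Z"
  shows "assemble_arr gO gA gF (\<alpha> \<cdot>\<^bsub>E\<^esub> \<beta>) = assemble_arr gO gA gF \<alpha> \<cdot>\<^bsub>E\<^esub> assemble_arr gO gA gF \<beta>"
proof (rule nt_eqI[OF assemble_arr_hom[OF E.FC.comp_hom[OF \<alpha> \<beta>]]
      E.FC.comp_hom[OF assemble_arr_hom[OF \<alpha>] assemble_arr_hom[OF \<beta>]]])
  fix \<xi> assume \<xi>: "\<xi> \<in> Obj D"
  note A = fam_arr_hom'[OF component.gA_hom[OF g _ \<xi>]]
  show "NMap (assemble_arr gO gA gF (\<alpha> \<cdot>\<^bsub>E\<^esub> \<beta>)) \<xi> = NMap (assemble_arr gO gA gF \<alpha> \<cdot>\<^bsub>E\<^esub> assemble_arr gO gA gF \<beta>) \<xi>"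
    using fam_arr_eqI[OF A[OF _ E.FC.comp_hom[OF \<alpha> \<beta>]] D.comp_hom[OF A[OF _ \<alpha>] A[OF _ \<beta>]]]
      component.gA_comp[OF g \<alpha> \<beta> \<xi>] \<xi> by simp
qed

text \<open>Components preserve limits at each family and sort, which is exactly what a pointwise
  limit records.\<close>

lemma assemble_limit:
  assumes l: "pointwise_limit C S X d L p"
  shows "pointwise_limit C S (\<lambda>n. assemble_obj gO gF (X n)) (\<lambda>n. assemble_arr gO gA gF (d n))
    (assemble_obj gO gF L) (\<lambda>n. assemble_arr gO gA gF (p n))"
  unfolding pointwise_limit_def
  using assemble_obj_endo pointwise_limitD[OF l] assemble_arr_hom component.g_limit[OF g l] by auto

end

text \<open>\<open>H\<close> is compared with the assembled functor only on the objects and arrows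
  of \<open>E\<close> and is extensional outside, because \<open>sig_functor\<close> and
  \<open>id_plus\<close> are defined by restricted functions.\<close>

lemma is_functor_assemble:
  assumes g: "\<And>t. t \<in> S \<Longrightarrow> component C S (gO t) (gA t) (gF t)"
    and H: "\<And>X. X \<in> Obj E \<Longrightarrow> FObj H X = assemble_obj gO gF X"
      "\<And>\<alpha>. \<alpha> \<in> Arr E \<Longrightarrow> FArr H \<alpha> = assemble_arr gO gA gF \<alpha>"
      "FObj H \<in> extensional (Obj E)" "FArr H \<in> extensional (Arr E)"
  shows "is_functor (endo D) (endo D) H"
proof (intro is_functor.intro is_functor_axioms.intro E.category_endo)
  note a = assemble_arr_hom[OF g] assemble_obj_endo[OF g] assemble_arr_idt[OF g] assemble_arr_comp[OF g]
  show "FObj H X \<in> Obj (endo D)" if "X \<in> Obj (endo D)" for X using that H(1) a(2) by simp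
  show "FArr H f \<in> hom (endo D) (FObj H X) (FObj H Y)" if "f \<in> hom (endo D) X Y" for f X Y
  proof -
    have f: "f \<in> hom E X Y" using that by simp
    then show ?thesis using H(1,2) a(1)[OF _ f] E.FC.hom_obj[OF f] E.FC.homD[OF f] by simp
  qed
  show "FArr H (Idt (endo D) X) = Idt (endo D) (FObj H X)" if "X \<in> Obj (endo D)" for X
    using that H(1,2) a(3) by simp
  show "FArr H (f \<cdot>\<^bsub>endo D\<^esub> k) = FArr H f \<cdot>\<^bsub>endo D\<^esub> FArr H k"
    if "f \<in> hom (endo D) X Y" "k \<in> hom (endo D) Y Z" for f X Y k Z
  proof -
    have f: "f \<in> hom E X Y" "k \<in> hom E Y Z" using that by simp_all
    then show ?thesis using H(2) a(4)[OF _ f] E.FC.homD[OF f(1)] E.FC.homD[OF f(2)] E.FC.homD[OF E.FC.comp_hom[OF f]] by simp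
  qed
qed (use H in auto)

lemma assemble_strength_hom:
  assumes g: "\<And>t. t \<in> S \<Longrightarrow> strong_component C S (gO t) (gA t) (gF t) (g\<theta> t)"
    and Ye: "Ye \<in> ptd_obj (endo D)" and X: "X \<in> Obj E"
  shows "assemble_strength gO gF g\<theta> Ye X
    \<in> hom E (fcomp D (fst Ye) (assemble_obj gO gF X)) (assemble_obj gO gF (fcomp D (fst Ye) X))"
  unfolding assemble_strength_def
proof (rule E.mk_nt_hom)
  have g': "component C S (gO t) (gA t) (gF t)" if "t \<in> S" for t
    using g[OF that] by (simp add: strong_component_def)
  note ao = assemble_obj_endo[OF g']
  have Y: "fst Ye \<in> Obj E" "fcomp D (fst Ye) X \<in> Obj E" using Ye X by simp_all
  show "fcomp D (fst Ye) (assemble_obj gO gF X) \<in> Obj E" "assemble_obj gO gF (fcomp D (fst Ye) X) \<in> Obj E"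
    using Y X ao by simp_all
  note A = fam_arr_hom'[OF strong_component.g\<theta>_hom[OF g Ye X]]
  show "fam_arr C S (\<lambda>t. g\<theta> t Ye X \<xi>) \<in> hom D (FObj (fcomp D (fst Ye) (assemble_obj gO gF X)) \<xi>) (FObj (assemble_obj gO gF (fcomp D (fst Ye) X)) \<xi>)"
    if "\<xi> \<in> Obj D" for \<xi> using A[OF _ that] that Y by simp
  fix f \<xi> \<zeta> assume f: "f \<in> hom D \<xi> \<zeta>"
  have f': "f \<in> Arr D" "\<xi> \<in> Obj D" "\<zeta> \<in> Obj D" "FArr (fst Ye) f \<in> Arr D"
    using f D.hom_obj[OF f] Y(1) by (auto simp: hom_def)
  have "fam_arr C S (\<lambda>t. gF t X (FArr (fst Ye) f)) \<cdot>\<^bsub>D\<^esub> fam_arr C S (\<lambda>t. g\<theta> t Ye X \<zeta>)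
      = fam_arr C S (\<lambda>t. g\<theta> t Ye X \<xi>) \<cdot>\<^bsub>D\<^esub> fam_arr C S (\<lambda>t. gF t (fcomp D (fst Ye) X) f)"
    by (rule fam_arr_eqI[OF D.comp_hom[OF fam_arr_hom'[OF component.gF_hom[OF g' X E.FArr_hom[OF Y(1) f]]] A[OF _ f'(3)]]
          D.comp_hom[OF A[OF _ f'(2)] fam_arr_hom'[OF component.gF_hom[OF g' Y(2) f]]]])
      (use strong_component.g\<theta>_gF[OF g Ye X f] in auto)
  then show "FArr (fcomp D (fst Ye) (assemble_obj gO gF X)) f \<cdot>\<^bsub>D\<^esub> fam_arr C S (\<lambda>t. g\<theta> t Ye X \<zeta>)
      = fam_arr C S (\<lambda>t. g\<theta> t Ye X \<xi>) \<cdot>\<^bsub>D\<^esub> FArr (assemble_obj gO gF (fcomp D (fst Ye) X)) f"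
    using f' by simp
qed

text \<open>All coherence morphisms are identities, so each law becomes an equality of
  transformations. It is checked at a family and a sort, where it is an axiom of the strong
  component.\<close>

theorem pointed_strength_assemble:
  assumes g: "\<And>t. t \<in> S \<Longrightarrow> strong_component C S (gO t) (gA t) (gF t) (g\<theta> t)"
    and H: "\<And>X. X \<in> Obj E \<Longrightarrow> FObj H X = assemble_obj gO gF X"
      "\<And>\<alpha>. \<alpha> \<in> Arr E \<Longrightarrow> FArr H \<alpha> = assemble_arr gO gA gF \<alpha>"
      "FObj H \<in> extensional (Obj E)" "FArr H \<in> extensional (Arr E)"
    and \<theta>: "\<And>Ye X. \<lbrakk>Ye \<in> ptd_obj (endo D); X \<in> Obj E\<rbrakk> \<Longrightarrow> \<theta> Ye X = assemble_strength gO gF g\<theta> Ye X"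
  shows "pointed_strength (endo D) H \<theta>"
proof -
  have g': "component C S (gO t) (gA t) (gF t)" if "t \<in> S" for t
    using g[OF that] by (simp add: strong_component_def)
  note ao = assemble_obj_endo[OF g'] and ah = assemble_arr_hom[OF g']
  interpret H: is_functor "endo D" "endo D" H by (rule is_functor_assemble[OF g' H])
  have th: "assemble_strength gO gF g\<theta> Ye X \<in> hom E (fcomp D (fst Ye) (assemble_obj gO gF X)) (assemble_obj gO gF (fcomp D (fst Ye) X))"
    if "Ye \<in> ptd_obj (endo D)" "X \<in> Obj E" for Ye X
    by (rule assemble_strength_hom[OF g that])
  show ?thesis
  proof (intro pointed_strength.intro pointed_strength_axioms.intro E.monoidal_category_endo H.is_functor_axioms)
    fix Ye X assume Ye: "Ye \<in> ptd_obj (endo D)" and "X \<in> Obj (endo D)"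
    then have X: "X \<in> Obj E" "fcomp D (fst Ye) X \<in> Obj E" by simp_all
    show "\<theta> Ye X \<in> hom (endo D) (fst Ye \<otimes>\<^bsub>endo D\<^esub> FObj H X) (FObj H (fst Ye \<otimes>\<^bsub>endo D\<^esub> X))"
      using th[OF Ye X(1)] \<theta>[OF Ye X(1)] H(1) X by simp
  next
    fix X assume "X \<in> Obj (endo D)"
    then have X: "X \<in> Obj E" by simp
    let ?I = "ptd_unit (endo D)"
    have I: "?I \<in> ptd_obj (endo D)" using E.FC.idt_hom[OF E.fid_obj] by (simp add: ptd_obj_def ptd_unit_def)
    have f: "fst ?I = fid D" by (simp add: ptd_unit_def)
    note AX = ao[OF _ X, simplified]
    have t: "assemble_strength gO gF g\<theta> ?I X \<in> hom E (assemble_obj gO gF X) (assemble_obj gO gF X)"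
      using th[OF I X] X AX by (simp add: f)
    have "assemble_strength gO gF g\<theta> ?I X = Idt E (assemble_obj gO gF X)"
    proof (rule nt_eqI[OF t E.FC.idt_hom[OF AX]])
      fix \<xi> assume \<xi>: "\<xi> \<in> Obj D"
      have o: "fam_obj C S (\<lambda>t. gO t X \<xi>) \<in> Obj D" using component.gO_obj[OF g' X \<xi>] by simp
      show "NMap (assemble_strength gO gF g\<theta> ?I X) \<xi> = NMap (Idt E (assemble_obj gO gF X)) \<xi>"
        using fam_arr_eqI[OF E.NMap_hom[OF t \<xi>] E.NMap_hom[OF E.FC.idt_hom[OF AX] \<xi>]]
          strong_component.g\<theta>_unit[OF g X \<xi>] \<xi> by simp
    qed
    then show "\<theta> ?I X \<cdot>\<^bsub>endo D\<^esub> FArr H (Lam (endo D) X) = Lam (endo D) (FObj H X)"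
      using X AX H.FArr_idt[of X] H(1) by (simp add: \<theta>[OF I X])
  next
    fix Ye We X assume Ye: "Ye \<in> ptd_obj (endo D)" and We: "We \<in> ptd_obj (endo D)" and "X \<in> Obj (endo D)"
    then have X: "X \<in> Obj E" by simp
    have Y: "fst Ye \<in> Obj E" and W: "fst We \<in> Obj E" using Ye We by simp_all
    let ?T = "ptd_tens (endo D) Ye We"
    have li: "inv_arr (endo D) (Idt E (fid D)) = Idt E (fid D)"
      using E.FC.inv_arr_eq[OF E.FC.is_inverse_idt[OF E.fid_obj]] by (simp add: inv_arr_def)
    have p: "snd Ye \<in> hom E (fid D) (fst Ye)" "snd We \<in> hom E (fid D) (fst We)"
      using Ye We by (auto simp: ptd_obj_def)
    have h: "hcomp D D (snd Ye) (snd We) \<in> hom E (fid D) (fcomp D (fst Ye) (fst We))"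
      using E.hcomp_hom[OF p] by simp
    have T: "?T \<in> ptd_obj (endo D)" "fst ?T = fcomp D (fst Ye) (fst We)"
      using h Y W E.FC.idt_comp[OF h] by (simp_all add: ptd_tens_def ptd_obj_def li)
    have WX: "fcomp D (fst We) X \<in> Obj E" and YWX: "fcomp D (fst Ye) (fcomp D (fst We) X) \<in> Obj E" using X Y W by simp_all
    note AX = ao[OF _ X, simplified] and AWX = ao[OF _ WX, simplified] and AYWX = ao[OF _ YWX, simplified]
    have tT: "assemble_strength gO gF g\<theta> ?T X \<in> hom E (fcomp D (fst Ye) (fcomp D (fst We) (assemble_obj gO gF X)))
        (assemble_obj gO gF (fcomp D (fst Ye) (fcomp D (fst We) X)))"
      using th[OF T(1) X] X Y W AX by (simp add: T(2))
    note tW = th[OF We X] and tY = th[OF Ye WX]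
    have tw: "hcomp D D (Idt E (fst Ye)) (assemble_strength gO gF g\<theta> We X)
        \<in> hom E (fcomp D (fst Ye) (fcomp D (fst We) (assemble_obj gO gF X))) (fcomp D (fst Ye) (assemble_obj gO gF (fcomp D (fst We) X)))"
      using E.hcomp_hom[OF E.FC.idt_hom[OF Y] tW] .
    have "assemble_strength gO gF g\<theta> ?T X
      = hcomp D D (Idt E (fst Ye)) (assemble_strength gO gF g\<theta> We X) \<cdot>\<^bsub>E\<^esub> assemble_strength gO gF g\<theta> Ye (fcomp D (fst We) X)"
    proof (rule nt_eqI[OF tT E.FC.comp_hom[OF tw tY]])
      fix \<xi> assume \<xi>: "\<xi> \<in> Obj D"
      show "NMap (assemble_strength gO gF g\<theta> ?T X) \<xi>
        = NMap (hcomp D D (Idt E (fst Ye)) (assemble_strength gO gF g\<theta> We X) \<cdot>\<^bsub>E\<^esub> assemble_strength gO gF g\<theta> Ye (fcomp D (fst We) X)) \<xi>"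
      proof (rule fam_arr_eqI[OF E.NMap_hom[OF tT \<xi>] E.NMap_hom[OF E.FC.comp_hom[OF tw tY] \<xi>]])
        fix t assume t: "t \<in> S"
        have Y\<xi>: "FObj (fst Ye) \<xi> \<in> Obj D" using Y \<xi> by simp
        have "fcomp D (fst We) (assemble_obj gO gF X) \<in> Obj E" using W AX by simp
        then have e: "FArr (fcomp D (fst We) (assemble_obj gO gF X)) (Idt D (FObj (fst Ye) \<xi>))
            = Idt D (FObj (fcomp D (fst We) (assemble_obj gO gF X)) (FObj (fst Ye) \<xi>))"
          using Y\<xi> by (rule E.FObj_simps)
        \<comment> \<open>Whiskering by \<open>Y\<close> evaluates the transformation at
          \<open>Y \<xi>\<close>; the other factor of \<open>hcomp\<close> is the image of an
          identity, and \<open>e\<close> removes it.\<close>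
        have "NMap (hcomp D D (Idt E (fst Ye)) (assemble_strength gO gF g\<theta> We X)) \<xi>
            = fam_arr C S (\<lambda>t. g\<theta> t We X (FObj (fst Ye) \<xi>))"
          using D.idt_comp[OF E.NMap_hom[OF tW Y\<xi>]] \<xi> Y\<xi> e by simp
        then show "NMap (NMap (assemble_strength gO gF g\<theta> ?T X) \<xi>) t
          = NMap (NMap (hcomp D D (Idt E (fst Ye)) (assemble_strength gO gF g\<theta> We X) \<cdot>\<^bsub>E\<^esub> assemble_strength gO gF g\<theta> Ye (fcomp D (fst We) X)) \<xi>) t"
          using strong_component.g\<theta>_tens[OF g[OF t] Ye We X \<xi>] t \<xi> by simp
      qed
    qed
    moreover have "FArr H (Assoc (endo D) (fst Ye) (fst We) X) = Idt E (assemble_obj gO gF (fcomp D (fst Ye) (fcomp D (fst We) X)))"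
      using H.FArr_idt[of "fcomp D (fst Ye) (fcomp D (fst We) X)"] X Y W YWX H(1) by simp
    ultimately show "\<theta> ?T X \<cdot>\<^bsub>endo D\<^esub> FArr H (Assoc (endo D) (fst Ye) (fst We) X)
       = Assoc (endo D) (fst Ye) (fst We) (FObj H X) \<cdot>\<^bsub>endo D\<^esub> (Idt (endo D) (fst Ye) \<odot>\<^bsub>endo D\<^esub> \<theta> We X)
         \<cdot>\<^bsub>endo D\<^esub> \<theta> Ye (fst We \<otimes>\<^bsub>endo D\<^esub> X)"
      using \<theta>[OF T(1) X] \<theta>[OF We X] \<theta>[OF Ye WX] H(1) X Y W AX E.FC.comp_idt[OF tT] E.FC.idt_comp[OF tw] by simp
  next
    fix Ye We \<phi> \<alpha> X Z
    assume Ye: "Ye \<in> ptd_obj (endo D)" and We: "We \<in> ptd_obj (endo D)" and \<phi>: "\<phi> \<in> ptd_hom (endo D) Ye We"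
      and "\<alpha> \<in> hom (endo D) X Z"
    then have \<alpha>: "\<alpha> \<in> hom E X Z" by simp
    have f: "\<phi> \<in> hom E (fst Ye) (fst We)" using \<phi> by (simp add: ptd_hom_def)
    have o: "X \<in> Obj E" "Z \<in> Obj E" "fst Ye \<in> Obj E" "fst We \<in> Obj E" using E.FC.hom_obj[OF \<alpha>] Ye We by simp_all
    have hf: "hcomp D D \<phi> \<alpha> \<in> hom E (fcomp D (fst Ye) X) (fcomp D (fst We) Z)" using E.hcomp_hom[OF f \<alpha>] .
    have A: "assemble_arr gO gA gF \<alpha> \<in> hom E (assemble_obj gO gF X) (assemble_obj gO gF Z)" by (rule ah[OF _ \<alpha>])
    have B: "assemble_arr gO gA gF (hcomp D D \<phi> \<alpha>) \<in> hom E (assemble_obj gO gF (fcomp D (fst Ye) X)) (assemble_obj gO gF (fcomp D (fst We) Z))"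
      by (rule ah[OF _ hf])
    note l = E.FC.comp_hom[OF E.hcomp_hom[OF f A] th[OF We o(2)]] and r = E.FC.comp_hom[OF th[OF Ye o(1)] B]
    have "hcomp D D \<phi> (assemble_arr gO gA gF \<alpha>) \<cdot>\<^bsub>E\<^esub> assemble_strength gO gF g\<theta> We Z
        = assemble_strength gO gF g\<theta> Ye X \<cdot>\<^bsub>E\<^esub> assemble_arr gO gA gF (hcomp D D \<phi> \<alpha>)"
    proof (rule nt_eqI[OF l r])
      fix \<xi> assume \<xi>: "\<xi> \<in> Obj D"
      show "NMap (hcomp D D \<phi> (assemble_arr gO gA gF \<alpha>) \<cdot>\<^bsub>E\<^esub> assemble_strength gO gF g\<theta> We Z) \<xi>
        = NMap (assemble_strength gO gF g\<theta> Ye X \<cdot>\<^bsub>E\<^esub> assemble_arr gO gA gF (hcomp D D \<phi> \<alpha>)) \<xi>"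
      proof (rule fam_arr_eqI[OF E.NMap_hom[OF l \<xi>] E.NMap_hom[OF r \<xi>]])
        fix t assume t: "t \<in> S"
        have W\<xi>: "FObj (fst We) \<xi> \<in> Obj D" using o \<xi> by simp
        have p: "NMap \<phi> \<xi> \<in> Arr D" using E.NMap_hom[OF f \<xi>] by (simp add: hom_def)
        have d: "NDom \<alpha> = X" "NCod \<phi> = fst We" using \<alpha> f by (simp_all add: hom_def)
        note gg = g[OF t] and gc = g'[OF t]
        note 1 = component.gF_hom[OF gc o(1) E.NMap_hom[OF f \<xi>]] and 2 = component.gA_hom[OF gc \<alpha> W\<xi>]
          and 3 = strong_component.g\<theta>_hom[OF gg We o(2) \<xi>]
        show "NMap (NMap (hcomp D D \<phi> (assemble_arr gO gA gF \<alpha>) \<cdot>\<^bsub>E\<^esub> assemble_strength gO gF g\<theta> We Z) \<xi>) t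
          = NMap (NMap (assemble_strength gO gF g\<theta> Ye X \<cdot>\<^bsub>E\<^esub> assemble_arr gO gA gF (hcomp D D \<phi> \<alpha>)) \<xi>) t"
          using strong_component.g\<theta>_natural[OF gg Ye We \<phi> \<alpha> \<xi>] comp_assoc[OF 1 2 3] t \<xi> W\<xi> p d by simp
      qed
    qed
    then show "\<phi> \<odot>\<^bsub>endo D\<^esub> FArr H \<alpha> \<cdot>\<^bsub>endo D\<^esub> \<theta> We Z = \<theta> Ye X \<cdot>\<^bsub>endo D\<^esub> FArr H (\<phi> \<odot>\<^bsub>endo D\<^esub> \<alpha>)"
      using H(2) E.FC.homD[OF \<alpha>] E.FC.homD[OF hf] \<theta>[OF We o(2)] \<theta>[OF Ye o(1)] by simp
  qed
qed

end

subsection \<open>Pointwise operations\<close>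

context sorted_families
begin

text \<open>The functions \<open>Go\<close> and \<open>Ga\<close> come from recursive definitions on
  lists. These predicates let an induction carry the components existentially while remembering that
  \<open>Go\<close> and \<open>Ga\<close> are literally the assembled functors and
  transformations.\<close>

definition represents where
  "represents gO gA gF Go Ga \<longleftrightarrow> (\<forall>t\<in>S. component C S (gO t) (gA t) (gF t))
     \<and> (\<forall>X\<in>Obj E. Go X = assemble_obj gO gF X) \<and> (\<forall>\<alpha>\<in>Arr E. Ga \<alpha> = assemble_arr gO gA gF \<alpha>)"

definition strongly_represents where
  "strongly_represents gO gA gF g\<theta> Go Ga G\<theta> \<longleftrightarrow> represents gO gA gF Go Ga
     \<and> (\<forall>t\<in>S. strong_component C S (gO t) (gA t) (gF t) (g\<theta> t))
     \<and> (\<forall>Ye\<in>ptd_obj (endo D). \<forall>X\<in>Obj E. G\<theta> Ye X = assemble_strength gO gF g\<theta> Ye X)"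

text \<open>A common form of \<open>pw_coprod\<close> and \<open>pw_prod\<close> for an arbitrary
  operation, so that closure is proved once for both.\<close>

definition pw_obj :: "(('j \<Rightarrow> 'o) \<Rightarrow> 'o) \<Rightarrow> (('j \<Rightarrow> 'm) \<Rightarrow> 'm) \<Rightarrow> ('j \<Rightarrow> ('s, 'o, 'm) endofun)
    \<Rightarrow> ('s, 'o, 'm) endofun" where
  "pw_obj Q M F = \<lparr>FObj = (\<lambda>\<xi>\<in>Obj D. fam_obj C S (\<lambda>t. Q (\<lambda>j. FObj (FObj (F j) \<xi>) t))),
     FArr = (\<lambda>f\<in>Arr D. fam_arr C S (\<lambda>t. M (\<lambda>j. NMap (FArr (F j) f) t)))\<rparr>"

definition pw_arr :: "(('j \<Rightarrow> 'o) \<Rightarrow> 'o) \<Rightarrow> (('j \<Rightarrow> 'm) \<Rightarrow> 'm) \<Rightarrow> ('j \<Rightarrow> ('s, 'o, 'm) endotrans)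
    \<Rightarrow> ('s, 'o, 'm) endotrans" where
  "pw_arr Q M \<alpha> = mk_nt D (pw_obj Q M (\<lambda>j. NDom (\<alpha> j))) (pw_obj Q M (\<lambda>j. NCod (\<alpha> j)))
     (\<lambda>\<xi>. fam_arr C S (\<lambda>t. M (\<lambda>j. NMap (NMap (\<alpha> j) \<xi>) t)))"

lemma pw_obj_cong:
  assumes op: "continuous_operation C J Q M" and F: "\<And>j. j \<in> J \<Longrightarrow> F j = G j"
  shows "pw_obj Q M F = pw_obj Q M G"
  unfolding pw_obj_def
  by (auto intro!: restrict_ext fam_obj_cong fam_arr_cong continuous_operation.op_obj_cong[OF op]
      continuous_operation.op_cong[OF op] simp: F)

lemma pw_arr_cong:
  assumes op: "continuous_operation C J Q M" and F: "\<And>j. j \<in> J \<Longrightarrow> \<alpha> j = \<beta> j"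
  shows "pw_arr Q M \<alpha> = pw_arr Q M \<beta>"
proof -
  have "pw_obj Q M (\<lambda>j. NDom (\<alpha> j)) = pw_obj Q M (\<lambda>j. NDom (\<beta> j))"
    "pw_obj Q M (\<lambda>j. NCod (\<alpha> j)) = pw_obj Q M (\<lambda>j. NCod (\<beta> j))"
    using F by (auto intro!: pw_obj_cong[OF op])
  moreover have "(\<lambda>\<xi>. fam_arr C S (\<lambda>t. M (\<lambda>j. NMap (NMap (\<alpha> j) \<xi>) t)))
      = (\<lambda>\<xi>. fam_arr C S (\<lambda>t. M (\<lambda>j. NMap (NMap (\<beta> j) \<xi>) t)))"
    using F by (auto intro!: fam_arr_cong continuous_operation.op_cong[OF op])
  ultimately show ?thesis unfolding pw_arr_def by simp
qed

text \<open>The operation meets the assembled values only at sorts in \<open>S\<close>, where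
  \<open>fam_obj\<close> and \<open>fam_arr\<close> return them unchanged.\<close>

lemma pw_obj_assemble:
  fixes X :: "('s, 'o, 'm) endofun"
  assumes op: "continuous_operation C J Q M"
  shows "pw_obj Q M (\<lambda>j. assemble_obj (gO j) (gF j) X)
    = assemble_obj (\<lambda>t X \<xi>. Q (\<lambda>j. gO j t X \<xi>)) (\<lambda>t X f. M (\<lambda>j. gF j t X f)) X"
  unfolding pw_obj_def assemble_obj_def[of "\<lambda>t X \<xi>. Q (\<lambda>j. gO j t X \<xi>)"]
  by (auto intro!: restrict_ext fam_obj_cong fam_arr_cong continuous_operation.op_obj_cong[OF op]
      continuous_operation.op_cong[OF op])

lemma represents_pw:
  assumes op: "continuous_operation C J Q M"
    and r: "\<And>j. j \<in> J \<Longrightarrow> represents (gO j) (gA j) (gF j) (Go j) (Ga j)"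
  shows "represents (\<lambda>t X \<xi>. Q (\<lambda>j. gO j t X \<xi>)) (\<lambda>t \<alpha> \<xi>. M (\<lambda>j. gA j t \<alpha> \<xi>)) (\<lambda>t X f. M (\<lambda>j. gF j t X f))
    (\<lambda>X. pw_obj Q M (\<lambda>j. Go j X)) (\<lambda>\<alpha>. pw_arr Q M (\<lambda>j. Ga j \<alpha>))"
  unfolding represents_def
proof (intro conjI ballI)
  show "component C S (\<lambda>X \<xi>. Q (\<lambda>j. gO j t X \<xi>)) (\<lambda>\<alpha> \<xi>. M (\<lambda>j. gA j t \<alpha> \<xi>)) (\<lambda>X f. M (\<lambda>j. gF j t X f))"
    if t: "t \<in> S" for t
    by (rule component_op[OF op]) (use r t in \<open>simp add: represents_def\<close>)
  show "pw_obj Q M (\<lambda>j. Go j X) = assemble_obj (\<lambda>t X \<xi>. Q (\<lambda>j. gO j t X \<xi>)) (\<lambda>t X f. M (\<lambda>j. gF j t X f)) X"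
    if X: "X \<in> Obj E" for X
    unfolding pw_obj_assemble[OF op, symmetric]
    by (rule pw_obj_cong[OF op]) (use r X in \<open>simp add: represents_def\<close>)
  fix \<alpha> assume \<alpha>: "\<alpha> \<in> Arr E"
  have "pw_arr Q M (\<lambda>j. Ga j \<alpha>) = pw_arr Q M (\<lambda>j. assemble_arr (gO j) (gA j) (gF j) \<alpha>)"
    by (rule pw_arr_cong[OF op]) (use r \<alpha> in \<open>simp add: represents_def\<close>)
  also have "\<dots> = assemble_arr (\<lambda>t X \<xi>. Q (\<lambda>j. gO j t X \<xi>)) (\<lambda>t \<alpha> \<xi>. M (\<lambda>j. gA j t \<alpha> \<xi>)) (\<lambda>t X f. M (\<lambda>j. gF j t X f)) \<alpha>"
    unfolding pw_arr_def assemble_simps pw_obj_assemble[OF op] assemble_arr_def[of "\<lambda>t X \<xi>. Q (\<lambda>j. gO j t X \<xi>)"] mk_nt_def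
    by (auto intro!: restrict_ext fam_arr_cong continuous_operation.op_cong[OF op])
  finally show "pw_arr Q M (\<lambda>j. Ga j \<alpha>) = assemble_arr (\<lambda>t X \<xi>. Q (\<lambda>j. gO j t X \<xi>)) (\<lambda>t \<alpha> \<xi>. M (\<lambda>j. gA j t \<alpha> \<xi>)) (\<lambda>t X f. M (\<lambda>j. gF j t X f)) \<alpha>" .
qed

text \<open>Precomposition only changes the family at which all summands or factors are evaluated,
  so it commutes strictly with pointwise operations. The sources of the compound strengths match
  because of this equation.\<close>

lemma fcomp_pw_obj:
  assumes Y: "Y \<in> Obj E" and op: "continuous_operation C J Q M"
  shows "fcomp D Y (pw_obj Q M F) = pw_obj Q M (\<lambda>j. fcomp D Y (F j))"
  using Y unfolding fcomp_def pw_obj_def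
  by (auto intro!: restrict_ext fam_obj_cong fam_arr_cong)

lemma strongly_represents_pw:
  assumes op: "continuous_operation C J Q M"
    and r: "\<And>j. j \<in> J \<Longrightarrow> strongly_represents (gO j) (gA j) (gF j) (g\<theta> j) (Go j) (Ga j) (G\<theta> j)"
  shows "strongly_represents (\<lambda>t X \<xi>. Q (\<lambda>j. gO j t X \<xi>)) (\<lambda>t \<alpha> \<xi>. M (\<lambda>j. gA j t \<alpha> \<xi>)) (\<lambda>t X f. M (\<lambda>j. gF j t X f))
    (\<lambda>t Ye X \<xi>. M (\<lambda>j. g\<theta> j t Ye X \<xi>))
    (\<lambda>X. pw_obj Q M (\<lambda>j. Go j X)) (\<lambda>\<alpha>. pw_arr Q M (\<lambda>j. Ga j \<alpha>)) (\<lambda>Ye X. pw_arr Q M (\<lambda>j. G\<theta> j Ye X))"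
  unfolding strongly_represents_def
proof (intro conjI ballI represents_pw[OF op])
  show "represents (gO j) (gA j) (gF j) (Go j) (Ga j)" if "j \<in> J" for j
    using r[OF that] by (simp add: strongly_represents_def)
  show "strong_component C S (\<lambda>X \<xi>. Q (\<lambda>j. gO j t X \<xi>)) (\<lambda>\<alpha> \<xi>. M (\<lambda>j. gA j t \<alpha> \<xi>)) (\<lambda>X f. M (\<lambda>j. gF j t X f))
      (\<lambda>Ye X \<xi>. M (\<lambda>j. g\<theta> j t Ye X \<xi>))" if t: "t \<in> S" for t
    by (rule strong_component_op[OF op]) (use r t in \<open>simp add: strongly_represents_def\<close>)
  fix Ye X assume Ye: "Ye \<in> ptd_obj (endo D)" and X: "X \<in> Obj E"
  have Y: "fst Ye \<in> Obj E" using Ye by simp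
  have "pw_arr Q M (\<lambda>j. G\<theta> j Ye X) = pw_arr Q M (\<lambda>j. assemble_strength (gO j) (gF j) (g\<theta> j) Ye X)"
    by (rule pw_arr_cong[OF op]) (use r Ye X in \<open>simp add: strongly_represents_def\<close>)
  also have "\<dots> = assemble_strength (\<lambda>t X \<xi>. Q (\<lambda>j. gO j t X \<xi>)) (\<lambda>t X f. M (\<lambda>j. gF j t X f)) (\<lambda>t Ye X \<xi>. M (\<lambda>j. g\<theta> j t Ye X \<xi>)) Ye X"
    unfolding pw_arr_def assemble_simps fcomp_pw_obj[OF Y op, symmetric] pw_obj_assemble[OF op]
      assemble_strength_def[of "\<lambda>t X \<xi>. Q (\<lambda>j. gO j t X \<xi>)"] mk_nt_def
    by (auto intro!: restrict_ext fam_arr_cong continuous_operation.op_cong[OF op])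
  finally show "pw_arr Q M (\<lambda>j. G\<theta> j Ye X) = assemble_strength (\<lambda>t X \<xi>. Q (\<lambda>j. gO j t X \<xi>))
      (\<lambda>t X f. M (\<lambda>j. gF j t X f)) (\<lambda>t Ye X \<xi>. M (\<lambda>j. g\<theta> j t Ye X \<xi>)) Ye X" .
qed

lemma pw_coprod_eq:
  "pw_coprod C S J F = pw_obj (coprod_obj C J) (coprod_map C J) F"
  "pw_coprod_map C S J \<alpha> = pw_arr (coprod_obj C J) (coprod_map C J) \<alpha>"
  unfolding pw_coprod_def pw_obj_def pw_coprod_map_def pw_arr_def by simp_all

text \<open>Binary products are read as an operation of arity \<open>bool\<close>, with
  \<open>True\<close> for the left factor.\<close>

lemma pw_prod_eq:
  "pw_prod C S F G = pw_obj (\<lambda>x. prod_obj C (x True) (x False)) (\<lambda>f. prod_map C (f True) (f False)) (\<lambda>j. if j then F else G)"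
  "pw_prod_map C S \<alpha> \<beta> = pw_arr (\<lambda>x. prod_obj C (x True) (x False)) (\<lambda>f. prod_map C (f True) (f False)) (\<lambda>j. if j then \<alpha> else \<beta>)"
  unfolding pw_prod_def pw_obj_def pw_prod_map_def pw_arr_def by (simp_all add: if_distrib)

text \<open>The last claim gives a coproduct of families at every argument. This pointwise form
  implies the one for endofunctors and is what survives precomposition.\<close>

lemma pw_coprod:
  assumes op: "continuous_operation C J (coprod_obj C J) (coprod_map C J)" and hc: "has_coproducts C J"
    and F: "\<And>j. j \<in> J \<Longrightarrow> F j \<in> Obj E"
  shows "pw_coprod C S J F \<in> Obj E"
    and "j \<in> J \<Longrightarrow> pw_coprod_inj C S J F j \<in> hom E (F j) (pw_coprod C S J F)"
    and "\<xi> \<in> Obj D \<Longrightarrow> is_coproduct D J (\<lambda>j. FObj (F j) \<xi>) (FObj (pw_coprod C S J F) \<xi>)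
      (\<lambda>j. NMap (pw_coprod_inj C S J F j) \<xi>)"
proof -
  interpret op: continuous_operation C J "coprod_obj C J" "coprod_map C J" by fact
  let ?P = "pw_coprod C S J F"
  have Fo: "FObj (FObj (F j) \<xi>) t \<in> Obj C" if "j \<in> J" "\<xi> \<in> Obj D" "t \<in> S" for j \<xi> t using F that by simp
  have Fh: "NMap (FArr (F j) f) t \<in> hom C (FObj (FObj (F j) \<xi>) t) (FObj (FObj (F j) \<zeta>) t)"
    if "j \<in> J" "f \<in> hom D \<xi> \<zeta>" "t \<in> S" for j f \<xi> \<zeta> t
    using fam_hom[OF E.FArr_hom[OF F[OF that(1)] that(2)] that(3)] .
  have PO: "FObj ?P \<xi> = fam_obj C S (\<lambda>t. coprod_obj C J (\<lambda>j. FObj (FObj (F j) \<xi>) t))" if "\<xi> \<in> Obj D" for \<xi>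
    using that by (simp add: pw_coprod_def)
  have PA: "FArr ?P f = fam_arr C S (\<lambda>t. coprod_map C J (\<lambda>j. NMap (FArr (F j) f) t))" if "f \<in> hom D \<xi> \<zeta>" for f \<xi> \<zeta>
    using that by (simp add: pw_coprod_def hom_def)
  have cop: "is_coproduct C J (\<lambda>j. FObj (FObj (F j) \<xi>) t) (coprod_obj C J (\<lambda>j. FObj (FObj (F j) \<xi>) t))
      (coprod_inj C J (\<lambda>j. FObj (FObj (F j) \<xi>) t))" if "\<xi> \<in> Obj D" "t \<in> S" for \<xi> t
    by (rule is_coproduct_coprod[OF hc Fo[OF _ that]])
  have Pob: "FObj ?P \<xi> \<in> Obj D" if "\<xi> \<in> Obj D" for \<xi>
    using coproductD(1)[OF cop[OF that]] PO[OF that] by simp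
  have PAh: "FArr ?P f \<in> hom D (FObj ?P \<xi>) (FObj ?P \<zeta>)" if f: "f \<in> hom D \<xi> \<zeta>" for f \<xi> \<zeta>
  proof -
    have o: "\<xi> \<in> Obj D" "\<zeta> \<in> Obj D" using D.hom_obj[OF f] by auto
    show ?thesis unfolding PA[OF f] PO[OF o(1)] PO[OF o(2)]
      by (rule fam_arr_hom') (rule op.op_hom, rule Fh[OF _ f])
  qed
  show P: "?P \<in> Obj E"
  proof (rule E.functorI[OF _ _ Pob PAh])
    show "FObj ?P \<in> extensional (Obj D)" "FArr ?P \<in> extensional (Arr D)" by (simp_all add: pw_coprod_def)
    fix \<xi> assume \<xi>: "\<xi> \<in> Obj D"
    note i = D.idt_hom[OF \<xi>]
    show "FArr ?P (Idt D \<xi>) = Idt D (FObj ?P \<xi>)"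
    proof (rule fam_arr_eqI[OF PAh[OF i] D.idt_hom[OF Pob[OF \<xi>]]])
      fix t assume t: "t \<in> S"
      have "coprod_map C J (\<lambda>j. NMap (FArr (F j) (Idt D \<xi>)) t) = coprod_map C J (\<lambda>j. Idt C (FObj (FObj (F j) \<xi>) t))"
        by (rule op.op_cong) (use F \<xi> t in simp)
      then show "NMap (FArr ?P (Idt D \<xi>)) t = NMap (Idt D (FObj ?P \<xi>)) t"
        using op.op_idt[of "\<lambda>j. FObj (FObj (F j) \<xi>) t"] Fo[OF _ \<xi> t] PA[OF i] PO[OF \<xi>] t by simp
    qed
  next
    fix f \<xi> \<zeta> g \<omega> assume f: "f \<in> hom D \<xi> \<zeta>" and g: "g \<in> hom D \<zeta> \<omega>"
    note fg = D.comp_hom[OF f g]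
    show "FArr ?P (f \<cdot>\<^bsub>D\<^esub> g) = FArr ?P f \<cdot>\<^bsub>D\<^esub> FArr ?P g"
    proof (rule fam_arr_eqI[OF PAh[OF fg] D.comp_hom[OF PAh[OF f] PAh[OF g]]])
      fix t assume t: "t \<in> S"
      have "coprod_map C J (\<lambda>j. NMap (FArr (F j) (f \<cdot>\<^bsub>D\<^esub> g)) t)
          = coprod_map C J (\<lambda>j. NMap (FArr (F j) f) t) \<cdot> coprod_map C J (\<lambda>j. NMap (FArr (F j) g) t)"
      proof (rule op.op_factor[OF Fh[OF _ f t] Fh[OF _ g t]])
        show "NMap (FArr (F j) (f \<cdot>\<^bsub>D\<^esub> g)) t = NMap (FArr (F j) f) t \<cdot> NMap (FArr (F j) g) t" if j: "j \<in> J" for j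
          using E.FArr_comp[OF F[OF j], of f g] D.homD[OF f] D.homD[OF g] t by simp
      qed
      then show "NMap (FArr ?P (f \<cdot>\<^bsub>D\<^esub> g)) t = NMap (FArr ?P f \<cdot>\<^bsub>D\<^esub> FArr ?P g) t"
        using PA[OF f] PA[OF g] PA[OF fg] t by simp
    qed
  qed
  have ih: "fam_arr C S (\<lambda>t. coprod_inj C J (\<lambda>j. FObj (FObj (F j) \<xi>) t) j) \<in> hom D (FObj (F j) \<xi>) (FObj ?P \<xi>)"
    if "j \<in> J" "\<xi> \<in> Obj D" for j \<xi>
    by (rule fam_arr_hom) (use F that Pob coproductD(2)[OF cop] in \<open>simp_all add: PO\<close>)
  show inj: "pw_coprod_inj C S J F j \<in> hom E (F j) ?P" if j: "j \<in> J" for j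
    unfolding pw_coprod_inj_def
  proof (rule E.mk_nt_hom[OF F[OF j] P ih[OF j]])
    fix f \<xi> \<zeta> assume f: "f \<in> hom D \<xi> \<zeta>"
    have o: "\<xi> \<in> Obj D" "\<zeta> \<in> Obj D" using D.hom_obj[OF f] by auto
    show "FArr (F j) f \<cdot>\<^bsub>D\<^esub> fam_arr C S (\<lambda>t. coprod_inj C J (\<lambda>j. FObj (FObj (F j) \<zeta>) t) j)
        = fam_arr C S (\<lambda>t. coprod_inj C J (\<lambda>j. FObj (FObj (F j) \<xi>) t) j) \<cdot>\<^bsub>D\<^esub> FArr ?P f"
    proof (rule fam_arr_eqI[OF D.comp_hom[OF E.FArr_hom[OF F[OF j] f] ih[OF j o(2)]] D.comp_hom[OF ih[OF j o(1)] PAh[OF f]]])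
      fix t assume t: "t \<in> S"
      have "coprod_inj C J (\<lambda>j. FObj (FObj (F j) \<xi>) t) j \<cdot> coprod_map C J (\<lambda>j. NMap (FArr (F j) f) t)
          = NMap (FArr (F j) f) t \<cdot> coprod_inj C J (\<lambda>j. FObj (FObj (F j) \<zeta>) t) j"
        by (rule coprod_map(2)[OF hc Fh[OF _ f t] j])
      then show "NMap (FArr (F j) f \<cdot>\<^bsub>D\<^esub> fam_arr C S (\<lambda>t. coprod_inj C J (\<lambda>j. FObj (FObj (F j) \<zeta>) t) j)) t
        = NMap (fam_arr C S (\<lambda>t. coprod_inj C J (\<lambda>j. FObj (FObj (F j) \<xi>) t) j) \<cdot>\<^bsub>D\<^esub> FArr ?P f) t"
        using PA[OF f] t by simp
    qed
  qed
  assume \<xi>: "\<xi> \<in> Obj D"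
  show "is_coproduct D J (\<lambda>j. FObj (F j) \<xi>) (FObj ?P \<xi>) (\<lambda>j. NMap (pw_coprod_inj C S J F j) \<xi>)"
  proof (rule is_coproduct_fam)
    show "FObj (F j) \<xi> \<in> Obj D" if "j \<in> J" for j using F that \<xi> by simp
    show "FObj ?P \<xi> \<in> Obj D" using Pob \<xi> .
    show "NMap (pw_coprod_inj C S J F j) \<xi> \<in> hom D (FObj (F j) \<xi>) (FObj ?P \<xi>)" if "j \<in> J" for j
      using E.NMap_hom[OF inj[OF that] \<xi>] .
    show "is_coproduct C J (\<lambda>j. FObj (FObj (F j) \<xi>) t) (FObj (FObj ?P \<xi>) t) (\<lambda>j. NMap (NMap (pw_coprod_inj C S J F j) \<xi>) t)"
      if t: "t \<in> S" for t
      using cop[OF \<xi> t] \<xi> t by (simp add: PO pw_coprod_inj_def)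
  qed
qed

lemma is_coproduct_pw_coprod:
  assumes "continuous_operation C J (coprod_obj C J) (coprod_map C J)" "has_coproducts C J"
    and "\<And>j. j \<in> J \<Longrightarrow> F j \<in> Obj E"
  shows "is_coproduct E J F (pw_coprod C S J F) (pw_coprod_inj C S J F)"
  by (rule E.is_coproduct_pointwise) (use pw_coprod[OF assms] assms in auto)

text \<open>At a family \<open>\<xi>\<close> the claim is the pointwise coproduct at the family
  \<open>Z \<xi>\<close>, with the same injections.\<close>

lemma is_coproduct_precomp:
  assumes op: "continuous_operation C J (coprod_obj C J) (coprod_map C J)" and hc: "has_coproducts C J"
    and F: "\<And>j. j \<in> J \<Longrightarrow> F j \<in> Obj E" and Z: "Z \<in> Obj E"
  shows "is_coproduct E J (\<lambda>j. fcomp D Z (F j)) (fcomp D Z (pw_coprod C S J F))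
    (\<lambda>j. hcomp D D (Idt E Z) (pw_coprod_inj C S J F j))"
proof (rule E.is_coproduct_pointwise)
  let ?P = "pw_coprod C S J F" and ?i = "pw_coprod_inj C S J F"
  have P: "?P \<in> Obj E" by (rule pw_coprod(1)[OF op hc F])
  have i: "?i j \<in> hom E (F j) ?P" if "j \<in> J" for j by (rule pw_coprod(2)[OF op hc F that])
  show "fcomp D Z (F j) \<in> Obj E" if "j \<in> J" for j using F that Z by simp
  show "fcomp D Z ?P \<in> Obj E" using P Z by simp
  show "hcomp D D (Idt E Z) (?i j) \<in> hom E (fcomp D Z (F j)) (fcomp D Z ?P)" if "j \<in> J" for j
    using E.hcomp_hom[OF E.FC.idt_hom[OF Z] i[OF that]] .
  fix \<xi> assume \<xi>: "\<xi> \<in> Obj D"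
  have Z\<xi>: "FObj Z \<xi> \<in> Obj D" using Z \<xi> by simp
  have c: "is_coproduct D J (\<lambda>j. FObj (F j) (FObj Z \<xi>)) (FObj ?P (FObj Z \<xi>)) (\<lambda>j. NMap (?i j) (FObj Z \<xi>))"
    by (rule pw_coprod(3)[OF op hc F Z\<xi>])
  have "is_coproduct D J (\<lambda>j. FObj (fcomp D Z (F j)) \<xi>) (FObj ?P (FObj Z \<xi>))
      (\<lambda>j. NMap (hcomp D D (Idt E Z) (?i j)) \<xi>)"
  proof (rule D.is_coproduct_cong[OF c])
    fix j assume j: "j \<in> J"
    show "FObj (F j) (FObj Z \<xi>) = FObj (fcomp D Z (F j)) \<xi>" using \<xi> by simp
    show "NMap (?i j) (FObj Z \<xi>) = NMap (hcomp D D (Idt E Z) (?i j)) \<xi>"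
      using E.FC.homD[OF i[OF j]] F[OF j] \<xi> Z\<xi> D.idt_comp[OF E.NMap_hom[OF i[OF j] Z\<xi>]] by simp
  qed
  then show "is_coproduct D J (\<lambda>j. FObj (fcomp D Z (F j)) \<xi>) (FObj (fcomp D Z ?P) \<xi>)
      (\<lambda>j. NMap (hcomp D D (Idt E Z) (?i j)) \<xi>)"
    using \<xi> by simp
qed

end

subsection \<open>Arities\<close>

locale signature_families = option_families C S
  for C :: "('o, 'm) category" (structure) and S :: "'s set" +
  assumes C_products: "has_binary_products C"
    and unit_continuous: "\<And>J :: unit set. continuous_operation C J (coprod_obj C J) (coprod_map C J)"
begin

lemma hat_simps:
  "c \<in> Obj C \<Longrightarrow> FObj (hat C S t) c = fam_obj C S (\<lambda>u. coprod_obj C (eq_proofs t u) (\<lambda>_. c))"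
  "f \<in> Arr C \<Longrightarrow> FArr (hat C S t) f = fam_arr C S (\<lambda>u. coprod_map C (eq_proofs t u) (\<lambda>_. f))"
  by (simp_all add: hat_def)

lemma pr_simps:
  "\<xi> \<in> Obj D \<Longrightarrow> FObj (pr C S s) \<xi> = FObj \<xi> s"
  "f \<in> Arr D \<Longrightarrow> FArr (pr C S s) f = NMap f s"
  by (simp_all add: pr_def)

text \<open>At sort \<open>u\<close>, \<open>hat\<close> is a coproduct over the proofs of
  \<open>t = u\<close>, that is, the coproduct operation over a subset of \<open>unit\<close>
  applied to an evaluation component. Distributivity over subsingletons enters here, as
  \<open>unit_continuous\<close>.\<close>

lemma strongly_represents_arg:
  assumes s: "snd a \<in> S"
  shows "\<exists>gO gA gF g\<theta>. strongly_represents gO gA gF g\<theta> (arg_obj C S a t) (arg_arr C S a t) (arg_strength C S a t)"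
proof -
  define P where "P = option_list C S (fst a)"
  have P: "P \<in> Obj E" unfolding P_def by (rule option_list_endo)
  let ?K = "\<lambda>u. eq_proofs t u"
  define gO where "gO u X \<xi> = coprod_obj C (?K u) (\<lambda>_. FObj (FObj X (FObj P \<xi>)) (snd a))" for u and X :: "('s, 'o, 'm) endofun" and \<xi>
  define gA where "gA u \<alpha> \<xi> = coprod_map C (?K u) (\<lambda>_. NMap (NMap \<alpha> (FObj P \<xi>)) (snd a))" for u and \<alpha> :: "('s, 'o, 'm) endotrans" and \<xi>
  define gF where "gF u X f = coprod_map C (?K u) (\<lambda>_. NMap (FArr X (FArr P f)) (snd a))" for u and X :: "('s, 'o, 'm) endofun" and f
  define g\<theta> where "g\<theta> u Ye X \<xi> = coprod_map C (?K u) (\<lambda>_. NMap (FArr X (gamma_list C S Ye (fst a) \<xi>)) (snd a))" for u Ye and X :: "('s, 'o, 'm) endofun" and \<xi>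
  have sc: "strong_component C S (gO u) (gA u) (gF u) (g\<theta> u)" for u
    unfolding gO_def gA_def gF_def g\<theta>_def
    by (rule strong_component_op[OF unit_continuous strong_component_eval[OF s, of "fst a", folded P_def]])
  then have c: "component C S (gO u) (gA u) (gF u)" for u by (simp add: strong_component_def)
  have o: "arg_obj C S a t X = assemble_obj gO gF X" if X: "X \<in> Obj E" for X
    using X P s unfolding arg_obj_def assemble_obj_def fcomp_def P_def[symmetric] gO_def gF_def
    by (auto intro!: restrict_ext simp: hat_simps pr_simps)
  have r: "represents gO gA gF (arg_obj C S a t) (arg_arr C S a t)"
    unfolding represents_def
  proof (intro conjI ballI c o)
    fix \<alpha> assume \<alpha>: "\<alpha> \<in> Arr E"
    have d: "NDom \<alpha> \<in> Obj E" "NCod \<alpha> \<in> Obj E" using \<alpha> by simp_all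
    show "arg_arr C S a t \<alpha> = assemble_arr gO gA gF \<alpha>"
      unfolding arg_arr_def assemble_arr_def o[OF d(1)] o[OF d(2)] mk_nt_def P_def[symmetric] gA_def
      using \<alpha> P s by (auto intro!: restrict_ext simp: hat_simps pr_simps)
  qed
  have "strongly_represents gO gA gF g\<theta> (arg_obj C S a t) (arg_arr C S a t) (arg_strength C S a t)"
    unfolding strongly_represents_def
  proof (intro conjI ballI r sc)
    fix Ye X assume Ye: "Ye \<in> Ptd" and X: "X \<in> Obj E"
    have YX: "fcomp D (fst Ye) X \<in> Obj E" using Ye X by simp
    have "FArr X (gamma_list C S Ye (fst a) \<xi>) \<in> Arr D" if "\<xi> \<in> Obj D" for \<xi>
      using E.FArr_hom[OF X gamma_list_hom[OF Ye that]] by (auto simp: hom_def)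
    then show "arg_strength C S a t Ye X = assemble_strength gO gF g\<theta> Ye X"
      unfolding arg_strength_def assemble_strength_def o[OF X] o[OF YX] mk_nt_def g\<theta>_def
      using s by (auto intro!: restrict_ext simp: hat_simps pr_simps)
  qed
  then show ?thesis by blast
qed

text \<open>At each sort the constant family is a constant operation, so the strength consists of
  identities.\<close>

lemma strongly_represents_nullary:
  "\<exists>gO gA gF g\<theta>. strongly_represents gO gA gF g\<theta> (arity_obj C S [] t) (arity_arr C S [] t) (arity_strength C S [] t)"
proof -
  define k where "k u = coprod_obj C (eq_proofs t u) (\<lambda>_. terminal C)" for u
  define gO where "gO u X \<xi> = k u" for u and X :: "('s, 'o, 'm) endofun" and \<xi> :: "('s, 'o, 'm) fam"
  define gA where "gA u \<alpha> \<xi> = Idt C (k u)" for u and \<alpha> :: "('s, 'o, 'm) endotrans" and \<xi> :: "('s, 'o, 'm) fam"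
  define gF where "gF u X f = Idt C (k u)" for u and X :: "('s, 'o, 'm) endofun" and f :: "('s, 'o, 'm) famarr"
  define g\<theta> where "g\<theta> u Ye X \<xi> = Idt C (k u)" for u and Ye :: "('s, 'o, 'm) endofun \<times> ('s, 'o, 'm) endotrans"
    and X :: "('s, 'o, 'm) endofun" and \<xi> :: "('s, 'o, 'm) fam"
  have k: "k u \<in> Obj C" for u by (simp add: k_def)
  have sc: "strong_component C S (gO u) (gA u) (gF u) (g\<theta> u)" for u
    unfolding gO_def gA_def gF_def g\<theta>_def
    \<comment> \<open>Over the empty index set there are no parts to supply, so arbitrary values
      fill their places; \<open>unit\<close> merely serves as the index type.\<close>
    by (rule strong_component_op[OF continuous_operation_const[OF k], of "\<lambda>_ :: unit. undefined"
          "\<lambda>_. undefined" "\<lambda>_. undefined" "\<lambda>_. undefined"]) simp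
  then have c: "component C S (gO u) (gA u) (gF u)" for u by (simp add: strong_component_def)
  have kf: "fam_obj C S k \<in> Obj D" using k by simp
  have ki: "Idt D (fam_obj C S k) = fam_arr C S (\<lambda>u. Idt C (k u))"
    by (rule fam_arr_eqI[OF D.idt_hom[OF kf] fam_arr_hom'[OF idt_hom[OF k]]]) simp
  have h: "FObj (hat C S t) (terminal C) = fam_obj C S k"
    using terminal_obj by (simp add: hat_simps k_def[abs_def])
  have o: "arity_obj C S [] t X = assemble_obj gO gF X" for X
    by (simp add: const_functor_def assemble_obj_def h ki gO_def gF_def)
  have r: "represents gO gA gF (arity_obj C S [] t) (arity_arr C S [] t)"
    unfolding represents_def
  proof (intro conjI ballI c o)
    fix \<alpha> assume \<alpha>: "\<alpha> \<in> Arr E"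
    show "arity_arr C S [] t \<alpha> = assemble_arr gO gA gF \<alpha>"
      unfolding arity_arr.simps assemble_arr_def o[symmetric] arity_obj.simps
      by (auto simp: functor_cat_def mk_nt_def const_functor_def h ki gA_def)
  qed
  have "strongly_represents gO gA gF g\<theta> (arity_obj C S [] t) (arity_arr C S [] t) (arity_strength C S [] t)"
    unfolding strongly_represents_def
    by (intro conjI ballI r sc)
      (simp only: arity_strength.simps assemble_strength_def o[symmetric] h ki g\<theta>_def)
  then show ?thesis by blast
qed

lemma strongly_represents_pw_prod:
  assumes "strongly_represents gO gA gF g\<theta> Go Ga G\<theta>" "strongly_represents gO' gA' gF' g\<theta>' Go' Ga' G\<theta>'"
  shows "\<exists>gO gA gF g\<theta>. strongly_represents gO gA gF g\<theta> (\<lambda>X. pw_prod C S (Go X) (Go' X))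
    (\<lambda>\<alpha>. pw_prod_map C S (Ga \<alpha>) (Ga' \<alpha>)) (\<lambda>Ye X. pw_prod_map C S (G\<theta> Ye X) (G\<theta>' Ye X))"
proof -
  \<comment> \<open>The two factors become one family over \<open>bool\<close>;
    \<open>if_distribR\<close> then moves the arguments into the branches, to match
    \<open>pw_prod_eq\<close>.\<close>
  have "strongly_represents (if j then gO else gO') (if j then gA else gA') (if j then gF else gF') (if j then g\<theta> else g\<theta>')
      (if j then Go else Go') (if j then Ga else Ga') (if j then G\<theta> else G\<theta>')" for j
    using assms by simp
  note r = strongly_represents_pw[OF continuous_operation_prod[OF C_products] this]
  show ?thesis
    unfolding pw_prod_eq using r[unfolded if_distribR] by (intro exI)
qed

text \<open>The induction follows the three clauses of \<open>arity_obj\<close>: a list with one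
  argument is that factor alone, without a product with the empty case.\<close>

lemma strongly_represents_arity:
  "as \<in> lists (lists S \<times> S) \<Longrightarrow> \<exists>gO gA gF g\<theta>.
    strongly_represents gO gA gF g\<theta> (arity_obj C S as t) (arity_arr C S as t) (arity_strength C S as t)"
proof (induction as rule: induct_list012)
  case 1
  show ?case by (rule strongly_represents_nullary)
next
  case (2 a)
  then show ?case using strongly_represents_arg[of a t] by (auto simp: fun_eq_iff)
next
  case (3 a b as)
  have "\<exists>gO gA gF g\<theta>. strongly_represents gO gA gF g\<theta> (arg_obj C S a t) (arg_arr C S a t) (arg_strength C S a t)"
    using 3 by (intro strongly_represents_arg) auto
  moreover have "\<exists>gO gA gF g\<theta>. strongly_represents gO gA gF g\<theta> (arity_obj C S (b # as) t) (arity_arr C S (b # as) t) (arity_strength C S (b # as) t)"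
    using 3 by auto
  ultimately show ?case
    unfolding arity_obj.simps(3)[abs_def] arity_arr.simps(3)[abs_def] arity_strength.simps(3)[abs_def]
    using strongly_represents_pw_prod by blast
qed

end

section \<open>The final coalgebra and its monad\<close>

context endofunctors
begin

text \<open>Since \<open>X \<otimes> Y\<close> means first \<open>X\<close>, then \<open>Y\<close>,
  the whiskering of \<open>\<eta>\<close> on the left has component
  \<open>FArr T (NMap \<eta> a)\<close>: the left unit law of the monoid is the monad law in which
  \<open>T\<close> is applied to the unit.\<close>

lemma is_monad_monoid:
  assumes m: "is_monoid (endo A) T \<eta> \<mu>"
  shows "is_monad A T \<eta> \<mu>"
proof -
  have T: "T \<in> Obj FC" and \<eta>: "\<eta> \<in> hom FC (fid A) T" and \<mu>: "\<mu> \<in> hom FC (fcomp A T T) T"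
    and e: "hcomp A A \<eta> (Idt FC T) \<cdot>\<^bsub>FC\<^esub> \<mu> = Idt FC T" "hcomp A A (Idt FC T) \<eta> \<cdot>\<^bsub>FC\<^esub> \<mu> = Idt FC T"
      "hcomp A A \<mu> (Idt FC T) \<cdot>\<^bsub>FC\<^esub> \<mu>
        = Idt FC (fcomp A T (fcomp A T T)) \<cdot>\<^bsub>FC\<^esub> hcomp A A (Idt FC T) \<mu> \<cdot>\<^bsub>FC\<^esub> \<mu>"
    using m unfolding is_monoid_def by auto
  have d: "\<eta> \<in> Arr FC" "NDom \<eta> = fid A" "NCod \<eta> = T" "\<mu> \<in> Arr FC" "NDom \<mu> = fcomp A T T" "NCod \<mu> = T"
    using \<eta> \<mu> by (auto simp: hom_def)
  have "FArr T (NMap \<eta> a) \<cdot>\<^bsub>A\<^esub> NMap \<mu> a = Idt A (FObj T a)"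
    "NMap \<eta> (FObj T a) \<cdot>\<^bsub>A\<^esub> NMap \<mu> a = Idt A (FObj T a)"
    "FArr T (NMap \<mu> a) \<cdot>\<^bsub>A\<^esub> NMap \<mu> a = NMap \<mu> (FObj T a) \<cdot>\<^bsub>A\<^esub> NMap \<mu> a" if a: "a \<in> Obj A" for a
  proof -
    note e' = arg_cong[OF e(1), of "\<lambda>\<alpha>. NMap \<alpha> a"] arg_cong[OF e(2), of "\<lambda>\<alpha>. NMap \<alpha> a"] arg_cong[OF e(3), of "\<lambda>\<alpha>. NMap \<alpha> a"]
    show "FArr T (NMap \<eta> a) \<cdot>\<^bsub>A\<^esub> NMap \<mu> a = Idt A (FObj T a)" using e'(1) T d a by simp
    show "NMap \<eta> (FObj T a) \<cdot>\<^bsub>A\<^esub> NMap \<mu> a = Idt A (FObj T a)" using e'(2) T d a by simp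
    show "FArr T (NMap \<mu> a) \<cdot>\<^bsub>A\<^esub> NMap \<mu> a = NMap \<mu> (FObj T a) \<cdot>\<^bsub>A\<^esub> NMap \<mu> a" using e'(3) T d a by simp
  qed
  then show ?thesis
    using T \<eta> \<mu> unfolding is_monad_def by (simp add: functor_cat_hom functor_cat_obj)
qed

end

context sorted_families
begin

lemma cochain_limit_fam:
  assumes "\<And>n. X n \<in> Obj D" "\<And>n. d n \<in> hom D (X (Suc n)) (X n)" "L \<in> Obj D" "\<And>n. p n \<in> hom D L (X n)"
    and "\<And>t. t \<in> S \<Longrightarrow> cochain_limit C (\<lambda>n. FObj (X n) t) (\<lambda>n. NMap (d n) t) (FObj L t) (\<lambda>n. NMap (p n) t)"
  shows "cochain_limit D X d L p"
  using assms unfolding fam_cat_def by (intro fam.cochain_limit_pointwise) auto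

text \<open>The pointwise criterion is applied twice, from sorts to families and from families to
  endofunctors.\<close>

lemma pointwise_limit_limit:
  assumes l: "pointwise_limit C S X d L p"
  shows "cochain_limit E X d L p"
proof -
  note lD = pointwise_limitD[OF l]
  show ?thesis
  proof (rule E.cochain_limit_pointwise)
    show "X n \<in> Obj E" "d n \<in> hom E (X (Suc n)) (X n)" "L \<in> Obj E" "p n \<in> hom E L (X n)" for n
      by (rule lD)+
    fix \<xi> assume \<xi>: "\<xi> \<in> Obj D"
    show "cochain_limit D (\<lambda>n. FObj (X n) \<xi>) (\<lambda>n. NMap (d n) \<xi>) (FObj L \<xi>) (\<lambda>n. NMap (p n) \<xi>)"
    proof (rule cochain_limit_fam)
      show "FObj (X n) \<xi> \<in> Obj D" "FObj L \<xi> \<in> Obj D" for n using lD(1)[of n] lD(3) \<xi> by simp_all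
      show "NMap (d n) \<xi> \<in> hom D (FObj (X (Suc n)) \<xi>) (FObj (X n) \<xi>)" for n by (rule E.NMap_hom[OF lD(2) \<xi>])
      show "NMap (p n) \<xi> \<in> hom D (FObj L \<xi>) (FObj (X n) \<xi>)" for n by (rule E.NMap_hom[OF lD(4) \<xi>])
    qed (rule lD(5)[OF \<xi>])
  qed
qed

text \<open>The limit is chosen sort by sort in \<open>C\<close> and carried up two levels. Building
  it this way keeps the limit cone at each family and sort in view, and that is what components take
  as input.\<close>

lemma pointwise_limit_exists:
  assumes hl: "has_omega_limits C" and X: "\<And>n. X n \<in> Obj E" and d: "\<And>n. d n \<in> hom E (X (Suc n)) (X n)"
  obtains L p where "pointwise_limit C S X d L p"
proof -
  define x where "x \<xi> t n = FObj (FObj (X n) \<xi>) t" for \<xi> t n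
  define e where "e \<xi> t n = NMap (NMap (d n) \<xi>) t" for \<xi> t n
  define l where "l \<xi> = fam_obj C S (\<lambda>t. omega_lim C (x \<xi> t) (e \<xi> t))" for \<xi>
  define \<pi> where "\<pi> \<xi> n = fam_arr C S (\<lambda>t. omega_proj C (x \<xi> t) (e \<xi> t) n)" for \<xi> n
  have lim: "cochain_limit C (x \<xi> t) (e \<xi> t) (omega_lim C (x \<xi> t) (e \<xi> t)) (omega_proj C (x \<xi> t) (e \<xi> t))"
    if "\<xi> \<in> Obj D" "t \<in> S" for \<xi> t
  proof (rule cochain_limit_omega_lim[OF hl])
    show "is_cochain C (x \<xi> t) (e \<xi> t)"
      unfolding is_cochain_def x_def e_def using X that fam_hom[OF E.NMap_hom[OF d]] by simp
  qed
  note ld = cochain_limitD[OF lim]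
  have D_lim: "cochain_limit D (\<lambda>n. FObj (X n) \<xi>) (\<lambda>n. NMap (d n) \<xi>) (l \<xi>) (\<lambda>n. \<pi> \<xi> n)" if \<xi>: "\<xi> \<in> Obj D" for \<xi>
  proof (rule cochain_limit_fam)
    show o: "FObj (X n) \<xi> \<in> Obj D" "l \<xi> \<in> Obj D" for n using X \<xi> ld(3)[OF \<xi>] by (simp_all add: l_def)
    show "NMap (d n) \<xi> \<in> hom D (FObj (X (Suc n)) \<xi>) (FObj (X n) \<xi>)" for n by (rule E.NMap_hom[OF d \<xi>])
    show "\<pi> \<xi> n \<in> hom D (l \<xi>) (FObj (X n) \<xi>)" for n
      unfolding \<pi>_def by (rule fam_arr_hom[OF o(2) o(1)]) (use ld(4)[OF \<xi>] in \<open>simp add: l_def x_def\<close>)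
    show "cochain_limit C (\<lambda>n. FObj (FObj (X n) \<xi>) t) (\<lambda>n. NMap (NMap (d n) \<xi>) t) (FObj (l \<xi>) t) (\<lambda>n. NMap (\<pi> \<xi> n) t)"
      if t: "t \<in> S" for t
      using lim[OF \<xi> t] t by (simp add: x_def[abs_def] e_def[abs_def] l_def \<pi>_def)
  qed
  obtain L p where Lp: "L \<in> Obj E" "\<And>n. p n \<in> hom E L (X n)" "\<And>\<xi>. \<xi> \<in> Obj D \<Longrightarrow> FObj L \<xi> = l \<xi>"
    "\<And>\<xi> n. \<xi> \<in> Obj D \<Longrightarrow> NMap (p n) \<xi> = \<pi> \<xi> n"
    using E.pointwise_limitE[OF X d D_lim] by blast
  have "pointwise_limit C S X d L p"
    unfolding pointwise_limit_def
  proof (intro conjI allI ballI)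
    fix \<xi> t assume \<xi>: "\<xi> \<in> Obj D" and t: "t \<in> S"
    show "cochain_limit C (\<lambda>n. FObj (FObj (X n) \<xi>) t) (\<lambda>n. NMap (NMap (d n) \<xi>) t) (FObj (FObj L \<xi>) t)
        (\<lambda>n. NMap (NMap (p n) \<xi>) t)"
      using lim[OF \<xi> t] t by (simp add: Lp(3,4)[OF \<xi>] x_def[abs_def] e_def[abs_def] l_def \<pi>_def)
  qed (use X d Lp(1,2) in simp_all)
  then show ?thesis using that by blast
qed

lemma pw_coprod_inj_natural:
  assumes hc: "has_coproducts C J" and \<alpha>: "\<And>j. j \<in> J \<Longrightarrow> \<alpha> j \<in> hom E (F j) (G j)"
    and i: "pw_coprod_inj C S J F j \<in> hom E (F j) (pw_coprod C S J F)"
      "pw_coprod_inj C S J G j \<in> hom E (G j) (pw_coprod C S J G)"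
    and m: "pw_coprod_map C S J \<alpha> \<in> hom E (pw_coprod C S J F) (pw_coprod C S J G)" and j: "j \<in> J"
  shows "pw_coprod_inj C S J F j \<cdot>\<^bsub>E\<^esub> pw_coprod_map C S J \<alpha> = \<alpha> j \<cdot>\<^bsub>E\<^esub> pw_coprod_inj C S J G j"
proof (rule nt_eqI[OF E.FC.comp_hom[OF i(1) m] E.FC.comp_hom[OF \<alpha>[OF j] i(2)]])
  fix \<xi> assume \<xi>: "\<xi> \<in> Obj D"
  show "NMap (pw_coprod_inj C S J F j \<cdot>\<^bsub>E\<^esub> pw_coprod_map C S J \<alpha>) \<xi> = NMap (\<alpha> j \<cdot>\<^bsub>E\<^esub> pw_coprod_inj C S J G j) \<xi>"
  proof (rule fam_arr_eqI[OF E.NMap_hom[OF E.FC.comp_hom[OF i(1) m] \<xi>] E.NMap_hom[OF E.FC.comp_hom[OF \<alpha>[OF j] i(2)] \<xi>]])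
    fix t assume t: "t \<in> S"
    have "coprod_inj C J (\<lambda>j. FObj (FObj (F j) \<xi>) t) j \<cdot> coprod_map C J (\<lambda>j. NMap (NMap (\<alpha> j) \<xi>) t)
        = NMap (NMap (\<alpha> j) \<xi>) t \<cdot> coprod_inj C J (\<lambda>j. FObj (FObj (G j) \<xi>) t) j"
      by (rule coprod_map(2)[OF hc fam_hom[OF E.NMap_hom[OF \<alpha> \<xi>] t] j])
    then show "NMap (NMap (pw_coprod_inj C S J F j \<cdot>\<^bsub>E\<^esub> pw_coprod_map C S J \<alpha>) \<xi>) t
        = NMap (NMap (\<alpha> j \<cdot>\<^bsub>E\<^esub> pw_coprod_inj C S J G j) \<xi>) t"
      using \<xi> t by (simp add: pw_coprod_inj_def pw_coprod_map_def)
  qed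
qed

text \<open>Families and their arrows are rebuilt from their values without change, so
  \<open>Id\<close> is itself an assembled functor and \<open>Id + H\<close> falls under the general
  closure result.\<close>

lemma represents_id:
  "represents (\<lambda>t X \<xi>. FObj \<xi> t) (\<lambda>t \<alpha> \<xi>. Idt C (FObj \<xi> t)) (\<lambda>t X f. NMap f t)
    (\<lambda>X. fid D) (\<lambda>\<alpha>. Idt E (fid D))"
proof -
  have o: "fid D = assemble_obj (\<lambda>t X \<xi>. FObj \<xi> t) (\<lambda>t X f. NMap f t) X" for X :: "('s, 'o, 'm) endofun"
    unfolding fid_def assemble_obj_def by (auto intro!: restrict_ext simp: fam_obj_eta fam_arr_eta)
  have i: "Idt D \<xi> = fam_arr C S (\<lambda>t. Idt C (FObj \<xi> t))" if \<xi>: "\<xi> \<in> Obj D" for \<xi>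
    by (rule fam_arr_eqI[OF D.idt_hom[OF \<xi>] fam_arr_hom[OF \<xi> \<xi>]]) (use \<xi> in \<open>simp_all add: idt_hom\<close>)
  have "Idt E (fid D) = mk_nt D (fid D) (fid D) (\<lambda>\<xi>. Idt D (FObj (fid D) \<xi>))"
    by (simp add: functor_cat_def)
  also have "\<dots> = mk_nt D (fid D) (fid D) (\<lambda>\<xi>. fam_arr C S (\<lambda>t. Idt C (FObj \<xi> t)))"
    unfolding mk_nt_def by (auto intro!: restrict_ext simp: i)
  finally have "Idt E (fid D) = assemble_arr (\<lambda>t X \<xi>. FObj \<xi> t) (\<lambda>t \<alpha> \<xi>. Idt C (FObj \<xi> t)) (\<lambda>t X f. NMap f t) \<alpha>"
    for \<alpha> :: "('s, 'o, 'm) endotrans"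
    unfolding assemble_arr_def o[symmetric] .
  then show ?thesis unfolding represents_def using component_id o by blast
qed

end

locale signature_functor = signature_families C S
  for C :: "('o, 'm) category" (structure) and S :: "'s set" +
  fixes I :: "'u set" and ar :: "'u \<Rightarrow> ('s list \<times> 's) list \<times> 's"
  assumes signature: "binding_signature S I ar"
    and C_limits: "has_omega_limits C"
    and C_coproducts: "has_coproducts C I"
    and bool_continuous: "continuous_operation C (UNIV :: bool set) (coprod_obj C UNIV) (coprod_map C UNIV)"
    and I_continuous: "continuous_operation C I (coprod_obj C I) (coprod_map C I)"
begin

abbreviation V where "V \<equiv> endo D"
abbreviation H where "H \<equiv> sig_functor C S I ar"
abbreviation \<theta> where "\<theta> \<equiv> sig_strength C S I ar"
abbreviation F where "F \<equiv> id_plus C S H"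

lemma H_simps:
  "X \<in> Obj E \<Longrightarrow> FObj H X = pw_coprod C S I (\<lambda>i. arity_obj C S (fst (ar i)) (snd (ar i)) X)"
  "\<alpha> \<in> Arr E \<Longrightarrow> FArr H \<alpha> = pw_coprod_map C S I (\<lambda>i. arity_arr C S (fst (ar i)) (snd (ar i)) \<alpha>)"
  by (simp_all add: sig_functor_def)

lemma strongly_represents_sig:
  obtains gO gA gF g\<theta> where "strongly_represents gO gA gF g\<theta> (FObj H) (FArr H) \<theta>"
proof -
  have "\<exists>gO gA gF g\<theta>. strongly_represents gO gA gF g\<theta> (arity_obj C S (fst (ar i)) (snd (ar i)))
      (arity_arr C S (fst (ar i)) (snd (ar i))) (arity_strength C S (fst (ar i)) (snd (ar i)))" if i: "i \<in> I" for i
    by (rule strongly_represents_arity) (use signature i in \<open>auto simp: binding_signature_def mem_Times_iff\<close>)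
  then obtain gO gA gF g\<theta> where g: "\<And>i. i \<in> I \<Longrightarrow> strongly_represents (gO i) (gA i) (gF i) (g\<theta> i)
      (arity_obj C S (fst (ar i)) (snd (ar i))) (arity_arr C S (fst (ar i)) (snd (ar i)))
      (arity_strength C S (fst (ar i)) (snd (ar i)))"
    by metis
  define kO where "kO t X \<xi> = coprod_obj C I (\<lambda>i. gO i t X \<xi>)" for t X \<xi>
  define kA where "kA t \<alpha> \<xi> = coprod_map C I (\<lambda>i. gA i t \<alpha> \<xi>)" for t \<alpha> \<xi>
  define kF where "kF t X f = coprod_map C I (\<lambda>i. gF i t X f)" for t X f
  define k\<theta> where "k\<theta> t Ye X \<xi> = coprod_map C I (\<lambda>i. g\<theta> i t Ye X \<xi>)" for t Ye X \<xi>
  have r: "strongly_represents kO kA kF k\<theta> (\<lambda>X. pw_coprod C S I (\<lambda>i. arity_obj C S (fst (ar i)) (snd (ar i)) X))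
      (\<lambda>\<alpha>. pw_coprod_map C S I (\<lambda>i. arity_arr C S (fst (ar i)) (snd (ar i)) \<alpha>))
      (\<lambda>Ye X. pw_coprod_map C S I (\<lambda>i. arity_strength C S (fst (ar i)) (snd (ar i)) Ye X))"
    unfolding pw_coprod_eq kO_def kA_def kF_def k\<theta>_def by (rule strongly_represents_pw[OF I_continuous g])
  have sc: "strong_component C S (kO t) (kA t) (kF t) (k\<theta> t)" if "t \<in> S" for t
    using r that unfolding strongly_represents_def by blast
  have c: "component C S (kO t) (kA t) (kF t)" if "t \<in> S" for t
    using sc[OF that] by (simp add: strong_component_def)
  have "\<theta> Ye X = assemble_strength kO kF k\<theta> Ye X" if Ye: "Ye \<in> Ptd" and X: "X \<in> Obj E" for Ye X
  proof -
    have Y: "fst Ye \<in> Obj E" using Ye by simp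
    let ?G = "\<lambda>i. arity_obj C S (fst (ar i)) (snd (ar i)) X"
    have G: "pw_coprod C S I ?G = assemble_obj kO kF X"
      using r X unfolding strongly_represents_def represents_def by blast
    have Go: "fcomp D (fst Ye) (assemble_obj kO kF X) \<in> Obj E"
      using assemble_obj_endo[OF c X] Y by simp
    have "precomp_coprod C S I (fst Ye) ?G = Idt E (fcomp D (fst Ye) (assemble_obj kO kF X))"
      \<comment> \<open>Source and target of the canonical isomorphism are one functor, by
        strictness of precomposition, so it is an identity and drops out of
        \<open>sig_strength\<close>.\<close>
      unfolding precomp_coprod_def G
      unfolding pw_coprod_eq(1) fcomp_pw_obj[OF Y I_continuous, symmetric]
      unfolding pw_coprod_eq(1)[symmetric] G
      by (rule E.mk_nt_idt[OF Go]) simp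
    moreover have "pw_coprod_map C S I (\<lambda>i. arity_strength C S (fst (ar i)) (snd (ar i)) Ye X) = assemble_strength kO kF k\<theta> Ye X"
      using r Ye X unfolding strongly_represents_def by blast
    ultimately show ?thesis
      using E.FC.idt_comp[OF assemble_strength_hom[OF sc Ye X]] unfolding sig_strength_def by simp
  qed
  then have "strongly_represents kO kA kF k\<theta> (FObj H) (FArr H) \<theta>"
    using r unfolding strongly_represents_def represents_def by (simp add: H_simps)
  then show ?thesis using that by blast
qed

theorem pointed_strength_sig: "pointed_strength V H \<theta>"
proof -
  obtain gO gA gF g\<theta> where r: "strongly_represents gO gA gF g\<theta> (FObj H) (FArr H) \<theta>"
    using strongly_represents_sig by blast
  show ?thesis
    by (rule pointed_strength_assemble[of gO gA gF g\<theta>])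
      (use r in \<open>simp_all add: strongly_represents_def represents_def sig_functor_def\<close>)
qed

sublocale ps: pointed_strength V H \<theta> by (rule pointed_strength_sig)

lemma represents_F: obtains gO gA gF where "represents gO gA gF (FObj F) (FArr F)"
proof -
  obtain gO gA gF g\<theta> where "strongly_represents gO gA gF g\<theta> (FObj H) (FArr H) \<theta>"
    using strongly_represents_sig by blast
  then have "represents gO gA gF (FObj H) (FArr H)" by (simp add: strongly_represents_def)
  then have "represents (if j then (\<lambda>t X \<xi>. FObj \<xi> t) else gO) (if j then (\<lambda>t \<alpha> \<xi>. Idt C (FObj \<xi> t)) else gA)
      (if j then (\<lambda>t X f. NMap f t) else gF) (if j then (\<lambda>X. fid D) else FObj H) (if j then (\<lambda>\<alpha>. Idt E (fid D)) else FArr H)" for j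
    using represents_id by simp
  note r = represents_pw[OF bool_continuous this]
  have "\<exists>kO kA kF. represents kO kA kF (\<lambda>X. pw_coprod C S UNIV (\<lambda>j. if j then fid D else FObj H X))
      (\<lambda>\<alpha>. pw_coprod_map C S UNIV (\<lambda>j. if j then Idt E (fid D) else FArr H \<alpha>))"
    unfolding pw_coprod_eq using r[unfolded if_distribR] by (intro exI)
  then obtain kO kA kF where
    k: "represents kO kA kF (\<lambda>X. pw_coprod C S UNIV (\<lambda>j. if j then fid D else FObj H X))
      (\<lambda>\<alpha>. pw_coprod_map C S UNIV (\<lambda>j. if j then Idt E (fid D) else FArr H \<alpha>))"
    by blast
  have "represents kO kA kF (FObj F) (FArr F)"
    using k unfolding represents_def by (simp add: id_plus_def id_plus_family_def cong: if_cong)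
  then show ?thesis using that by blast
qed

lemma is_functor_F: "is_functor V V F"
proof -
  obtain gO gA gF where r: "represents gO gA gF (FObj F) (FArr F)" using represents_F by blast
  show ?thesis
    by (rule is_functor_assemble[of gO gA gF]) (use r in \<open>simp_all add: represents_def id_plus_def\<close>)
qed

text \<open>Continuity of all the operations comes together here: \<open>F\<close> is assembled from
  components, and these preserve limits taken at each family and sort.\<close>

lemma F_limit:
  assumes l: "pointwise_limit C S X d L p"
  shows "cochain_limit V (\<lambda>n. FObj F (X n)) (\<lambda>n. FArr F (d n)) (FObj F L) (\<lambda>n. FArr F (p n))"
proof -
  obtain gO gA gF where r: "represents gO gA gF (FObj F) (FArr F)" using represents_F by blast
  have c: "component C S (gO t) (gA t) (gF t)" if "t \<in> S" for t using r that by (simp add: represents_def)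
  note lD = pointwise_limitD[OF l]
  have "d n \<in> Arr E" "p n \<in> Arr E" for n using lD(2)[of n] lD(4)[of n] by (auto simp: hom_def)
  then have "FObj F (X n) = assemble_obj gO gF (X n)" "FArr F (d n) = assemble_arr gO gA gF (d n)"
    "FObj F L = assemble_obj gO gF L" "FArr F (p n) = assemble_arr gO gA gF (p n)" for n
    using r lD(1,3) unfolding represents_def by blast+
  then show ?thesis using pointwise_limit_limit[OF assemble_limit[OF c l]] by simp
qed

theorem final_coalgebra_exists: "\<exists>T out. is_final_coalgebra V F T out"
proof -
  interpret F: is_functor V V F by (rule is_functor_F)
  \<comment> \<open>The terminal endofunctor is constant at the terminal family, which is in turn
    constant at the terminal object of \<open>C\<close>.\<close>
  let ?u = "const_functor D D (const_functor (discrete S) C (terminal C))"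
  have u: "is_terminal V ?u"
    using E.is_terminal_const_functor[of "const_functor (discrete S) C (terminal C)"]
      fam.is_terminal_const_functor[OF terminal[OF C_terminal]] unfolding endo_limits fam_cat_def by blast
  then have uo: "?u \<in> Obj V" by (simp add: is_terminal_def)
  then obtain b where b: "b \<in> hom V (FObj F ?u) ?u"
    using u F.FObj_obj[OF uo] unfolding is_terminal_def by blast
  define X where "X = rec_nat ?u (\<lambda>_. FObj F)"
  \<comment> \<open>Beyond the first map \<open>b\<close>, which ends in a terminal object, each map
    is the image of its predecessor under \<open>F\<close>, the shape that
    \<open>final_coalgebra_limit\<close> expects.\<close>
  define d where "d = rec_nat b (\<lambda>_. FArr F)"
  have Xs: "X 0 = ?u" "X (Suc n) = FObj F (X n)" and ds: "d 0 = b" "d (Suc n) = FArr F (d n)" for n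
    by (simp_all add: X_def d_def)
  have X: "X n \<in> Obj V" for n by (induction n) (simp_all only: Xs uo F.FObj_obj)
  have d: "d n \<in> hom V (X (Suc n)) (X n)" for n
  proof (induction n)
    case 0 show ?case using b by (simp only: Xs ds)
  next
    case (Suc n) show ?case using F.FArr_hom[OF Suc] by (simp only: Xs ds)
  qed
  obtain L p where l: "pointwise_limit C S X d L p"
    using pointwise_limit_exists[OF C_limits, of X d] X d by auto
  have L: "cochain_limit V X d L p" using pointwise_limit_limit[OF l] by simp
  show ?thesis
    using category.final_coalgebra_limit[OF E.category_endo is_functor_F u Xs ds(2) L F_limit[OF l]] by blast
qed

section \<open>The coproduct \<open>Id + H X\<close> and its behaviour under precomposition\<close>

lemma id_plus_family_obj: "X \<in> Obj E \<Longrightarrow> id_plus_family C S H X j \<in> Obj E"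
  using ps.H.FObj_obj[of X] by (simp add: id_plus_family_def)

lemma F_obj: "X \<in> Obj E \<Longrightarrow> FObj F X = pw_coprod C S UNIV (id_plus_family C S H X)"
  by (simp add: id_plus_def)

lemma sum_inj: "pw_coprod_inj C S UNIV (id_plus_family C S H X) k = (if k then id_plus_inl C S H X else id_plus_inr C S H X)"
  by (simp add: id_plus_inl_def id_plus_inr_def)

lemma sum:
  assumes X: "X \<in> Obj E"
  shows "is_coproduct2 V (Unit V) (FObj H X) (FObj F X) (id_plus_inl C S H X) (id_plus_inr C S H X)"
proof -
  have c: "is_coproduct E UNIV (id_plus_family C S H X) (FObj F X)
      (\<lambda>k. if k then id_plus_inl C S H X else id_plus_inr C S H X)"
    unfolding F_obj[OF X] sum_inj[symmetric]
    by (rule is_coproduct_pw_coprod[OF bool_continuous C_plus]) (rule id_plus_family_obj[OF X])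
  show ?thesis unfolding is_coproduct2_def endo_limits endo_simps
    by (rule E.FC.is_coproduct_cong[OF c]) (simp_all add: id_plus_family_def)
qed

lemma tens_sum:
  assumes Z: "Z \<in> Obj E" and X: "X \<in> Obj E"
  shows "is_coproduct2 V (Z \<otimes>\<^bsub>V\<^esub> Unit V) (Z \<otimes>\<^bsub>V\<^esub> FObj H X) (Z \<otimes>\<^bsub>V\<^esub> FObj F X)
    (Idt V Z \<odot>\<^bsub>V\<^esub> id_plus_inl C S H X) (Idt V Z \<odot>\<^bsub>V\<^esub> id_plus_inr C S H X)"
proof -
  have c: "is_coproduct E UNIV (\<lambda>k. fcomp D Z (id_plus_family C S H X k)) (fcomp D Z (FObj F X))
      (\<lambda>k. hcomp D D (Idt E Z) (if k then id_plus_inl C S H X else id_plus_inr C S H X))"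
    unfolding F_obj[OF X] sum_inj[symmetric]
    by (rule is_coproduct_precomp[OF bool_continuous C_plus _ Z]) (rule id_plus_family_obj[OF X])
  show ?thesis unfolding is_coproduct2_def endo_limits endo_simps
    by (rule E.FC.is_coproduct_cong[OF c]) (simp_all add: id_plus_family_def)
qed

lemma sum_map:
  assumes f: "f \<in> hom E X Y"
  shows "id_plus_inl C S H X \<cdot>\<^bsub>E\<^esub> FArr F f = id_plus_inl C S H Y"
    "id_plus_inr C S H X \<cdot>\<^bsub>E\<^esub> FArr F f = FArr H f \<cdot>\<^bsub>E\<^esub> id_plus_inr C S H Y"
proof -
  have o: "X \<in> Obj E" "Y \<in> Obj E" "f \<in> Arr E" using f E.FC.hom_obj[OF f] by (auto simp: hom_def)
  let ?\<alpha> = "\<lambda>k. if k then Idt E (fid D) else FArr H f"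
  have Hf: "FArr H f \<in> hom E (FObj H X) (FObj H Y)" using ps.H.FArr_hom[of f X Y] f by simp
  have \<alpha>: "?\<alpha> k \<in> hom E (id_plus_family C S H X k) (id_plus_family C S H Y k)" for k
    using Hf E.FC.idt_hom[OF E.fid_obj] by (simp add: id_plus_family_def)
  have e: "FArr F f = pw_coprod_map C S UNIV ?\<alpha>" using o by (simp add: id_plus_def cong: if_cong)
  have Ff: "FArr F f \<in> hom E (FObj F X) (FObj F Y)" using is_functor.FArr_hom[OF is_functor_F, of f X Y] f by simp
  have iX: "pw_coprod_inj C S UNIV (id_plus_family C S H Z) k
      \<in> hom E (id_plus_family C S H Z k) (pw_coprod C S UNIV (id_plus_family C S H Z))"
    if "Z \<in> Obj E" for Z k
    by (rule pw_coprod(2)[OF bool_continuous C_plus]) (simp_all add: id_plus_family_obj[OF that])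
  have n: "pw_coprod_inj C S UNIV (id_plus_family C S H X) k \<cdot>\<^bsub>E\<^esub> FArr F f
      = ?\<alpha> k \<cdot>\<^bsub>E\<^esub> pw_coprod_inj C S UNIV (id_plus_family C S H Y) k" for k
    unfolding e
    by (rule pw_coprod_inj_natural[OF C_plus \<alpha> iX[OF o(1)] iX[OF o(2)] Ff[unfolded e F_obj[OF o(1)] F_obj[OF o(2)]] UNIV_I])
  show "id_plus_inl C S H X \<cdot>\<^bsub>E\<^esub> FArr F f = id_plus_inl C S H Y"
  proof -
    have "id_plus_inl C S H Y \<in> hom E (id_plus_family C S H Y True) (pw_coprod C S UNIV (id_plus_family C S H Y))"
      using iX[OF o(2), of True] by (simp add: sum_inj)
    moreover have "id_plus_family C S H Y True = fid D" by (simp add: id_plus_family_def)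
    ultimately have "Idt E (fid D) \<cdot>\<^bsub>E\<^esub> id_plus_inl C S H Y = id_plus_inl C S H Y"
      by (metis E.FC.idt_comp)
    then show ?thesis using n[of True] by (simp add: sum_inj)
  qed
  show "id_plus_inr C S H X \<cdot>\<^bsub>E\<^esub> FArr F f = FArr H f \<cdot>\<^bsub>E\<^esub> id_plus_inr C S H Y"
    using n[of False] by (simp add: sum_inj)
qed

theorem mhss_final_coalgebra:
  assumes fin: "is_final_coalgebra V F T out"
  shows "is_mhss V H \<theta> T (id_plus_inl C S H T \<cdot>\<^bsub>V\<^esub> inv_arr V out) (id_plus_inr C S H T \<cdot>\<^bsub>V\<^esub> inv_arr V out)"
proof (rule ps.is_mhss_final_coalgebra[OF fin])
  \<comment> \<open>Sums of arbitrary endofunctors provide the carrier of the primitive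
    corecursion.\<close>
  show "\<exists>P i j. is_coproduct2 V X Y P i j" if "X \<in> Obj V" "Y \<in> Obj V" for X Y
  proof -
    have XY: "(if k then X else Y) \<in> Obj E" for k using that by simp
    have "is_coproduct E UNIV (\<lambda>k. if k then X else Y) (pw_coprod C S UNIV (\<lambda>k. if k then X else Y))
        (\<lambda>k. if k then pw_coprod_inj C S UNIV (\<lambda>k. if k then X else Y) True else pw_coprod_inj C S UNIV (\<lambda>k. if k then X else Y) False)"
      by (rule E.FC.is_coproduct_cong[OF is_coproduct_pw_coprod[OF bool_continuous C_plus XY]]) auto
    then show ?thesis unfolding is_coproduct2_def endo_limits by blast
  qed
qed (use sum tens_sum sum_map in auto)

theorem strength_monoid_final_coalgebra:
  assumes fin: "is_final_coalgebra V F T out"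
  defines "\<eta> \<equiv> id_plus_inl C S H T \<cdot>\<^bsub>V\<^esub> inv_arr V out" and "\<tau> \<equiv> id_plus_inr C S H T \<cdot>\<^bsub>V\<^esub> inv_arr V out"
  shows "is_strength_monoid V H \<theta> T \<eta> (mhss_map V H \<theta> T \<eta> \<tau> T \<eta> (Idt V T)) \<tau>"
proof (rule ps.is_strength_monoid_mhss)
  show "is_mhss V H \<theta> T \<eta> \<tau>" unfolding \<eta>_def \<tau>_def by (rule mhss_final_coalgebra[OF fin])
  have T: "T \<in> Obj E" using fin by (simp add: is_final_coalgebra_def)
  \<comment> \<open>Both coherence hypotheses compare identities, because composition of functors is
    strict.\<close>
  show "Lam V (Unit V) = Rho V (Unit V)" by simp
  show "Assoc V T T (Unit V) \<cdot>\<^bsub>V\<^esub> (Idt V T \<odot>\<^bsub>V\<^esub> Rho V T) = Rho V (T \<otimes>\<^bsub>V\<^esub> T)"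
    using T E.FC.idt_comp[OF E.FC.idt_hom] by simp
qed

end

text \<open>The type \<open>'u\<close> plays the role of a universe of small sets: its subsets index
  the available coproducts, and \<open>I\<close> is one of them. Existence of a final coalgebra is a
  separate claim; the substitution system, the monoid and the monad are obtained for every final
  coalgebra.\<close>

theorem mainTheorem4:
  fixes C :: "('o, 'm) category"
    and S :: "'s set"
    and I :: "'u set"
    and ar :: "'u \<Rightarrow> ('s list \<times> 's) list \<times> 's"
  assumes universe: "infinite (UNIV :: 'u set)"
    and signature: "binding_signature S I ar"
    and C: "category C"
    and terminal: "has_terminal C"
    and products: "has_binary_products C"
    and coproducts: "\<And>J :: 'u set. has_coproducts C J"
    and limits: "has_omega_limits C"
    and distribute_subsingleton:
      "\<And>J :: 'u set. (\<forall>i \<in> J. \<forall>j \<in> J. i = j) \<Longrightarrow> omega_limits_distribute C J"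
    and distribute_I: "omega_limits_distribute C I"
    and distribute_two: "\<And>J :: 'u set. card J = 2 \<Longrightarrow> omega_limits_distribute C J"
  shows
    "let V = endo (fam_cat C S);
         H = sig_functor C S I ar;
         \<theta> = sig_strength C S I ar;
         F = id_plus C S H
     in pointed_strength V H \<theta>
      \<and> (\<exists>T out. is_final_coalgebra V F T out)
      \<and> (\<forall>T out. is_final_coalgebra V F T out \<longrightarrow>
           is_iso V out
         \<and> (let \<eta> = id_plus_inl C S H T \<cdot>\<^bsub>V\<^esub> inv_arr V out;
                \<tau> = id_plus_inr C S H T \<cdot>\<^bsub>V\<^esub> inv_arr V out;
                \<mu> = mhss_map V H \<theta> T \<eta> \<tau> T \<eta> (Idt V T)
            in is_mhss V H \<theta> T \<eta> \<tau>
             \<and> is_strength_monoid V H \<theta> T \<eta> \<mu> \<tau>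
             \<and> is_monad (fam_cat C S) T \<eta> \<mu>))"
proof -
  interpret category C by (rule C)
  have preserve: "coproducts_preserve_limits C J" if "omega_limits_distribute C J" for J :: "'u set"
    by (rule coproducts_preserve_limitsI[OF coproducts limits that])
  \<comment> \<open>Two distinct elements of the universe give a two-element index set, from which
    coproducts over \<open>bool\<close> inherit existence and distributivity.\<close>
  obtain a b :: 'u where ab: "a \<noteq> b"
    using universe by (metis (full_types) finite.emptyI finite_insert finite_subset insert_iff subsetI)
  \<comment> \<open>A subset of \<open>unit\<close> has at most one element, and so has its image in
    the universe, to which the subsingleton hypothesis applies.\<close>
  have unit_bij: "bij_betw (\<lambda>_. a) J ((\<lambda>_. a) ` J)" for J :: "unit set"
    by (auto simp: bij_betw_def inj_on_def)
  have bool_bij: "bij_betw (\<lambda>k. if k then a else b) (UNIV :: bool set) {a, b}"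
    using ab by (auto simp: bij_betw_def inj_on_def)
  have unit_coproducts: "has_coproducts C J" for J :: "unit set"
    by (rule has_coproducts_reindex[OF unit_bij coproducts])
  have bool_coproducts: "has_coproducts C (UNIV :: bool set)"
    by (rule has_coproducts_reindex[OF bool_bij coproducts])
  have unit_continuous: "continuous_operation C J (coprod_obj C J) (coprod_map C J)" for J :: "unit set"
    by (rule continuous_operation_coprod[OF unit_coproducts
          coproducts_preserve_limits_reindex[OF unit_bij preserve[OF distribute_subsingleton]]]) auto
  have bool_continuous: "continuous_operation C UNIV (coprod_obj C (UNIV :: bool set)) (coprod_map C UNIV)"
    by (rule continuous_operation_coprod[OF bool_coproducts
          coproducts_preserve_limits_reindex[OF bool_bij preserve[OF distribute_two]]]) (use ab in simp)
  interpret signature_functor C S I ar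
    by (intro signature_functor.intro signature_functor_axioms.intro signature_families.intro
        signature_families_axioms.intro option_families.intro option_families_axioms.intro sorted_families.intro
        assms(2-5) unit_coproducts bool_coproducts limits coproducts unit_continuous
        bool_continuous continuous_operation_coprod[OF coproducts preserve[OF distribute_I]])
  have iso: "is_iso V out" if "is_final_coalgebra V F T out" for T out
    by (rule category.final_coalgebra_iso[OF E.category_endo that])
  show ?thesis
    unfolding Let_def
    using pointed_strength_sig final_coalgebra_exists iso mhss_final_coalgebra strength_monoid_final_coalgebra
      E.is_monad_monoid by (simp add: is_strength_monoid_def)
qed

end
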